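(* Let $l\ge 3$. The composite map $\ast\circ\Phi_{\mathbb Z}:\mathcal B_{l-1}^{(1),ap}\xrightarrow{\Phi_{\mathbb Z}}(\mathcal{BZ}_{\mathbb Z}^e)^{\sigma}(\mathbf O^* )\xrightarrow{\ast}\mathcal{BZ}_{\mathbb Z}^{\sigma}(\mathbf O)$ gives rise to an isomorphism of crystals of type $A_{l-1}^{(1)}$ $$\bigl(\mathcal B_{l-1}^{(1),ap};\mathrm{wt},\widehat\varepsilon_p^*,\widehat\varphi_p^*,\widehat e_p^*,\widehat f_p^*\bigr)\ \overset{\sim}{\longrightarrow}\ \bigl(\mathcal{BZ}_{\mathbb Z}^{\sigma}(\mathbf O);\mathrm{wt},\widehat\varepsilon_p,\widehat\varphi_p,\widehat e_p,\widehat f_p\bigr).$$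
   Context: **Affine root datum.** Fix $l\ge 3$, $\widehat I=\{0,1,\dots,l-1\}$. $\widehat\alpha_p,\widehat h_p$ ($p\in\widehat I$) are the simple roots and coroots of the affine Lie algebra of type $A_{l-1}^{(1)}$. Crystals, morphisms of crystals and $B(\infty)$ are in Kashiwara's sense. **Intervals and Maya diagrams.** For a finite interval $I=[n+1,n+m]\subset\mathbb Z$ put $\widetilde I=[n+1,n+m+1]$, $\mathcal M_I$ = set of all subsets of $\widetilde I$, $\mathcal M_I^\times=\mathcal M_I\setminus\{\emptyset,\widetilde I\}$. $\mathcal M_{\mathbb Z}$ is the set of Maya diagrams: subsets $\mathbf k\subset\mathbb Z$ such that for some $r\in\mathbb Z$ (the charge) and $p,q\ge0$, $\mathbb Z_{\le r-p}\subset\mathbf k\subset\mathbb Z_{\le r+q}$ and $|\mathbf k\cap\mathbb Z_{>r-p}|=p$. $\mathbf k^c=\mathbb Z\setminus\mathbf k$, and $\mathcal M_{\mathbb Z}^c=\{\mathbf k^c\mid\mathbf k\in\mathcal M_{\mathbb Z}\}$. $\mathcal M_{\mathbb Z}(I)=\{\mathbb Z_{\le n}\cup\mathbf k_I\mid \mathbf k_I\in\mathcal M_I^\times\}$, $\mathcal M_{\mathbb Z}^c(I)=\{\mathbf k_I\cup\mathbb Z_{\ge n+m+2}\mid\mathbf k_I\in\mathcal M_I^\times\}$. The bijections $\mathrm{res}_I:\mathcal M_{\mathbb Z}(I)\to\mathcal M_I^\times$ and $\mathrm{res}_I^c:\mathcal M_{\mathbb Z}^c(I)\to\mathcal M_I^\times$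 are $\mathbf k\mapsto\mathbf k\cap\widetilde I$. Put $\Omega_I(\mathbf k)=\mathbb Z_{\le n}\cup(\widetilde I\setminus\mathbf k)$ for $\mathbf k\in\mathcal M_{\mathbb Z}(I)$ and $\Omega_I^c(\mathbf k)=(\widetilde I\setminus\mathbf k)\cup\mathbb Z_{\ge n+m+2}$ for $\mathbf k\in\mathcal M^c_{\mathbb Z}(I)$. **Lusztig data.** $\Delta_{\mathbb Z}^+=\{(i,j)\in\mathbb Z^2\mid i<j\}$. $\mathcal B_{\mathbb Z}$ is the set of families $\mathbf a=(a_{i,j})_{(i,j)\in\Delta^+_{\mathbb Z}}$ of nonnegative integers for which there is $N_{\mathbf a}>0$ with $a_{i,j}=0$ whenever $j-i\ge N_{\mathbf a}$. $\mathcal B_{l-1}^{(1)}=\{\mathbf a\in\mathcal B_{\mathbb Z}\mid a_{i,j}=a_{i+l,j+l}\ \forall (i,j)\}$; $\mathcal B_{l-1}^{(1),ap}$ (aperiodic data) is the subset of those $\mathbf a\in\mathcal B_{l-1}^{(1)}$ such that for each $(i,j)\in\Delta_{\mathbb Z}^+$ at least one of $a_{i,j},a_{i+1,j+1},\dots,a_{i+l-1,j+l-1}$ is $0$. $\mathbf a^I$ denotes the restriction of $\mathbf a$ to $\Delta_I^+=\{(i,j)\mid i<j,\ i,j\in\widetilde I\}$. **$\ast$-crystal structure on Lusztig data.** For $\mathbf a\in\mathcal B_{\mathbb Z}$, $p\in\mathbb Z$, $k\ge p$: $A_k^{*(p)}(\mathbf a)=\sum_{t\ge k+1}(a_{p,t}-a_{p+1,t+1})$,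 $\varepsilon_p^*(\mathbf a)=\max_{k\ge p}A_k^{*(p)}(\mathbf a)\ge 0$. Let $k_f^*$ be the smallest $k\ge p$ with $A_k^{*(p)}(\mathbf a)=\varepsilon_p^*(\mathbf a)$ and, if $\varepsilon_p^*(\mathbf a)>0$, $k_e^*$ the largest such $k$. $\widetilde f_p^*\mathbf a$ is obtained from $\mathbf a$ by adding $1$ to $a_{p,k_f^*+1}$ and subtracting $1$ from $a_{p+1,k_f^*+1}$; if $\varepsilon_p^*(\mathbf a)>0$, $\widetilde e_p^*\mathbf a$ is obtained by subtracting $1$ from $a_{p,k_e^*+1}$ and adding $1$ to $a_{p+1,k_e^*+1}$ (changes at the non-existent index $(p+1,p+1)$ are ignored); if $\varepsilon_p^*(\mathbf a)=0$, $\widetilde e_p^*\mathbf a=0$. On $\mathcal B_{l-1}^{(1)}$, for $p\in\widehat I$: $\mathrm{wt}(\mathbf a)=-\sum_{p\in\widehat I}r_p(\mathbf a)\widehat\alpha_p$ with $r_p(\mathbf a)=\sum_{s\le p}\sum_{t\ge p+1}a_{s,t}$; $\widehat\varepsilon_p^*(\mathbf a)=\varepsilon_p^*(\mathbf a)$; $\widehat\varphi_p^*(\mathbf a)=\widehat\varepsilon_p^*(\mathbf a)+\langle\widehat h_p,\mathrm{wt}(\mathbf a)\rangle$; $\widehat e_p^*=\prod_{r\in\mathbb Z}\widetilde e_{p+rl}^*$, $\widehat f_p^*=\prod_{r\in\mathbb Z}\widetilde f_{p+rl}^*$ (commuting factors acting on disjoint sets of entries; $\widehat e_p^*\mathbf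 a=0$ if $\widehat\varepsilon_p^*(\mathbf a)=0$). This makes $\mathcal B_{l-1}^{(1),ap}$ a crystal of type $A_{l-1}^{(1)}$. **The map $\Phi_{\mathbb Z}$.** For $I=[n+1,n+m]$ and $\mathbf k=\{k_{n+1}<\dots<k_{n+u}\}\in\mathcal M_I^\times$, a $\mathbf k$-tableau is an upper triangular integer matrix $C=(c_{p,q})_{n+1\le p\le q\le n+u}$ with $c_{p,p}=k_p$, $c_{p,q}\le c_{p,q+1}$, $c_{p,q}<c_{p+1,q}$. Put $$M_{\mathbf k}(\mathbf a^I)=-\sum_{j=n+1}^{n+u}\sum_{i=n+1}^{k_j-1}a_{i,k_j}+\min_{C\ \mathbf k\text{-tableau}}\ \sum_{n+1\le p<q\le n+u}a_{c_{p,q},c_{p,q}+(q-p)}.$$ For $\mathbf a\in\mathcal B_{\mathbb Z}$, $\mathbf k\in\mathcal M_{\mathbb Z}$, $M_{\mathbf k}(\mathbf a)$ is the common value of $M_{\mathrm{res}_I(\mathbf k)}(\mathbf a^I)$ for all sufficiently large finite intervals $I$ (it stabilizes). $\Phi_{\mathbb Z}(\mathbf a)=\mathbf M(\mathbf a)=(M_{\mathbf k}(\mathbf a))_{\mathbf k\in\mathcal M_{\mathbb Z}}$. **Finite BZ data.** A BZ datum for $I$ is a family of integers $(M_{\mathbf k})_{\mathbf k\in\mathcal M_I^\times}$ such that, with $M_\emptyset=M_{\widetilde I}=0$: (BZ-1) $M_{\mathbf k\cup\{i\}}+M_{\mathbf k\cup\{j\}}\le M_{\mathbf k\cup\{i,j\}}+M_{\mathbf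 k}$ for $i\ne j$ in $\widetilde I$, $\mathbf k\in\mathcal M_I$, $\mathbf k\cap\{i,j\}=\emptyset$; (BZ-2) $M_{\mathbf k\cup\{i,k\}}+M_{\mathbf k\cup\{j\}}=\min\{M_{\mathbf k\cup\{i,j\}}+M_{\mathbf k\cup\{k\}},\,M_{\mathbf k\cup\{j,k\}}+M_{\mathbf k\cup\{i\}}\}$ for $i<j<k$ in $\widetilde I$, $\mathbf k\in\mathcal M_I$, $\mathbf k\cap\{i,j,k\}=\emptyset$. $\mathcal{BZ}_I$ is the set of BZ data with $M_{[i+1,n+m+1]}=0$ for all $i\in I$; $\mathcal{BZ}_I^e$ is the set of BZ data with $M_{[n+1,i]}=0$ for all $i\in I$. For $\mathbf M\in\mathcal{BZ}_I$, $i\in I$: $\varepsilon_i(\mathbf M)=-(M_{[n+1,i]}+M_{[n+1,i-1]\cup\{i+1\}}-M_{[n+1,i-1]}-M_{[n+1,i+1]})$; $\widetilde f_i\mathbf M$ (resp., if $\varepsilon_i(\mathbf M)>0$, $\widetilde e_i\mathbf M$) is the unique element of $\mathcal{BZ}_I$ whose $[n+1,i]$-component is $M_{[n+1,i]}-1$ (resp. $M_{[n+1,i]}+1$) and whose $\mathbf k$-component equals $M_{\mathbf k}$ for all $\mathbf k$ not satisfying ($i\in\mathbf k$ and $i+1\notin\mathbf k$); $\widetilde e_i\mathbf M=0$ if $\varepsilon_i(\mathbf M)=0$ (existence and uniqueness: Kamnitzer). **BZ data for $\mathbb Z$.** $\mathcal{BZ}_{\mathbb Z}$ is the set of families of integers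 $\mathbf M=(M_{\mathbf k})_{\mathbf k\in\mathcal M_{\mathbb Z}^c}$ such that (a) for every finite interval $K$, $\mathbf M_K:=(M_{\mathbf k})_{\mathbf k\in\mathcal M^c_{\mathbb Z}(K)}$, viewed as indexed by $\mathcal M_K^\times$ via $\mathrm{res}_K^c$, is in $\mathcal{BZ}_K$; (b) for each $\mathbf k\in\mathcal M_{\mathbb Z}^c$ there is a finite interval $I$ with $\mathbf k\in\mathcal M_{\mathbb Z}^c(I)$ and $M_{\Omega_J^c(\mathbf k)}=M_{\Omega_I^c(\mathbf k)}$ for all finite intervals $J\supset I$; the set of such $I$ is $\mathrm{Int}^c(\mathbf M;\mathbf k)$. $\mathcal{BZ}_{\mathbb Z}^e$ is the set of families $(M_{\mathbf k})_{\mathbf k\in\mathcal M_{\mathbb Z}}$ satisfying the same conditions with $\mathcal M_{\mathbb Z},\mathcal M_{\mathbb Z}(\cdot),\mathrm{res},\Omega,\mathcal{BZ}^e_K$ in place of $\mathcal M_{\mathbb Z}^c,\mathcal M_{\mathbb Z}^c(\cdot),\mathrm{res}^c,\Omega^c,\mathcal{BZ}_K$. The bijection $\ast:\mathcal{BZ}_{\mathbb Z}\leftrightarrow\mathcal{BZ}_{\mathbb Z}^e$ is $(\mathbf M^* )_{\mathbf k}=M_{\mathbf k^c}$. For $\mathbf M\in\mathcal{BZ}_{\mathbb Z}$, $\mathbf k\in\mathcal M_{\mathbb Z}$: $\Theta(\mathbf M)_{\mathbf k}=M_{\Omega_I^c(\mathbf k^c)}$ for any $I\in\mathrm{Int}^c(\mathbf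 M;\mathbf k^c)$. For $p\in\mathbb Z$, $\varepsilon_p(\mathbf M)=-(\Theta(\mathbf M)_{\mathbb Z_{\le p}}+\Theta(\mathbf M)_{\mathbb Z_{\le p-1}\cup\{p+1\}}-\Theta(\mathbf M)_{\mathbb Z_{\le p+1}}-\Theta(\mathbf M)_{\mathbb Z_{\le p-1}})$. If $\varepsilon_p(\mathbf M)=0$, $\widetilde e_p\mathbf M=0$; otherwise $(\widetilde e_p\mathbf M)_{\mathbf k}=(\widetilde e_p\mathbf M_I)_{\mathrm{res}_I^c(\mathbf k)}$, and always $(\widetilde f_p\mathbf M)_{\mathbf k}=(\widetilde f_p\mathbf M_I)_{\mathrm{res}_I^c(\mathbf k)}$, where $I$ is any finite interval with $\mathbf k\in\mathcal M_{\mathbb Z}^c(I)$ and $I\in\mathrm{Int}^c(\mathbf M;\mathbf m^c)$ for $\mathbf m=\mathbb Z_{\le p},\ \mathbb Z_{\le p-1}\cup\{p+1\}$ and, for $\widetilde e_p$, also $\mathbf m=\mathbb Z_{\le p+1},\mathbb Z_{\le p-1}$ (independent of $I$; result in $\mathcal{BZ}_{\mathbb Z}$). **Affine type.** $\sigma$ is the shift $x\mapsto x+l$ on $\mathbb Z$, hence on (complementary) Maya diagrams, and $\sigma(\mathbf M)_{\mathbf k}=M_{\sigma^{-1}(\mathbf k)}$. $\mathcal{BZ}_{\mathbb Z}^\sigma$ and $(\mathcal{BZ}_{\mathbb Z}^e)^\sigma$ are the $\sigma$-fixed subsets; $\ast$ restricts to a bijection between them. On $\mathcal{BZ}_{\mathbb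 Z}^\sigma$, for $p\in\widehat I$: $\mathrm{wt}(\mathbf M)=\sum_{p\in\widehat I}\Theta(\mathbf M)_{\mathbb Z_{\le p}}\widehat\alpha_p$, $\widehat\varepsilon_p=\varepsilon_p$, $\widehat\varphi_p=\widehat\varepsilon_p+\langle\widehat h_p,\mathrm{wt}\rangle$; $\widehat e_p\mathbf M=0$ if $\widehat\varepsilon_p(\mathbf M)=0$, otherwise $(\widehat e_p\mathbf M)_{\mathbf k}=\bigl(\prod_{q\in L(\mathbf k,p)}\widetilde e_q\,\mathbf M\bigr)_{\mathbf k}$, and $(\widehat f_p\mathbf M)_{\mathbf k}=\bigl(\prod_{q\in L(\mathbf k,p)}\widetilde f_q\,\mathbf M\bigr)_{\mathbf k}$, where $L(\mathbf k,p)=\{q\in p+l\mathbb Z\mid q\in\mathbf k,\ q+1\notin\mathbf k\}$ (finite; factors commute). On $(\mathcal{BZ}_{\mathbb Z}^e)^\sigma$: $\mathrm{wt}(\mathbf M)=\mathrm{wt}(\mathbf M^* )$, $\widehat\varepsilon_p^*(\mathbf M)=\widehat\varepsilon_p(\mathbf M^* )$, $\widehat\varphi_p^*(\mathbf M)=\widehat\varepsilon_p^*(\mathbf M)+\langle\widehat h_p,\mathrm{wt}(\mathbf M)\rangle$, $\widehat e_p^*\mathbf M=(\widehat e_p(\mathbf M^* ))^*$, $\widehat f_p^*\mathbf M=(\widehat f_p(\mathbf M^* ))^*$ (with $0^*=0$). These are crystals of type $A_{l-1}^{(1)}$ [Naito–Sagaki–Saito]. $\mathbf O\in\mathcal{BZ}_{\mathbb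 Z}^\sigma$ and $\mathbf O^*\in(\mathcal{BZ}_{\mathbb Z}^e)^\sigma$ are the families with all components $0$; $\mathcal{BZ}_{\mathbb Z}^\sigma(\mathbf O)$ and $(\mathcal{BZ}_{\mathbb Z}^e)^\sigma(\mathbf O^* )$ are the connected components of the respective crystals containing $\mathbf O$, $\mathbf O^*$. *)

theory Defs
  imports Complex_Main "HOL-Library.FuncSet" "HOL-Library.Extended" "HOL-Number_Theory.Cong"
begin

section \<open>Affine root datum\<close>

definition Ihat :: "int \<Rightarrow> int set" where
  "Ihat l = {0..<l}"

definition cartan :: "int \<Rightarrow> int \<Rightarrow> int \<Rightarrow> int" where
  "cartan l p q =
     (if p = q then 2
      else if [p = q + 1] (mod l) \<or> [q = p + 1] (mod l) then -1 else 0)"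

text \<open>The weight lattice is realised as the free abelian group on the fundamental weights and the
  null root: a weight is its coefficient function.  The coroot \<open>h\<^sub>p\<close> is dual to the
  fundamental weight with index \<open>p\<close> and vanishes on the null root.  The null root occurs in
  \<open>\<alpha>\<^sub>0\<close> with coefficient 1, which makes the simple roots linearly independent.\<close>

datatype wt_basis = Fund int | Null

type_synonym weight = "wt_basis \<Rightarrow> int"

definition weight_lattice :: "int \<Rightarrow> weight set" where
  "weight_lattice l = {\<mu>. \<forall>q. q \<notin> Ihat l \<longrightarrow> \<mu> (Fund q) = 0}"

definition simple_root :: "int \<Rightarrow> int \<Rightarrow> weight" where
  "simple_root l p = (\<lambda>b. case b of
     Fund q \<Rightarrow> if q \<in> Ihat l then cartan l q p else 0
   | Null \<Rightarrow> if p = 0 then 1 else 0)"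

definition coroot :: "int \<Rightarrow> weight \<Rightarrow> int" where
  "coroot p \<mu> = \<mu> (Fund p)"

definition root_comb :: "int \<Rightarrow> (int \<Rightarrow> int) \<Rightarrow> weight" where
  "root_comb l c = (\<lambda>b. \<Sum>p\<in>Ihat l. c p * simple_root l p b)"


section \<open>Kashiwara crystals\<close>

text \<open>The element \<open>0\<close> adjoined to a crystal is \<open>None\<close>.\<close>

record 'b crystal_data =
  elems :: "'b set"
  wt :: "'b \<Rightarrow> weight"
  eps :: "int \<Rightarrow> 'b \<Rightarrow> int extended"
  phi :: "int \<Rightarrow> 'b \<Rightarrow> int extended"
  eop :: "int \<Rightarrow> 'b \<Rightarrow> 'b option"
  fop :: "int \<Rightarrow> 'b \<Rightarrow> 'b option"

definition crystal :: "int \<Rightarrow> 'b crystal_data \<Rightarrow> bool" where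
  "crystal l B \<longleftrightarrow>
     (\<forall>b\<in>elems B. wt B b \<in> weight_lattice l) \<and>
     (\<forall>p\<in>Ihat l. \<forall>b\<in>elems B.
        eps B p b \<noteq> \<infinity> \<and> phi B p b \<noteq> \<infinity> \<and>
        phi B p b = eps B p b + Fin (coroot p (wt B b)) \<and>
        (\<forall>b'. eop B p b = Some b' \<longrightarrow>
           b' \<in> elems B \<and>
           wt B b' = (\<lambda>x. wt B b x + simple_root l p x) \<and>
           eps B p b' = eps B p b - 1 \<and>
           phi B p b' = phi B p b + 1) \<and>
        (\<forall>b'. fop B p b = Some b' \<longrightarrow>
           b' \<in> elems B \<and>
           wt B b' = (\<lambda>x. wt B b x - simple_root l p x) \<and>
           eps B p b' = eps B p b + 1 \<and>
           phi B p b' = phi B p b - 1) \<and>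
        (\<forall>b'\<in>elems B. fop B p b = Some b' \<longleftrightarrow> eop B p b' = Some b) \<and>
        (phi B p b = -\<infinity> \<longrightarrow> eop B p b = None \<and> fop B p b = None))"

definition crystal_morphism ::
  "int \<Rightarrow> 'b crystal_data \<Rightarrow> 'c crystal_data \<Rightarrow> ('b option \<Rightarrow> 'c option) \<Rightarrow> bool" where
  "crystal_morphism l B C \<psi> \<longleftrightarrow>
     \<psi> None = None \<and>
     (\<forall>b\<in>elems B. \<psi> (Some b) \<in> insert None (Some ` elems C)) \<and>
     (\<forall>b\<in>elems B. \<forall>c. \<psi> (Some b) = Some c \<longrightarrow>
        wt C c = wt B b \<and>
        (\<forall>p\<in>Ihat l. eps C p c = eps B p b \<and> phi C p c = phi B p b)) \<and>
     (\<forall>p\<in>Ihat l. \<forall>b\<in>elems B. \<forall>b' c c'.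
        \<psi> (Some b) = Some c \<and> \<psi> (Some b') = Some c' \<longrightarrow>
        (eop B p b = Some b' \<longrightarrow> eop C p c = Some c') \<and>
        (fop B p b = Some b' \<longrightarrow> fop C p c = Some c'))"

text \<open>Invertibility is required in the category of crystals: a bijective morphism need not be an
  isomorphism, since it need not commute with operators that give \<open>0\<close>.\<close>

definition crystal_iso ::
  "int \<Rightarrow> 'b crystal_data \<Rightarrow> 'c crystal_data \<Rightarrow> ('b \<Rightarrow> 'c) \<Rightarrow> bool" where
  "crystal_iso l B C f \<longleftrightarrow>
     crystal l B \<and> crystal l C \<and>
     crystal_morphism l B C (map_option f) \<and>
     (\<exists>g. crystal_morphism l C B (map_option g) \<and>
          (\<forall>b\<in>elems B. g (f b) = b) \<and> (\<forall>c\<in>elems C. f (g c) = c))"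

definition crystal_edges :: "int \<Rightarrow> 'b crystal_data \<Rightarrow> ('b \<times> 'b) set" where
  "crystal_edges l B =
     {(b, b'). b \<in> elems B \<and> b' \<in> elems B \<and>
        (\<exists>p\<in>Ihat l. eop B p b = Some b' \<or> fop B p b = Some b')}"

definition crystal_component :: "int \<Rightarrow> 'b crystal_data \<Rightarrow> 'b \<Rightarrow> 'b crystal_data" where
  "crystal_component l B b\<^sub>0 =
     B\<lparr>elems := {b. (b\<^sub>0, b) \<in> (crystal_edges l B \<union> (crystal_edges l B)\<inverse>)\<^sup>*}\<rparr>"


section \<open>Intervals and Maya diagrams\<close>

definition intervals :: "int set set" where
  "intervals = {{s..t} |s t. s \<le> t}"

definition tilde :: "int set \<Rightarrow> int set" where
  "tilde I = {Min I..Max I + 1}"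

definition subsets_proper :: "int set \<Rightarrow> int set set" where
  "subsets_proper I = Pow (tilde I) - {{}, tilde I}"

definition maya :: "int set set" where
  "maya = {k. \<exists>(r::int) (p::nat) (q::nat).
     {..r - int p} \<subseteq> k \<and> k \<subseteq> {..r + int q} \<and> card (k \<inter> {r - int p<..}) = p}"

definition mayac :: "int set set" where
  "mayac = {- k |k. k \<in> maya}"

definition maya_int :: "int set \<Rightarrow> int set set" where
  "maya_int I = {{..<Min I} \<union> k |k. k \<in> subsets_proper I}"

definition mayac_int :: "int set \<Rightarrow> int set set" where
  "mayac_int I = {k \<union> {Max I + 2..} |k. k \<in> subsets_proper I}"

text \<open>The formula is the same on \<open>maya_int I\<close> and on \<open>mayac_int I\<close>.\<close>

definition res :: "int set \<Rightarrow> int set \<Rightarrow> int set" where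
  "res I k = k \<inter> tilde I"

definition Omega :: "int set \<Rightarrow> int set \<Rightarrow> int set" where
  "Omega I k = {..<Min I} \<union> (tilde I - k)"

definition Omegac :: "int set \<Rightarrow> int set \<Rightarrow> int set" where
  "Omegac I k = (tilde I - k) \<union> {Max I + 2..}"


section \<open>Lusztig data\<close>

type_synonym lusztig = "int \<times> int \<Rightarrow> nat"

definition Delta :: "(int \<times> int) set" where
  "Delta = {(i, j). i < j}"

definition Delta_int :: "int set \<Rightarrow> (int \<times> int) set" where
  "Delta_int I = {(i, j). i < j \<and> i \<in> tilde I \<and> j \<in> tilde I}"

definition LusZ :: "lusztig set" where
  "LusZ = {a \<in> Delta \<rightarrow>\<^sub>E UNIV. \<exists>N>0. \<forall>(i, j)\<in>Delta. j - i \<ge> N \<longrightarrow> a (i, j) = 0}"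

definition LusAff :: "int \<Rightarrow> lusztig set" where
  "LusAff l = {a \<in> LusZ. \<forall>(i, j)\<in>Delta. a (i, j) = a (i + l, j + l)}"

definition LusAp :: "int \<Rightarrow> lusztig set" where
  "LusAp l = {a \<in> LusAff l. \<forall>(i, j)\<in>Delta. \<exists>s\<in>{0..<l}. a (i + s, j + s) = 0}"

text \<open>The sums over infinite index sets below have finite support on \<open>LusZ\<close> and are taken over
  that support.\<close>

definition A_star :: "int \<Rightarrow> lusztig \<Rightarrow> int \<Rightarrow> int" where
  "A_star p a k =
     (let g = (\<lambda>t. int (a (p, t)) - int (a (p + 1, t + 1)))
      in \<Sum>t\<in>{t. t \<ge> k + 1 \<and> g t \<noteq> 0}. g t)"

definition eps_star :: "int \<Rightarrow> lusztig \<Rightarrow> int" where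
  "eps_star p a = Max {A_star p a k |k. k \<ge> p}"

definition kf_star :: "int \<Rightarrow> lusztig \<Rightarrow> int" where
  "kf_star p a = (LEAST k. k \<ge> p \<and> A_star p a k = eps_star p a)"

definition ke_star :: "int \<Rightarrow> lusztig \<Rightarrow> int" where
  "ke_star p a = (GREATEST k. k \<ge> p \<and> A_star p a k = eps_star p a)"

text \<open>Restricting to \<open>Delta\<close> implements that the change at \<open>(p + 1, p + 1)\<close> is ignored.  The
  truncated subtractions are genuine on \<open>LusZ\<close>: the entries concerned are positive by the
  extremality of \<open>kf_star\<close> and \<open>ke_star\<close>.\<close>

definition f_star :: "int \<Rightarrow> lusztig \<Rightarrow> lusztig" where
  "f_star p a = (\<lambda>x\<in>Delta.
     if x = (p, kf_star p a + 1) then a x + 1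
     else if x = (p + 1, kf_star p a + 1) then a x - 1
     else a x)"

definition e_star :: "int \<Rightarrow> lusztig \<Rightarrow> lusztig option" where
  "e_star p a =
     (if eps_star p a = 0 then None
      else Some (\<lambda>x\<in>Delta.
        if x = (p, ke_star p a + 1) then a x - 1
        else if x = (p + 1, ke_star p a + 1) then a x + 1
        else a x))"

text \<open>The infinite products over \<open>p + l\<int>\<close>: the factor with index \<open>q\<close> reads and changes only the
  rows \<open>q\<close> and \<open>q + 1\<close>, so that for \<open>l \<ge> 2\<close> an entry of row \<open>i\<close> is affected by at most one
  factor, whose index is \<open>i\<close> or \<open>i - 1\<close>.\<close>

definition fhat_star :: "int \<Rightarrow> int \<Rightarrow> lusztig \<Rightarrow> lusztig" where
  "fhat_star l p a = (\<lambda>(i, j)\<in>Delta.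
     if [i = p] (mod l) then f_star i a (i, j)
     else if [i - 1 = p] (mod l) then f_star (i - 1) a (i, j)
     else a (i, j))"

definition ehat_star :: "int \<Rightarrow> int \<Rightarrow> lusztig \<Rightarrow> lusztig option" where
  "ehat_star l p a =
     (if eps_star p a = 0 then None
      else Some (\<lambda>(i, j)\<in>Delta.
        if [i = p] (mod l) then the (e_star i a) (i, j)
        else if [i - 1 = p] (mod l) then the (e_star (i - 1) a) (i, j)
        else a (i, j)))"

definition r_coef :: "int \<Rightarrow> lusztig \<Rightarrow> int" where
  "r_coef p a = (\<Sum>(s, t)\<in>{(s, t). s \<le> p \<and> t \<ge> p + 1 \<and> a (s, t) \<noteq> 0}. int (a (s, t)))"

definition wt_lus :: "int \<Rightarrow> lusztig \<Rightarrow> weight" where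
  "wt_lus l a = root_comb l (\<lambda>p. - r_coef p a)"

definition lus_ap_crystal :: "int \<Rightarrow> lusztig crystal_data" where
  "lus_ap_crystal l =
     \<lparr>elems = LusAp l,
      wt = wt_lus l,
      eps = (\<lambda>p a. Fin (eps_star p a)),
      phi = (\<lambda>p a. Fin (eps_star p a + coroot p (wt_lus l a))),
      eop = ehat_star l,
      fop = (\<lambda>p a. Some (fhat_star l p a))\<rparr>"


section \<open>The map from Lusztig data to families indexed by Maya diagrams\<close>

text \<open>The rows and columns of a \<open>k\<close>-tableau are indexed from \<open>0\<close>; only differences of indices
  matter.  Entries \<open>C p q\<close> outside \<open>p \<le> q < card k\<close> are irrelevant.\<close>

definition tableau :: "int set \<Rightarrow> (nat \<Rightarrow> nat \<Rightarrow> int) \<Rightarrow> bool" where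
  "tableau k C \<longleftrightarrow>
     (\<forall>p<card k. C p p = sorted_list_of_set k ! p) \<and>
     (\<forall>p q. p \<le> q \<and> q + 1 < card k \<longrightarrow> C p q \<le> C p (q + 1)) \<and>
     (\<forall>p q. p < q \<and> q < card k \<longrightarrow> C p q < C (p + 1) q)"

definition M_fin :: "int set \<Rightarrow> lusztig \<Rightarrow> int set \<Rightarrow> int" where
  "M_fin I a k =
     - (\<Sum>j\<in>k. \<Sum>i\<in>{Min I..j - 1}. int (a (i, j)))
     + Min {(\<Sum>(p, q)\<in>{(p, q). p < q \<and> q < card k}. int (a (C p q, C p q + int (q - p)))) |C.
              tableau k C}"

definition M_Z :: "lusztig \<Rightarrow> int set \<Rightarrow> int" where
  "M_Z a k = (THE v. \<exists>I\<^sub>0\<in>intervals. \<forall>I\<in>intervals. I\<^sub>0 \<subseteq> I \<longrightarrow>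
     k \<in> maya_int I \<and> M_fin I (restrict a (Delta_int I)) (res I k) = v)"

type_synonym family = "int set \<Rightarrow> int"

definition Phi_Z :: "lusztig \<Rightarrow> family" where
  "Phi_Z a = (\<lambda>k\<in>maya. M_Z a k)"


section \<open>Finite BZ data\<close>

text \<open>The convention \<open>M\<^sub>\<emptyset> = M\<^sub>\<tilde>\<^sub>I = 0\<close>.\<close>

definition comp0 :: "int set \<Rightarrow> family \<Rightarrow> family" where
  "comp0 I M k = (if k = {} \<or> k = tilde I then 0 else M k)"

definition BZ_datum :: "int set \<Rightarrow> family \<Rightarrow> bool" where
  "BZ_datum I M \<longleftrightarrow>
     M \<in> subsets_proper I \<rightarrow>\<^sub>E UNIV \<and>
     (\<forall>k\<in>Pow (tilde I). \<forall>i\<in>tilde I. \<forall>j\<in>tilde I. i \<noteq> j \<and> k \<inter> {i, j} = {} \<longrightarrow>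
        comp0 I M (k \<union> {i}) + comp0 I M (k \<union> {j}) \<le> comp0 I M (k \<union> {i, j}) + comp0 I M k) \<and>
     (\<forall>k\<in>Pow (tilde I). \<forall>h\<in>tilde I. \<forall>i\<in>tilde I. \<forall>j\<in>tilde I.
        h < i \<and> i < j \<and> k \<inter> {h, i, j} = {} \<longrightarrow>
        comp0 I M (k \<union> {h, j}) + comp0 I M (k \<union> {i}) =
          min (comp0 I M (k \<union> {h, i}) + comp0 I M (k \<union> {j}))
              (comp0 I M (k \<union> {i, j}) + comp0 I M (k \<union> {h})))"

definition BZ :: "int set \<Rightarrow> family set" where
  "BZ I = {M. BZ_datum I M \<and> (\<forall>i\<in>I. M {i + 1..Max I + 1} = 0)}"

definition BZe :: "int set \<Rightarrow> family set" where
  "BZe I = {M. BZ_datum I M \<and> (\<forall>i\<in>I. M {Min I..i} = 0)}"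

definition eps_fin :: "int set \<Rightarrow> int \<Rightarrow> family \<Rightarrow> int" where
  "eps_fin I i M =
     - (comp0 I M {Min I..i} + comp0 I M ({Min I..i - 1} \<union> {i + 1})
        - comp0 I M {Min I..i - 1} - comp0 I M {Min I..i + 1})"

definition f_fin :: "int set \<Rightarrow> int \<Rightarrow> family \<Rightarrow> family" where
  "f_fin I i M = (THE M'. M' \<in> BZ I \<and> M' {Min I..i} = M {Min I..i} - 1 \<and>
     (\<forall>k\<in>subsets_proper I. \<not> (i \<in> k \<and> i + 1 \<notin> k) \<longrightarrow> M' k = M k))"

definition e_fin :: "int set \<Rightarrow> int \<Rightarrow> family \<Rightarrow> family option" where
  "e_fin I i M =
     (if eps_fin I i M = 0 then None
      else Some (THE M'. M' \<in> BZ I \<and> M' {Min I..i} = M {Min I..i} + 1 \<and>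
        (\<forall>k\<in>subsets_proper I. \<not> (i \<in> k \<and> i + 1 \<notin> k) \<longrightarrow> M' k = M k)))"


section \<open>BZ data for the integers\<close>

definition fam_res :: "int set \<Rightarrow> family \<Rightarrow> family" where
  "fam_res K M = (\<lambda>k\<in>subsets_proper K. M ({..<Min K} \<union> k))"

definition fam_resc :: "int set \<Rightarrow> family \<Rightarrow> family" where
  "fam_resc K M = (\<lambda>k\<in>subsets_proper K. M (k \<union> {Max K + 2..}))"

definition Int_e :: "family \<Rightarrow> int set \<Rightarrow> int set set" where
  "Int_e M k = {I \<in> intervals. k \<in> maya_int I \<and>
     (\<forall>J\<in>intervals. I \<subseteq> J \<longrightarrow> M (Omega J k) = M (Omega I k))}"

definition Int_c :: "family \<Rightarrow> int set \<Rightarrow> int set set" where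
  "Int_c M k = {I \<in> intervals. k \<in> mayac_int I \<and>
     (\<forall>J\<in>intervals. I \<subseteq> J \<longrightarrow> M (Omegac J k) = M (Omegac I k))}"

definition BZ_Z :: "family set" where
  "BZ_Z = {M \<in> mayac \<rightarrow>\<^sub>E UNIV.
     (\<forall>K\<in>intervals. fam_resc K M \<in> BZ K) \<and> (\<forall>k\<in>mayac. Int_c M k \<noteq> {})}"

definition BZe_Z :: "family set" where
  "BZe_Z = {M \<in> maya \<rightarrow>\<^sub>E UNIV.
     (\<forall>K\<in>intervals. fam_res K M \<in> BZe K) \<and> (\<forall>k\<in>maya. Int_e M k \<noteq> {})}"

text \<open>The two directions of the bijection \<open>\<ast>\<close>: \<open>star_e\<close> maps \<open>BZ_Z\<close> to \<open>BZe_Z\<close> and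
  \<open>star_c\<close> maps \<open>BZe_Z\<close> to \<open>BZ_Z\<close>.\<close>

definition star_e :: "family \<Rightarrow> family" where
  "star_e M = (\<lambda>k\<in>maya. M (- k))"

definition star_c :: "family \<Rightarrow> family" where
  "star_c M = (\<lambda>k\<in>mayac. M (- k))"

definition Theta :: "family \<Rightarrow> family" where
  "Theta M = (\<lambda>k\<in>maya. M (Omegac (SOME I. I \<in> Int_c M (- k)) (- k)))"

definition eps_Z :: "int \<Rightarrow> family \<Rightarrow> int" where
  "eps_Z p M =
     - (Theta M {..p} + Theta M ({..p - 1} \<union> {p + 1})
        - Theta M {..p + 1} - Theta M {..p - 1})"

definition f_Z :: "int \<Rightarrow> family \<Rightarrow> family" where
  "f_Z p M = (\<lambda>k\<in>mayac.
     let I = (SOME I. I \<in> intervals \<and> k \<in> mayac_int I \<and>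
                (\<forall>m\<in>{{..p}, {..p - 1} \<union> {p + 1}}. I \<in> Int_c M (- m)))
     in f_fin I p (fam_resc I M) (res I k))"

definition e_Z :: "int \<Rightarrow> family \<Rightarrow> family option" where
  "e_Z p M =
     (if eps_Z p M = 0 then None
      else Some (\<lambda>k\<in>mayac.
        let I = (SOME I. I \<in> intervals \<and> k \<in> mayac_int I \<and>
                   (\<forall>m\<in>{{..p}, {..p - 1} \<union> {p + 1}, {..p + 1}, {..p - 1}}. I \<in> Int_c M (- m)))
        in the (e_fin I p (fam_resc I M)) (res I k)))"


section \<open>BZ data of affine type\<close>

definition BZ_aff :: "int \<Rightarrow> family set" where
  "BZ_aff l = {M \<in> BZ_Z. \<forall>k\<in>mayac. M ((\<lambda>x. x - l) ` k) = M k}"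

definition BZe_aff :: "int \<Rightarrow> family set" where
  "BZe_aff l = {M \<in> BZe_Z. \<forall>k\<in>maya. M ((\<lambda>x. x - l) ` k) = M k}"

definition wt_BZ :: "int \<Rightarrow> family \<Rightarrow> weight" where
  "wt_BZ l M = root_comb l (\<lambda>p. Theta M {..p})"

definition L_set :: "int \<Rightarrow> int set \<Rightarrow> int \<Rightarrow> int set" where
  "L_set l k p = {q. [q = p] (mod l) \<and> q \<in> k \<and> q + 1 \<notin> k}"

text \<open>The factors of the finite products commute; they are applied in increasing order of \<open>q\<close>.\<close>

definition f_prod :: "int set \<Rightarrow> family \<Rightarrow> family" where
  "f_prod Q M = fold f_Z (sorted_list_of_set Q) M"

definition e_prod :: "int set \<Rightarrow> family \<Rightarrow> family option" where
  "e_prod Q M = fold (\<lambda>q N. Option.bind N (e_Z q)) (sorted_list_of_set Q) (Some M)"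

definition fhat :: "int \<Rightarrow> int \<Rightarrow> family \<Rightarrow> family" where
  "fhat l p M = (\<lambda>k\<in>mayac. f_prod (L_set l k p) M k)"

definition ehat :: "int \<Rightarrow> int \<Rightarrow> family \<Rightarrow> family option" where
  "ehat l p M =
     (if eps_Z p M = 0 then None
      else Some (\<lambda>k\<in>mayac. the (e_prod (L_set l k p) M) k))"

definition BZ_crystal :: "int \<Rightarrow> family crystal_data" where
  "BZ_crystal l =
     \<lparr>elems = BZ_aff l,
      wt = wt_BZ l,
      eps = (\<lambda>p M. Fin (eps_Z p M)),
      phi = (\<lambda>p M. Fin (eps_Z p M + coroot p (wt_BZ l M))),
      eop = ehat l,
      fop = (\<lambda>p M. Some (fhat l p M))\<rparr>"

definition BZe_crystal :: "int \<Rightarrow> family crystal_data" where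
  "BZe_crystal l =
     \<lparr>elems = BZe_aff l,
      wt = (\<lambda>M. wt_BZ l (star_c M)),
      eps = (\<lambda>p M. Fin (eps_Z p (star_c M))),
      phi = (\<lambda>p M. Fin (eps_Z p (star_c M) + coroot p (wt_BZ l (star_c M)))),
      eop = (\<lambda>p M. map_option star_e (ehat l p (star_c M))),
      fop = (\<lambda>p M. Some (star_e (fhat l p (star_c M))))\<rparr>"

definition O_fam :: family where
  "O_fam = (\<lambda>k\<in>mayac. 0)"

definition Oe_fam :: family where
  "Oe_fam = (\<lambda>k\<in>maya. 0)"

definition BZ_O :: "int \<Rightarrow> family crystal_data" where
  "BZ_O l = crystal_component l (BZ_crystal l) O_fam"

definition BZe_O :: "int \<Rightarrow> family crystal_data" where
  "BZe_O l = crystal_component l (BZe_crystal l) Oe_fam"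

end

theory Submission
  imports Defs
begin

text \<open>A tableau is read as a sequence of interlacing height functions, one for each diagonal.
  Exchanging two such sequences on a connected region where one exceeds the other preserves both
  interlacing and total weight; this gives the supermodularity and the tropical Pluecker relations of
  the minimal weights, the hard inequality resting on a discrete Jordan curve argument.  The Pluecker
  relations determine a family by its components at intervals.  These are partial sums of the
  Lusztig datum, so the operators on both sides can be compared on intervals.  The zeros of an
  aperiodic datum on each diagonal make the minimum over the part of a tableau that joins two distant
  blocks vanish, which identifies \<open>Theta\<close> with the weight of the Lusztig datum.  In the converse
  direction the components of an affine datum at intervals stabilise, their second differences form an
  aperiodic Lusztig datum, and it recovers the whole family; hence the component of \<open>O_fam\<close> is
  everything.\<close>

subsection \<open>Tableaux and height functions\<close>

text \<open>Height functions replace entries because they make tableaux of different sizes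
  comparable: the weight sees only increments, so \<open>f\<close> can be compared with
  \<open>g + 1\<close> as well as with \<open>g\<close>, and the size reappears as the value at the
  right end. A minimum over tableaux has no closed formula in general; every evaluation below rests
  on entries that are forced or cost nothing. The operators \<open>f_Z\<close> and
  \<open>e_Z\<close> involve chosen intervals and definite descriptions. Rather than computing them,
  the proof characterises a candidate by its untouched components and one value of
  \<open>Theta\<close>, and shows that it is the result on every admissible interval. A single
  factor of an affine operator destroys periodicity, so the middle part works with
  \<open>zeros_left\<close> in place of aperiodicity. In the converse direction aperiodicity is
  forced: along a diagonal without zeros every tableau pays for joining the sea to a distant block,
  which contradicts stabilisation. The crystal axioms are verified on the Lusztig side and carried
  over by the bijection.\<close>

definition tableau_weight :: "lusztig \<Rightarrow> nat \<Rightarrow> (nat \<Rightarrow> nat \<Rightarrow> int) \<Rightarrow> int" where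
  "tableau_weight a n C =
     (\<Sum>(p, q)\<in>{(p, q). p < q \<and> q < n}. int (a (C p q, C p q + int (q - p))))"

definition min_weight :: "lusztig \<Rightarrow> int set \<Rightarrow> int" where
  "min_weight a K = Min {tableau_weight a (card K) C |C. tableau K C}"

lemma tableau_diag: "tableau K C \<Longrightarrow> p < card K \<Longrightarrow> C p p = sorted_list_of_set K ! p"
  and tableau_row: "tableau K C \<Longrightarrow> p \<le> q \<Longrightarrow> q + 1 < card K \<Longrightarrow> C p q \<le> C p (q + 1)"
  and tableau_col: "tableau K C \<Longrightarrow> p < q \<Longrightarrow> q < card K \<Longrightarrow> C p q < C (p + 1) q"
  unfolding tableau_def by blast+

lemma tableau_lower:
  assumes "tableau K C" "p \<le> q" "q < card K"
  shows "sorted_list_of_set K ! p \<le> C p q"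
  using assms(2,3)
proof (induction q rule: dec_induct)
  case base
  then show ?case using tableau_diag[OF assms(1)] by simp
next
  case (step q)
  then show ?case using tableau_row[OF assms(1), of p q] by simp
qed

lemma tableau_upper:
  assumes "tableau K C" "p \<le> q" "q < card K"
  shows "C p q + int (q - p) \<le> sorted_list_of_set K ! q"
  using assms(2)
proof (induction p rule: inc_induct)
  case base
  then show ?case using tableau_diag[OF assms(1,3)] by simp
next
  case (step p)
  then show ?case using tableau_col[OF assms(1), of p q] assms(3) by simp
qed

lemma sorted_list_bounds:
  assumes "finite K" "K \<subseteq> {lo..<hi}" "p < card K"
  shows "lo \<le> sorted_list_of_set K ! p" "sorted_list_of_set K ! p < hi"
proof -
  have "sorted_list_of_set K ! p \<in> K"
    using assms by (metis length_sorted_list_of_set nth_mem set_sorted_list_of_set)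
  then show "lo \<le> sorted_list_of_set K ! p" "sorted_list_of_set K ! p < hi"
    using assms(2) by auto
qed

lemma tableau_bounds:
  assumes "tableau K C" "finite K" "K \<subseteq> {lo..<hi}" "p \<le> q" "q < card K"
  shows "lo \<le> C p q" "C p q + int (q - p) < hi"
  using tableau_lower[OF assms(1,4,5)] tableau_upper[OF assms(1,4,5)]
    sorted_list_bounds[OF assms(2,3), of p] sorted_list_bounds[OF assms(2,3), of q] assms(4,5)
  by auto

lemma tableau_exists: "finite K \<Longrightarrow> \<exists>C. tableau K C"
  by (rule exI[of _ "\<lambda>p q. sorted_list_of_set K ! p"])
    (auto simp: tableau_def intro!: sorted_wrt_nth_less[OF strict_sorted_list_of_set])

lemma tableau_weight_nonneg: "0 \<le> tableau_weight a n C"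
  unfolding tableau_weight_def by (auto intro!: sum_nonneg)

text \<open>Infinitely many functions \<open>C\<close> are \<open>K\<close>-tableaux, since entries
  outside the triangle are free. So the weights are bounded instead: entries lie in a window
  containing \<open>K\<close>, and \<open>B\<close> charges every position with all values in that
  window.\<close>

lemma finite_tableau_weights:
  assumes "finite K"
  shows "finite {tableau_weight a (card K) C |C. tableau K C}"
proof -
  obtain lo hi where K: "K \<subseteq> {lo..<hi}"
  proof
    show "K \<subseteq> {(if K = {} then 0 else Min K)..<(if K = {} then 0 else Max K) + 1}"
      using assms Max_ge[OF assms] Min_le[OF assms] by fastforce
  qed
  define B where "B = (\<Sum>(p, q)\<in>{(p, q). p < q \<and> q < card K}.
      \<Sum>x\<in>{lo..<hi}. int (a (x, x + int (q - p))))"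
  have "tableau_weight a (card K) C \<in> {0..B}" if C: "tableau K C" for C
  proof -
    have "tableau_weight a (card K) C \<le> B"
      unfolding tableau_weight_def B_def
    proof (rule sum_mono, clarify)
      fix p q assume pq: "p < q" "q < card K"
      have "C p q \<in> {lo..<hi}"
        using tableau_bounds[OF C assms K, of p q] pq by auto
      then show "int (a (C p q, C p q + int (q - p))) \<le> (\<Sum>x\<in>{lo..<hi}. int (a (x, x + int (q - p))))"
        by (intro member_le_sum) auto
    qed
    then show ?thesis by (simp add: tableau_weight_nonneg)
  qed
  then have "{tableau_weight a (card K) C |C. tableau K C} \<subseteq> {0..B}" by blast
  then show ?thesis by (rule finite_subset) simp
qed

lemma min_weight_le: "finite K \<Longrightarrow> tableau K C \<Longrightarrow> min_weight a K \<le> tableau_weight a (card K) C"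
  unfolding min_weight_def by (intro Min_le finite_tableau_weights) auto

lemma min_weight_attained:
  assumes "finite K"
  obtains C where "tableau K C" "min_weight a K = tableau_weight a (card K) C"
proof -
  have "min_weight a K \<in> {tableau_weight a (card K) C |C. tableau K C}"
    unfolding min_weight_def using tableau_exists[OF assms]
    by (intro Min_in finite_tableau_weights[OF assms]) blast
  then show ?thesis using that by blast
qed

lemma min_weight_eqI:
  assumes "finite K" "tableau K C" "tableau_weight a (card K) C = w"
    and "\<And>C. tableau K C \<Longrightarrow> w \<le> tableau_weight a (card K) C"
  shows "min_weight a K = w"
  by (metis assms min_weight_attained min_weight_le order_antisym)

definition ht :: "int set \<Rightarrow> int \<Rightarrow> int" where
  "ht K x = int (card (K \<inter> {..<x}))"

text \<open>Steps of 0 or 1 express that entries increase strictly along a diagonal. Of the two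
  conditions between neighbouring layers, the first is the weak increase along rows, the second the
  strict increase down columns.\<close>

definition interlaced :: "nat \<Rightarrow> (nat \<Rightarrow> int \<Rightarrow> int) \<Rightarrow> bool" where
  "interlaced D h \<longleftrightarrow>
     (\<forall>d\<le>D. \<forall>x. h d x \<le> h d (x + 1) \<and> h d (x + 1) \<le> h d x + 1) \<and>
     (\<forall>d<D. \<forall>x. h (Suc d) x \<le> h d x \<and> h d (x + 1) \<le> h (Suc d) x + 1)"

text \<open>\<open>h d x\<close> counts the entries less than \<open>x\<close> on the \<open>d\<close>-th superdiagonal of a tableau of
  size \<open>n\<close>.\<close>

definition height_pattern :: "int \<Rightarrow> int \<Rightarrow> nat \<Rightarrow> int \<Rightarrow> (nat \<Rightarrow> int \<Rightarrow> int) \<Rightarrow> bool" where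
  "height_pattern lo hi D n h \<longleftrightarrow> interlaced D h \<and>
     (\<forall>d\<le>D. \<forall>x\<le>lo. h d x = 0) \<and> (\<forall>d\<le>D. \<forall>x\<ge>hi. h d x = n - int d)"

definition layer_weight :: "lusztig \<Rightarrow> int \<Rightarrow> int \<Rightarrow> nat \<Rightarrow> (int \<Rightarrow> int) \<Rightarrow> int" where
  "layer_weight a lo hi d f = (\<Sum>x\<in>{lo..<hi}. (f (x + 1) - f x) * int (a (x, x + int d)))"

definition pattern_weight :: "lusztig \<Rightarrow> int \<Rightarrow> int \<Rightarrow> nat \<Rightarrow> (nat \<Rightarrow> int \<Rightarrow> int) \<Rightarrow> int" where
  "pattern_weight a lo hi D h = (\<Sum>d\<in>{1..D}. layer_weight a lo hi d (h d))"

lemma int_step_mono: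
  fixes f :: "int \<Rightarrow> int"
  assumes "\<And>x. f x \<le> f (x + 1)" "x \<le> y"
  shows "f x \<le> f y"
  using assms(2)
proof (induction y rule: int_ge_induct)
  case (step y)
  then show ?case using assms(1)[of y] by simp
qed simp

lemma interlaced_mono: "interlaced D h \<Longrightarrow> d \<le> D \<Longrightarrow> x \<le> y \<Longrightarrow> h d x \<le> h d y"
  by (rule int_step_mono) (auto simp: interlaced_def)

lemma height_pattern_bounds:
  assumes "height_pattern lo hi D n h" "d \<le> D"
  shows "0 \<le> h d x" "h d x \<le> n - int d"
proof -
  have i: "interlaced D h" using assms by (simp add: height_pattern_def)
  have "h d (min x lo) \<le> h d x" "h d x \<le> h d (max x hi)"
    using interlaced_mono[OF i assms(2)] by auto
  moreover have "h d (min x lo) = 0" "h d (max x hi) = n - int d"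
    using assms by (auto simp: height_pattern_def)
  ultimately show "0 \<le> h d x" "h d x \<le> n - int d" by auto
qed

text \<open>Assumption \<open>gal\<close> is the Galois correspondence between the entries
  \<open>c p\<close> of a diagonal and their counting function \<open>h\<close>; hence the increment
  of \<open>h\<close> at \<open>x\<close> counts the entries equal to \<open>x\<close>.\<close>

lemma layer_weight_eq_sum:
  fixes c :: "nat \<Rightarrow> int"
  assumes gal: "\<And>p x. p < m \<Longrightarrow> c p < x \<longleftrightarrow> int p < h x"
    and bnd: "\<And>x. 0 \<le> h x \<and> h x \<le> int m"
    and rng: "\<And>p. p < m \<Longrightarrow> c p \<in> {lo..<hi}"
  shows "layer_weight a lo hi d h = (\<Sum>p<m. int (a (c p, c p + int d)))"
proof -
  have hx: "h x = (\<Sum>p<m. if c p < x then 1 else 0)" for x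
  proof -
    have "{p. p < m \<and> c p < x} = {..<nat (h x)}"
      using gal[of _ x] bnd[of x] by (auto simp: zless_nat_eq_int_zless)
    then have "(\<Sum>p<m. if c p < x then 1 else (0::int)) = int (card {..<nat (h x)})"
      by (simp add: sum.If_cases Int_def)
    then show ?thesis using bnd[of x] by simp
  qed
  have "h (x + 1) - h x = (\<Sum>p<m. if c p = x then 1 else 0)" for x
    unfolding hx by (subst sum_subtractf[symmetric]) (auto intro!: sum.cong)
  then have "layer_weight a lo hi d h =
      (\<Sum>x\<in>{lo..<hi}. \<Sum>p<m. (if c p = x then 1 else 0) * int (a (x, x + int d)))"
    unfolding layer_weight_def by (simp add: sum_distrib_right)
  also have "\<dots> = (\<Sum>p<m. \<Sum>x\<in>{lo..<hi}. if c p = x then int (a (x, x + int d)) else 0)"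
    by (subst sum.swap) (auto intro!: sum.cong)
  also have "\<dots> = (\<Sum>p<m. int (a (c p, c p + int d)))"
    using rng by (intro sum.cong) (auto simp: sum.delta)
  finally show ?thesis .
qed

lemma tableau_weight_diagonals:
  assumes "n \<le> D + 1"
  shows "tableau_weight a n C = (\<Sum>d\<in>{1..D}. \<Sum>p<n - d. int (a (C p (p + d), C p (p + d) + int d)))"
proof -
  have "tableau_weight a n C =
      (\<Sum>(d, p)\<in>(SIGMA d:{1..D}. {..<n - d}). int (a (C p (p + d), C p (p + d) + int d)))"
    unfolding tableau_weight_def
    by (rule sum.reindex_bij_witness[of _ "\<lambda>(d, p). (p, p + d)" "\<lambda>(p, q). (q - p, p)"])
      (use assms in auto)
  then show ?thesis by (simp add: sum.Sigma)
qed

lemma downward_closed_eq_lessThan: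
  fixes A :: "nat set"
  assumes "finite A" "\<And>p q. p \<in> A \<Longrightarrow> q \<le> p \<Longrightarrow> q \<in> A"
  shows "A = {..<card A}"
proof (cases "A = {}")
  case False
  then have "A = {..Max A}" using assms by (auto intro: Max_in assms(2)[of "Max A"])
  then show ?thesis by (metis card_atMost lessThan_Suc_atMost)
qed simp

lemma ht_sorted_list:
  assumes "finite K" "p < card K"
  shows "sorted_list_of_set K ! p < x \<longleftrightarrow> int p < ht K x"
proof -
  let ?xs = "sorted_list_of_set K" and ?A = "{p. p < card K \<and> sorted_list_of_set K ! p < x}"
  have mono: "?xs ! p \<le> ?xs ! q" if "p \<le> q" "q < card K" for p q
    using that by (simp add: sorted_nth_mono)
  have A: "?A = {..<card ?A}"
    by (rule downward_closed_eq_lessThan) (auto dest: mono intro: le_less_trans)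
  have "bij_betw (\<lambda>p. ?xs ! p) ?A (K \<inter> {..<x})"
  proof (rule bij_betw_imageI)
    show "inj_on (\<lambda>p. ?xs ! p) ?A"
      by (auto simp: inj_on_def nth_eq_iff_index_eq)
    have "K = (\<lambda>p. ?xs ! p) ` {..<card K}"
      using assms(1) by (metis atLeast0LessThan length_sorted_list_of_set nth_image take_all order_refl set_sorted_list_of_set)
    then show "(\<lambda>p. ?xs ! p) ` ?A = K \<inter> {..<x}" by auto
  qed
  then have "ht K x = int (card ?A)" unfolding ht_def by (simp add: bij_betw_same_card)
  then show ?thesis using A assms(2) by auto
qed

lemma ht_bounds: "finite K \<Longrightarrow> 0 \<le> ht K x \<and> ht K x \<le> int (card K)"
  unfolding ht_def by (auto intro: card_mono)

lemma ht_insert: "finite K \<Longrightarrow> i \<notin> K \<Longrightarrow> ht (insert i K) x = ht K x + (if i < x then 1 else 0)"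
  by (auto simp: ht_def Int_insert_left)

text \<open>Keeping only the layers up to \<open>D\<close> can only lose weight, and loses none if
  all superdiagonals survive. The truncation lets tableaux of sizes that differ by one or two be
  exchanged layer by layer.\<close>

lemma tableau_to_pattern:
  assumes C: "tableau K C" and K: "finite K" "K \<subseteq> {lo..<hi}"
    and D: "D \<le> card K"
  obtains h where "height_pattern lo hi D (int (card K)) h" "h 0 = ht K"
    "pattern_weight a lo hi D h \<le> tableau_weight a (card K) C"
    "card K \<le> D + 1 \<Longrightarrow> pattern_weight a lo hi D h = tableau_weight a (card K) C"
proof -
  let ?n = "card K"
  define A where "A d x = {p. p + d < ?n \<and> C p (p + d) < x}" for d x
  define h where "h d x = int (card (A d x))" for d x
  have fin: "finite (A d x)" for d x
    by (rule finite_subset[of _ "{..<?n}"]) (auto simp: A_def)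
  have step: "C p (p + d) < C (Suc p) (Suc p + d)" if "Suc p + d < ?n" for p d
  proof (cases d)
    case 0
    then show ?thesis
      using that K sorted_wrt_nth_less[OF strict_sorted_list_of_set[of K], of p "Suc p"]
      by (simp add: tableau_diag[OF C])
  next
    case (Suc e)
    have "C p (p + d) < C (Suc p) (p + d)" using tableau_col[OF C, of p "p + d"] Suc that by simp
    also have "\<dots> \<le> C (Suc p) (Suc p + d)" using tableau_row[OF C, of "Suc p" "p + d"] Suc that by simp
    finally show ?thesis .
  qed
  have mono: "C q (q + d) \<le> C p (p + d)" if "q \<le> p" "p + d < ?n" for p q d
    using that
  proof (induction p rule: dec_induct)
    case (step p)
    then show ?case using \<open>\<And>d p. Suc p + d < ?n \<Longrightarrow> C p (p + d) < C (Suc p) (Suc p + d)\<close>[of p d]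
      by simp
  qed simp
  \<comment> \<open>Entries increase along a diagonal, so those below \<open>x\<close> form an
    initial segment and its length decides membership.\<close>
  have Aeq: "A d x = {..<card (A d x)}" for d x
    by (rule downward_closed_eq_lessThan[OF fin]) (auto simp: A_def dest: mono intro: le_less_trans)
  have gal: "C p (p + d) < x \<longleftrightarrow> int p < h d x" if "p + d < ?n" for p d x
  proof -
    have "p \<in> A d x \<longleftrightarrow> p < card (A d x)" using Aeq[of d x] by blast
    then show ?thesis using that by (simp add: A_def h_def)
  qed
  have bnd: "0 \<le> h d x \<and> h d x \<le> int (?n - d)" for d x
  proof -
    have "card (A d x) \<le> card {..<?n - d}" by (rule card_mono) (auto simp: A_def)
    then show ?thesis by (simp add: h_def)
  qed
  have h0: "h 0 x = ht K x" for x
  proof (rule ccontr)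
    assume ne: "h 0 x \<noteq> ht K x"
    define p where "p = nat (min (h 0 x) (ht K x))"
    have p: "int p = min (h 0 x) (ht K x)" using bnd[of 0 x] ht_bounds[OF K(1), of x] by (simp add: p_def)
    then have "p < ?n" using ne bnd[of 0 x] ht_bounds[OF K(1), of x] by auto
    then have "int p < h 0 x \<longleftrightarrow> int p < ht K x"
      using gal[of p 0 x] ht_sorted_list[OF K(1), of p x] tableau_diag[OF C, of p] by simp
    then show False using ne p by auto
  qed
  have i1: "h d x \<le> h d (x + 1)" for d x
  proof -
    have "card (A d x) \<le> card (A d (x + 1))" by (rule card_mono[OF fin]) (auto simp: A_def)
    then show ?thesis by (simp add: h_def)
  qed
  \<comment> \<open>In this and the next two inequalities: were the claim false, the entry whose
    index equals the smaller height would itself be counted in that height.\<close>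
  have i2: "h d (x + 1) \<le> h d x + 1" for d x
  proof (rule ccontr)
    assume *: "\<not> ?thesis"
    define p where "p = nat (h d x)"
    have p: "int p = h d x" using bnd[of d x] by (simp add: p_def)
    have "Suc p + d < ?n" using * p bnd[of d "x + 1"] by linarith
    moreover from this have "C (Suc p) (Suc p + d) < x + 1" using gal[of "Suc p" d "x + 1"] * p by simp
    ultimately have "int p < h d x" using gal[of p d x] step[of p d] by linarith
    then show False using p by simp
  qed
  have i3: "h (Suc d) x \<le> h d x" for d x
  proof (rule ccontr)
    assume *: "\<not> ?thesis"
    define p where "p = nat (h d x)"
    have p: "int p = h d x" using bnd[of d x] by (simp add: p_def)
    have n: "p + Suc d < ?n" using * p bnd[of "Suc d" x] by linarith
    then have "C p (p + Suc d) < x" using gal[of p "Suc d" x] * p by simp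
    moreover have "C p (p + d) \<le> C p (p + Suc d)" using tableau_row[OF C, of p "p + d"] n by simp
    ultimately have "int p < h d x" using gal[of p d x] n by simp
    then show False using p by simp
  qed
  have i4: "h d (x + 1) \<le> h (Suc d) x + 1" for d x
  proof (rule ccontr)
    assume *: "\<not> ?thesis"
    define p where "p = nat (h (Suc d) x)"
    have p: "int p = h (Suc d) x" using bnd[of "Suc d" x] by (simp add: p_def)
    have n: "Suc p + d < ?n" using * p bnd[of d "x + 1"] by linarith
    then have "C (Suc p) (Suc p + d) < x + 1" using gal[of "Suc p" d "x + 1"] * p by simp
    moreover have "C p (p + Suc d) < C (Suc p) (Suc p + d)" using tableau_col[OF C, of p "p + Suc d"] n by simp
    ultimately have "int p < h (Suc d) x" using gal[of p "Suc d" x] n by simp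
    then show False using p by simp
  qed
  have rng: "C p (p + d) \<in> {lo..<hi}" if "p + d < ?n" for p d
    using tableau_bounds[OF C K, of p "p + d"] that by auto
  have left: "h d x = 0" if "x \<le> lo" for d x
  proof -
    have "\<not> C p (p + d) < x" if "p + d < ?n" for p
      using rng[OF that] \<open>x \<le> lo\<close> by auto
    then have "A d x = {}" by (auto simp: A_def)
    then show ?thesis by (simp add: h_def)
  qed
  have right: "h d x = int ?n - int d" if "hi \<le> x" "d \<le> D" for d x
  proof -
    have "C p (p + d) < x" if "p + d < ?n" for p
      using rng[OF that] \<open>hi \<le> x\<close> by auto
    then have "A d x = {..<?n - d}" by (auto simp: A_def)
    then show ?thesis using that D by (simp add: h_def)
  qed
  have lw: "layer_weight a lo hi d (h d) = (\<Sum>p<?n - d. int (a (C p (p + d), C p (p + d) + int d)))" for d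
    by (rule layer_weight_eq_sum) (use gal bnd rng in auto)
  show thesis
  proof (rule that)
    show "height_pattern lo hi D (int ?n) h"
      using i1 i2 i3 i4 left right by (auto simp: height_pattern_def interlaced_def)
    show "h 0 = ht K" using h0 by auto
    show "pattern_weight a lo hi D h = tableau_weight a ?n C" if "?n \<le> D + 1"
      unfolding tableau_weight_diagonals[OF that] pattern_weight_def lw ..
    show "pattern_weight a lo hi D h \<le> tableau_weight a ?n C"
    proof -
      have "tableau_weight a ?n C =
          (\<Sum>d\<in>{1..D + ?n}. \<Sum>p<?n - d. int (a (C p (p + d), C p (p + d) + int d)))"
        by (rule tableau_weight_diagonals) simp
      also have "\<dots> \<ge> pattern_weight a lo hi D h"
        unfolding pattern_weight_def lw by (rule sum_mono2) (auto intro!: sum_nonneg)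
      finally show ?thesis .
    qed
  qed
qed

text \<open>Reads an entry back from a counting function: \<open>c\<close> is the last argument at
  which \<open>f\<close> is still at most \<open>p\<close>, the inverse half of the Galois
  correspondence.\<close>

lemma int_threshold:
  fixes f :: "int \<Rightarrow> int"
  assumes "\<And>x y. x \<le> y \<Longrightarrow> f x \<le> f y" "f lo \<le> p" "p < f hi"
  shows "\<exists>c\<in>{lo..<hi}. \<forall>x. c < x \<longleftrightarrow> p < f x"
proof -
  have lohi: "lo < hi" using assms by (meson le_less_trans not_le)
  let ?S = "{x\<in>{lo..<hi}. f x \<le> p}"
  have "finite ?S" by (rule finite_subset[of _ "{lo..<hi}"]) auto
  with assms lohi have S: "finite ?S" "lo \<in> ?S" by auto
  then have m: "Max ?S \<in> ?S" by (metis (no_types, lifting) Max_in empty_iff)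
  have "Max ?S < x \<longleftrightarrow> p < f x" for x
  proof
    assume x: "Max ?S < x"
    show "p < f x"
    proof (cases "x < hi")
      case True
      then have "x \<notin> ?S" using Max_ge[OF S(1), of x] x by auto
      moreover have "lo \<le> x" using x m by auto
      ultimately show ?thesis using True by auto
    next
      case False
      then show ?thesis using assms(1)[of hi x] assms(3) by simp
    qed
  next
    assume "p < f x"
    then show "Max ?S < x" using m assms(1)[of x "Max ?S"] by (force simp: not_less[symmetric])
  qed
  then show ?thesis using m by blast
qed

text \<open>Thresholds of the layers give the entries of a tableau, and interlacing becomes the row
  and column conditions. The bound \<open>card K \<le> D + 1\<close> guarantees that no
  superdiagonal is missing from the weight of the pattern.\<close>

lemma min_weight_le_pattern:
  assumes h: "height_pattern lo hi D (int (card K)) h" "h 0 = ht K"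
    and K: "finite K" "K \<subseteq> {lo..<hi}" and D: "card K \<le> D + 1"
  shows "min_weight a K \<le> pattern_weight a lo hi D h"
proof -
  let ?n = "card K"
  have il: "interlaced D h" using h by (simp add: height_pattern_def)
  \<comment> \<open>Heights in layer \<open>D\<close> lie between 0 and
    \<open>card K - D\<close>.\<close>
  have Dn: "D \<le> ?n"
    using height_pattern_bounds[OF h(1), of D lo] by simp
  have "\<exists>c. c \<in> {lo..<hi} \<and> (\<forall>x. c < x \<longleftrightarrow> int p < h d x)" if "p + d < ?n" for p d
  proof -
    have d: "d \<le> D" using that D by simp
    have "h d lo = 0" "h d hi = int ?n - int d" using h d by (auto simp: height_pattern_def)
    then show ?thesis
      using int_threshold[of "h d" lo "int p" hi] interlaced_mono[OF il d] that by force
  qed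
  then obtain c where c: "\<And>p d. p + d < ?n \<Longrightarrow> c p d \<in> {lo..<hi}"
      "\<And>p d x. p + d < ?n \<Longrightarrow> c p d < x \<longleftrightarrow> int p < h d x"
    by metis
  define C where "C p q = c p (q - p)" for p q
  have il': "h (Suc d) x \<le> h d x" "h d (x + 1) \<le> h (Suc d) x + 1" if "Suc d < ?n" for d x
    using il that D by (auto simp: interlaced_def)
  have "tableau K C"
    unfolding tableau_def
  proof (intro conjI allI impI)
    fix p assume p: "p < ?n"
    have "\<forall>x. c p 0 < x \<longleftrightarrow> sorted_list_of_set K ! p < x"
      using c(2)[of p 0] p ht_sorted_list[OF K(1) p] h(2) by simp
    then show "C p p = sorted_list_of_set K ! p"
      by (metis C_def diff_self_eq_0 linorder_neqE order_less_irrefl)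
  next
    fix p q assume pq: "p \<le> q \<and> q + 1 < ?n"
    have "\<not> c p (Suc (q - p)) < c p (q - p)"
      using c(2)[of p "Suc (q - p)" "c p (q - p)"] c(2)[of p "q - p" "c p (q - p)"]
        il'(1)[of "q - p" "c p (q - p)"] pq by force
    then show "C p q \<le> C p (q + 1)"
      using pq by (simp add: C_def Suc_diff_le)
  next
    fix p q assume pq: "p < q \<and> q < ?n"
    then obtain d where d: "q = p + Suc d" by (metis less_imp_Suc_add add_Suc_right)
    have "c p (Suc d) < c (Suc p) d"
      using c(2)[of "Suc p" d "c (Suc p) d + 1"] c(2)[of p "Suc d" "c (Suc p) d"]
        il'(2)[of d "c (Suc p) d"] pq d by force
    then show "C p q < C (p + 1) q" by (simp add: C_def d)
  qed
  then have "min_weight a K \<le> tableau_weight a ?n C" by (rule min_weight_le[OF K(1)])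
  also have "\<dots> = (\<Sum>d\<in>{1..D}. \<Sum>p<?n - d. int (a (c p d, c p d + int d)))"
    by (simp add: tableau_weight_diagonals[OF D] C_def)
  also have "\<dots> = pattern_weight a lo hi D h"
    unfolding pattern_weight_def
  proof (rule sum.cong[OF refl], rule layer_weight_eq_sum[symmetric])
    fix d x assume "d \<in> {1..D}"
    then show "0 \<le> h d x \<and> h d x \<le> int (?n - d)"
      using height_pattern_bounds[OF h(1), of d x] Dn by auto
  qed (use c in auto)
  finally show ?thesis .
qed

lemma min_weight_pattern_attained:
  assumes "finite K" "K \<subseteq> {lo..<hi}" "D \<le> card K"
  obtains h where "height_pattern lo hi D (int (card K)) h" "h 0 = ht K"
    "pattern_weight a lo hi D h \<le> min_weight a K"
proof -
  obtain C where C: "tableau K C" "min_weight a K = tableau_weight a (card K) C"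
    by (rule min_weight_attained[OF assms(1)])
  show ?thesis
    by (rule tableau_to_pattern[OF C(1) assms]) (use that C(2) in auto)
qed

subsection \<open>Exchanging parts of two height functions\<close>

definition swap_on :: "(nat \<times> int) set \<Rightarrow> (nat \<Rightarrow> int \<Rightarrow> int) \<Rightarrow> (nat \<Rightarrow> int \<Rightarrow> int) \<Rightarrow> nat \<Rightarrow> int \<Rightarrow> int" where
  "swap_on S f g d x = (if (d, x) \<in> S then g d x else f d x)"

text \<open>The pairs of positions whose heights are compared in \<open>interlaced\<close>.\<close>

definition adj :: "nat \<times> int \<Rightarrow> nat \<times> int \<Rightarrow> bool" where
  "adj u v \<longleftrightarrow> (fst u = fst v \<and> (snd v = snd u + 1 \<or> snd u = snd v + 1))
     \<or> (fst v = Suc (fst u) \<and> (snd v = snd u \<or> snd v + 1 = snd u))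
     \<or> (fst u = Suc (fst v) \<and> (snd u = snd v \<or> snd u + 1 = snd v))"

text \<open>A union of connected components, with respect to \<open>adj\<close>, of the region where
  \<open>f\<close> exceeds \<open>g\<close> in the layers up to \<open>D\<close>.\<close>

definition island :: "nat \<Rightarrow> (nat \<Rightarrow> int \<Rightarrow> int) \<Rightarrow> (nat \<Rightarrow> int \<Rightarrow> int) \<Rightarrow> (nat \<times> int) set \<Rightarrow> bool" where
  "island D f g S \<longleftrightarrow> (\<forall>(d, x)\<in>S. d \<le> D \<and> g d x < f d x) \<and>
     (\<forall>u\<in>S. \<forall>d x. adj u (d, x) \<and> d \<le> D \<and> g d x < f d x \<longrightarrow> (d, x) \<in> S)"

text \<open>Every interlacing condition has the form \<open>h u \<le> h v + c\<close> for adjacent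
  \<open>u\<close>, \<open>v\<close>, where \<open>c\<close> is 0 or 1. If only one of the two lies
  in \<open>S\<close>, then \<open>g < f\<close> there and \<open>f \<le> g\<close> at the other,
  and the mixed condition follows from that of \<open>f\<close> or of \<open>g\<close>.\<close>

lemma island_swap_interlaced:
  assumes f: "interlaced D f" and g: "interlaced D g" and S: "island D f g S"
  shows "interlaced D (swap_on S f g)" "interlaced D (swap_on S g f)"
proof -
  have in_S: "g d x < f d x" if "(d, x) \<in> S" for d x
    using S that by (auto simp: island_def)
  have closed: "f e y \<le> g e y" if "(d, x) \<in> S" "(e, y) \<notin> S" "adj (d, x) (e, y)" "e \<le> D" for d x e y
    using S that unfolding island_def by (meson not_less)
  have f1: "f d x \<le> f d (x + 1)" "f d (x + 1) \<le> f d x + 1" if "d \<le> D" for d x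
    using f that by (auto simp: interlaced_def)
  have g1: "g d x \<le> g d (x + 1)" "g d (x + 1) \<le> g d x + 1" if "d \<le> D" for d x
    using g that by (auto simp: interlaced_def)
  have f2: "f (Suc d) x \<le> f d x" "f d (x + 1) \<le> f (Suc d) x + 1" if "d < D" for d x
    using f that by (auto simp: interlaced_def)
  have g2: "g (Suc d) x \<le> g d x" "g d (x + 1) \<le> g (Suc d) x + 1" if "d < D" for d x
    using g that by (auto simp: interlaced_def)
  have A: "(swap_on S f g d x \<le> swap_on S f g d (x + 1) \<and> swap_on S f g d (x + 1) \<le> swap_on S f g d x + 1) \<and>
    (swap_on S g f d x \<le> swap_on S g f d (x + 1) \<and> swap_on S g f d (x + 1) \<le> swap_on S g f d x + 1)"
    if "d \<le> D" for d x
    using f1[OF that, of x] g1[OF that, of x] in_S[of d x] in_S[of d "x + 1"]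
      closed[of d x d "x + 1"] closed[of d "x + 1" d x] that
    by (auto simp: swap_on_def adj_def)
  have B: "(swap_on S f g (Suc d) x \<le> swap_on S f g d x \<and> swap_on S f g d (x + 1) \<le> swap_on S f g (Suc d) x + 1) \<and>
    (swap_on S g f (Suc d) x \<le> swap_on S g f d x \<and> swap_on S g f d (x + 1) \<le> swap_on S g f (Suc d) x + 1)"
    if "d < D" for d x
    using f2[OF that, of x] g2[OF that, of x] in_S[of d x] in_S[of d "x + 1"] in_S[of "Suc d" x]
      closed[of d x "Suc d" x] closed[of "Suc d" x d x]
      closed[of d "x + 1" "Suc d" x] closed[of "Suc d" x d "x + 1"] that
    by (auto simp: swap_on_def adj_def)
  show "interlaced D (swap_on S f g)" "interlaced D (swap_on S g f)"
    using A B by (auto simp: interlaced_def)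
qed

lemma pattern_weight_add:
  assumes "\<And>d x. f' d x + g' d x = f d x + g d x"
  shows "pattern_weight a lo hi D f' + pattern_weight a lo hi D g' =
    pattern_weight a lo hi D f + pattern_weight a lo hi D g"
proof -
  have *: "f' d x = f d x + g d x - g' d x" for d x using assms[of d x] by simp
  show ?thesis
    unfolding pattern_weight_def layer_weight_def sum.distrib[symmetric]
    by (intro sum.cong refl) (simp add: * algebra_simps)
qed

lemma interlaced_shift: "interlaced D f \<Longrightarrow> interlaced D (\<lambda>d x. f d x + c)"
  by (simp add: interlaced_def)

section \<open>Crossing parity of walks in the grid of positions\<close>

text \<open>\<open>crosses q v v'\<close>: the edge from \<open>v\<close> to \<open>v'\<close> crosses the ray that starts from \<open>q\<close> in the
  direction of increasing layers, just to the right of the column of \<open>q\<close>.\<close>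

definition crosses :: "nat \<times> int \<Rightarrow> nat \<times> int \<Rightarrow> nat \<times> int \<Rightarrow> bool" where
  "crosses q v v' \<longleftrightarrow> min (snd v) (snd v') = snd q \<and> max (snd v) (snd v') = snd q + 1 \<and>
     (if fst v = fst v' then fst q < fst v else fst q \<le> min (fst v) (fst v'))"

text \<open>\<open>w q\<close> is the parity of the number of steps that cross the ray of
  \<open>q\<close>; \<open>P\<close> is the region in which the walk stays.\<close>

inductive walk :: "(nat \<times> int \<Rightarrow> bool) \<Rightarrow> nat \<times> int \<Rightarrow> nat \<times> int \<Rightarrow> (nat \<times> int \<Rightarrow> bool) \<Rightarrow> bool"
  for P u where
  walk_start: "P u \<Longrightarrow> walk P u u (\<lambda>q. False)"
| walk_extend: "walk P u v w \<Longrightarrow> adj v v' \<Longrightarrow> P v' \<Longrightarrow> walk P u v' (\<lambda>q. w q \<noteq> crosses q v v')"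

lemma walk_end: "walk P u v w \<Longrightarrow> P v"
  by (induction rule: walk.induct)

text \<open>The rays of two neighbours in adjacent columns bound a strip of width one. These are its
  vertices, strictly beyond the smaller starting layer; neighbours in the same column have no
  strip.\<close>

definition between :: "nat \<times> int \<Rightarrow> nat \<times> int \<Rightarrow> nat \<times> int \<Rightarrow> bool" where
  "between q q' v \<longleftrightarrow> snd q \<noteq> snd q' \<and> snd v = max (snd q) (snd q') \<and> min (fst q) (fst q') < fst v"

text \<open>All configurations are local, so the only planar topology needed, namely that a strip is
  entered or left through one of its two bounding rays, is a finite case distinction.\<close>

lemma crosses_adj:
  assumes "adj q q'" "adj v v'" "v \<noteq> q" "v \<noteq> q'" "v' \<noteq> q" "v' \<noteq> q'"
  shows "(crosses q v v' \<noteq> crosses q' v v') \<longleftrightarrow> (between q q' v \<noteq> between q q' v')"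
proof -
  obtain e z e' z' d x d' x' where [simp]: "q = (e, z)" "q' = (e', z')" "v = (d, x)" "v' = (d', x')"
    by (cases q, cases q', cases v, cases v') auto
  show ?thesis
    using assms(1) unfolding adj_def
    using assms(2) unfolding adj_def
    using assms(3-6) unfolding crosses_def between_def
    by (elim disjE conjE) (simp_all add: min_def max_def, (presburger | linarith | auto)+)
qed

text \<open>Summing \<open>crosses_adj\<close> along the walk telescopes: off the region
  \<open>P\<close> the parity is locally constant, except where exactly one end of the walk lies in
  the strip.\<close>

lemma walk_parity_adj:
  assumes "walk P u v w" "adj q q'" "\<not> P q" "\<not> P q'"
  shows "(w q \<noteq> w q') \<longleftrightarrow> (between q q' u \<noteq> between q q' v)"
  using assms
proof (induction rule: walk.induct)
  case (walk_extend v w v')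
  have "P v" using walk_extend(1) by (rule walk_end)
  then have "v \<noteq> q" "v \<noteq> q'" "v' \<noteq> q" "v' \<noteq> q'" using walk_extend by auto
  then show ?case using crosses_adj[of q q' v v'] walk_extend by auto
qed auto

text \<open>Apart from an edge at its own starting point, the ray of \<open>(0, j)\<close> meets
  every edge between columns \<open>j\<close> and \<open>j + 1\<close>, so crossing it means
  changing sides.\<close>

lemma walk_parity_top:
  assumes "walk P u v w" "\<not> P (0, j)"
  shows "w (0, j) \<longleftrightarrow> (snd u \<le> j) \<noteq> (snd v \<le> j)"
  using assms
proof (induction rule: walk.induct)
  case (walk_extend v w v')
  have "P v" using walk_extend(1) by (rule walk_end)
  then have "v \<noteq> (0, j)" "v' \<noteq> (0, j)" using walk_extend by auto
  then have "crosses (0, j) v v' \<longleftrightarrow> (snd v \<le> j) \<noteq> (snd v' \<le> j)"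
    using walk_extend(2) by (cases v; cases v') (auto simp: adj_def crosses_def min_def max_def)
  then show ?case using walk_extend by auto
qed auto

lemma walk_parity_left:
  assumes "walk P u v w" "\<And>v. P v \<Longrightarrow> snd q < snd v"
  shows "\<not> w q"
  using assms
proof (induction rule: walk.induct)
  case (walk_extend v w v')
  have "snd q < snd v" "snd q < snd v'" using walk_extend walk_end[OF walk_extend(1)] by auto
  then have "\<not> crosses q v v'" by (auto simp: crosses_def min_def)
  then show ?case using walk_extend by auto
qed auto

text \<open>A discrete form of the Jordan curve theorem: if the component of \<open>(0, i)\<close> in the region
  \<open>g < f\<close> reaches the right end, then a walk to that end cuts off \<open>(0, j)\<close> from the left end, and
  the points of the complementary region with odd crossing parity form an island.\<close>

lemma island_cases:
  assumes left: "\<And>d x. d \<le> D \<Longrightarrow> x \<le> lo \<Longrightarrow> f d x \<le> g d x"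
    and right: "\<And>d x. d \<le> D \<Longrightarrow> hi \<le> x \<Longrightarrow> g d x < f d x"
    and i: "g 0 i < f 0 i" and j: "f 0 j \<le> g 0 j" and "i < j"
  obtains (up) S where "island D f g S" "(0, i) \<in> S" "\<And>d x. (d, x) \<in> S \<Longrightarrow> x < hi"
  | (down) S where "island D (\<lambda>d x. g d x + 1) f S" "(0, j) \<in> S" "\<And>d x. (d, x) \<in> S \<Longrightarrow> lo < x"
proof -
  define P where "P v \<longleftrightarrow> fst v \<le> D \<and> g (fst v) (snd v) < f (fst v) (snd v)" for v
  define S where "S = {v. \<exists>w. walk P (0, i) v w}"
  have Pi: "P (0, i)" using i by (simp add: P_def)
  then have iS: "(0, i) \<in> S" using walk_start unfolding S_def by blast
  have S: "island D f g S"
    unfolding island_def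
  proof (intro conjI ballI allI impI)
    fix v assume "v \<in> S"
    then show "case v of (d, x) \<Rightarrow> d \<le> D \<and> g d x < f d x"
      using walk_end by (fastforce simp: S_def P_def)
  next
    fix u d x assume "u \<in> S" "adj u (d, x) \<and> d \<le> D \<and> g d x < f d x"
    then show "(d, x) \<in> S"
      unfolding S_def using walk_extend[of P "(0, i)" u _ "(d, x)"] by (auto simp: P_def)
  qed
  show thesis
  proof (cases "\<forall>d x. (d, x) \<in> S \<longrightarrow> x < hi")
    case True
    then show ?thesis using up[OF S iS] by blast
  next
    case False
    then obtain d y w where w: "walk P (0, i) (d, y) w" and y: "hi \<le> y"
      by (auto simp: S_def not_less)
    define T where "T = {v. fst v \<le> D \<and> \<not> P v \<and> w v}"
    have lt_hi: "x < hi" if "e \<le> D" "\<not> P (e, x)" for e x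
      using right[of e x] that by (force simp: P_def)
    have "island D (\<lambda>d x. g d x + 1) f T"
      unfolding island_def
    proof (intro conjI ballI allI impI)
      fix v assume "v \<in> T"
      then show "case v of (d, x) \<Rightarrow> d \<le> D \<and> f d x < g d x + 1"
        by (auto simp: T_def P_def)
    next
      fix u e x assume u: "u \<in> T" and e: "adj u (e, x) \<and> e \<le> D \<and> f e x < g e x + 1"
      have np: "\<not> P u" "\<not> P (e, x)" using u e by (auto simp: T_def P_def)
      have "snd u < hi" "x < hi" using lt_hi[of "fst u" "snd u"] lt_hi[of e x] np u e by (auto simp: T_def)
      \<comment> \<open>One end of the walk lies in layer 0, hence never strictly beyond the start
        of a ray; the other lies at or beyond \<open>hi\<close>, to the right of both points. So the
        parity does not change between neighbours of the complementary region.\<close>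
      then have "\<not> between u (e, x) (0, i)" "\<not> between u (e, x) (d, y)"
        using y by (auto simp: between_def max_def)
      then have "w u = w (e, x)" using walk_parity_adj[OF w _ np] e by auto
      then show "(e, x) \<in> T" using u e np by (auto simp: T_def)
    qed
    moreover have "(0, j) \<in> T"
    proof -
      have nj: "\<not> P (0, j)" using j by (auto simp: P_def)
      then have "j < hi" using lt_hi[of 0 j] by simp
      then show ?thesis using walk_parity_top[OF w nj] y nj \<open>i < j\<close> by (simp add: T_def)
    qed
    moreover have "lo < x" if "(e, x) \<in> T" for e x
    proof (rule ccontr)
      assume *: "\<not> lo < x"
      have "x < snd v" if "P v" for v
        using left[of "fst v" "snd v"] that * by (force simp: P_def)
      then have "\<not> w (e, x)" using walk_parity_left[OF w, of "(e, x)"] by auto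
      then show False using that by (simp add: T_def)
    qed
    ultimately show ?thesis by (rule down)
  qed
qed

section \<open>Supermodularity and tropical Pluecker relations of the minimal weights\<close>

lemma island_all: "island D f g {(d, x). d \<le> D \<and> g d x < f d x}"
  by (auto simp: island_def)

text \<open>Bookkeeping shared by the four exchanges. Boundary values are required of
  \<open>f'\<close> alone, since those of \<open>g'\<close> follow from the conserved sum. Optimal
  patterns may have been truncated, which is why their weights enter with an inequality.\<close>

lemma exchange_le:
  assumes f: "height_pattern lo hi D (int (card K)) f" "pattern_weight a lo hi D f \<le> min_weight a K"
    and g: "height_pattern lo hi D (int (card L)) g" "pattern_weight a lo hi D g \<le> min_weight a L"
    and sum: "\<And>d x. f' d x + g' d x = f d x + g d x"
    and f': "interlaced D f'" "f' 0 = ht K'" and g': "interlaced D g'" "g' 0 = ht L'"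
    and fin: "finite K'" "K' \<subseteq> {lo..<hi}" "finite L'" "L' \<subseteq> {lo..<hi}"
    and D: "card K' \<le> D + 1" "card L' \<le> D + 1"
    and left: "\<And>d x. d \<le> D \<Longrightarrow> x \<le> lo \<Longrightarrow> f' d x = 0"
    and right: "\<And>d x. d \<le> D \<Longrightarrow> hi \<le> x \<Longrightarrow> f' d x = int (card K') - int d"
    and card: "card K' + card L' = card K + card L"
  shows "min_weight a K' + min_weight a L' \<le> min_weight a K + min_weight a L"
proof -
  have "height_pattern lo hi D (int (card K')) f'"
    using f' left right by (simp add: height_pattern_def)
  moreover have "height_pattern lo hi D (int (card L')) g'"
    unfolding height_pattern_def
  proof (intro conjI allI impI)
    show "interlaced D g'" by (rule g')
    fix d x assume "d \<le> D" "x \<le> lo"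
    then show "g' d x = 0" using sum[of d x] left f g by (simp add: height_pattern_def)
  next
    fix d x assume "d \<le> D" "hi \<le> x"
    then show "g' d x = int (card L') - int d"
      using sum[of d x] right f g card by (simp add: height_pattern_def)
  qed
  ultimately have "min_weight a K' + min_weight a L' \<le> pattern_weight a lo hi D f' + pattern_weight a lo hi D g'"
    using f' g' fin D by (intro add_mono min_weight_le_pattern)
  also have "\<dots> = pattern_weight a lo hi D f + pattern_weight a lo hi D g"
    by (rule pattern_weight_add[OF sum])
  finally show ?thesis using f(2) g(2) by simp
qed

lemma finite_int_window:
  assumes "finite (K :: int set)"
  obtains lo hi where "K \<subseteq> {lo..<hi}" "lo \<le> hi"
proof (cases "K = {}")
  case False
  have K: "K \<subseteq> {Min K..<Max K + 1}"
    using Max_ge[OF assms] Min_le[OF assms] by fastforce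
  then have "Min K \<le> Max K + 1" using False by fastforce
  with K show ?thesis by (rule that)
qed (use that[of 0 0] in simp)

context
  fixes a :: lusztig and k :: "int set"
  assumes k: "finite k"
begin

text \<open>Exchanging on the whole region where \<open>f\<close> exceeds \<open>g + 1\<close> turns
  optimal patterns for the large set and for \<open>k\<close> into the minimum of \<open>f\<close>
  and \<open>g + 1\<close> and the maximum lowered by 1. In layer 0 this distributes the two extra
  steps at \<open>i < j\<close>, one to each.\<close>

lemma min_weight_supermodular_less:
  assumes ij: "i < j" "i \<notin> k" "j \<notin> k"
  shows "min_weight a (insert i k) + min_weight a (insert j k) \<le>
    min_weight a (insert i (insert j k)) + min_weight a k"
proof -
  obtain lo hi where w: "insert i (insert j k) \<subseteq> {lo..<hi}" by (rule finite_int_window[of "insert i (insert j k)"]) (use k in auto)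
  let ?K = "insert i (insert j k)"
  have c: "card ?K = card k + 2" "card (insert i k) = card k + 1" "card (insert j k) = card k + 1"
    using k ij by auto
  obtain f where f: "height_pattern lo hi (card k) (int (card ?K)) f" "f 0 = ht ?K"
      "pattern_weight a lo hi (card k) f \<le> min_weight a ?K"
    using min_weight_pattern_attained[of ?K lo hi "card k" a] k w c by auto
  obtain g where g: "height_pattern lo hi (card k) (int (card k)) g" "g 0 = ht k"
      "pattern_weight a lo hi (card k) g \<le> min_weight a k"
    using min_weight_pattern_attained[of k lo hi "card k" a] k w by auto
  let ?g = "\<lambda>d x. g d x + 1"
  let ?S = "{(d, x). d \<le> card k \<and> ?g d x < f d x}"
  have il: "interlaced (card k) f" "interlaced (card k) ?g"
    using f g by (auto simp: height_pattern_def interlaced_shift)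
  note sw = island_swap_interlaced[OF il island_all]
  have bd: "f d x = 0" "g d x = 0" if "d \<le> card k" "x \<le> lo" for d x
    using f g that by (auto simp: height_pattern_def)
  have bd': "f d x = int (card k) + 2 - int d" "g d x = int (card k) - int d" if "d \<le> card k" "hi \<le> x" for d x
    using f g that c by (auto simp: height_pattern_def)
  have top: "f 0 x = ht k x + (if i < x then 1 else 0) + (if j < x then 1 else 0)" "g 0 x = ht k x" for x
    using f(2) g(2) k ij by (auto simp: ht_insert)
  show ?thesis
  proof (rule exchange_le[OF f(1,3) g(1,3), where f' = "swap_on ?S f ?g" and g' = "\<lambda>d x. swap_on ?S ?g f d x + -1" and K' = "(insert i k)" and L' = "(insert j k)"])
    show "interlaced (card k) (swap_on ?S f ?g)" by (rule sw)
    show "interlaced (card k) (\<lambda>d x. swap_on ?S ?g f d x + -1)" by (rule interlaced_shift[OF sw(2)])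
    show "swap_on ?S f ?g d x + (swap_on ?S ?g f d x + -1) = f d x + g d x" for d x
      by (simp add: swap_on_def)
    show "swap_on ?S f ?g 0 = ht (insert i k)"
      using top k ij by (auto simp: swap_on_def ht_insert)
    show "(\<lambda>x. swap_on ?S ?g f 0 x + -1) = ht (insert j k)"
      using top k ij by (auto simp: swap_on_def ht_insert)
    show "swap_on ?S f ?g d x = 0" if "d \<le> card k" "x \<le> lo" for d x
      using bd[OF that] by (simp add: swap_on_def)
    show "swap_on ?S f ?g d x = int (card (insert i k)) - int d" if "d \<le> card k" "hi \<le> x" for d x
      using bd'[OF that] that c by (simp add: swap_on_def)
  qed (use w k c in auto)
qed

lemma min_weight_supermodular:
  assumes ij: "i \<noteq> j" "i \<notin> k" "j \<notin> k"
  shows "min_weight a (insert i k) + min_weight a (insert j k) \<le>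
    min_weight a (insert i (insert j k)) + min_weight a k"
  using min_weight_supermodular_less[of i j] min_weight_supermodular_less[of j i] assms
  by (cases "i < j") (auto simp: insert_commute)

context
  fixes h i j :: int
  assumes hij: "h < i" "i < j" "h \<notin> k" "i \<notin> k" "j \<notin> k"
begin

text \<open>The minimum of \<open>f\<close> and \<open>g + 1\<close> again: in layer 0
  \<open>f\<close> exceeds \<open>g + 1\<close> exactly between \<open>i\<close> and
  \<open>j\<close>, so the exchange gives away the step at \<open>i\<close> and takes the step at
  \<open>j\<close> in return.\<close>

lemma min_weight_plucker_le1:
  "min_weight a (insert h (insert j k)) + min_weight a (insert i k) \<le>
    min_weight a (insert h (insert i k)) + min_weight a (insert j k)"
proof -
  let ?K = "insert h (insert i k)" and ?L = "insert j k" and ?D = "card k + 1"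
  obtain lo hi where w: "insert h (insert i (insert j k)) \<subseteq> {lo..<hi}" by (rule finite_int_window[of "insert h (insert i (insert j k))"]) (use k in auto)
  have c: "card ?K = card k + 2" "card ?L = card k + 1"
      "card (insert h (insert j k)) = card k + 2" "card (insert i k) = card k + 1"
    using k hij by auto
  obtain f where f: "height_pattern lo hi ?D (int (card ?K)) f" "f 0 = ht ?K"
      "pattern_weight a lo hi ?D f \<le> min_weight a ?K"
    using min_weight_pattern_attained[of ?K lo hi ?D a] k w c by auto
  obtain g where g: "height_pattern lo hi ?D (int (card ?L)) g" "g 0 = ht ?L"
      "pattern_weight a lo hi ?D g \<le> min_weight a ?L"
    using min_weight_pattern_attained[of ?L lo hi ?D a] k w c by auto
  let ?g = "\<lambda>d x. g d x + 1"
  let ?S = "{(d, x). d \<le> ?D \<and> ?g d x < f d x}"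
  have il: "interlaced ?D f" "interlaced ?D ?g"
    using f g by (auto simp: height_pattern_def interlaced_shift)
  note sw = island_swap_interlaced[OF il island_all]
  have bd: "f d x = 0" "g d x = 0" if "d \<le> ?D" "x \<le> lo" for d x
    using f g that by (auto simp: height_pattern_def)
  have bd': "f d x = int (card k) + 2 - int d" "g d x = int (card k) + 1 - int d" if "d \<le> ?D" "hi \<le> x" for d x
    using f g that c by (auto simp: height_pattern_def)
  have top: "f 0 x = ht k x + (if h < x then 1 else 0) + (if i < x then 1 else 0)"
      "g 0 x = ht k x + (if j < x then 1 else 0)" for x
    using f(2) g(2) k hij by (auto simp: ht_insert)
  show ?thesis
  proof (rule exchange_le[OF f(1,3) g(1,3), where f' = "swap_on ?S f ?g" and g' = "\<lambda>d x. swap_on ?S ?g f d x + -1" and K' = "(insert h (insert j k))" and L' = "(insert i k)"])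
    show "interlaced ?D (swap_on ?S f ?g)" by (rule sw)
    show "interlaced ?D (\<lambda>d x. swap_on ?S ?g f d x + -1)" by (rule interlaced_shift[OF sw(2)])
    show "swap_on ?S f ?g d x + (swap_on ?S ?g f d x + -1) = f d x + g d x" for d x
      by (simp add: swap_on_def)
    show "swap_on ?S f ?g 0 = ht (insert h (insert j k))"
      using top k hij by (auto simp: swap_on_def ht_insert)
    show "(\<lambda>x. swap_on ?S ?g f 0 x + -1) = ht (insert i k)"
      using top k hij by (auto simp: swap_on_def ht_insert)
    show "swap_on ?S f ?g d x = 0" if "d \<le> ?D" "x \<le> lo" for d x
      using bd[OF that] by (simp add: swap_on_def)
    show "swap_on ?S f ?g d x = int (card (insert h (insert j k))) - int d" if "d \<le> ?D" "hi \<le> x" for d x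
      using bd'[OF that] that c by (simp add: swap_on_def)
  qed (use w k c in auto)
qed

text \<open>Here the patterns are compared without a shift: in layer 0 \<open>g\<close> exceeds
  \<open>f\<close> exactly between \<open>h\<close> and \<open>i\<close>, and the exchange trades
  the step at \<open>i\<close> for that at \<open>h\<close>.\<close>

lemma min_weight_plucker_le2:
  "min_weight a (insert h (insert j k)) + min_weight a (insert i k) \<le>
    min_weight a (insert i (insert j k)) + min_weight a (insert h k)"
proof -
  let ?K = "insert i (insert j k)" and ?L = "insert h k" and ?D = "card k + 1"
  obtain lo hi where w: "insert h (insert i (insert j k)) \<subseteq> {lo..<hi}" by (rule finite_int_window[of "insert h (insert i (insert j k))"]) (use k in auto)
  have c: "card ?K = card k + 2" "card ?L = card k + 1"
      "card (insert h (insert j k)) = card k + 2" "card (insert i k) = card k + 1"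
    using k hij by auto
  obtain f where f: "height_pattern lo hi ?D (int (card ?K)) f" "f 0 = ht ?K"
      "pattern_weight a lo hi ?D f \<le> min_weight a ?K"
    using min_weight_pattern_attained[of ?K lo hi ?D a] k w c by auto
  obtain g where g: "height_pattern lo hi ?D (int (card ?L)) g" "g 0 = ht ?L"
      "pattern_weight a lo hi ?D g \<le> min_weight a ?L"
    using min_weight_pattern_attained[of ?L lo hi ?D a] k w c by auto
  let ?S = "{(d, x). d \<le> ?D \<and> f d x < g d x}"
  have il: "interlaced ?D f" "interlaced ?D g"
    using f g by (auto simp: height_pattern_def)
  note sw = island_swap_interlaced[OF il(2,1) island_all]
  have bd: "f d x = 0" "g d x = 0" if "d \<le> ?D" "x \<le> lo" for d x
    using f g that by (auto simp: height_pattern_def)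
  have bd': "f d x = int (card k) + 2 - int d" "g d x = int (card k) + 1 - int d" if "d \<le> ?D" "hi \<le> x" for d x
    using f g that c by (auto simp: height_pattern_def)
  have top: "f 0 x = ht k x + (if i < x then 1 else 0) + (if j < x then 1 else 0)"
      "g 0 x = ht k x + (if h < x then 1 else 0)" for x
    using f(2) g(2) k hij by (auto simp: ht_insert)
  show ?thesis
  proof (rule exchange_le[OF f(1,3) g(1,3), where f' = "swap_on ?S f g" and g' = "swap_on ?S g f" and K' = "(insert h (insert j k))" and L' = "(insert i k)"])
    show "interlaced ?D (swap_on ?S f g)" by (rule sw)
    show "interlaced ?D (swap_on ?S g f)" by (rule sw)
    show "swap_on ?S f g d x + swap_on ?S g f d x = f d x + g d x" for d x
      by (simp add: swap_on_def)
    show "swap_on ?S f g 0 = ht (insert h (insert j k))"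
      using top k hij by (auto simp: swap_on_def ht_insert)
    show "swap_on ?S g f 0 = ht (insert i k)"
      using top k hij by (auto simp: swap_on_def ht_insert)
    show "swap_on ?S f g d x = 0" if "d \<le> ?D" "x \<le> lo" for d x
      using bd[OF that] by (simp add: swap_on_def)
    show "swap_on ?S f g d x = int (card (insert h (insert j k))) - int d" if "d \<le> ?D" "hi \<le> x" for d x
      using bd'[OF that] that c by (simp add: swap_on_def)
  qed (use w k c in auto)
qed

lemma island_row:
  assumes S: "island D f g S" and ij: "(0, x) \<in> S" and "\<And>y. x < y \<Longrightarrow> y \<le> z \<Longrightarrow> g 0 y < f 0 y" "x \<le> z"
  shows "(0, z) \<in> S"
  using assms(4,3)
proof (induction z rule: int_ge_induct)
  case base
  then show ?case using ij by simp
next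
  case (step z)
  then have "(0, z) \<in> S" by auto
  moreover have "g 0 (z + 1) < f 0 (z + 1)" using step by auto
  moreover have "adj (0, z) (0, z + 1)" by (simp add: adj_def)
  ultimately show ?case using S unfolding island_def by blast
qed

lemma island_row':
  assumes S: "island D f g S" and ij: "(0, x) \<in> S" and "\<And>y. z \<le> y \<Longrightarrow> y < x \<Longrightarrow> g 0 y < f 0 y" "z \<le> x"
  shows "(0, z) \<in> S"
  using assms(4,3)
proof (induction z rule: int_le_induct)
  case base
  then show ?case using ij by simp
next
  case (step z)
  then have "(0, z) \<in> S" by auto
  moreover have "g 0 (z - 1) < f 0 (z - 1)" using step by auto
  moreover have "adj (0, z) (0, z - 1)" by (simp add: adj_def)
  ultimately show ?case using S unfolding island_def by blast
qed

text \<open>Now \<open>f\<close> exceeds \<open>g\<close> in layer 0 both between \<open>h\<close>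
  and \<open>i\<close> and beyond \<open>j\<close>, and a full exchange would swap both pieces. By
  planarity either the first piece can be exchanged alone, or the stretch between \<open>i\<close>
  and \<open>j\<close>, where \<open>f \<le> g\<close>, can be exchanged alone with
  \<open>g + 1\<close>. The two cases are the two terms of the minimum.\<close>

lemma min_weight_plucker_ge:
  "min (min_weight a (insert h (insert i k)) + min_weight a (insert j k))
       (min_weight a (insert i (insert j k)) + min_weight a (insert h k)) \<le>
    min_weight a (insert h (insert j k)) + min_weight a (insert i k)"
proof -
  let ?K = "insert h (insert j k)" and ?L = "insert i k" and ?D = "card k + 1"
  obtain lo hi where w: "insert h (insert i (insert j k)) \<subseteq> {lo..<hi}" by (rule finite_int_window[of "insert h (insert i (insert j k))"]) (use k in auto)
  have c: "card ?K = card k + 2" "card ?L = card k + 1"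
      "card (insert h (insert i k)) = card k + 2" "card (insert j k) = card k + 1"
      "card (insert i (insert j k)) = card k + 2" "card (insert h k) = card k + 1"
    using k hij by auto
  obtain f where f: "height_pattern lo hi ?D (int (card ?K)) f" "f 0 = ht ?K"
      "pattern_weight a lo hi ?D f \<le> min_weight a ?K"
    using min_weight_pattern_attained[of ?K lo hi ?D a] k w c by auto
  obtain g where g: "height_pattern lo hi ?D (int (card ?L)) g" "g 0 = ht ?L"
      "pattern_weight a lo hi ?D g \<le> min_weight a ?L"
    using min_weight_pattern_attained[of ?L lo hi ?D a] k w c by auto
  have il: "interlaced ?D f" "interlaced ?D g" "interlaced ?D (\<lambda>d x. g d x + 1)"
    using f g by (auto simp: height_pattern_def interlaced_shift)
  have bd: "f d x = 0" "g d x = 0" if "d \<le> ?D" "x \<le> lo" for d x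
    using f g that by (auto simp: height_pattern_def)
  have bd': "f d x = int (card k) + 2 - int d" "g d x = int (card k) + 1 - int d" if "d \<le> ?D" "hi \<le> x" for d x
    using f g that c by (auto simp: height_pattern_def)
  have top: "f 0 x = ht k x + (if h < x then 1 else 0) + (if j < x then 1 else 0)"
      "g 0 x = ht k x + (if i < x then 1 else 0)" for x
    using f(2) g(2) k hij by (auto simp: ht_insert)
  consider (up) S where "island ?D f g S" "(0, i) \<in> S" "\<And>d x. (d, x) \<in> S \<Longrightarrow> x < hi"
    | (down) S where "island ?D (\<lambda>d x. g d x + 1) f S" "(0, j) \<in> S" "\<And>d x. (d, x) \<in> S \<Longrightarrow> lo < x"
    by (rule island_cases[of ?D lo f g hi i j]) (use bd bd' top hij in auto)
  then show ?thesis
  proof cases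
    case (up S)
    note sw = island_swap_interlaced[OF il(1,2) up(1)]
    have row: "(0, x) \<in> S \<longleftrightarrow> h < x \<and> x \<le> i" for x
    proof
      assume x: "(0, x) \<in> S"
      then have "g 0 x < f 0 x" using up(1) by (auto simp: island_def)
      then have "h < x \<and> x \<le> i \<or> j < x" using top[of x] hij by (auto split: if_splits)
      moreover have "\<not> j < x"
      proof
        assume "j < x"
        then have "(0, hi) \<in> S" using top hij w up(3)[OF x]
          by (intro island_row[OF up(1) x]) auto
        then show False using up(3) by blast
      qed
      ultimately show "h < x \<and> x \<le> i" by blast
    next
      assume "h < x \<and> x \<le> i"
      then show "(0, x) \<in> S" using top hij by (intro island_row'[OF up(1,2)]) auto
    qed
    have "min_weight a (insert i (insert j k)) + min_weight a (insert h k) \<le> min_weight a ?K + min_weight a ?L"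
    proof (rule exchange_le[OF f(1,3) g(1,3), where f' = "swap_on S f g" and g' = "swap_on S g f" and K' = "(insert i (insert j k))" and L' = "(insert h k)"])
      show "interlaced ?D (swap_on S f g)" by (rule sw)
      show "interlaced ?D (swap_on S g f)" by (rule sw)
      show "swap_on S f g d x + swap_on S g f d x = f d x + g d x" for d x
        by (simp add: swap_on_def)
      show "swap_on S f g 0 = ht (insert i (insert j k))"
        using top k hij row by (auto simp: swap_on_def ht_insert)
      show "swap_on S g f 0 = ht (insert h k)"
        using top k hij row by (auto simp: swap_on_def ht_insert)
      show "swap_on S f g d x = 0" if "d \<le> ?D" "x \<le> lo" for d x
        using bd[OF that] by (simp add: swap_on_def)
      show "swap_on S f g d x = int (card (insert i (insert j k))) - int d" if "d \<le> ?D" "hi \<le> x" for d x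
        using bd'[OF that] that c up(3)[of d x] by (auto simp: swap_on_def)
    qed (use w k c in auto)
    then show ?thesis by simp
  next
    case (down S)
    let ?g = "\<lambda>d x. g d x + 1"
    note sw = island_swap_interlaced[OF il(3,1) down(1)]
    have row: "(0, x) \<in> S \<longleftrightarrow> i < x \<and> x \<le> j" for x
    proof
      assume x: "(0, x) \<in> S"
      then have "f 0 x < g 0 x + 1" using down(1) by (auto simp: island_def)
      then have "i < x \<and> x \<le> j \<or> x \<le> h" using top[of x] hij by (auto split: if_splits)
      moreover have "\<not> x \<le> h"
      proof
        assume "x \<le> h"
        then have "(0, lo) \<in> S" using top hij w down(3)[OF x]
          by (intro island_row'[OF down(1) x]) auto
        then show False using down(3) by blast
      qed
      ultimately show "i < x \<and> x \<le> j" by blast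
    next
      assume "i < x \<and> x \<le> j"
      then show "(0, x) \<in> S" using top hij by (intro island_row'[OF down(1,2)]) auto
    qed
    have out: "(d, x) \<notin> S" if "d \<le> ?D" "hi \<le> x" for d x
      using down(1) bd'[OF that] by (auto simp: island_def)
    have "min_weight a (insert h (insert i k)) + min_weight a (insert j k) \<le> min_weight a ?K + min_weight a ?L"
    proof (rule exchange_le[OF f(1,3) g(1,3), where f' = "swap_on S f ?g" and g' = "\<lambda>d x. swap_on S ?g f d x + -1" and K' = "(insert h (insert i k))" and L' = "(insert j k)"])
      show "interlaced ?D (swap_on S f ?g)" by (rule sw)
      show "interlaced ?D (\<lambda>d x. swap_on S ?g f d x + -1)" by (rule interlaced_shift[OF sw(1)])
      show "swap_on S f ?g d x + (swap_on S ?g f d x + -1) = f d x + g d x" for d x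
        by (simp add: swap_on_def)
      show "swap_on S f ?g 0 = ht (insert h (insert i k))"
        using top k hij row by (auto simp: swap_on_def ht_insert)
      show "(\<lambda>x. swap_on S ?g f 0 x + -1) = ht (insert j k)"
        using top k hij row by (auto simp: swap_on_def ht_insert)
      show "swap_on S f ?g d x = 0" if "d \<le> ?D" "x \<le> lo" for d x
        using bd[OF that] down(3)[of d x] that by (auto simp: swap_on_def)
      show "swap_on S f ?g d x = int (card (insert h (insert i k))) - int d" if "d \<le> ?D" "hi \<le> x" for d x
        using bd'[OF that] out[OF that] that c by (auto simp: swap_on_def)
    qed (use w k c in auto)
    then show ?thesis by simp
  qed
qed

lemma min_weight_plucker:
  "min_weight a (insert h (insert j k)) + min_weight a (insert i k) =
    min (min_weight a (insert h (insert i k)) + min_weight a (insert j k))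
        (min_weight a (insert i (insert j k)) + min_weight a (insert h k))"
  using min_weight_plucker_ge min_weight_plucker_le1 min_weight_plucker_le2 by linarith

end

end

subsection \<open>Block decompositions of tableaux\<close>

lemma tableau_weight_columns:
  "tableau_weight a n C = (\<Sum>q<n. \<Sum>p<q. int (a (C p q, C p q + int (q - p))))"
proof -
  have "tableau_weight a n C =
      (\<Sum>(q, p)\<in>(SIGMA q:{..<n}. {..<q}). int (a (C p q, C p q + int (q - p))))"
    unfolding tableau_weight_def
    by (rule sum.reindex_bij_witness[of _ "\<lambda>(q, p). (p, q)" "\<lambda>(p, q). (q, p)"]) auto
  also have "\<dots> = (\<Sum>q<n. \<Sum>p<q. int (a (C p q, C p q + int (q - p))))"
    by (rule sum.Sigma[symmetric]) auto
  finally show ?thesis .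
qed

lemma sum_lessThan_add: "(\<Sum>q<m + n. f q) = (\<Sum>q<m. f q) + (\<Sum>q<n. f (q + m :: nat) :: int)"
  by (induction n) (simp_all add: add.commute)

lemma sum_int_interval: "s \<le> t \<Longrightarrow> (\<Sum>j\<in>{s..<t}. f j) = (\<Sum>q<nat (t - s). f (s + int q))"
  by (rule sum.reindex_bij_witness[of _ "\<lambda>q. s + int q" "\<lambda>j. nat (j - s)"]) auto

lemma sum_int_split:
  fixes f :: "int \<Rightarrow> int"
  assumes "s \<le> t" "t \<le> u"
  shows "(\<Sum>j\<in>{s..<u}. f j) = (\<Sum>j\<in>{s..<t}. f j) + (\<Sum>j\<in>{t..<u}. f j)"
proof -
  have "{s..<u} = {s..<t} \<union> {t..<u}" using assms by auto
  then show ?thesis by (simp add: sum.union_disjoint)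
qed

lemma sorted_list_of_set_Un:
  assumes "finite Y" "finite Z" "\<And>y z. y \<in> Y \<Longrightarrow> z \<in> Z \<Longrightarrow> (y::int) < z"
  shows "sorted_list_of_set (Y \<union> Z) = sorted_list_of_set Y @ sorted_list_of_set Z"
proof (rule sorted_list_of_set_unique[THEN iffD1])
  have "Y \<inter> Z = {}" using assms(3) by fastforce
  then show "sorted_wrt (<) (sorted_list_of_set Y @ sorted_list_of_set Z) \<and>
      set (sorted_list_of_set Y @ sorted_list_of_set Z) = Y \<union> Z \<and>
      length (sorted_list_of_set Y @ sorted_list_of_set Z) = card (Y \<union> Z)"
    using assms by (auto simp: sorted_wrt_append card_Un_disjoint)
qed (use assms in auto)

lemma sorted_list_of_interval:
  "sorted_list_of_set {s..<t} = map (\<lambda>p. s + int p) [0..<nat (t - s)]"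
proof (rule sorted_list_of_set_unique[THEN iffD1])
  have "{s..<t} \<subseteq> (\<lambda>p. s + int p) ` {0..<nat (t - s)}"
  proof
    fix x assume "x \<in> {s..<t}"
    then have "x = s + int (nat (x - s))" "nat (x - s) \<in> {0..<nat (t - s)}" by auto
    then show "x \<in> (\<lambda>p. s + int p) ` {0..<nat (t - s)}" by blast
  qed
  then show "sorted_wrt (<) (map (\<lambda>p. s + int p) [0..<nat (t - s)]) \<and>
      set (map (\<lambda>p. s + int p) [0..<nat (t - s)]) = {s..<t} \<and>
      length (map (\<lambda>p. s + int p) [0..<nat (t - s)]) = card {s..<t}"
    by (auto simp: sorted_wrt_map)
qed simp

text \<open>Consecutive elements make the lower bound from the row and the upper bound from the
  column meet.\<close>

lemma tableau_forced:
  assumes "tableau K C" "p \<le> q" "q < card K"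
    and "sorted_list_of_set K ! q = sorted_list_of_set K ! p + int (q - p)"
  shows "C p q = sorted_list_of_set K ! p"
  using tableau_lower[OF assms(1-3)] tableau_upper[OF assms(1-3)] assms(4) by simp

definition triangle_sum :: "lusztig \<Rightarrow> int \<Rightarrow> int \<Rightarrow> int" where
  "triangle_sum a s t = (\<Sum>j\<in>{s..<t}. \<Sum>i\<in>{s..<j}. int (a (i, j)))"

text \<open>Cost of the rectangle in which the rows of a first block of size \<open>m\<close> meet
  the columns of a second block of size \<open>n\<close>. Columns are numbered from the start of the
  second block, hence the superdiagonal \<open>m + q - p\<close>.\<close>

definition cross_sum :: "lusztig \<Rightarrow> nat \<Rightarrow> nat \<Rightarrow> (nat \<Rightarrow> nat \<Rightarrow> int) \<Rightarrow> int" where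
  "cross_sum a m n g = (\<Sum>q<n. \<Sum>p<m. int (a (g p q, g p q + int (m + q - p))))"

context
  fixes r s :: int and Y :: "int set" and m n :: nat
  assumes rs: "r \<le> s" and Y: "finite Y" "Y \<subseteq> {s..}"
  defines "m \<equiv> nat (s - r)" and "n \<equiv> card Y"
begin

lemma sorted_block: "sorted_list_of_set ({r..<s} \<union> Y) = map (\<lambda>p. r + int p) [0..<m] @ sorted_list_of_set Y"
  unfolding m_def using Y by (subst sorted_list_of_set_Un) (auto simp: sorted_list_of_interval)

lemma nth_block1: "p < m \<Longrightarrow> sorted_list_of_set ({r..<s} \<union> Y) ! p = r + int p"
  by (simp add: sorted_block nth_append)

lemma nth_block2: "sorted_list_of_set ({r..<s} \<union> Y) ! (p + m) = sorted_list_of_set Y ! p"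
  by (simp add: sorted_block nth_append)

lemma card_block: "card ({r..<s} \<union> Y) = m + n"
proof -
  have "{r..<s} \<inter> Y = {}" using Y by auto
  then show ?thesis using Y(1) by (simp add: card_Un_disjoint m_def n_def)
qed

text \<open>An interval at the front forces its own triangle, so a tableau splits into this
  triangle, a tableau of \<open>Y\<close> and a rectangle, of which only the last two can
  vary.\<close>

lemma block_weight:
  assumes "\<And>p q. p < q \<Longrightarrow> q < m \<Longrightarrow> C p q = r + int p"
  shows "tableau_weight a (m + n) C = triangle_sum a r s +
    tableau_weight a n (\<lambda>p q. C (p + m) (q + m)) + cross_sum a m n (\<lambda>p q. C p (q + m))"
proof -
  let ?f = "\<lambda>p q. int (a (C p q, C p q + int (q - p)))"
  have "tableau_weight a (m + n) C = (\<Sum>q<m. \<Sum>p<q. ?f p q) + (\<Sum>q<n. \<Sum>p<q + m. ?f p (q + m))"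
    by (simp add: tableau_weight_columns sum_lessThan_add)
  also have "(\<Sum>q<m. \<Sum>p<q. ?f p q) = triangle_sum a r s"
  proof -
    have "triangle_sum a r s = (\<Sum>q<m. \<Sum>p<q. int (a (r + int p, r + int q)))"
      unfolding triangle_sum_def m_def using rs by (simp add: sum_int_interval)
    also have "\<dots> = (\<Sum>q<m. \<Sum>p<q. ?f p q)"
      using assms by (intro sum.cong refl) (auto simp: of_nat_diff)
    finally show ?thesis by simp
  qed
  also have "(\<Sum>q<n. \<Sum>p<q + m. ?f p (q + m)) =
      cross_sum a m n (\<lambda>p q. C p (q + m)) + tableau_weight a n (\<lambda>p q. C (p + m) (q + m))"
    unfolding cross_sum_def tableau_weight_columns sum.distrib[symmetric]
  proof (rule sum.cong[OF refl])
    fix q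
    show "(\<Sum>p<q + m. ?f p (q + m)) = (\<Sum>p<m. int (a (C p (q + m), C p (q + m) + int (m + q - p)))) +
        (\<Sum>p<q. int (a (C (p + m) (q + m), C (p + m) (q + m) + int (q - p))))"
      using sum_lessThan_add[of "\<lambda>p. ?f p (q + m)" m q] by (simp add: add.commute)
  qed
  finally show ?thesis by simp
qed

lemma block_restrict:
  assumes C: "tableau ({r..<s} \<union> Y) C"
  shows "tableau Y (\<lambda>p q. C (p + m) (q + m))"
    and "tableau_weight a (card ({r..<s} \<union> Y)) C = triangle_sum a r s +
      tableau_weight a n (\<lambda>p q. C (p + m) (q + m)) + cross_sum a m n (\<lambda>p q. C p (q + m))"
    and "\<And>p q. p < m \<Longrightarrow> q < n \<Longrightarrow> sorted_list_of_set Y ! q = s + int q \<Longrightarrow> C p (q + m) = r + int p"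
proof -
  note card = card_block
  show "tableau Y (\<lambda>p q. C (p + m) (q + m))"
    unfolding tableau_def
  proof (intro conjI allI impI)
    fix p assume "p < card Y"
    then show "C (p + m) (p + m) = sorted_list_of_set Y ! p"
      using tableau_diag[OF C, of "p + m"] card by (simp add: nth_block2 n_def)
  next
    fix p q assume "p \<le> q \<and> q + 1 < card Y"
    then show "C (p + m) (q + m) \<le> C (p + m) (q + 1 + m)"
      using tableau_row[OF C, of "p + m" "q + m"] card by (simp add: n_def add.assoc add.left_commute)
  next
    fix p q assume "p < q \<and> q < card Y"
    then show "C (p + m) (q + m) < C (p + 1 + m) (q + m)"
      using tableau_col[OF C, of "p + m" "q + m"] card by (simp add: n_def)
  qed
  show "tableau_weight a (card ({r..<s} \<union> Y)) C = triangle_sum a r s +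
      tableau_weight a n (\<lambda>p q. C (p + m) (q + m)) + cross_sum a m n (\<lambda>p q. C p (q + m))"
    unfolding card
  proof (rule block_weight)
    fix p q :: nat assume "p < q" "q < m"
    then show "C p q = r + int p"
      using tableau_forced[OF C, of p q] card nth_block1 by simp
  qed
  \<comment> \<open>Where \<open>Y\<close> continues the interval consecutively from
    \<open>s\<close>, the columns of the rectangle are forced as well.\<close>
  show "C p (q + m) = r + int p" if "p < m" "q < n" "sorted_list_of_set Y ! q = s + int q" for p q
    using tableau_forced[OF C, of p "q + m"] that card nth_block1[of p] nth_block2[of q] rs
    by (simp add: m_def)
qed

text \<open>The rectangle may be filled independently of \<open>C\<close> as long as it is row and
  column monotone and stays above the forced triangle; it meets \<open>C\<close> only below its last
  row, in row 0 of \<open>C\<close>.\<close>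

lemma block_extend:
  assumes C: "tableau Y C"
    and lower: "\<And>p q. p < m \<Longrightarrow> q < n \<Longrightarrow> r + int p \<le> g p q"
    and row: "\<And>p q. p < m \<Longrightarrow> q + 1 < n \<Longrightarrow> g p q \<le> g p (q + 1)"
    and col: "\<And>p q. p + 1 < m \<Longrightarrow> q < n \<Longrightarrow> g p q < g (p + 1) q"
    and last: "\<And>p q. p + 1 = m \<Longrightarrow> q < n \<Longrightarrow> g p q < C 0 q"
  shows "min_weight a ({r..<s} \<union> Y) \<le> triangle_sum a r s + tableau_weight a n C + cross_sum a m n g"
proof -
  define E where "E p q = (if p < m then if q < m then r + int p else g p (q - m) else C (p - m) (q - m))" for p q
  have "tableau ({r..<s} \<union> Y) E"
    unfolding tableau_def
  proof (intro conjI allI impI)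
    fix p assume p: "p < card ({r..<s} \<union> Y)"
    show "E p p = sorted_list_of_set ({r..<s} \<union> Y) ! p"
      using p tableau_diag[OF C, of "p - m"] nth_block1[of p] nth_block2[of "p - m"] card_block
      by (auto simp: E_def n_def)
  next
    fix p q assume pq: "p \<le> q \<and> q + 1 < card ({r..<s} \<union> Y)"
    show "E p q \<le> E p (q + 1)"
      using pq tableau_row[OF C, of "p - m" "q - m"] lower[of p 0] row[of p "q - m"] card_block
      by (auto simp: E_def n_def Suc_diff_le not_less less_Suc_eq_le le_Suc_eq)
  next
    fix p q assume pq: "p < q \<and> q < card ({r..<s} \<union> Y)"
    have g: "g p (q - m) < g (p + 1) (q - m)" if "p + 1 < m" "m \<le> q"
      using col[of p "q - m"] that pq card_block by auto
    have c: "C (p - m) (q - m) < C (p + 1 - m) (q - m)" if "m \<le> p"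
      using tableau_col[OF C, of "p - m" "q - m"] that pq card_block by (auto simp: n_def Suc_diff_le)
    have l: "g p (q - m) < C 0 (q - m)" if "p + 1 = m"
      using last[of p "q - m"] that pq card_block by auto
    consider "m \<le> p" | "p + 1 = m" | "p + 1 < m" by linarith
    then show "E p q < E (p + 1) q"
      by cases (use g c l pq in \<open>auto simp: E_def\<close>)
  qed
  then have "min_weight a ({r..<s} \<union> Y) \<le> tableau_weight a (m + n) E"
    using min_weight_le[of "{r..<s} \<union> Y" E a] Y(1) card_block by simp
  also have "\<dots> = triangle_sum a r s + tableau_weight a n (\<lambda>p q. E (p + m) (q + m)) +
      cross_sum a m n (\<lambda>p q. E p (q + m))"
    by (rule block_weight) (simp add: E_def)
  also have "(\<lambda>p q. E (p + m) (q + m)) = C" by (simp add: E_def)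
  also have "cross_sum a m n (\<lambda>p q. E p (q + m)) = cross_sum a m n g"
    unfolding cross_sum_def by (auto simp: E_def intro!: sum.cong)
  finally show ?thesis .
qed

lemma cross_sum_nonneg: "0 \<le> cross_sum a m n g"
  unfolding cross_sum_def by (intro sum_nonneg) simp

lemma min_weight_block_ge: "triangle_sum a r s + min_weight a Y \<le> min_weight a ({r..<s} \<union> Y)"
proof -
  obtain C where C: "tableau ({r..<s} \<union> Y) C"
      "min_weight a ({r..<s} \<union> Y) = tableau_weight a (card ({r..<s} \<union> Y)) C"
    using min_weight_attained[of "{r..<s} \<union> Y" a] Y(1) by auto
  have "min_weight a Y \<le> tableau_weight a n (\<lambda>p q. C (p + m) (q + m))"
    unfolding n_def by (rule min_weight_le[OF Y(1) block_restrict(1)[OF C(1)]])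
  then show ?thesis
    using C(2) block_restrict(2)[OF C(1)] cross_sum_nonneg by (simp add: add_increasing2)
qed

text \<open>In the first column of the rectangle, row \<open>m - d\<close> lies on superdiagonal
  \<open>d\<close>. Whatever value stands there, it costs something if that diagonal of
  \<open>a\<close> has no zero.\<close>

lemma min_weight_block_gt:
  assumes pos: "\<And>c. 0 < a (c, c + int d)" and d: "0 < d" "d \<le> m" and n: "0 < n"
  shows "triangle_sum a r s + min_weight a Y < min_weight a ({r..<s} \<union> Y)"
proof -
  obtain C where C: "tableau ({r..<s} \<union> Y) C"
      "min_weight a ({r..<s} \<union> Y) = tableau_weight a (card ({r..<s} \<union> Y)) C"
    using min_weight_attained[of "{r..<s} \<union> Y" a] Y(1) by auto
  have "min_weight a Y \<le> tableau_weight a n (\<lambda>p q. C (p + m) (q + m))"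
    unfolding n_def by (rule min_weight_le[OF Y(1) block_restrict(1)[OF C(1)]])
  moreover have "0 < cross_sum a m n (\<lambda>p q. C p (q + m))"
  proof -
    let ?f = "\<lambda>p q. int (a (C p (q + m), C p (q + m) + int (m + q - p)))"
    have "0 < ?f (m - d) 0" using pos d by simp
    also have "\<dots> \<le> (\<Sum>p<m. ?f p 0)" using d by (intro member_le_sum) auto
    also have "\<dots> \<le> (\<Sum>q<n. \<Sum>p<m. ?f p q)" using n by (intro member_le_sum sum_nonneg) auto
    finally show ?thesis by (simp add: cross_sum_def)
  qed
  ultimately show ?thesis
    using C(2) block_restrict(2)[OF C(1), of a] by simp
qed

end

lemma min_weight_empty: "min_weight a {} = 0"
  by (rule min_weight_eqI[of _ "\<lambda>p q. 0"]) (auto simp: tableau_def tableau_weight_columns)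

lemma min_weight_interval: "min_weight a {s..<t} = triangle_sum a s t"
proof (cases "s \<le> t")
  case True
  have "min_weight a ({s..<t} \<union> {}) \<le> triangle_sum a s t + tableau_weight a (card ({}::int set)) (\<lambda>p q. 0)
      + cross_sum a (nat (t - s)) (card ({}::int set)) (\<lambda>p q. 0)"
    by (rule block_extend[OF True]) (auto simp: tableau_def)
  moreover have "tableau_weight a (card ({}::int set)) (\<lambda>p q. 0) = 0" "cross_sum a (nat (t - s)) (card ({}::int set)) (\<lambda>p q. 0) = 0"
    by (simp_all add: tableau_weight_columns cross_sum_def)
  moreover have "triangle_sum a s t + min_weight a {} \<le> min_weight a ({s..<t} \<union> {})"
    by (rule min_weight_block_ge[OF True]) auto
  ultimately show ?thesis by (simp add: min_weight_empty)
next
  case False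
  then show ?thesis by (simp add: min_weight_empty triangle_sum_def)
qed

lemma tableau_weight_cong:
  assumes "\<And>p q. p < q \<Longrightarrow> q < n \<Longrightarrow> a (C p q, C p q + int (q - p)) = b (D p q, D p q + int (q - p))"
  shows "tableau_weight a n C = tableau_weight b n D"
  unfolding tableau_weight_columns using assms by (intro sum.cong refl) simp

lemma min_weight_cong:
  assumes K: "finite K" "K \<subseteq> {lo..<hi}"
    and eq: "\<And>i j. lo \<le> i \<Longrightarrow> i < j \<Longrightarrow> j < hi \<Longrightarrow> a (i, j) = b (i, j)"
  shows "min_weight a K = min_weight b K"
proof -
  have "tableau_weight a (card K) C = tableau_weight b (card K) C" if C: "tableau K C" for C
    by (rule tableau_weight_cong, rule eq) (use tableau_bounds[OF C K] in auto)
  then show ?thesis unfolding min_weight_def by (metis (mono_tags, opaque_lifting))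
qed

lemma min_weight_translate:
  assumes K: "finite K"
  shows "min_weight a ((\<lambda>x. x + c) ` K) = min_weight (\<lambda>(i, j). a (i + c, j + c)) K"
proof -
  have le: "min_weight a ((\<lambda>x. x + c) ` K) \<le> min_weight (\<lambda>(i, j). a (i + c, j + c)) K"
    if K: "finite K" for a c K
  proof -
    have card: "card ((\<lambda>x. x + c) ` K) = card K" by (simp add: card_image)
    have srt: "sorted_list_of_set ((\<lambda>x. x + c) ` K) = map (\<lambda>x. x + c) (sorted_list_of_set K)"
      by (rule sorted_list_of_set_unique[THEN iffD1]) (use K card in \<open>auto simp: sorted_wrt_map\<close>)
    obtain C where C: "tableau K C"
      "min_weight (\<lambda>(i, j). a (i + c, j + c)) K = tableau_weight (\<lambda>(i, j). a (i + c, j + c)) (card K) C"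
      using min_weight_attained[OF K] by blast
    have "tableau ((\<lambda>x. x + c) ` K) (\<lambda>p q. C p q + c)"
      using C(1) unfolding tableau_def card srt by auto
    then have "min_weight a ((\<lambda>x. x + c) ` K) \<le> tableau_weight a (card K) (\<lambda>p q. C p q + c)"
      using min_weight_le[of "(\<lambda>x. x + c) ` K"] K card by fastforce
    also have "\<dots> = min_weight (\<lambda>(i, j). a (i + c, j + c)) K"
      unfolding C(2) by (rule tableau_weight_cong) (simp add: algebra_simps)
    finally show ?thesis .
  qed
  \<comment> \<open>Translating back by \<open>- c\<close> turns the same inequality into its
    converse.\<close>
  have "min_weight (\<lambda>(i, j). a (i + c, j + c)) ((\<lambda>x. x + - c) ` ((\<lambda>x. x + c) ` K)) \<le>
      min_weight (\<lambda>(i, j). (\<lambda>(i, j). a (i + c, j + c)) (i + - c, j + - c)) ((\<lambda>x. x + c) ` K)"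
    by (rule le) (use K in auto)
  then show ?thesis using le[OF K, of a c] by (simp add: image_image case_prod_unfold)
qed

subsection \<open>Normalised minimal weights\<close>

text \<open>\<open>mm a s K\<close> is the component of the paper's family at \<open>K\<close> for any interval with minimum \<open>s\<close>;
  it does not depend on the maximum.\<close>

definition mm :: "lusztig \<Rightarrow> int \<Rightarrow> int set \<Rightarrow> int" where
  "mm a s K = min_weight a K - (\<Sum>j\<in>K. \<Sum>i\<in>{s..<j}. int (a (i, j)))"

definition vanishes_from :: "int \<Rightarrow> lusztig \<Rightarrow> bool" where
  "vanishes_from B a \<longleftrightarrow> 0 < B \<and> (\<forall>i j. B \<le> j - i \<longrightarrow> a (i, j) = 0)"

text \<open>What remains of aperiodicity for data that are not periodic. It survives changes
  confined to rows from some index on, whereas a single operator \<open>f_star\<close> already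
  destroys periodicity.\<close>

definition zeros_left :: "lusztig \<Rightarrow> bool" where
  "zeros_left a \<longleftrightarrow> (\<forall>d>0. \<forall>x. \<exists>c<x. a (c, c + int d) = 0)"

lemma mm_empty [simp]: "mm a s {} = 0"
  by (simp add: mm_def min_weight_empty)

lemma mm_supermodular:
  assumes "finite k" "i \<noteq> j" "i \<notin> k" "j \<notin> k"
  shows "mm a s (insert i k) + mm a s (insert j k) \<le> mm a s (insert i (insert j k)) + mm a s k"
  using min_weight_supermodular[OF assms, of a] assms by (simp add: mm_def)

lemma mm_plucker:
  assumes "finite k" "h < i" "i < j" "h \<notin> k" "i \<notin> k" "j \<notin> k"
  shows "mm a s (insert h (insert j k)) + mm a s (insert i k) =
    min (mm a s (insert h (insert i k)) + mm a s (insert j k))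
        (mm a s (insert i (insert j k)) + mm a s (insert h k))"
  using min_weight_plucker[OF assms, of a] assms by (simp add: mm_def)

text \<open>The triangle inside the interval cancels against the same part of the subtracted sum,
  and a rectangle of the datum remains.\<close>

lemma mm_interval:
  assumes "s \<le> u"
  shows "mm a s {u..<v} = - (\<Sum>j\<in>{u..<v}. \<Sum>i\<in>{s..<u}. int (a (i, j)))"
proof -
  have "(\<Sum>j\<in>{u..<v}. \<Sum>i\<in>{s..<j}. int (a (i, j))) =
      (\<Sum>j\<in>{u..<v}. (\<Sum>i\<in>{s..<u}. int (a (i, j))) + (\<Sum>i\<in>{u..<j}. int (a (i, j))))"
    using assms by (intro sum.cong refl sum_int_split) auto
  then show ?thesis by (simp add: mm_def min_weight_interval triangle_sum_def sum.distrib)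
qed

lemma mm_cong:
  assumes K: "finite K" "K \<subseteq> {s..<t}"
    and eq: "\<And>i j. s \<le> i \<Longrightarrow> i < j \<Longrightarrow> j < t \<Longrightarrow> a (i, j) = b (i, j)"
  shows "mm a s K = mm b s K"
proof -
  have "min_weight a K = min_weight b K" using K eq by (rule min_weight_cong)
  moreover have "(\<Sum>j\<in>K. \<Sum>i\<in>{s..<j}. int (a (i, j))) = (\<Sum>j\<in>K. \<Sum>i\<in>{s..<j}. int (b (i, j)))"
    using K eq by (intro sum.cong refl) auto
  ultimately show ?thesis by (simp add: mm_def)
qed

lemma mm_translate:
  assumes K: "finite K"
  shows "mm a (s + c) ((\<lambda>x. x + c) ` K) = mm (\<lambda>(i, j). a (i + c, j + c)) s K"
proof -
  have "(\<Sum>i\<in>{s + c..<j + c}. f i) = (\<Sum>i\<in>{s..<j}. f (i + c))" for j and f :: "int \<Rightarrow> int"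
    by (rule sum.reindex_bij_witness[of _ "\<lambda>i. i + c" "\<lambda>i. i - c"]) auto
  then show ?thesis
    by (simp add: mm_def min_weight_translate[OF K] sum.reindex)
qed

lemma mm_block:
  assumes rs: "r \<le> s" and Y: "finite Y" "Y \<subseteq> {s..}"
  shows "mm a r ({r..<s} \<union> Y) = min_weight a ({r..<s} \<union> Y) - triangle_sum a r s
    - (\<Sum>j\<in>Y. \<Sum>i\<in>{r..<j}. int (a (i, j)))"
proof -
  have "{r..<s} \<inter> Y = {}" using Y by auto
  then show ?thesis using Y(1) by (simp add: mm_def triangle_sum_def sum.union_disjoint)
qed

lemma mm_block_gt:
  assumes "r \<le> s" "finite Y" "Y \<subseteq> {s..}" "Y \<noteq> {}"
    and "\<And>c. 0 < a (c, c + int d)" "0 < d" "int d \<le> s - r"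
  shows "mm a r Y < mm a r ({r..<s} \<union> Y)"
  using min_weight_block_gt[OF assms(1-3), of a d] assms
  by (simp add: mm_block[OF assms(1-3)] mm_def[of a r Y] card_gt_0_iff le_nat_iff)

text \<open>The first \<open>B\<close> elements of \<open>Y\<close> are consecutive, so their
  columns of the rectangle are forced; all later columns lie on superdiagonals where
  \<open>a\<close> vanishes. The forced cost \<open>X\<close> is exactly what the subtracted sum
  over \<open>Y\<close> gains from the rows in \<open>{r..<s}\<close>.\<close>

lemma mm_stable:
  assumes B: "vanishes_from B a" and rs: "r \<le> s"
    and Y: "finite Y" "Y \<subseteq> {s..}" "{s..<s + B} \<subseteq> Y"
  shows "mm a r ({r..<s} \<union> Y) = mm a s Y"
proof -
  note block = rs Y(1,2)
  let ?m = "nat (s - r)" and ?n = "card Y"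
  have B0: "0 < B" and van: "\<And>i j. B \<le> j - i \<Longrightarrow> a (i, j) = 0"
    using B by (auto simp: vanishes_from_def)
  define X where "X = (\<Sum>j\<in>{s..<s + B}. \<Sum>i\<in>{r..<s}. int (a (i, j)))"
  have n: "nat B \<le> ?n" using card_mono[OF Y(1,3)] by simp
  have Ysplit: "Y = {s..<s + B} \<union> (Y - {s..<s + B})" using Y(3) by auto
  have nthY: "sorted_list_of_set Y ! q = s + int q" if "q < nat B" for q
  proof -
    have "Y - {s..<s + B} \<subseteq> {s + B..}" using Y(2) by auto
    then show ?thesis
      using that nth_block1[of s "s + B" "Y - {s..<s + B}" q] B0 Y(1) Ysplit by simp
  qed
  have X: "cross_sum a ?m ?n g = X"
    if g: "\<And>p q. p < ?m \<Longrightarrow> q < nat B \<Longrightarrow> g p q = r + int p" for g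
  proof -
    have "cross_sum a ?m ?n g = (\<Sum>q<nat B. \<Sum>p<?m. int (a (g p q, g p q + int (?m + q - p))))"
      unfolding cross_sum_def using n van
      by (intro sum.mono_neutral_right) (auto intro!: sum.neutral)
    also have "\<dots> = (\<Sum>q<nat B. \<Sum>p<?m. int (a (r + int p, s + int q)))"
      using g rs by (intro sum.cong refl) (auto simp: of_nat_diff)
    also have "\<dots> = X"
      unfolding X_def using B0 rs by (simp add: sum_int_interval)
    finally show ?thesis .
  qed
  have mw: "min_weight a ({r..<s} \<union> Y) = triangle_sum a r s + min_weight a Y + X"
  proof (rule antisym)
    obtain C where C: "tableau Y C" "min_weight a Y = tableau_weight a ?n C"
      using min_weight_attained[OF Y(1)] by blast
    have "min_weight a ({r..<s} \<union> Y) \<le>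
        triangle_sum a r s + tableau_weight a ?n C + cross_sum a ?m ?n (\<lambda>p q. r + int p)"
    proof (rule block_extend[OF block C(1)])
      fix p q assume "p + 1 = ?m" "q < ?n"
      moreover have "s \<le> sorted_list_of_set Y ! 0" using nthY[of 0] B0 by simp
      moreover have "sorted_list_of_set Y ! 0 \<le> C 0 q" using tableau_lower[OF C(1), of 0 q] \<open>q < ?n\<close> by simp
      ultimately show "r + int p < C 0 q" by linarith
    qed auto
    then show "min_weight a ({r..<s} \<union> Y) \<le> triangle_sum a r s + min_weight a Y + X"
      using C(2) X by simp
  next
    obtain C where C: "tableau ({r..<s} \<union> Y) C"
        "min_weight a ({r..<s} \<union> Y) = tableau_weight a (card ({r..<s} \<union> Y)) C"
      using min_weight_attained[of "{r..<s} \<union> Y" a] Y(1) by auto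
    have "min_weight a Y \<le> tableau_weight a ?n (\<lambda>p q. C (p + ?m) (q + ?m))"
      by (rule min_weight_le[OF Y(1) block_restrict(1)[OF block C(1)]])
    moreover have "cross_sum a ?m ?n (\<lambda>p q. C p (q + ?m)) = X"
      by (rule X, rule block_restrict(3)[OF block C(1)]) (use n nthY in auto)
    ultimately show "triangle_sum a r s + min_weight a Y + X \<le> min_weight a ({r..<s} \<union> Y)"
      using C(2) block_restrict(2)[OF block C(1), of a] by simp
  qed
  have "(\<Sum>j\<in>Y. \<Sum>i\<in>{r..<j}. int (a (i, j))) =
      (\<Sum>j\<in>Y. (\<Sum>i\<in>{r..<s}. int (a (i, j))) + (\<Sum>i\<in>{s..<j}. int (a (i, j))))"
    using Y rs by (intro sum.cong refl sum_int_split) auto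
  also have "\<dots> = (\<Sum>j\<in>Y. \<Sum>i\<in>{r..<s}. int (a (i, j))) + (\<Sum>j\<in>Y. \<Sum>i\<in>{s..<j}. int (a (i, j)))"
    by (simp add: sum.distrib)
  also have "(\<Sum>j\<in>Y. \<Sum>i\<in>{r..<s}. int (a (i, j))) = X"
    unfolding X_def using Y van by (intro sum.mono_neutral_right) (auto intro!: sum.neutral)
  finally show ?thesis
    by (simp add: mm_block[OF block] mw mm_def[of a s Y])
qed

lemma exists_descending_zeros:
  assumes "zeros_left a" "\<And>m. 0 < e m"
  shows "\<exists>z. z 0 < x \<and> (\<forall>m. z (Suc m) < z m) \<and> (\<forall>m. a (z m, z m + int (e m)) = 0)"
proof -
  have ex: "\<exists>c<x. a (c, c + int (e m)) = 0" for m x using assms unfolding zeros_left_def by blast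
  define z where "z = rec_nat (SOME c. c < x \<and> a (c, c + int (e 0)) = 0)
    (\<lambda>m c'. SOME c. c < c' \<and> a (c, c + int (e (Suc m))) = 0)"
  have "z 0 < x \<and> a (z 0, z 0 + int (e 0)) = 0"
    using someI_ex[OF ex[of x 0]] by (simp add: z_def)
  moreover have "z (Suc m) < z m \<and> a (z (Suc m), z (Suc m) + int (e (Suc m))) = 0" for m
    using someI_ex[OF ex[of "z m" "Suc m"]] by (simp add: z_def)
  ultimately show ?thesis by (metis not0_implies_Suc)
qed

text \<open>Far to the left of \<open>Y\<close> there are enough zeros of \<open>a\<close> on each diagonal to fill the part of
  the tableau between the two blocks without cost.\<close>

lemma mm_decouple:
  assumes B: "vanishes_from B a" and zl: "zeros_left a"
  obtains s0 where "s0 \<le> y0"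
    "\<And>r s Y. r \<le> s \<Longrightarrow> s \<le> s0 \<Longrightarrow> finite Y \<Longrightarrow> Y \<subseteq> {y0..} \<Longrightarrow> mm a r ({r..<s} \<union> Y) = mm a r Y"
proof -
  define N where "N = nat B"
  have van: "a (i, i + int d) = 0" if "N < d" for i d
    using B that by (simp add: vanishes_from_def N_def)
  \<comment> \<open>The slot of the rectangle at height \<open>d\<close> above its last row and in
    column \<open>q\<close> gets the number \<open>m = d * Suc N + (N - q)\<close> and lies on
    superdiagonal \<open>e m = Suc (d + q)\<close>. As \<open>z\<close> decreases in
    \<open>m\<close>, the chosen zeros increase along rows and strictly down columns.\<close>
  define e where "e m = Suc (m div Suc N + (N - m mod Suc N))" for m
  obtain z where z: "z 0 < y0" "\<And>m. z (Suc m) < z m" "\<And>m. a (z m, z m + int (e m)) = 0"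
    using exists_descending_zeros[OF zl, of e y0] by (auto simp: e_def)
  have dec: "z m' \<le> z m" if "m \<le> m'" for m m' using that
  proof (induction m' rule: dec_induct)
    case (step m') then show ?case using z(2)[of m'] by simp
  qed simp
  have sdec: "z m' < z m" if "m < m'" for m m'
    using dec[of "Suc m" m'] z(2)[of m] that by simp
  define M where "M = Suc N * Suc N"
  show thesis
  proof (rule that)
    show "z M \<le> y0" using dec[of 0 M] z(1) by simp
    fix r s Y assume rs: "r \<le> s" "s \<le> z M" and Y: "finite Y" "Y \<subseteq> {y0..}"
    have Ys: "Y \<subseteq> {s..}" using Y rs \<open>z M \<le> y0\<close> by auto
    note block = rs(1) Y(1) Ys
    let ?m = "nat (s - r)" and ?n = "card Y"
    \<comment> \<open>Columns after \<open>N\<close> repeat column \<open>N\<close>, and rows more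
      than \<open>N\<close> above the last keep the smallest value \<open>r + int p\<close>; in both
      cases the superdiagonal exceeds \<open>N\<close> and \<open>a\<close> vanishes. The condition
      \<open>s \<le> z M\<close> puts all chosen zeros at or beyond \<open>s\<close>.\<close>
    define g where "g p q = (if ?m - 1 - p \<le> N then z ((?m - 1 - p) * Suc N + (N - min q N)) else r + int p)" for p q
    have idx: "d * Suc N + (N - min q N) \<le> M" if "d \<le> N" for d q
    proof -
      have "d * Suc N + (N - min q N) \<le> N * Suc N + Suc N" using that by (intro add_mono mult_right_mono) auto
      then show ?thesis by (simp add: M_def)
    qed
    have gz: "s \<le> z (d * Suc N + (N - min q N))" if "d \<le> N" for d q
      using dec[OF idx[OF that]] rs(2) by (rule order_trans[rotated])
    obtain C where C: "tableau Y C" "min_weight a Y = tableau_weight a ?n C"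
      using min_weight_attained[OF Y(1)] by blast
    have "min_weight a ({r..<s} \<union> Y) \<le> triangle_sum a r s + tableau_weight a ?n C + cross_sum a ?m ?n g"
    proof (rule block_extend[OF block C(1)])
      fix p q assume pq: "p < ?m" "q < ?n"
      have "r + int p < s" using pq by simp
      then show "r + int p \<le> g p q" using gz[of "?m - 1 - p" q] by (auto simp: g_def)
    next
      fix p q assume pq: "p < ?m" "q + 1 < ?n"
      have "z (d + (N - min q N)) \<le> z (d + (N - min (q + 1) N))" for d
        by (rule dec, rule add_left_mono) simp
      then show "g p q \<le> g p (q + 1)"
        unfolding g_def by (cases "?m - 1 - p \<le> N") (simp_all only: if_True if_False order_refl)
    next
      fix p q assume pq: "p + 1 < ?m" "q < ?n"
      have lt: "r + int p < s" using pq by simp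
      show "g p q < g (p + 1) q"
      proof (cases "?m - 1 - p \<le> N")
        case True
        define d where "d = ?m - 1 - (p + 1)"
        have d: "?m - 1 - p = Suc d" using pq by (simp add: d_def)
        have "z (Suc d * Suc N + (N - min q N)) < z (d * Suc N + (N - min q N))"
          by (rule sdec) simp
        moreover have "g p q = z (Suc d * Suc N + (N - min q N))" "g (p + 1) q = z (d * Suc N + (N - min q N))"
          using True d unfolding g_def d_def[symmetric] by simp_all
        ultimately show ?thesis by simp
      next
        case False
        then show ?thesis using gz[of "?m - 1 - (p + 1)" q] lt by (auto simp: g_def)
      qed
    next
      fix p q assume pq: "p + 1 = ?m" "q < ?n"
      have ne: "Y \<noteq> {}" using pq by auto
      have "y0 \<le> sorted_list_of_set Y ! 0"
      proof -
        have "sorted_list_of_set Y ! 0 \<in> Y"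
          using pq Y(1) by (metis length_sorted_list_of_set nth_mem set_sorted_list_of_set not_less0 neq0_conv card_0_eq ne)
        then show ?thesis using Y(2) by auto
      qed
      also have "\<dots> \<le> C 0 q" using tableau_lower[OF C(1), of 0 q] pq by simp
      finally have "y0 \<le> C 0 q" .
      moreover have "g p q = z (N - min q N)" using pq(1) by (auto simp: g_def)
      moreover have "z (N - min q N) \<le> z 0" by (rule dec) simp
      ultimately show "g p q < C 0 q" using z(1) by linarith
    qed
    moreover have "cross_sum a ?m ?n g = 0"
      unfolding cross_sum_def
    proof (intro sum.neutral ballI)
      fix q p assume "q \<in> {..<?n}" "p \<in> {..<?m}"
      then have p: "p < ?m" by simp
      show "int (a (g p q, g p q + int (?m + q - p))) = 0"
      proof (cases "?m - 1 - p \<le> N \<and> q \<le> N")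
        case True
        define d where "d = ?m - 1 - p"
        have "e (d * Suc N + (N - q)) = Suc (d + q)"
        proof -
          have "(d * Suc N + (N - q)) div Suc N = d" "(d * Suc N + (N - q)) mod Suc N = N - q"
            using div_mult_self3[of "Suc N" "N - q" d] mod_mult_self3[of d "Suc N" "N - q"]
            by (simp_all del: mult_Suc_right div_mult_self3 mod_mult_self3 add: add.commute)
          then show ?thesis using True by (simp add: e_def)
        qed
        moreover have "?m + q - p = Suc (d + q)" using p by (simp add: d_def)
        moreover have "g p q = z (d * Suc N + (N - q))" using True by (simp add: g_def d_def min_def)
        ultimately show ?thesis using z(3)[of "d * Suc N + (N - q)"] by (simp only: of_nat_0)
      next
        case False
        then show ?thesis using van[of "?m + q - p"] p by auto
      qed
    qed
    ultimately have "min_weight a ({r..<s} \<union> Y) \<le> triangle_sum a r s + min_weight a Y"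
      using C(2) by simp
    with min_weight_block_ge[OF block, of a]
    show "mm a r ({r..<s} \<union> Y) = mm a r Y"
      by (simp add: mm_block[OF block] mm_def[of a r Y])
  qed
qed

text \<open>Mirror image of \<open>mm_stable\<close> at the right end: the last \<open>B\<close>
  entries of the new column are forced and the others lie on superdiagonals where \<open>a\<close>
  vanishes, so the cost equals the newly subtracted column sum.\<close>

lemma mm_extend_right:
  assumes B: "vanishes_from B a" and Y: "finite Y" "Y \<subseteq> {..<t}" "{t - B..<t} \<subseteq> Y" and r: "r \<le> t - B"
  shows "mm a r (insert t Y) = mm a r Y"
proof -
  have B0: "0 < B" and van: "\<And>i j. B \<le> j - i \<Longrightarrow> a (i, j) = 0"
    using B by (auto simp: vanishes_from_def)
  let ?n = "card Y" and ?K = "insert t Y"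
  define X where "X = (\<Sum>i\<in>{t - B..<t}. int (a (i, t)))"
  have tY: "t \<notin> Y" using Y by auto
  have card: "card ?K = Suc ?n" using Y tY by simp
  have "sorted_list_of_set (Y \<union> {t}) = sorted_list_of_set Y @ sorted_list_of_set {t}"
    by (rule sorted_list_of_set_Un) (use Y in auto)
  then have srt: "sorted_list_of_set ?K = sorted_list_of_set Y @ [t]"
    by (simp only: Un_insert_right Un_empty_right) simp
  have nB: "nat B \<le> ?n" using card_mono[OF Y(1,3)] by simp
  have nth: "sorted_list_of_set Y ! p = t - int (?n - p)" if "p < ?n" "?n - p \<le> nat B" for p
  proof -
    let ?Z = "Y - {t - B..<t}"
    have "Y = ?Z \<union> {t - B..<t}" using Y(3) by auto
    moreover have "sorted_list_of_set (?Z \<union> {t - B..<t}) =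
        sorted_list_of_set ?Z @ sorted_list_of_set {t - B..<t}"
      by (rule sorted_list_of_set_Un) (use Y in \<open>auto simp: subset_iff not_le\<close>)
    ultimately have "sorted_list_of_set Y = sorted_list_of_set ?Z @ sorted_list_of_set {t - B..<t}"
      by simp
    moreover have "length (sorted_list_of_set ?Z) = ?n - nat B"
      using Y by (simp add: card_Diff_subset)
    moreover have "\<not> p < ?n - nat B" using that by simp
    moreover have "p - (?n - nat B) < nat B" using that nB by simp
    moreover have "t - B + int (p - (?n - nat B)) = t - int (?n - p)" using that nB B0 by simp
    ultimately show ?thesis
      by (simp only: nth_append sorted_list_of_interval if_False) simp
  qed
  have restrict: "tableau Y C" "tableau_weight a (Suc ?n) C = tableau_weight a ?n C + X"
    if C: "tableau ?K C" for C
  proof -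
    show "tableau Y C"
      using C unfolding tableau_def card srt by (auto simp: nth_append)
    have "(\<Sum>p<?n. int (a (C p ?n, C p ?n + int (?n - p)))) =
        (\<Sum>p\<in>{?n - nat B..<?n}. int (a (C p ?n, C p ?n + int (?n - p))))"
      using van B0 by (intro sum.mono_neutral_right) auto
    also have "\<dots> = (\<Sum>p\<in>{?n - nat B..<?n}. int (a (t - int (?n - p), t)))"
    proof (intro sum.cong refl)
      fix p assume "p \<in> {?n - nat B..<?n}"
      then have p: "p < ?n" "?n - p \<le> nat B" by auto
      have "C p ?n = t - int (?n - p)"
        using tableau_forced[OF C, of p ?n] nth[OF p] p card by (simp add: srt nth_append)
      then show "int (a (C p ?n, C p ?n + int (?n - p))) = int (a (t - int (?n - p), t))" by simp
    qed
    also have "\<dots> = X"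
      unfolding X_def
      by (rule sum.reindex_bij_witness[of _ "\<lambda>i. nat (i - t + int ?n)" "\<lambda>p. t - int (?n - p)"])
        (use nB in auto)
    finally show "tableau_weight a (Suc ?n) C = tableau_weight a ?n C + X"
      by (simp add: tableau_weight_columns)
  qed
  have mw: "min_weight a ?K = min_weight a Y + X"
  proof (rule antisym)
    obtain C where C: "tableau Y C" "min_weight a Y = tableau_weight a ?n C"
      using min_weight_attained[OF Y(1)] by blast
    have n0: "0 < ?n" using nB B0 by simp
    \<comment> \<open>Apart from its diagonal entry \<open>t\<close>, the new column copies the
      previous one.\<close>
    define E where "E p q = (if q < ?n then C p q else if p < ?n then C p (?n - 1) else t)" for p q
    have "tableau ?K E"
      unfolding tableau_def card
    proof (intro conjI allI impI)
      fix p assume "p < Suc ?n"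
      then show "E p p = sorted_list_of_set ?K ! p"
        using tableau_diag[OF C(1), of p] by (auto simp: E_def srt nth_append)
    next
      fix p q assume "p \<le> q \<and> q + 1 < Suc ?n"
      moreover from this have "?n - 1 = q \<and> q + 1 = ?n \<or> q + 1 < ?n" by auto
      ultimately show "E p q \<le> E p (q + 1)"
        using tableau_row[OF C(1), of p q] by (auto simp: E_def simp del: diff_Suc_1 One_nat_def)
    next
      fix p q assume pq: "p < q \<and> q < Suc ?n"
      show "E p q < E (p + 1) q"
      proof (cases "q < ?n")
        case True
        then show ?thesis using tableau_col[OF C(1), of p q] pq by (auto simp: E_def)
      next
        case False
        then have q: "q = ?n" using pq by simp
        show ?thesis
        proof (cases "p + 1 < ?n")
          case True
          then show ?thesis using tableau_col[OF C(1), of p "?n - 1"] q by (auto simp: E_def)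
        next
          case False
          then have p: "p = ?n - 1" using pq q by auto
          then have "C p p < t"
            using tableau_diag[OF C(1), of p] nth[of p] n0 nB B0 by auto
          then show ?thesis using p q n0 by (auto simp: E_def)
        qed
      qed
    qed
    then have "min_weight a ?K \<le> tableau_weight a ?n E + X"
      using min_weight_le[of ?K E a] restrict(2)[of E] Y card by simp
    moreover have "tableau_weight a ?n E = tableau_weight a ?n C"
      by (rule tableau_weight_cong) (simp add: E_def)
    ultimately show "min_weight a ?K \<le> min_weight a Y + X" using C by simp
  next
    obtain C where C: "tableau ?K C" "min_weight a ?K = tableau_weight a (card ?K) C"
      using min_weight_attained[of ?K a] Y(1) by auto
    show "min_weight a Y + X \<le> min_weight a ?K"
      using C(2) restrict[OF C(1)] min_weight_le[OF Y(1), of C a] card by simp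
  qed
  have "(\<Sum>i\<in>{r..<t}. int (a (i, t))) = X"
    unfolding X_def using r van by (intro sum.mono_neutral_right) auto
  then show ?thesis using mw tY Y(1) by (simp add: mm_def)
qed

subsection \<open>Families satisfying the tropical Pluecker relations\<close>

definition plucker :: "int set \<Rightarrow> family \<Rightarrow> bool" where
  "plucker S F \<longleftrightarrow> (\<forall>k h i j. finite k \<and> k \<subseteq> S \<and> h \<in> S \<and> i \<in> S \<and> j \<in> S \<and>
     h < i \<and> i < j \<and> h \<notin> k \<and> i \<notin> k \<and> j \<notin> k \<longrightarrow>
     F (insert h (insert j k)) + F (insert i k) =
       min (F (insert h (insert i k)) + F (insert j k)) (F (insert i (insert j k)) + F (insert h k)))"

lemma pluckerD:
  assumes "plucker S F" "finite k" "k \<subseteq> S" "h \<in> S" "i \<in> S" "j \<in> S"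
    "h < i" "i < j" "h \<notin> k" "i \<notin> k" "j \<notin> k"
  shows "F (insert h (insert j k)) + F (insert i k) =
    min (F (insert h (insert i k)) + F (insert j k)) (F (insert i (insert j k)) + F (insert h k))"
  using assms unfolding plucker_def by blast

lemma plucker_subset: "plucker S F \<Longrightarrow> T \<subseteq> S \<Longrightarrow> plucker T F"
  unfolding plucker_def by (meson order_trans subsetD)

lemma plucker_mm: "plucker S (mm a s)"
  unfolding plucker_def using mm_plucker by blast

text \<open>\<open>K\<close> is the only one of the six sets that contains both \<open>h\<close> and
  \<open>j\<close>. When these are its extreme elements, the relation expresses its value by sets of
  smaller spread.\<close>

lemma plucker_step:
  assumes F: "plucker S F" and G: "plucker S G" and K: "finite K" "K \<subseteq> S"
    and hij: "h \<in> K" "j \<in> K" "i \<notin> K" "i \<in> S" "h < i" "i < j"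
    and eq: "\<And>L. L \<in> {insert i (K - {h, j}), insert i (K - {j}), insert i (K - {h}), K - {h}, K - {j}}
      \<Longrightarrow> F L = G L"
  shows "F K = G K"
proof -
  let ?k = "K - {h, j}"
  have sets: "insert h (insert j ?k) = K" "insert h (insert i ?k) = insert i (K - {j})"
    "insert j ?k = K - {h}" "insert i (insert j ?k) = insert i (K - {h})" "insert h ?k = K - {j}"
    using hij by auto
  have "H K + H (insert i ?k) =
      min (H (insert i (K - {j})) + H (K - {h})) (H (insert i (K - {h})) + H (K - {j}))"
    if H: "plucker S H" for H
  proof -
    have k: "finite ?k" "?k \<subseteq> S" "h \<in> S" "j \<in> S" "h \<notin> ?k" "i \<notin> ?k" "j \<notin> ?k"
      using K hij by auto
    note eqs = sets[THEN arg_cong[where f = H]]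
    show ?thesis
      using pluckerD[OF H k(1-3) hij(4) k(4) hij(5,6) k(5-7)] unfolding eqs .
  qed
  from this[OF F] this[OF G] show ?thesis using eq by simp
qed

text \<open>The operators with index \<open>p\<close> change only the components at \<open>k\<close> with \<open>p \<notin> k\<close> and
  \<open>p + 1 \<in> k\<close>. Solving the Pluecker relation for the set with the largest spread reduces every other
  set to intervals and to the sets \<open>{p} \<union> [p + 2, v)\<close>.\<close>

lemma plucker_agree_untouched:
  assumes F: "plucker S F" and G: "plucker S G"
    and conv: "\<And>x y. x \<in> S \<Longrightarrow> y \<in> S \<Longrightarrow> {x..y} \<subseteq> S"
    and int: "\<And>u v. {u..<v} \<subseteq> S \<Longrightarrow> u \<noteq> p + 1 \<Longrightarrow> F {u..<v} = G {u..<v}"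
    and gap: "\<And>v. insert p {p + 2..<v} \<subseteq> S \<Longrightarrow> F (insert p {p + 2..<v}) = G (insert p {p + 2..<v})"
    and K: "finite K" "K \<subseteq> S" "p \<in> K \<or> p + 1 \<notin> K"
  shows "F K = G K"
proof -
  have main: "F K = G K" if "K \<subseteq> {x..<x + int n}" "K \<subseteq> S" "p \<in> K \<or> p + 1 \<notin> K" for x n K
    using that
  proof (induction n arbitrary: x K)
    case 0
    then have "K = {p..<p}" by auto
    then show ?case using int[of p p] by simp
  next
    case (Suc n)
    have fin: "finite L" if "L \<subseteq> {x..<x + int (Suc n)}" for L
      using that finite_subset by blast
    have IH: "F L = G L" if "L \<subseteq> {x..<x + int (Suc n)}" "L \<subseteq> S" "p \<in> L \<or> p + 1 \<notin> L"
      "x \<notin> L \<or> x + int n \<notin> L" for L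
    proof -
      have L: "x \<le> y" "y < x + int n + 1" if "y \<in> L" for y
        using \<open>L \<subseteq> {x..<x + int (Suc n)}\<close> that by auto
      have "L \<subseteq> {x + 1..<x + 1 + int n} \<or> L \<subseteq> {x..<x + int n}"
      proof (cases "x \<in> L")
        case True
        then have ne: "y \<noteq> x + int n" if "y \<in> L" for y using \<open>x \<notin> L \<or> x + int n \<notin> L\<close> that by blast
        have "y \<in> {x..<x + int n}" if "y \<in> L" for y using L[OF that] ne[OF that] by simp
        then show ?thesis by blast
      next
        case False
        then have ne: "y \<noteq> x" if "y \<in> L" for y using that by blast
        have "y \<in> {x + 1..<x + 1 + int n}" if "y \<in> L" for y using L[OF that] ne[OF that] by simp
        then show ?thesis by blast
      qed
      then show ?thesis using Suc.IH that by blast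
    qed
    define j where "j = x + int n"
    \<comment> \<open>The window has ends \<open>x\<close> and \<open>j\<close>. Hypothesis
      \<open>nt\<close> demands that none of the five smaller sets contains \<open>p + 1\<close>
      without \<open>p\<close>; the cases below differ in how the middle element \<open>i\<close>
      achieves this.\<close>
    have step: "F K = G K"
      if K: "K \<subseteq> {x..<x + int (Suc n)}" "K \<subseteq> S" "x \<in> K" "j \<in> K"
        and i: "i \<notin> K" "x < i" "i < j"
        and nt: "\<And>L. L \<in> {insert i (K - {x, j}), insert i (K - {j}), insert i (K - {x}), K - {x}, K - {j}}
          \<Longrightarrow> p \<in> L \<or> p + 1 \<notin> L" for K i
    proof (rule plucker_step[OF F G fin[OF K(1)] K(2-4) i(1)])
      have "{x..j} \<subseteq> S" using conv K(2-4) by blast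
      then show iS: "i \<in> S" using i by auto
      fix L assume L: "L \<in> {insert i (K - {x, j}), insert i (K - {j}), insert i (K - {x}), K - {x}, K - {j}}"
      show "F L = G L"
        by (rule IH) (use L K i iS nt[OF L] in \<open>auto simp: j_def\<close>)
    qed (use i in auto)
    have all: "F K = G K"
      if K: "K \<subseteq> {x..<x + int (Suc n)}" "K \<subseteq> S" "x \<in> K" "j \<in> K" and full: "{x..j} \<subseteq> K" and nt: "p \<in> K \<or> p + 1 \<notin> K" for K
    proof -
      have "K = {x..<j + 1}" using K(1) full by (auto simp: j_def)
      moreover have "x \<noteq> p + 1" using nt K(1,3) by auto
      ultimately show ?thesis using int[of x "j + 1"] K(2) by simp
    qed
    \<comment> \<open>Sets avoiding \<open>p + 1\<close> come first because the last case needs them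
      in the same window.\<close>
    have no_succ: "F K = G K"
      if K: "K \<subseteq> {x..<x + int (Suc n)}" "K \<subseteq> S" "p + 1 \<notin> K" for K
    proof (cases "x \<in> K \<and> j \<in> K")
      case False
      then show ?thesis using IH[OF K(1,2)] K(3) by (auto simp: j_def)
    next
      case True
      then have xj: "x \<in> K" "j \<in> K" by auto
      note K' = K(1,2) xj
      show ?thesis
      proof (cases "{x..j} \<subseteq> K")
        case True
        then show ?thesis using all[OF K' True] K(3) by simp
      next
        case False
        then obtain i0 where i0: "i0 \<notin> K" "x < i0" "i0 < j" using xj by force
        show ?thesis
        proof (cases "p \<in> K")
          case False
          show ?thesis
          proof (cases "x < p \<and> p < j")
            case True
            then show ?thesis using step[OF K', of p] False K(3) by auto
          next
            case False
            have "i0 \<noteq> p + 1" using False i0 xj \<open>p \<notin> K\<close> K(3) by force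
            then show ?thesis using step[OF K' i0] \<open>p \<notin> K\<close> K(3) by auto
          qed
        next
          case pK: True
          show ?thesis
          proof (cases "p = x")
            case False
            show ?thesis
              by (rule step[OF K' i0]) (use pK K(3) i0 False in auto)
          next
            case px: True
            show ?thesis
            proof (cases "\<exists>i. i \<notin> K \<and> x < i \<and> i < j \<and> i \<noteq> p + 1")
              case True
              then obtain i where i: "i \<notin> K" "x < i" "i < j" "i \<noteq> p + 1" by blast
              show ?thesis by (rule step[OF K' i(1-3)]) (use pK K(3) i px in auto)
            next
              case False
              \<comment> \<open>The only gap is \<open>p + 1\<close>, and filling it after removing
                \<open>p = x\<close> would give a set of the excluded kind; hence the separate
                hypothesis \<open>gap\<close>.\<close>
              have "K = insert p {p + 2..<j + 1}"
              proof
                show "K \<subseteq> insert p {p + 2..<j + 1}"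
                proof
                  fix y assume y: "y \<in> K"
                  then have "y \<noteq> p + 1" "x \<le> y" "y \<le> j" using K by (auto simp: j_def)
                  then show "y \<in> insert p {p + 2..<j + 1}" using px by auto
                qed
                show "insert p {p + 2..<j + 1} \<subseteq> K"
                proof
                  fix y assume y: "y \<in> insert p {p + 2..<j + 1}"
                  show "y \<in> K"
                  proof (cases "y = p \<or> y = j")
                    case True
                    then show ?thesis using pK xj by blast
                  next
                    case False2: False
                    then have "x < y" "y < j" "y \<noteq> p + 1" using y px by auto
                    then show ?thesis using False by blast
                  qed
                qed
              qed
              then show ?thesis using gap[of "j + 1"] K(2) by simp
            qed
          qed
        qed
      qed
    qed
    show ?case
    proof (cases "p + 1 \<in> K")
      case False
      then show ?thesis using no_succ[of K] Suc.prems by blast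
    next
      case True
      then have pK: "p \<in> K" using Suc.prems by simp
      note K = Suc.prems(1,2)
      show ?thesis
      proof (cases "x \<in> K \<and> j \<in> K \<and> \<not> {x..j} \<subseteq> K")
        case False
        then consider "x \<notin> K \<or> j \<notin> K" | "x \<in> K" "j \<in> K" "{x..j} \<subseteq> K" by blast
        then show ?thesis
          by cases (use IH[OF K Suc.prems(3)] all[OF K _ _ _ Suc.prems(3)] j_def in auto)
      next
        case True2: True
        then obtain i where i: "i \<notin> K" "x < i" "i < j" by force
        have xj: "x \<in> K" "j \<in> K" using True2 by auto
        show ?thesis
        proof (cases "p = x")
          case False
          have "p \<noteq> j" using True K by (auto simp: j_def)
          show ?thesis by (rule step[OF K xj i]) (use False \<open>p \<noteq> j\<close> pK in auto)
        next
          case px: True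
          \<comment> \<open>Removing \<open>x = p\<close> would leave \<open>p + 1\<close> without
            \<open>p\<close>, so \<open>p + 1\<close> takes the part of the lower element. The
            resulting sets without \<open>p + 1\<close> are covered by \<open>no_succ\<close>, and
            those with it have lost \<open>j\<close>.\<close>
          have lt: "p + 1 < i" using px i True by (cases "i = p + 1") auto
          have "{x..j} \<subseteq> S" using conv K(2) xj by blast
          then have iS: "i \<in> S" using i by auto
          show ?thesis
          proof (rule plucker_step[OF F G fin[OF K(1)] K(2) True xj(2) i(1) iS lt i(3)])
            fix L assume L: "L \<in> {insert i (K - {p + 1, j}), insert i (K - {j}), insert i (K - {p + 1}), K - {p + 1}, K - {j}}"
            show "F L = G L"
            proof (cases "p + 1 \<in> L")
              case False
              show ?thesis by (rule no_succ) (use L False K iS i in \<open>auto simp: j_def\<close>)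
            next
              case True
              show ?thesis
                by (rule IH) (use L True K iS i pK px lt in \<open>auto simp: j_def\<close>)
            qed
          qed
        qed
      qed
    qed
  qed
  obtain lo hi where "K \<subseteq> {lo..<hi}" "lo \<le> hi" using finite_int_window[OF K(1)] .
  then show ?thesis using main[of K lo "nat (hi - lo)"] K by simp
qed

text \<open>For \<open>p = s - 2\<close> both \<open>p\<close> and \<open>p + 1\<close> lie below
  \<open>S\<close>, so no subset of \<open>S\<close> is excluded and the sets of hypothesis
  \<open>gap\<close> do not occur.\<close>

lemma plucker_agree_intervals:
  assumes "plucker S F" "plucker S G" "\<And>x y. x \<in> S \<Longrightarrow> y \<in> S \<Longrightarrow> {x..y} \<subseteq> S"
    and "\<And>u v. {u..<v} \<subseteq> S \<Longrightarrow> F {u..<v} = G {u..<v}" and "S \<subseteq> {s..}" and "finite K" "K \<subseteq> S"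
  shows "F K = G K"
  by (rule plucker_agree_untouched[OF assms(1-3), where p = "s - 2"]) (use assms in auto)

text \<open>The sets left open contain \<open>p + 1\<close> but not \<open>p\<close>. Starting from
  the known \<open>{p + 1..<t}\<close>, the relations for \<open>p\<close>, \<open>p + 1\<close>,
  \<open>j\<close> remove an element \<open>j\<close> above and those for \<open>h\<close>,
  \<open>p\<close>, \<open>p + 1\<close> add an element \<open>h\<close> below. Each involves one
  known and one new set of this kind, and the new one stands outside the minimum.\<close>

lemma plucker_determined:
  assumes F: "plucker {s..<t} F" and G: "plucker {s..<t} G" and p: "s \<le> p" "p + 1 < t"
    and untouched: "\<And>K. K \<subseteq> {s..<t} \<Longrightarrow> p \<in> K \<or> p + 1 \<notin> K \<Longrightarrow> F K = G K"
    and top: "F {p + 1..<t} = G {p + 1..<t}" and K: "K \<subseteq> {s..<t}"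
  shows "F K = G K"
proof (cases "p \<in> K \<or> p + 1 \<notin> K")
  case False
  have up: "F ({p + 1..<t} - H) = G ({p + 1..<t} - H)" if "finite H" "H \<subseteq> {p + 2..<t}" for H
    using that
  proof (induction H rule: finite_induct)
    case empty
    then show ?case using top by simp
  next
    case (insert j H)
    let ?k = "{p + 2..<t} - insert j H"
    have sets: "insert (p + 1) ?k = {p + 1..<t} - insert j H"
      "insert (p + 1) (insert j ?k) = {p + 1..<t} - H" using insert p by auto
    have rel: "E (insert p (insert j ?k)) + E ({p + 1..<t} - insert j H) =
      min (E (insert p (insert (p + 1) ?k)) + E (insert j ?k)) (E ({p + 1..<t} - H) + E (insert p ?k))"
      if "plucker {s..<t} E" for E
    proof -
      have "?k \<subseteq> {s..<t}" by (rule subset_trans[OF Diff_subset]) (use p in auto)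
      then show ?thesis
        using pluckerD[OF that, of ?k p "p + 1" j] insert.prems p unfolding sets by auto
    qed
    have un: "F L = G L" if "L \<in> {insert p (insert j ?k), insert p (insert (p + 1) ?k), insert j ?k, insert p ?k}" for L
      by (rule untouched) (use that insert.prems p in auto)
    show ?case using rel[OF F] rel[OF G] un insert by simp
  qed
  have low: "F (L \<union> ({p + 1..<t} - H)) = G (L \<union> ({p + 1..<t} - H))"
    if "finite L" "L \<subseteq> {s..<p}" "finite H" "H \<subseteq> {p + 2..<t}" for L H
    using that
  proof (induction L rule: finite_induct)
    case empty
    then show ?case using up by simp
  next
    case (insert h L)
    let ?k = "L \<union> ({p + 2..<t} - H)"
    have sets: "insert (p + 1) ?k = L \<union> ({p + 1..<t} - H)"
      "insert h (insert (p + 1) ?k) = insert h L \<union> ({p + 1..<t} - H)" using insert.prems p by auto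
    have fink: "finite ?k" using insert by simp
    have rel: "E (insert h L \<union> ({p + 1..<t} - H)) + E (insert p ?k) =
      min (E (insert h (insert p ?k)) + E (L \<union> ({p + 1..<t} - H)))
        (E (insert p (insert (p + 1) ?k)) + E (insert h ?k))"
      if "plucker {s..<t} E" for E
    proof -
      have k: "?k \<subseteq> {s..<t}" using p insert.prems by auto
      have L: "L \<subseteq> {s..<p}" "h \<in> {s..<p}" using insert.prems by auto
      then have "p \<notin> L" "p + 1 \<notin> L" by auto
      then show ?thesis
        using pluckerD[OF that fink k, of h p "p + 1"] L insert.hyps p unfolding sets by auto
    qed
    have un: "F L' = G L'" if "L' \<in> {insert p ?k, insert h (insert p ?k), insert p (insert (p + 1) ?k), insert h ?k}" for L'
      by (rule untouched) (use that insert.prems p in auto)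
    show ?case using rel[OF F] rel[OF G] un insert by simp
  qed
  have "K = (K \<inter> {s..<p}) \<union> ({p + 1..<t} - ({p + 2..<t} - K))"
  proof
    show "K \<subseteq> (K \<inter> {s..<p}) \<union> ({p + 1..<t} - ({p + 2..<t} - K))"
    proof
      fix x assume x: "x \<in> K"
      then have "x \<noteq> p" "s \<le> x" "x < t" using False K by auto
      then show "x \<in> (K \<inter> {s..<p}) \<union> ({p + 1..<t} - ({p + 2..<t} - K))" using x by auto
    qed
    show "(K \<inter> {s..<p}) \<union> ({p + 1..<t} - ({p + 2..<t} - K)) \<subseteq> K"
    proof
      fix x assume "x \<in> (K \<inter> {s..<p}) \<union> ({p + 1..<t} - ({p + 2..<t} - K))"
      then show "x \<in> K" using False by (cases "x = p + 1") auto
    qed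
  qed
  then show ?thesis using low[of "K \<inter> {s..<p}" "{p + 2..<t} - K"] by auto
qed (use untouched K in blast)

subsection \<open>Signature of the star operators\<close>

context
  fixes a :: lusztig and B p :: int
  assumes B: "vanishes_from B a"
begin

lemma vanish: "B \<le> j - i \<Longrightarrow> a (i, j) = 0"
  using B by (simp add: vanishes_from_def)

lemma B_pos: "0 < B"
  using B by (simp add: vanishes_from_def)

lemma A_star_eq: "p \<le> k \<Longrightarrow> k < t \<Longrightarrow> p + B \<le> t \<Longrightarrow>
    A_star p a k = (\<Sum>j\<in>{k + 1..<t}. int (a (p, j)) - int (a (p + 1, j + 1)))"
proof -
  assume k: "p \<le> k" "k < t" "p + B \<le> t"
  have "j < t" if "a (p, j) \<noteq> a (p + 1, j + 1)" for j
  proof (rule ccontr)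
    assume "\<not> j < t"
    then have "B \<le> j - p" "B \<le> (j + 1) - (p + 1)" using k by auto
    then show False using that vanish by metis
  qed
  then show ?thesis
    unfolding A_star_def Let_def by (intro sum.mono_neutral_left) auto
qed

lemma A_star_step:
  assumes "p \<le> k"
  shows "A_star p a k = A_star p a (k + 1) + int (a (p, k + 1)) - int (a (p + 1, k + 2))"
proof -
  define t where "t = k + 2 + B"
  have t: "k < t" "k + 1 < t" "p + B \<le> t" using assms B_pos by (auto simp: t_def)
  let ?f = "\<lambda>j. int (a (p, j)) - int (a (p + 1, j + 1))"
  have "A_star p a k = sum ?f {k + 1..<t}" "A_star p a (k + 1) = sum ?f {k + 1 + 1..<t}"
    by (rule A_star_eq; use assms t in simp)+
  moreover have "{k + 1..<t} = insert (k + 1) {k + 1 + 1..<t}" using t by auto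
  ultimately show ?thesis by (simp add: add.commute add.left_commute)
qed

lemma A_star_zero: "p + B \<le> k + 1 \<Longrightarrow> p \<le> k \<Longrightarrow> A_star p a k = 0"
  using A_star_eq[of k "k + 1"] by simp

lemma finite_A_star_values: "finite {A_star p a k |k. k \<ge> p}"
proof -
  have "{A_star p a k |k. k \<ge> p} \<subseteq> A_star p a ` {p..p + B}"
  proof
    fix y assume "y \<in> {A_star p a k |k. k \<ge> p}"
    then obtain k where k: "y = A_star p a k" "p \<le> k" by auto
    show "y \<in> A_star p a ` {p..p + B}"
    proof (cases "k \<le> p + B")
      case False
      then have "y = A_star p a (p + B)" using k A_star_zero[of k] A_star_zero[of "p + B"] B_pos by simp
      then show ?thesis using B_pos by auto
    qed (use k in auto)
  qed
  then show ?thesis by (rule finite_subset) simp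
qed

lemma A_star_le_eps: "p \<le> k \<Longrightarrow> A_star p a k \<le> eps_star p a"
  unfolding eps_star_def by (rule Max_ge[OF finite_A_star_values]) auto

lemma eps_star_attained: "\<exists>k\<ge>p. A_star p a k = eps_star p a"
proof -
  have "eps_star p a \<in> {A_star p a k |k. k \<ge> p}"
    unfolding eps_star_def by (rule Max_in[OF finite_A_star_values]) auto
  then show ?thesis by auto
qed

lemma eps_star_nonneg: "0 \<le> eps_star p a"
  using A_star_le_eps[of "p + B"] A_star_zero[of "p + B"] B_pos by simp

lemma eps_star_eqI:
  "p \<le> k \<Longrightarrow> A_star p a k = e \<Longrightarrow> (\<And>k. p \<le> k \<Longrightarrow> A_star p a k \<le> e) \<Longrightarrow> eps_star p a = e"
  by (metis A_star_le_eps eps_star_attained order_antisym)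

lemma kf_star:
  shows "p \<le> kf_star p a" "A_star p a (kf_star p a) = eps_star p a"
    "\<And>k. p \<le> k \<Longrightarrow> k < kf_star p a \<Longrightarrow> A_star p a k < eps_star p a"
proof -
  let ?P = "\<lambda>k. p \<le> k \<and> A_star p a k = eps_star p a"
  obtain k0 where k0: "?P k0" using eps_star_attained by blast
  \<comment> \<open>The integers are not well ordered; the bound \<open>p \<le> k\<close> moves the
    search for the least maximiser to natural numbers.\<close>
  define n where "n = (LEAST n. ?P (p + int n))"
  have ex: "?P (p + int (nat (k0 - p)))" using k0 by simp
  have n: "?P (p + int n)" unfolding n_def by (rule LeastI, rule ex)
  have least: "p + int n \<le> k" if "?P k" for k
  proof -
    have "n \<le> nat (k - p)" unfolding n_def by (rule Least_le) (use that in simp)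
    then show ?thesis using that le_nat_iff[of "k - p" n] by simp
  qed
  have eq: "kf_star p a = p + int n"
    unfolding kf_star_def by (rule Least_equality) (use n least in auto)
  show "p \<le> kf_star p a" "A_star p a (kf_star p a) = eps_star p a" using n eq by auto
  show "A_star p a k < eps_star p a" if "p \<le> k" "k < kf_star p a" for k
    using least[of k] that eq A_star_le_eps[of k] by force
qed

lemma kf_star_bound: "kf_star p a \<le> p + B"
proof (rule ccontr)
  assume *: "\<not> ?thesis"
  then have "A_star p a (kf_star p a) = 0" using A_star_zero[of "kf_star p a"] kf_star(1) by simp
  moreover have "A_star p a (p + B) < eps_star p a" using kf_star(3)[of "p + B"] * B_pos by simp
  ultimately show False using A_star_zero[of "p + B"] kf_star(2) B_pos by simp
qed

lemma kf_star_eqI: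
  "p \<le> k \<Longrightarrow> A_star p a k = eps_star p a \<Longrightarrow> (\<And>j. p \<le> j \<Longrightarrow> j < k \<Longrightarrow> A_star p a j < eps_star p a)
    \<Longrightarrow> kf_star p a = k"
  using kf_star by (metis linorder_neqE order_less_irrefl)

text \<open>Since \<open>A_star\<close> is 0 for all large \<open>k\<close>, a greatest maximiser
  exists only if the maximum is positive.\<close>

lemma ke_star:
  assumes "0 < eps_star p a"
  shows "p \<le> ke_star p a" "A_star p a (ke_star p a) = eps_star p a"
    "\<And>k. ke_star p a < k \<Longrightarrow> A_star p a k < eps_star p a"
    "ke_star p a < p + B"
proof -
  let ?P = "\<lambda>k. p \<le> k \<and> A_star p a k = eps_star p a"
  let ?S = "{k. ?P k}"
  have bound: "k < p + B" if "?P k" for k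
    using that A_star_zero[of k] assms by force
  have "?S \<subseteq> {p..p + B}" using bound by fastforce
  then have fin: "finite ?S" by (rule finite_subset) simp
  have ne: "?S \<noteq> {}" using eps_star_attained by blast
  have eq: "ke_star p a = Max ?S"
    unfolding ke_star_def
    by (rule Greatest_equality) (use Max_in[OF fin ne] Max_ge[OF fin] in auto)
  have P: "?P (ke_star p a)" using Max_in[OF fin ne] eq by simp
  then show "p \<le> ke_star p a" "A_star p a (ke_star p a) = eps_star p a" "ke_star p a < p + B"
    using bound by auto
  show "A_star p a k < eps_star p a" if "ke_star p a < k" for k
    using Max_ge[OF fin, of k] that eq A_star_le_eps[of k] P by force
qed

lemma ke_star_eqI:
  assumes "0 < eps_star p a" "p \<le> k" "A_star p a k = eps_star p a"
    "\<And>j. k < j \<Longrightarrow> A_star p a j < eps_star p a"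
  shows "ke_star p a = k"
  using ke_star[OF assms(1)] assms(2-4) by (metis linorder_neqE order_less_irrefl)

text \<open>\<open>A_star\<close> strictly increases on the step into its first maximum, so the
  entry to be lowered is positive and the truncated subtraction in \<open>f_star\<close> is exact.
  The next three inequalities come from the other steps beside an extremal maximiser.\<close>

lemma kf_entry_pos: "p < kf_star p a \<Longrightarrow> 0 < a (p + 1, kf_star p a + 1)"
  using A_star_step[of "kf_star p a - 1"] kf_star(2) kf_star(3)[of "kf_star p a - 1"] by (simp add: add.commute)

lemma kf_entry_le: "a (p + 1, kf_star p a + 2) \<le> a (p, kf_star p a + 1)"
  using A_star_step[of "kf_star p a"] kf_star(1,2) A_star_le_eps[of "kf_star p a + 1"] by (simp add: add.commute)

lemma ke_entry_pos: "0 < eps_star p a \<Longrightarrow> 0 < a (p, ke_star p a + 1)"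
  using A_star_step[of "ke_star p a"] ke_star(1,2) ke_star(3)[of "ke_star p a + 1"] by (simp add: add.commute)

lemma ke_entry_le: "0 < eps_star p a \<Longrightarrow> p < ke_star p a \<Longrightarrow> a (p, ke_star p a) \<le> a (p + 1, ke_star p a + 1)"
  using A_star_step[of "ke_star p a - 1"] ke_star(1,2) A_star_le_eps[of "ke_star p a - 1"] by (simp add: add.commute)

lemma f_star_entry:
  assumes "i < j"
  shows "int (f_star p a (i, j)) = int (a (i, j)) +
    (if i = p \<and> j = kf_star p a + 1 then 1 else 0) - (if i = p + 1 \<and> j = kf_star p a + 1 then 1 else 0)"
  using assms kf_entry_pos unfolding f_star_def Delta_def by (auto simp: of_nat_diff)

lemma vanishes_from_f_star: "vanishes_from (B + 2) (f_star p a)"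
  unfolding vanishes_from_def
proof (intro conjI allI impI)
  fix i j :: int assume ij: "B + 2 \<le> j - i"
  \<comment> \<open>By \<open>kf_star_bound\<close> the changed entries lie on superdiagonals up to
    \<open>B + 1\<close>, hence the new bound \<open>B + 2\<close>.\<close>
  have "\<not> (i = p \<and> j = kf_star p a + 1)" "\<not> (i = p + 1 \<and> j = kf_star p a + 1)"
    using ij kf_star_bound by auto
  then show "f_star p a (i, j) = 0"
    using f_star_entry[of i j] ij vanish[of j i] B_pos by (simp split: if_splits)
qed (use B_pos in simp)

subsection \<open>Effect of a star operator on minimal weights\<close>

context
  fixes s :: int
  assumes sp: "s \<le> p"
begin

text \<open>An interval component is minus a rectangle sum over the rows before \<open>u\<close>.
  The changes in rows \<open>p\<close> and \<open>p + 1\<close> stand in the same column and cancel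
  unless \<open>u = p + 1\<close> separates them.\<close>

lemma mm_interval_f_star:
  assumes "s \<le> u"
  shows "mm (f_star p a) s {u..<v} = mm a s {u..<v} - (if u = p + 1 \<and> kf_star p a + 1 < v then 1 else 0)"
proof -
  let ?k = "kf_star p a"
  have "(\<Sum>j\<in>{u..<v}. \<Sum>i\<in>{s..<u}. int (f_star p a (i, j))) =
      (\<Sum>j\<in>{u..<v}. \<Sum>i\<in>{s..<u}. int (a (i, j)) +
        ((if j = ?k + 1 then if i = p then 1 else 0 else 0) -
         (if j = ?k + 1 then if i = p + 1 then 1 else 0 else 0)))"
    by (intro sum.cong refl, subst f_star_entry) auto
  also have "\<dots> = (\<Sum>j\<in>{u..<v}. \<Sum>i\<in>{s..<u}. int (a (i, j))) +
      (\<Sum>j\<in>{u..<v}. if j = ?k + 1 then (if p < u then 1 else 0) - (if p + 1 < u then 1 else 0) else 0)"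
    unfolding sum.distrib[symmetric]
    using sp by (intro sum.cong refl) (auto simp: sum.distrib sum_subtractf)
  also have "(\<Sum>j\<in>{u..<v}. if j = ?k + 1 then (if p < u then 1 else 0) - (if p + 1 < u then 1 else (0::int)) else 0) =
      (if u = p + 1 \<and> ?k + 1 < v then 1 else 0)"
    using kf_star(1) by (auto simp: sum.delta)
  finally show ?thesis using assms by (simp add: mm_interval)
qed

lemma mm_gap_recursion:
  assumes "p + 2 \<le> v"
  shows "mm a' s (insert p {p + 2..<v + 1}) + mm a' s {p + 1..<v} =
    min (mm a' s {p..<v} + mm a' s {p + 2..<v + 1}) (mm a' s {p + 1..<v + 1} + mm a' s (insert p {p + 2..<v}))"
proof -
  have sets: "insert v {p + 2..<v} = {p + 2..<v + 1}" "insert (p + 1) {p + 2..<v} = {p + 1..<v}"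
    "insert p {p + 1..<v} = {p..<v}" "insert (p + 1) {p + 2..<v + 1} = {p + 1..<v + 1}"
    using assms by auto
  show ?thesis
    using mm_plucker[of "{p + 2..<v}" p "p + 1" v a' s] assms unfolding sets by simp
qed

text \<open>Normalised so that \<open>mm a s (insert p {p + 2..<v}) - mm a s {p + 1..<v}\<close> is \<open>gap_const\<close> minus the
  maximum of \<open>A_star p a k\<close> over \<open>p \<le> k \<le> v - 2\<close>.\<close>

definition gap_const :: int where
  "gap_const = mm a s {p..<p + 1} - mm a s {p + 1..<p + 2} + A_star p a p"

text \<open>Measures the first candidate of the minimum in \<open>mm_gap_recursion\<close>. The left
  side is a combination of rectangle sums; passing from \<open>v\<close> to \<open>v + 1\<close>
  changes it by two entries, which form exactly one step of \<open>A_star\<close>.\<close>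

lemma gap_slope:
  assumes "p + 1 \<le> v"
  shows "mm a s {p..<v} + mm a s {p + 2..<v + 1} - mm a s {p + 1..<v} - mm a s {p + 1..<v + 1} =
    gap_const - A_star p a (v - 1)"
  using assms
proof (induction v rule: int_ge_induct)
  case base
  then show ?case by (simp add: gap_const_def add.commute)
next
  case (step v)
  have ext: "mm a s {u..<w + 1} = mm a s {u..<w} - (\<Sum>i\<in>{s..<u}. int (a (i, w)))" if "s \<le> u" "u \<le> w" for u w
  proof -
    have "{u..<w + 1} = insert w {u..<w}" using that by auto
    then show ?thesis unfolding mm_interval[OF that(1)] by simp
  qed
  have row: "(\<Sum>i\<in>{s..<u + 1}. int (a (i, w))) = (\<Sum>i\<in>{s..<u}. int (a (i, w))) + int (a (u, w))" if "s \<le> u" for u w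
  proof -
    have "{s..<u + 1} = insert u {s..<u}" using that by auto
    then show ?thesis by simp
  qed
  have "A_star p a (v - 1) = A_star p a v + int (a (p, v)) - int (a (p + 1, v + 1))"
    using A_star_step[of "v - 1"] step.hyps by (simp add: add.commute)
  moreover have "(\<Sum>i\<in>{s..<p + 2}. int (a (i, v + 1))) =
      (\<Sum>i\<in>{s..<p + 1}. int (a (i, v + 1))) + int (a (p + 1, v + 1))"
  proof -
    have "{s..<p + 2} = insert (p + 1) {s..<p + 1}" using sp by auto
    then show ?thesis by simp
  qed
  moreover note row[OF sp, of v]
  moreover have "mm a s {p..<v + 1} = mm a s {p..<v} - (\<Sum>i\<in>{s..<p}. int (a (i, v)))"
    "mm a s {p + 2..<v + 1 + 1} = mm a s {p + 2..<v + 1} - (\<Sum>i\<in>{s..<p + 2}. int (a (i, v + 1)))"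
    "mm a s {p + 1..<v + 1} = mm a s {p + 1..<v} - (\<Sum>i\<in>{s..<p + 1}. int (a (i, v)))"
    "mm a s {p + 1..<v + 1 + 1} = mm a s {p + 1..<v + 1} - (\<Sum>i\<in>{s..<p + 1}. int (a (i, v + 1)))"
    using step.hyps sp by (simp_all only: ext)
  moreover have "v + 1 - 1 = v" by simp
  ultimately show ?case using step.IH by presburger
qed

text \<open>With \<open>gap_slope\<close> the recursion becomes a running minimum of
  \<open>gap_const - A_star p a k\<close>. This is where the signature rule of the crystal emerges
  from the Pluecker relations.\<close>

lemma gap_value:
  assumes "p + 2 \<le> v"
  shows "(\<forall>k\<in>{p..v - 2}. mm a s (insert p {p + 2..<v}) - mm a s {p + 1..<v} \<le> gap_const - A_star p a k) \<and>
    (\<exists>k\<in>{p..v - 2}. mm a s (insert p {p + 2..<v}) - mm a s {p + 1..<v} = gap_const - A_star p a k)"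
  using assms
proof (induction v rule: int_ge_induct)
  case base
  have "{p + 1..<p + 2} = {p + 1}" "{p..<p + 1} = {p}" by auto
  then show ?case by (auto simp: gap_const_def)
next
  case (step v)
  let ?u = "\<lambda>v. mm a s (insert p {p + 2..<v}) - mm a s {p + 1..<v}"
  have "?u (v + 1) = min (gap_const - A_star p a (v - 1)) (?u v)"
    using mm_gap_recursion[of v a] gap_slope[of v] step.hyps by simp
  moreover have "{p..v + 1 - 2} = insert (v - 1) {p..v - 2}" using step.hyps by auto
  ultimately show ?case using step.IH by (auto simp: min_def)
qed

lemma gap_value_large:
  assumes "kf_star p a + 2 \<le> v"
  shows "mm a s (insert p {p + 2..<v}) - mm a s {p + 1..<v} = gap_const - eps_star p a"
proof -
  have v: "p + 2 \<le> v" using assms kf_star(1) by simp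
  show ?thesis
  proof (rule antisym)
    have "kf_star p a \<in> {p..v - 2}" using kf_star(1) assms by simp
    then show "mm a s (insert p {p + 2..<v}) - mm a s {p + 1..<v} \<le> gap_const - eps_star p a"
      using gap_value[OF v] kf_star(2) by metis
    obtain k where "k \<in> {p..v - 2}" "mm a s (insert p {p + 2..<v}) - mm a s {p + 1..<v} = gap_const - A_star p a k"
      using gap_value[OF v] by blast
    then show "gap_const - eps_star p a \<le> mm a s (insert p {p + 2..<v}) - mm a s {p + 1..<v}"
      using A_star_le_eps[of k] by simp
  qed
qed

text \<open>The components at \<open>{p + 1..<v}\<close> drop by 1 once \<open>v\<close> exceeds
  \<open>kf_star p a + 1\<close>. At the switch the first candidate of the recursion attains the
  minimum with a margin of 1, because \<open>A_star\<close> reaches its maximum there for the first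
  time. Afterwards the second candidate attains it, and the drop occurs on both sides.\<close>

lemma mm_gap_f_star: "mm (f_star p a) s (insert p {p + 2..<v}) = mm a s (insert p {p + 2..<v})"
proof (cases "p + 2 \<le> v")
  case False
  then have "insert p {p + 2..<v} = {p..<p + 1}" by auto
  then show ?thesis using mm_interval_f_star[of p "p + 1"] sp by simp
next
  case True
  let ?k = "kf_star p a"
  show ?thesis using True
  proof (induction v rule: int_ge_induct)
    case base
    have "insert p {p + 2..<p + 2} = {p..<p + 1}" by auto
    then show ?case using mm_interval_f_star[of p "p + 1"] sp by simp
  next
    case (step v)
    let ?x = "\<lambda>a v. mm a s {p + 1..<v}" and ?y = "\<lambda>a v. mm a s (insert p {p + 2..<v})"
    let ?z = "mm a s {p..<v} + mm a s {p + 2..<v + 1}"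
    have x: "?x (f_star p a) w = ?x a w - (if ?k + 1 < w then 1 else 0)" for w
      using mm_interval_f_star[of "p + 1" w] sp by simp
    have z: "mm (f_star p a) s {p..<v} + mm (f_star p a) s {p + 2..<v + 1} = ?z"
      using mm_interval_f_star[of p v] mm_interval_f_star[of "p + 2" "v + 1"] sp by simp
    have r: "?y a (v + 1) + ?x a v = min ?z (?x a (v + 1) + ?y a v)"
      by (rule mm_gap_recursion[OF step.hyps])
    have r': "?y (f_star p a) (v + 1) + ?x (f_star p a) v = min ?z (?x (f_star p a) (v + 1) + ?y a v)"
      using mm_gap_recursion[OF step.hyps, of "f_star p a"] z step.IH by simp
    have slope: "?z - ?x a v - ?x a (v + 1) = gap_const - A_star p a (v - 1)"
      using gap_slope[of v] step.hyps by simp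
    consider "v < ?k + 1" | "v = ?k + 1" | "?k + 1 < v" by linarith
    then show ?case
    proof cases
      case 1
      then show ?thesis using r r' x[of v] x[of "v + 1"] by simp
    next
      case 2
      obtain j where j: "j \<in> {p..v - 2}" "?y a v - ?x a v = gap_const - A_star p a j"
        using gap_value[OF step.hyps] by blast
      have "A_star p a j < eps_star p a" using kf_star(3)[of j] j 2 by simp
      moreover have "A_star p a (v - 1) = eps_star p a" using kf_star(2) 2 by simp
      ultimately have "?z \<le> ?x a (v + 1) + ?y a v - 1" using slope j(2) by linarith
      then show ?thesis using r r' x[of v] x[of "v + 1"] 2 by simp
    next
      case 3
      have "?y a v - ?x a v = gap_const - eps_star p a" using gap_value_large[of v] 3 by simp
      then have "?x a (v + 1) + ?y a v \<le> ?z"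
        using slope A_star_le_eps[of "v - 1"] step.hyps by linarith
      then show ?thesis using r r' x[of v] x[of "v + 1"] 3 by simp
    qed
  qed
qed

lemma mm_f_star_untouched:
  assumes "finite K" "K \<subseteq> {s..}" "p \<in> K \<or> p + 1 \<notin> K"
  shows "mm (f_star p a) s K = mm a s K"
proof (rule plucker_agree_untouched[where S = "{s..}" and p = p])
  fix u v assume "{u..<v} \<subseteq> {s..}" "u \<noteq> p + 1"
  then show "mm (f_star p a) s {u..<v} = mm a s {u..<v}"
    using mm_interval_f_star[of u v] by (cases "u < v") auto
qed (use assms mm_gap_f_star plucker_mm in auto)

end

end

subsection \<open>Maya diagrams and intervals\<close>

text \<open>The charge can always be found by counting, so only the two seas matter. The witness
  \<open>r\<close> is chosen with \<open>r - int p = n - 1\<close>.\<close>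

lemma maya_iff: "k \<in> maya \<longleftrightarrow> (\<exists>n m. {..<n} \<subseteq> k \<and> k \<subseteq> {..<m})"
proof
  assume "k \<in> maya"
  then obtain r :: int and p q :: nat where "{..r - int p} \<subseteq> k" "k \<subseteq> {..r + int q}"
    by (auto simp: maya_def)
  then have "{..<r - int p} \<subseteq> k" "k \<subseteq> {..<r + int q + 1}" by auto
  then show "\<exists>n m. {..<n} \<subseteq> k \<and> k \<subseteq> {..<m}" by blast
next
  assume "\<exists>n m. {..<n} \<subseteq> k \<and> k \<subseteq> {..<m}"
  then obtain n m where nm: "{..<n} \<subseteq> k" "k \<subseteq> {..<m}" by blast
  define p where "p = card (k \<inter> {n - 1<..})"
  define r where "r = n - 1 + int p"
  have "{..r - int p} \<subseteq> k" using nm(1) by (auto simp: r_def)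
  moreover have "k \<subseteq> {..r + int (nat (m - r))}"
    using nm(2) by auto
  moreover have "card (k \<inter> {r - int p<..}) = p" by (simp add: p_def r_def)
  ultimately show "k \<in> maya" unfolding maya_def by blast
qed

lemma maya_prefix: "finite Y \<Longrightarrow> {..<s} \<union> Y \<in> maya"
proof -
  assume "finite Y"
  then obtain lo hi where "Y \<subseteq> {lo..<hi}" "lo \<le> hi" by (rule finite_int_window)
  then have "{..<s} \<union> Y \<subseteq> {..<max s hi}" by fastforce
  then show ?thesis unfolding maya_iff by blast
qed

lemma maya_cut:
  assumes "k \<in> maya" "{..<s} \<subseteq> k"
  shows "finite (k \<inter> {s..})" "k = {..<s} \<union> (k \<inter> {s..})"
proof -
  obtain m where "k \<subseteq> {..<m}" using assms by (auto simp: maya_iff)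
  then have "k \<inter> {s..} \<subseteq> {s..<m}" by auto
  then show "finite (k \<inter> {s..})" using finite_subset by blast
  show "k = {..<s} \<union> (k \<inter> {s..})" using assms(2) by force
qed

lemma mayac_iff: "k \<in> mayac \<longleftrightarrow> - k \<in> maya"
  unfolding mayac_def by (auto intro!: exI[of _ "- k"])

lemma interval_simps [simp]:
  "(s::int) \<le> t \<Longrightarrow> Min {s..t} = s" "(s::int) \<le> t \<Longrightarrow> Max {s..t} = t"
  by (auto intro!: Min_eqI Max_eqI)

lemma tilde_interval: "s \<le> t \<Longrightarrow> tilde {s..t} = {s..<t + 2}"
  by (auto simp: tilde_def)

lemma intervals_iff: "I \<in> intervals \<longleftrightarrow> (\<exists>s t. s \<le> t \<and> I = {s..t})"
  by (auto simp: intervals_def)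

lemma maya_int_iff:
  assumes "s \<le> t"
  shows "k \<in> maya_int {s..t} \<longleftrightarrow> {..<s} \<subseteq> k \<and> k \<subseteq> {..<t + 2} \<and> k \<noteq> {..<s} \<and> k \<noteq> {..<t + 2}"
proof
  assume "k \<in> maya_int {s..t}"
  then obtain k' where k': "k = {..<s} \<union> k'" "k' \<subseteq> {s..<t + 2}" "k' \<noteq> {}" "k' \<noteq> {s..<t + 2}"
    using assms by (auto simp: maya_int_def subsets_proper_def tilde_interval)
  have "k' = k \<inter> {s..}" using k' by auto
  moreover have "{..<s} \<inter> {s..} = {}" "{..<t + 2} \<inter> {s..} = {s..<t + 2}" by auto
  ultimately have "k \<noteq> {..<s}" "k \<noteq> {..<t + 2}" using k' by metis+
  then show "{..<s} \<subseteq> k \<and> k \<subseteq> {..<t + 2} \<and> k \<noteq> {..<s} \<and> k \<noteq> {..<t + 2}"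
    using k' assms by auto
next
  assume k: "{..<s} \<subseteq> k \<and> k \<subseteq> {..<t + 2} \<and> k \<noteq> {..<s} \<and> k \<noteq> {..<t + 2}"
  then have e: "k = {..<s} \<union> (k \<inter> {s..})" by force
  have "{..<t + 2} = {..<s} \<union> {s..<t + 2}" using assms by auto
  then have "k \<inter> {s..} \<in> subsets_proper {s..t}"
    using k e assms by (auto simp: subsets_proper_def tilde_interval)
  then show "k \<in> maya_int {s..t}" unfolding maya_int_def using e assms by auto
qed

lemma compl_mayac_int:
  assumes "s \<le> t"
  shows "k \<in> mayac_int {s..t} \<longleftrightarrow> - k \<in> maya_int {s..t}"
proof -
  have ex: "k \<in> mayac_int {s..t} \<longleftrightarrow> (\<exists>k'. k' \<subseteq> {s..<t + 2} \<and> k' \<noteq> {} \<and> k' \<noteq> {s..<t + 2} \<and> k = k' \<union> {t + 2..})"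
    using assms by (auto simp: mayac_int_def subsets_proper_def tilde_interval)
  show ?thesis
  proof
    assume "k \<in> mayac_int {s..t}"
    then obtain k' where k': "k' \<subseteq> {s..<t + 2}" "k' \<noteq> {}" "k' \<noteq> {s..<t + 2}" "k = k' \<union> {t + 2..}"
      using ex by blast
    have "- k = {..<s} \<union> ({s..<t + 2} - k')" using k'(1,4) assms by force
    moreover have "{s..<t + 2} - k' \<in> subsets_proper {s..t}"
      using k' assms by (auto simp: subsets_proper_def tilde_interval)
    ultimately show "- k \<in> maya_int {s..t}" unfolding maya_int_def using assms by auto
  next
    assume "- k \<in> maya_int {s..t}"
    then obtain k' where k': "- k = {..<s} \<union> k'" "k' \<subseteq> {s..<t + 2}" "k' \<noteq> {}" "k' \<noteq> {s..<t + 2}"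
      using assms by (auto simp: maya_int_def subsets_proper_def tilde_interval)
    have "k = - ({..<s} \<union> k')" using k'(1) by (metis double_complement)
    also have "\<dots> = ({s..<t + 2} - k') \<union> {t + 2..}" using k'(2) assms by force
    finally show "k \<in> mayac_int {s..t}" unfolding ex using k'(2-4) by blast
  qed
qed

lemma maya_int_mono:
  assumes "k \<in> maya_int I" "I \<subseteq> J" "I \<in> intervals" "J \<in> intervals"
  shows "k \<in> maya_int J"
proof -
  obtain s t s' t' where I: "s \<le> t" "I = {s..t}" "s' \<le> t'" "J = {s'..t'}"
    using assms by (auto simp: intervals_iff)
  then have st: "s' \<le> s" "t \<le> t'" using assms(2) by auto
  have k: "{..<s} \<subseteq> k" "k \<subseteq> {..<t + 2}" "k \<noteq> {..<s}" "k \<noteq> {..<t + 2}"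
    using assms(1) I by (auto simp: maya_int_iff)
  have "k \<noteq> {..<s'}"
  proof
    assume "k = {..<s'}"
    then have "s \<le> s'" using k(1) by (simp add: lessThan_subset_iff)
    then show False using \<open>k = {..<s'}\<close> k(3) st by simp
  qed
  moreover have "k \<noteq> {..<t' + 2}"
  proof
    assume "k = {..<t' + 2}"
    then have "t' \<le> t" using k(2) by (simp add: lessThan_subset_iff)
    then show False using \<open>k = {..<t' + 2}\<close> k(4) st by simp
  qed
  moreover have "{..<s'} \<subseteq> k" "k \<subseteq> {..<t' + 2}" using k(1,2) st by (auto simp: subset_iff)
  ultimately show ?thesis using I by (simp add: maya_int_iff)
qed

lemma maya_int_exists:
  assumes "k \<in> maya"
  obtains s t where "s \<le> t" "k \<in> maya_int {s..t}"
proof -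
  obtain n m where nm: "{..<n} \<subseteq> k" "k \<subseteq> {..<m}" using assms by (auto simp: maya_iff)
  have "n - 1 \<in> k" using nm(1) by auto
  then have lt: "n - 1 < m" using nm(2) by auto
  have "k \<noteq> {..<n - 1}" "k \<noteq> {..<m + 2}" using \<open>n - 1 \<in> k\<close> nm(2) by auto
  then have "k \<in> maya_int {n - 1..m}" using nm lt by (auto simp: maya_int_iff)
  then show ?thesis using that[of "n - 1" m] lt by simp
qed

lemma intervals_directed:
  assumes "I \<in> intervals" "J \<in> intervals"
  obtains K where "K \<in> intervals" "I \<subseteq> K" "J \<subseteq> K"
proof -
  obtain s t s' t' where st: "s \<le> t" "I = {s..t}" "s' \<le> t'" "J = {s'..t'}"
    using assms by (auto simp: intervals_iff)
  have "min s s' \<le> max t t'" using st by auto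
  then have "{min s s'..max t t'} \<in> intervals" unfolding intervals_iff by blast
  then show ?thesis using that[of "{min s s'..max t t'}"] st by auto
qed

subsection \<open>Berenstein-Zelevinsky data in terms of complements\<close>

definition supermodular :: "int set \<Rightarrow> family \<Rightarrow> bool" where
  "supermodular S F \<longleftrightarrow> (\<forall>k i j. finite k \<and> k \<subseteq> S \<and> i \<in> S \<and> j \<in> S \<and> i \<noteq> j \<and> i \<notin> k \<and> j \<notin> k \<longrightarrow>
     F (insert i k) + F (insert j k) \<le> F (insert i (insert j k)) + F k)"

lemma supermodularD:
  assumes "supermodular S F" "finite k" "k \<subseteq> S" "i \<in> S" "j \<in> S" "i \<noteq> j" "i \<notin> k" "j \<notin> k"
  shows "F (insert i k) + F (insert j k) \<le> F (insert i (insert j k)) + F k"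
  using assms unfolding supermodular_def by blast

lemma supermodular_cong: "(\<And>k. k \<subseteq> S \<Longrightarrow> F k = G k) \<Longrightarrow> supermodular S F = supermodular S G"
  unfolding supermodular_def by (simp cong: conj_cong)

lemma plucker_cong: "(\<And>k. k \<subseteq> S \<Longrightarrow> F k = G k) \<Longrightarrow> plucker S F = plucker S G"
  unfolding plucker_def by (simp cong: conj_cong)

text \<open>This condition and the Pluecker relation below are self-dual: complementation within
  \<open>S\<close> only permutes their terms. So families indexed by \<open>maya\<close> and by
  \<open>mayac\<close> satisfy the same conditions.\<close>

lemma supermodular_complement:
  assumes "finite S" "supermodular S F"
  shows "supermodular S (\<lambda>k. F (S - k))"
  unfolding supermodular_def
proof (intro allI impI, elim conjE)
  fix k i j assume k: "finite k" "k \<subseteq> S" "i \<in> S" "j \<in> S" "i \<noteq> j" "i \<notin> k" "j \<notin> k"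
  let ?k = "S - insert i (insert j k)"
  have sets: "S - insert i k = insert j ?k" "S - insert j k = insert i ?k" "S - k = insert i (insert j ?k)"
    using k by auto
  show "F (S - insert i k) + F (S - insert j k) \<le> F (S - insert i (insert j k)) + F (S - k)"
    using supermodularD[OF assms(2), of ?k i j] k assms(1) unfolding sets by simp
qed

lemma plucker_complement:
  assumes "finite S" "plucker S F"
  shows "plucker S (\<lambda>k. F (S - k))"
  unfolding plucker_def
proof (intro allI impI, elim conjE)
  fix k h i j assume k: "finite k" "k \<subseteq> S" "h \<in> S" "i \<in> S" "j \<in> S" "h < i" "i < j" "h \<notin> k" "i \<notin> k" "j \<notin> k"
  let ?k = "S - insert h (insert i (insert j k))"
  have sets: "S - insert h (insert j k) = insert i ?k" "S - insert i k = insert h (insert j ?k)"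
    "S - insert h (insert i k) = insert j ?k" "S - insert j k = insert h (insert i ?k)"
    "S - insert i (insert j k) = insert h ?k" "S - insert h k = insert i (insert j ?k)"
    using k by auto
  show "F (S - insert h (insert j k)) + F (S - insert i k) =
    min (F (S - insert h (insert i k)) + F (S - insert j k)) (F (S - insert i (insert j k)) + F (S - insert h k))"
    using pluckerD[OF assms(2), of ?k h i j] k assms(1) unfolding sets by (simp add: add.commute)
qed

lemma BZ_datum_iff:
  assumes "I \<in> intervals"
  shows "BZ_datum I M \<longleftrightarrow> M \<in> subsets_proper I \<rightarrow>\<^sub>E UNIV \<and>
    supermodular (tilde I) (comp0 I M) \<and> plucker (tilde I) (comp0 I M)"
proof -
  have fin: "finite k" if "k \<subseteq> tilde I" for k
    using that assms finite_subset[of k "tilde I"] by (auto simp: tilde_def)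
  show ?thesis
    unfolding BZ_datum_def supermodular_def plucker_def
    by (simp add: Un_insert_right Ball_def Pow_def) (intro conj_cong refl iffI allI impI; use fin in fastforce)
qed

text \<open>The definitions of \<open>BZ_Z\<close> and \<open>BZe_Z\<close> in terms of finite additions to a sea \<open>{..<s}\<close>; this is
  stated for the side of \<open>BZe_Z\<close>.\<close>

definition maya_datum :: "family \<Rightarrow> bool" where
  "maya_datum F \<longleftrightarrow> F \<in> maya \<rightarrow>\<^sub>E UNIV \<and>
     (\<forall>s. supermodular {s..} (\<lambda>Y. F ({..<s} \<union> Y)) \<and> plucker {s..} (\<lambda>Y. F ({..<s} \<union> Y))) \<and>
     (\<forall>n. F {..<n} = 0) \<and> (\<forall>k\<in>maya. Int_e F k \<noteq> {})"

lemma maya_datumD: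
  assumes "maya_datum F"
  shows "F \<in> maya \<rightarrow>\<^sub>E UNIV" "supermodular {s..} (\<lambda>Y. F ({..<s} \<union> Y))"
    "plucker {s..} (\<lambda>Y. F ({..<s} \<union> Y))" "F {..<n} = 0" "k \<in> maya \<Longrightarrow> Int_e F k \<noteq> {}"
  using assms by (auto simp: maya_datum_def)

lemma star_e_star_c: "F \<in> maya \<rightarrow>\<^sub>E UNIV \<Longrightarrow> star_e (star_c F) = F"
  by (rule ext) (auto simp: star_e_def star_c_def mayac_iff PiE_def extensional_def)

lemma star_c_star_e: "M \<in> mayac \<rightarrow>\<^sub>E UNIV \<Longrightarrow> star_c (star_e M) = M"
  by (rule ext) (auto simp: star_e_def star_c_def mayac_iff PiE_def extensional_def)

lemma star_c_apply: "- k \<in> maya \<Longrightarrow> star_c F k = F (- k)"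
  by (simp add: star_c_def mayac_iff)

lemma Omega_in_maya:
  assumes "I \<in> intervals"
  shows "Omega I k \<in> maya"
  unfolding Omega_def by (rule maya_prefix) (simp add: tilde_def)

lemma compl_Omegac:
  assumes "I \<in> intervals"
  shows "- Omegac I (- k) = Omega I k"
proof -
  obtain s t where I: "s \<le> t" "I = {s..t}" using assms by (auto simp: intervals_iff)
  show ?thesis
    unfolding Omega_def Omegac_def using I by (auto simp: tilde_interval)
qed

lemma star_c_Omegac: "I \<in> intervals \<Longrightarrow> star_c F (Omegac I (- k)) = F (Omega I k)"
  using Omega_in_maya[of I k] compl_Omegac[of I k] by (simp add: star_c_apply)

lemma Int_c_star_c: "Int_c (star_c F) (- k) = Int_e F k"
proof -
  have "I \<in> intervals \<Longrightarrow> - k \<in> mayac_int I \<longleftrightarrow> k \<in> maya_int I" for I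
    by (auto simp: intervals_iff compl_mayac_int)
  then show ?thesis
    unfolding Int_c_def Int_e_def by (auto simp: star_c_Omegac)
qed

lemma Int_e_mono:
  assumes "I \<in> Int_e F k" "I \<subseteq> J" "J \<in> intervals"
  shows "J \<in> Int_e F k"
proof -
  have I: "I \<in> intervals" "k \<in> maya_int I" using assms(1) by (auto simp: Int_e_def)
  have const: "F (Omega K k) = F (Omega I k)" if "K \<in> intervals" "I \<subseteq> K" for K
    using assms(1) that unfolding Int_e_def by blast
  have "F (Omega K k) = F (Omega J k)" if "K \<in> intervals" "J \<subseteq> K" for K
    using const[OF that(1) subset_trans[OF assms(2) that(2)]] const[OF assms(3,2)] by simp
  then show ?thesis
    using maya_int_mono[OF I(2) assms(2) I(1) assms(3)] assms(3) unfolding Int_e_def by blast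
qed

text \<open>The two sets excluded from \<open>subsets_proper\<close> correspond to the seas
  \<open>{..<s}\<close> and \<open>{..<t + 2}\<close>, so the convention of \<open>comp0\<close>
  matches the normalisation of \<open>F\<close>.\<close>

lemma comp0_fam_resc:
  assumes I: "s \<le> t" and F: "\<And>n. F {..<n} = 0" and K: "K \<subseteq> {s..<t + 2}"
  shows "comp0 {s..t} (fam_resc {s..t} (star_c F)) ({s..<t + 2} - K) = F ({..<s} \<union> K)"
proof -
  let ?k = "{s..<t + 2} - K"
  have eq: "- (?k \<union> {t + 2..}) = {..<s} \<union> K" using K I by force
  consider "?k = {}" | "?k = {s..<t + 2}" | "?k \<in> subsets_proper {s..t}"
    using I by (auto simp: subsets_proper_def tilde_interval)
  then show ?thesis
  proof cases
    case 1
    then have "{..<s} \<union> K = {..<t + 2}" using K I by auto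
    then show ?thesis using 1 F by (simp add: comp0_def)
  next
    case 2
    then have "K = {}" using K by blast
    then show ?thesis using F I by (simp add: comp0_def tilde_interval)
  next
    case 3
    have "{..<s} \<union> K \<in> maya" by (rule maya_prefix) (use K finite_subset in blast)
    moreover have "?k \<noteq> {}" "?k \<noteq> tilde {s..t}" using 3 by (auto simp: subsets_proper_def)
    ultimately show ?thesis
      using 3 I eq star_c_apply[of "?k \<union> {t + 2..}" F] by (simp add: comp0_def fam_resc_def)
  qed
qed

lemma comp0_fam_res:
  assumes I: "s \<le> t" and F: "\<And>n. F {..<n} = 0" and K: "K \<subseteq> {s..<t + 2}"
  shows "comp0 {s..t} (fam_res {s..t} F) K = F ({..<s} \<union> K)"
proof -
  have "{..<s} \<union> {s..<t + 2} = {..<t + 2}" using I by auto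
  then show ?thesis using I F K by (auto simp: comp0_def fam_res_def subsets_proper_def tilde_interval)
qed

lemma datum_on_interval:
  assumes "maya_datum F" and st: "s \<le> t"
  shows "supermodular {s..<t + 2} (\<lambda>K. F ({..<s} \<union> K))" "plucker {s..<t + 2} (\<lambda>K. F ({..<s} \<union> K))"
proof -
  have sub: "{s..<t + 2} \<subseteq> {s..}" by auto
  show "plucker {s..<t + 2} (\<lambda>K. F ({..<s} \<union> K))"
    by (rule plucker_subset[OF maya_datumD(3)[OF assms(1)] sub])
  show "supermodular {s..<t + 2} (\<lambda>K. F ({..<s} \<union> K))"
    using maya_datumD(2)[OF assms(1), of s] sub unfolding supermodular_def by (meson order_trans subsetD)
qed

lemma fam_resc_in_BZ:
  assumes F: "maya_datum F" and I: "I \<in> intervals"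
  shows "fam_resc I (star_c F) \<in> BZ I"
proof -
  obtain s t where st: "s \<le> t" and I': "I = {s..t}" using I by (auto simp: intervals_iff)
  let ?S = "{s..<t + 2}" and ?M = "fam_resc I (star_c F)" and ?G = "\<lambda>K. F ({..<s} \<union> K)"
  have eq: "comp0 I ?M k = ?G (?S - k)" if "k \<subseteq> ?S" for k
  proof -
    have "?S - (?S - k) = k" using that by auto
    then show ?thesis using comp0_fam_resc[OF st, of F "?S - k"] maya_datumD(4)[OF F] I' by simp
  qed
  have "supermodular ?S (comp0 I ?M)"
    using supermodular_complement[OF _ datum_on_interval(1)[OF F st]] eq
    by (subst supermodular_cong[where G = "\<lambda>k. ?G (?S - k)"]) auto
  moreover have "plucker ?S (comp0 I ?M)"
    using plucker_complement[OF _ datum_on_interval(2)[OF F st]] eq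
    by (subst plucker_cong[where G = "\<lambda>k. ?G (?S - k)"]) auto
  moreover have "?M \<in> subsets_proper I \<rightarrow>\<^sub>E UNIV" by (simp add: fam_resc_def)
  moreover have "?M {i + 1..Max I + 1} = 0" if "i \<in> I" for i
  proof -
    have s: "{i + 1..Max I + 1} \<subseteq> ?S" "?S - {i + 1..Max I + 1} = {s..<i + 1}"
      using that I' st by auto
    have "{i + 1..Max I + 1} \<noteq> {}" "{i + 1..Max I + 1} \<noteq> tilde I"
    proof -
      show "{i + 1..Max I + 1} \<noteq> {}" using that I' st by auto
      have "s \<in> tilde I" "s \<notin> {i + 1..Max I + 1}" using that I' st by (auto simp: tilde_interval)
      then show "{i + 1..Max I + 1} \<noteq> tilde I" by metis
    qed
    then have "?M {i + 1..Max I + 1} = comp0 I ?M {i + 1..Max I + 1}"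
      by (simp add: comp0_def)
    also have "\<dots> = F ({..<s} \<union> {s..<i + 1})" using eq[OF s(1)] s(2) by simp
    also have "{..<s} \<union> {s..<i + 1} = {..<i + 1}" using that I' by auto
    finally show ?thesis using maya_datumD(4)[OF F] by simp
  qed
  ultimately show ?thesis
    using I I' st by (simp add: BZ_def BZ_datum_iff tilde_interval)
qed

lemma fam_res_in_BZe:
  assumes F: "maya_datum F" and I: "I \<in> intervals"
  shows "fam_res I F \<in> BZe I"
proof -
  obtain s t where st: "s \<le> t" and I': "I = {s..t}" using I by (auto simp: intervals_iff)
  let ?S = "{s..<t + 2}" and ?M = "fam_res I F" and ?G = "\<lambda>K. F ({..<s} \<union> K)"
  have eq: "comp0 I ?M k = ?G k" if "k \<subseteq> ?S" for k
    using comp0_fam_res[OF st, of F k] maya_datumD(4)[OF F] that I' by simp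
  have "supermodular ?S (comp0 I ?M) = supermodular ?S ?G" "plucker ?S (comp0 I ?M) = plucker ?S ?G"
    by (rule supermodular_cong plucker_cong, erule eq)+
  then have "supermodular ?S (comp0 I ?M)" "plucker ?S (comp0 I ?M)"
    using datum_on_interval[OF F st] by simp_all
  moreover have "?M \<in> subsets_proper I \<rightarrow>\<^sub>E UNIV" by (simp add: fam_res_def)
  moreover have "?M {Min I..i} = 0" if "i \<in> I" for i
  proof -
    have "{..<s} \<union> {s..i} = {..<i + 1}" using that I' by auto
    moreover have "t + 1 \<in> tilde I" "t + 1 \<notin> {s..i}" "s \<in> {s..i}" using that I' st by (auto simp: tilde_interval)
    then have "{s..i} \<noteq> {}" "{s..i} \<noteq> tilde I" by (blast, metis)
    then have "?M {s..i} = comp0 I ?M {s..i}" by (simp add: comp0_def)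
    moreover have "{s..i} \<subseteq> ?S" using that I' by auto
    ultimately show ?thesis using eq[of "{s..i}"] maya_datumD(4)[OF F] I' st by simp
  qed
  ultimately show ?thesis
    using I I' st by (simp add: BZe_def BZ_datum_iff tilde_interval)
qed

lemma maya_datum_in_BZe_Z: "maya_datum F \<Longrightarrow> F \<in> BZe_Z"
  using fam_res_in_BZe maya_datumD by (auto simp: BZe_Z_def)

lemma maya_datum_star_c: "maya_datum F \<Longrightarrow> star_c F \<in> BZ_Z"
proof -
  assume F: "maya_datum F"
  have "Int_c (star_c F) k \<noteq> {}" if "k \<in> mayac" for k
    using maya_datumD(5)[OF F, of "- k"] Int_c_star_c[of F "- k"] that by (simp add: mayac_iff)
  then show ?thesis
    using fam_resc_in_BZ[OF F] by (auto simp: BZ_Z_def star_c_def)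
qed

lemma maya_datumI:
  assumes F: "F \<in> maya \<rightarrow>\<^sub>E UNIV" and zero: "\<And>n. F {..<n} = 0" and Int: "\<And>k. k \<in> maya \<Longrightarrow> Int_e F k \<noteq> {}"
    and sm: "\<And>s t. s \<le> t \<Longrightarrow> supermodular {s..<t + 2} (\<lambda>K. F ({..<s} \<union> K))"
    and pl: "\<And>s t. s \<le> t \<Longrightarrow> plucker {s..<t + 2} (\<lambda>K. F ({..<s} \<union> K))"
  shows "maya_datum F"
  unfolding maya_datum_def
proof (intro conjI allI ballI)
  fix s :: int
  have win: "\<exists>t\<ge>s. k \<subseteq> {s..<t + 2}" if k: "finite k" "k \<subseteq> {s..}" for k :: "int set"
  proof -
    obtain lo hi where "k \<subseteq> {lo..<hi}" "lo \<le> hi" using finite_int_window[OF k(1)] .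
    then have "k \<subseteq> {s..<max s hi + 2}" using k(2) by fastforce
    then show ?thesis by (meson max.cobounded1)
  qed
  show "supermodular {s..} (\<lambda>Y. F ({..<s} \<union> Y))"
    unfolding supermodular_def
  proof (intro allI impI, elim conjE)
    fix k i j assume k: "finite k" "k \<subseteq> {s..}" "i \<in> {s..}" "j \<in> {s..}" "i \<noteq> j" "i \<notin> k" "j \<notin> k"
    obtain t where t: "s \<le> t" "insert i (insert j k) \<subseteq> {s..<t + 2}"
      using win[of "insert i (insert j k)"] k by auto
    show "F ({..<s} \<union> insert i k) + F ({..<s} \<union> insert j k) \<le> F ({..<s} \<union> insert i (insert j k)) + F ({..<s} \<union> k)"
      using supermodularD[OF sm[OF t(1)], of k i j] k t(2) by auto
  qed
  show "plucker {s..} (\<lambda>Y. F ({..<s} \<union> Y))"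
    unfolding plucker_def
  proof (intro allI impI, elim conjE)
    fix k h i j assume k: "finite k" "k \<subseteq> {s..}" "h \<in> {s..}" "i \<in> {s..}" "j \<in> {s..}" "h < i" "i < j"
      "h \<notin> k" "i \<notin> k" "j \<notin> k"
    obtain t where t: "s \<le> t" "insert h (insert i (insert j k)) \<subseteq> {s..<t + 2}"
      using win[of "insert h (insert i (insert j k))"] k by auto
    have m: "k \<subseteq> {s..<t + 2}" "h \<in> {s..<t + 2}" "i \<in> {s..<t + 2}" "j \<in> {s..<t + 2}" using t(2) by auto
    show "F ({..<s} \<union> insert h (insert j k)) + F ({..<s} \<union> insert i k) =
      min (F ({..<s} \<union> insert h (insert i k)) + F ({..<s} \<union> insert j k))
          (F ({..<s} \<union> insert i (insert j k)) + F ({..<s} \<union> insert h k))"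
      by (rule pluckerD[OF pl[OF t(1)] k(1) m k(6-10)])
  qed
qed (use assms in auto)

lemma BZ_Z_maya_datum:
  assumes M: "M \<in> BZ_Z"
  shows "maya_datum (star_e M)"
proof -
  let ?F = "star_e M"
  have MF: "star_c ?F = M" by (rule star_c_star_e) (use M in \<open>simp add: BZ_Z_def\<close>)
  have zero: "?F {..<n} = 0" for n
  proof -
    \<comment> \<open>The one-point interval at \<open>n - 1\<close> suffices: its normalised
      component \<open>{n}\<close>, extended by all larger integers, has the sea
      \<open>{..<n}\<close> as complement.\<close>
    have "{n - 1..n - 1} \<in> intervals" unfolding intervals_iff by blast
    then have "fam_resc {n - 1..n - 1} M {n - 1 + 1..n - 1 + 1} = 0"
      using M by (force simp: BZ_Z_def BZ_def)
    moreover have "{n..n} \<in> subsets_proper {n - 1..n - 1}"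
      by (auto simp: subsets_proper_def tilde_def set_eq_iff intro: exI[of _ "n - 1"])
    moreover have "insert n {1 + n..} = {n..}" by auto
    moreover have "{..<n} \<in> maya" using maya_prefix[of "{}" n] by simp
    ultimately show ?thesis by (simp add: fam_resc_def star_e_def)
  qed
  show ?thesis
  proof (rule maya_datumI)
    show "?F \<in> maya \<rightarrow>\<^sub>E UNIV" by (simp add: star_e_def)
    show "?F {..<n} = 0" for n by (rule zero)
    show "Int_e ?F k \<noteq> {}" if "k \<in> maya" for k
    proof -
      have "- k \<in> mayac" using that by (simp add: mayac_iff)
      then have "Int_c M (- k) \<noteq> {}" using M by (auto simp: BZ_Z_def)
      then show ?thesis using Int_c_star_c[of ?F k] MF by simp
    qed
    fix s t :: int assume st: "s \<le> t"
    let ?I = "{s..t}" and ?S = "{s..<t + 2}"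
    have I: "?I \<in> intervals" using st by (auto simp: intervals_iff)
    have d: "supermodular ?S (comp0 ?I (fam_resc ?I M))" "plucker ?S (comp0 ?I (fam_resc ?I M))"
      using M I st BZ_datum_iff[OF I] by (auto simp: BZ_Z_def BZ_def tilde_interval)
    have eq: "comp0 ?I (fam_resc ?I M) (?S - K) = ?F ({..<s} \<union> K)" if "K \<subseteq> ?S" for K
      using comp0_fam_resc[where F = ?F, OF st zero that] MF by simp
    have fin: "finite ?S" by simp
    have "supermodular ?S (\<lambda>K. comp0 ?I (fam_resc ?I M) (?S - K)) = supermodular ?S (\<lambda>K. ?F ({..<s} \<union> K))"
      "plucker ?S (\<lambda>K. comp0 ?I (fam_resc ?I M) (?S - K)) = plucker ?S (\<lambda>K. ?F ({..<s} \<union> K))"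
      by (rule supermodular_cong plucker_cong, erule eq)+
    then show "supermodular ?S (\<lambda>K. ?F ({..<s} \<union> K))" "plucker ?S (\<lambda>K. ?F ({..<s} \<union> K))"
      using supermodular_complement[OF fin d(1)] plucker_complement[OF fin d(2)] by simp_all
  qed
qed

lemma BZe_Z_maya_datum:
  assumes F: "F \<in> BZe_Z"
  shows "maya_datum F"
proof -
  have zero: "F {..<n} = 0" for n
  proof -
    have "{n - 1..n - 1} \<in> intervals" unfolding intervals_iff by blast
    then have "fam_res {n - 1..n - 1} F {n - 1..n - 1} = 0"
      using F by (force simp: BZe_Z_def BZe_def)
    moreover have "{n - 1..n - 1} \<in> subsets_proper {n - 1..n - 1}"
      by (auto simp: subsets_proper_def tilde_def set_eq_iff intro: exI[of _ n])
    moreover have "{..<n - 1} \<union> {n - 1} = {..<n}" by auto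
    ultimately show ?thesis by (simp add: fam_res_def)
  qed
  show ?thesis
  proof (rule maya_datumI)
    fix s t :: int assume st: "s \<le> t"
    let ?I = "{s..t}" and ?S = "{s..<t + 2}"
    have I: "?I \<in> intervals" using st by (auto simp: intervals_iff)
    have d: "supermodular ?S (comp0 ?I (fam_res ?I F))" "plucker ?S (comp0 ?I (fam_res ?I F))"
      using F I st BZ_datum_iff[OF I] by (auto simp: BZe_Z_def BZe_def tilde_interval)
    have eq: "comp0 ?I (fam_res ?I F) K = F ({..<s} \<union> K)" if "K \<subseteq> ?S" for K
      using comp0_fam_res[where F = F, OF st zero that] .
    have "supermodular ?S (comp0 ?I (fam_res ?I F)) = supermodular ?S (\<lambda>K. F ({..<s} \<union> K))"
      "plucker ?S (comp0 ?I (fam_res ?I F)) = plucker ?S (\<lambda>K. F ({..<s} \<union> K))"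
      by (rule supermodular_cong plucker_cong, erule eq)+
    then show "supermodular ?S (\<lambda>K. F ({..<s} \<union> K))" "plucker ?S (\<lambda>K. F ({..<s} \<union> K))"
      using d by simp_all
  qed (use F zero in \<open>auto simp: BZe_Z_def\<close>)
qed

subsection \<open>Crystal operators on data for the integers\<close>

text \<open>Two admissible intervals lie in a common larger one, which has the same value as either,
  so the choice made in \<open>Theta\<close> is irrelevant.\<close>

lemma Theta_eq:
  assumes "k \<in> maya" "I \<in> Int_e F k"
  shows "Theta (star_c F) k = F (Omega I k)"
proof -
  define J where "J = (SOME I. I \<in> Int_e F k)"
  have J: "J \<in> Int_e F k" unfolding J_def by (rule someI, rule assms(2))
  have ints: "I \<in> intervals" "J \<in> intervals" using assms J by (auto simp: Int_e_def)
  obtain K where K: "K \<in> intervals" "I \<subseteq> K" "J \<subseteq> K" using intervals_directed[OF ints] .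
  have "F (Omega K k) = F (Omega I k)" "F (Omega K k) = F (Omega J k)"
    using assms(2) J K unfolding Int_e_def by blast+
  then have "F (Omega J k) = F (Omega I k)" by simp
  then show ?thesis
    using assms(1) ints(2) by (simp add: Theta_def Int_c_star_c J_def[symmetric] star_c_Omegac)
qed

lemma Theta_eq_mono:
  assumes "k \<in> maya" "{s..t} \<in> Int_e F k" "s' \<le> s" "t \<le> t'" "s \<le> t"
  shows "F (Omega {s'..t'} k) = Theta (star_c F) k"
proof -
  have "{s'..t'} \<in> intervals" unfolding intervals_iff using assms(3-5) by force
  then have "{s'..t'} \<in> Int_e F k" using Int_e_mono[OF assms(2)] assms(3-5) by auto
  then show ?thesis using Theta_eq[OF assms(1)] by simp
qed

definition swapped :: "int \<Rightarrow> int set" where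
  "swapped p = {..p - 1} \<union> {p + 1}"

lemma maya_basic: "{..p} \<in> maya" "swapped p \<in> maya"
proof -
  have "{..p} = {..<p + 1} \<union> {}" "swapped p = {..<p} \<union> {p + 1}" by (auto simp: swapped_def)
  then show "{..p} \<in> maya" "swapped p \<in> maya" using maya_prefix by (metis finite.emptyI, metis finite.emptyI finite.insertI)
qed

lemma Omega_basic:
  assumes "s \<le> p" "p \<le> t"
  shows "Omega {s..t} {..p} = {..<s} \<union> {p + 1..<t + 2}"
    "Omega {s..t} (swapped p) = {..<s} \<union> insert p {p + 2..<t + 2}"
    "Omega {s..t} {..p + 1} = {..<s} \<union> {p + 2..<t + 2}"
    "Omega {s..t} {..p - 1} = {..<s} \<union> {p..<t + 2}"
  using assms by (auto simp: Omega_def tilde_interval swapped_def)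

lemma Int_e_basic:
  assumes "{s..t} \<in> Int_e F {..p}" "s \<le> t"
  shows "s \<le> p" "p \<le> t"
proof -
  have "{..p} \<in> maya_int {s..t}" using assms by (simp add: Int_e_def)
  moreover have "{..p} = {..<p + 1}" by auto
  ultimately have "{..<s} \<subseteq> {..<p + 1} \<and> {..<p + 1} \<subseteq> {..<t + 2} \<and> {..<p + 1} \<noteq> {..<s} \<and> {..<p + 1} \<noteq> {..<t + 2}"
    using assms(2) by (simp add: maya_int_iff)
  then have "s \<le> p + 1 \<and> p + 1 \<le> t + 2 \<and> p + 1 \<noteq> s \<and> p + 1 \<noteq> t + 2"
    by (simp add: lessThan_subset_iff)
  then show "s \<le> p" "p \<le> t" by auto
qed

lemma common_interval:
  assumes F: "maya_datum F" and "finite Ms" "Ms \<subseteq> maya" "k \<in> maya"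
  shows "\<exists>I\<in>intervals. k \<in> maya_int I \<and> (\<forall>m\<in>Ms. I \<in> Int_e F m)"
  using assms(2,3)
proof (induction Ms rule: finite_induct)
  case empty
  obtain s t where "s \<le> t" "k \<in> maya_int {s..t}" using maya_int_exists[OF assms(4)] .
  then show ?case unfolding Bex_def intervals_iff by blast
next
  case (insert m Ms)
  then obtain I where I: "I \<in> intervals" "k \<in> maya_int I" "\<forall>m\<in>Ms. I \<in> Int_e F m" by auto
  obtain J where J: "J \<in> Int_e F m" using maya_datumD(5)[OF F, of m] insert.prems by auto
  then have Ji: "J \<in> intervals" by (simp add: Int_e_def)
  obtain K where K: "K \<in> intervals" "I \<subseteq> K" "J \<subseteq> K" using intervals_directed[OF I(1) Ji] .
  have "K \<in> Int_e F m" by (rule Int_e_mono[OF J K(3,1)])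
  moreover have "\<forall>m\<in>Ms. K \<in> Int_e F m" using I(3) Int_e_mono[OF _ K(2,1)] by blast
  ultimately show ?case
    using K(1) maya_int_mono[OF I(2) K(2) I(1) K(1)] by blast
qed

lemma fam_resc_res:
  assumes "I \<in> intervals" "k \<in> mayac_int I"
  shows "fam_resc I M (res I k) = M k"
proof -
  obtain s t where st: "s \<le> t" "I = {s..t}" using assms by (auto simp: intervals_iff)
  obtain k' where k': "k' \<in> subsets_proper I" "k = k' \<union> {t + 2..}"
    using assms st by (auto simp: mayac_int_def)
  then have "res I k = k'" using st by (auto simp: res_def subsets_proper_def tilde_interval)
  then show ?thesis using k' st by (simp add: fam_resc_def)
qed

text \<open>The uniqueness behind the descriptions in \<open>f_fin\<close> and \<open>e_fin\<close>.
  After complementation it is \<open>plucker_determined\<close>, with \<open>{s..p}\<close> turned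
  into \<open>{p + 1..<t + 2}\<close>.\<close>

lemma BZ_datum_unique:
  assumes st: "s \<le> t" and p: "s \<le> p" "p \<le> t"
    and N: "BZ_datum {s..t} N" and N': "BZ_datum {s..t} N'"
    and top: "N {s..p} = N' {s..p}"
    and untouched: "\<And>k. k \<in> subsets_proper {s..t} \<Longrightarrow> \<not> (p \<in> k \<and> p + 1 \<notin> k) \<Longrightarrow> N k = N' k"
  shows "N = N'"
proof -
  let ?I = "{s..t}" and ?S = "{s..<t + 2}"
  have I: "?I \<in> intervals" using st by (auto simp: intervals_iff)
  have fin: "finite ?S" by simp
  have pl: "plucker ?S (\<lambda>K. comp0 ?I N (?S - K))" "plucker ?S (\<lambda>K. comp0 ?I N' (?S - K))"
    using N N' st plucker_complement[OF fin] by (auto simp: BZ_datum_iff[OF I] tilde_interval)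
  have eq: "comp0 ?I N (?S - K) = comp0 ?I N' (?S - K)" if K: "K \<subseteq> ?S" for K
  proof (rule plucker_determined[OF pl, of p])
    fix K assume K: "K \<subseteq> ?S" "p \<in> K \<or> p + 1 \<notin> K"
    have "\<not> (p \<in> ?S - K \<and> p + 1 \<notin> ?S - K)" using K p by auto
    moreover have "?S - K \<in> subsets_proper ?I" if "?S - K \<noteq> {}" "?S - K \<noteq> tilde ?I"
      using that st by (auto simp: subsets_proper_def tilde_interval)
    ultimately show "comp0 ?I N (?S - K) = comp0 ?I N' (?S - K)"
      using untouched[of "?S - K"] by (auto simp: comp0_def)
  next
    have "?S - {p + 1..<t + 2} = {s..p}" using p by auto
    then show "comp0 ?I N (?S - {p + 1..<t + 2}) = comp0 ?I N' (?S - {p + 1..<t + 2})"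
      using top by (simp add: comp0_def)
  qed (use p K in auto)
  show ?thesis
  proof (rule PiE_ext)
    show "N \<in> subsets_proper ?I \<rightarrow>\<^sub>E UNIV" "N' \<in> subsets_proper ?I \<rightarrow>\<^sub>E UNIV"
      using N N' by (auto simp: BZ_datum_iff[OF I])
    fix k assume k: "k \<in> subsets_proper ?I"
    then have "k \<subseteq> ?S" "k \<noteq> {}" "k \<noteq> tilde ?I" using st by (auto simp: subsets_proper_def tilde_interval)
    moreover from this have "?S - (?S - k) = k" by auto
    ultimately show "N k = N' k" using eq[of "?S - k"] by (simp add: comp0_def)
  qed
qed

context
  fixes F F' :: family and p c :: int
  assumes F: "maya_datum F" and F': "maya_datum F'"
    and untouched: "\<And>k. k \<in> maya \<Longrightarrow> p \<in> k \<or> p + 1 \<notin> k \<Longrightarrow> F' k = F k"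
    and Theta': "Theta (star_c F') {..p} = Theta (star_c F) {..p} + c"
begin

context
  fixes s t :: int
  assumes st: "s \<le> t" and good: "{s..t} \<in> Int_e F {..p}" "{s..t} \<in> Int_e F (swapped p)"
    and case_c: "c = - 1 \<or> c = 1 \<and> {s..t} \<in> Int_e F {..p + 1} \<and> {s..t} \<in> Int_e F {..p - 1} \<and>
      0 < eps_Z p (star_c F)"
begin

text \<open>\<open>F'\<close> is the candidate for the result of an operator, with \<open>c\<close>
  equal to -1 for lowering and 1 for raising. The interval is known to be good for \<open>F\<close>
  only, while \<open>Theta\<close> of \<open>F'\<close> is attained on a possibly larger one. The
  value is carried back one unit at a time, first at the right end, then in the sea, by Pluecker
  relations whose minimum is attained by the term that carries it.\<close>

lemma component_at_good_interval:
  "F' ({..<s} \<union> {p + 1..<t + 2}) = Theta (star_c F) {..p} + c"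
proof -
  note p = Int_e_basic[OF good(1) st]
  define X where "X G u v = G ({..<u} \<union> {p + 1..<v + 2})" for G :: family and u v
  define Y where "Y u v = F ({..<u} \<union> insert p {p + 2..<v + 2})" for u v
  define B1 where "B1 u v = F ({..<u} \<union> {p..<v + 2})" for u v
  define B2 where "B2 u v = F ({..<u} \<union> {p + 2..<v + 2})" for u v
  define x where "x = Theta (star_c F) {..p}"
  define y where "y = Theta (star_c F) (swapped p)"
  have X: "X F u v = x" if "u \<le> s" "t \<le> v" for u v
    using Theta_eq_mono[OF maya_basic(1) good(1) that st] Omega_basic(1)[of u p v] p that
    by (simp add: X_def x_def)
  have Y: "Y u v = y" if "u \<le> s" "t \<le> v" for u v
    using Theta_eq_mono[OF maya_basic(2) good(2) that st] Omega_basic(2)[of u p v] p that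
    by (simp add: Y_def y_def)
  have un: "F' ({..<u} \<union> K) = F ({..<u} \<union> K)" if "u \<le> p" "finite K" "p \<in> K \<or> p + 1 \<notin> K" for u K
    by (rule untouched) (use that maya_prefix in auto)
  have rec1: "Y u (v + 1) + X G u v = min (B1 u v + B2 u (v + 1)) (X G u (v + 1) + Y u v)"
    if G: "G = F \<or> G = F'" and uv: "u \<le> p" "p \<le> v" for G u v
  proof -
    have "maya_datum G" using G F F' by auto
    note pl = maya_datumD(3)[OF this, of u]
    let ?k = "{p + 2..<v + 2}"
    have sets: "insert (v + 2) ?k = {p + 2..<v + 1 + 2}" "insert (p + 1) ?k = {p + 1..<v + 2}"
      "insert p {p + 1..<v + 2} = {p..<v + 2}" "insert (p + 1) {p + 2..<v + 1 + 2} = {p + 1..<v + 1 + 2}"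
      using uv by auto
    have e: "G ({..<u} \<union> insert p {p + 2..<v + 1 + 2}) = Y u (v + 1)"
      "G ({..<u} \<union> insert p {p + 2..<v + 2}) = Y u v"
      "G ({..<u} \<union> {p..<v + 2}) = B1 u v" "G ({..<u} \<union> {p + 2..<v + 1 + 2}) = B2 u (v + 1)"
      unfolding Y_def B1_def B2_def
      by (rule disjE[OF G], simp, simp only:, rule un; use uv in auto)+
    have "G ({..<u} \<union> insert p (insert (v + 2) ?k)) + G ({..<u} \<union> insert (p + 1) ?k) =
      min (G ({..<u} \<union> insert p (insert (p + 1) ?k)) + G ({..<u} \<union> insert (v + 2) ?k))
        (G ({..<u} \<union> insert (p + 1) (insert (v + 2) ?k)) + G ({..<u} \<union> insert p ?k))"
      by (rule pluckerD[OF pl]) (use uv in auto)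
    then show ?thesis unfolding sets e X_def .
  qed
  have rec2: "X G (u + 1) v + Y u v = min (Y (u + 1) v + X G u v) (B1 u v + B2 (u + 1) v)"
    if G: "G = F \<or> G = F'" and uv: "u < p" "p \<le> v" for G u v
  proof -
    have "maya_datum G" using G F F' by auto
    note pl = maya_datumD(3)[OF this, of u]
    let ?k = "{p + 2..<v + 2}"
    have sets: "{..<u} \<union> insert u K = {..<u + 1} \<union> K" "insert (p + 1) ?k = {p + 1..<v + 2}"
      "insert p {p + 1..<v + 2} = {p..<v + 2}" for K
      using uv by auto
    have e: "G ({..<u} \<union> insert p {p + 2..<v + 2}) = Y u v"
      "G ({..<u + 1} \<union> insert p {p + 2..<v + 2}) = Y (u + 1) v"
      "G ({..<u} \<union> {p..<v + 2}) = B1 u v" "G ({..<u + 1} \<union> {p + 2..<v + 2}) = B2 (u + 1) v"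
      unfolding Y_def B1_def B2_def
      by (rule disjE[OF G], simp, simp only:, rule un; use uv in auto)+
    have "G ({..<u} \<union> insert u (insert (p + 1) ?k)) + G ({..<u} \<union> insert p ?k) =
      min (G ({..<u} \<union> insert u (insert p ?k)) + G ({..<u} \<union> insert (p + 1) ?k))
        (G ({..<u} \<union> insert p (insert (p + 1) ?k)) + G ({..<u} \<union> insert u ?k))"
      by (rule pluckerD[OF pl]) (use uv in auto)
    then show ?thesis unfolding sets e X_def .
  qed
  \<comment> \<open>The competing term of each minimum is large enough. For \<open>c = - 1\<close>
    the relation of \<open>F\<close> itself shows this. For \<open>c = 1\<close> one more unit is
    required, and it comes from \<open>0 < eps_Z p (star_c F)\<close>, evaluated with the two
    additional sets that occur in \<open>e_Z\<close>.\<close>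
  have large: "x + c + y \<le> B1 u v + B2 u' v'" if uv: "u \<le> s" "t \<le> v" "u' = u \<and> v' = v + 1 \<or> u' = u + 1 \<and> v' = v \<and> u < s" for u v u' v'
    using case_c
  proof
    assume c: "c = - 1"
    from uv(3) show ?thesis
    proof
      assume e: "u' = u \<and> v' = v + 1"
      have "y + x = min (B1 u v + B2 u (v + 1)) (x + y)"
        using rec1[of F u v] X Y uv p by simp
      then show ?thesis using c e by simp
    next
      assume e: "u' = u + 1 \<and> v' = v \<and> u < s"
      have "x + y = min (y + x) (B1 u v + B2 (u + 1) v)"
        using rec2[of F u v] X[of u v] X[of "u + 1" v] Y[of u v] Y[of "u + 1" v] uv p e by simp
      then show ?thesis using c e by simp
    qed
  next
    assume c: "c = 1 \<and> {s..t} \<in> Int_e F {..p + 1} \<and> {s..t} \<in> Int_e F {..p - 1} \<and> 0 < eps_Z p (star_c F)"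
    have "B1 u v = Theta (star_c F) {..p - 1}"
      using Theta_eq_mono[OF maya_basic(1), of s t F "p - 1" u v] Omega_basic(4)[of u p v] p uv st c
      by (simp add: B1_def)
    moreover have "u' \<le> s" "t \<le> v'" using uv by auto
    then have "B2 u' v' = Theta (star_c F) {..p + 1}"
      using Theta_eq_mono[OF maya_basic(1), of s t F "p + 1" u' v'] Omega_basic(3)[of u' p v'] p st c
      by (simp add: B2_def)
    ultimately show ?thesis
      using c unfolding eps_Z_def swapped_def[symmetric] x_def y_def by simp
  qed
  obtain I where I: "I \<in> Int_e F' {..p}" using maya_datumD(5)[OF F' maya_basic(1)] by blast
  then obtain s0 t0 where st0: "s0 \<le> t0" "I = {s0..t0}" by (auto simp: Int_e_def intervals_iff)
  \<comment> \<open>An interval that contains both the given one and one that is good for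
    \<open>F'\<close>.\<close>
  define s1 where "s1 = min s s0"
  define t1 where "t1 = max t t0"
  have s1: "s1 \<le> s" "s1 \<le> s0" "t \<le> t1" "t0 \<le> t1" by (auto simp: s1_def t1_def)
  have top: "X F' s1 t1 = x + c"
    using Theta_eq_mono[OF maya_basic(1), of s0 t0 F' p s1 t1] Omega_basic(1)[of s1 p t1] I st0 s1 p Theta'
    by (simp add: X_def x_def)
  have col: "X F' s1 v = x + c" if "t \<le> v" "v \<le> t1" for v
    using that(2,1)
  proof (induction v rule: int_le_induct)
    case base
    then show ?case using top by simp
  next
    case (step v)
    then have "X F' s1 v = x + c" by simp
    then have "y + X F' s1 (v - 1) = min (B1 s1 (v - 1) + B2 s1 v) (x + c + y)"
      using rec1[of F' s1 "v - 1"] Y[of s1 v] Y[of s1 "v - 1"] s1 p step.prems by simp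
    moreover have "x + c + y \<le> B1 s1 (v - 1) + B2 s1 v"
      using large[of s1 "v - 1" s1 v] s1 step.prems by simp
    ultimately show ?case by simp
  qed
  have "X F' u t = x + c" if "s1 \<le> u" "u \<le> s" for u
    using that
  proof (induction u rule: int_ge_induct)
    case base
    then show ?case using col[of t] s1 by simp
  next
    case (step u)
    then have "X F' u t = x + c" by simp
    then have "X F' (u + 1) t + y = min (y + (x + c)) (B1 u t + B2 (u + 1) t)"
      using rec2[of F' u t] Y[of u t] Y[of "u + 1" t] p step.prems by simp
    moreover have "x + c + y \<le> B1 u t + B2 (u + 1) t"
      using large[of u t "u + 1" t] step.prems by simp
    ultimately show ?case by simp
  qed
  then show ?thesis using s1 by (simp add: X_def x_def)
qed

text \<open>Existence needs no abstract argument: the restriction of \<open>F'\<close> has the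
  required properties, and \<open>BZ_datum_unique\<close> gives uniqueness.\<close>

lemma operator_on_good_interval:
  "(THE N. N \<in> BZ {s..t} \<and> N {Min {s..t}..p} = fam_resc {s..t} (star_c F) {Min {s..t}..p} + c \<and>
     (\<forall>k\<in>subsets_proper {s..t}. \<not> (p \<in> k \<and> p + 1 \<notin> k) \<longrightarrow> N k = fam_resc {s..t} (star_c F) k)) =
   fam_resc {s..t} (star_c F')" (is "(THE N. ?P N) = ?N")
proof (rule the_equality)
  note p = Int_e_basic[OF good(1) st]
  have I: "{s..t} \<in> intervals" using st by (auto simp: intervals_iff)
  have sp: "{s..p} \<in> subsets_proper {s..t}"
  proof -
    have "t + 1 \<in> tilde {s..t}" "t + 1 \<notin> {s..p}" "s \<in> {s..p}" "{s..p} \<subseteq> tilde {s..t}"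
      using p st by (auto simp: tilde_interval)
    then show ?thesis unfolding subsets_proper_def by blast
  qed
  have eq: "fam_resc {s..t} (star_c G) k = G ({..<s} \<union> ({s..<t + 2} - k))"
    if "k \<in> subsets_proper {s..t}" for G k
  proof -
    have "k \<subseteq> {s..<t + 2}" using that st by (auto simp: subsets_proper_def tilde_interval)
    then have "- (k \<union> {t + 2..}) = {..<s} \<union> ({s..<t + 2} - k)" using st by force
    moreover have "{..<s} \<union> ({s..<t + 2} - k) \<in> maya" by (rule maya_prefix) simp
    ultimately show ?thesis using that st by (simp add: fam_resc_def star_c_apply)
  qed
  have "{s..<t + 2} - {s..p} = {p + 1..<t + 2}" using p by auto
  moreover have "F ({..<s} \<union> {p + 1..<t + 2}) = Theta (star_c F) {..p}"
    using Theta_eq[OF maya_basic(1) good(1)] Omega_basic(1)[OF p] by simp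
  ultimately have top: "?N {s..p} = fam_resc {s..t} (star_c F) {s..p} + c"
    using component_at_good_interval sp by (simp add: eq)
  have un: "?N k = fam_resc {s..t} (star_c F) k"
    if "k \<in> subsets_proper {s..t}" "\<not> (p \<in> k \<and> p + 1 \<notin> k)" for k
  proof -
    have "F' ({..<s} \<union> ({s..<t + 2} - k)) = F ({..<s} \<union> ({s..<t + 2} - k))"
      by (rule untouched) (use that p maya_prefix in auto)
    then show ?thesis using that by (simp add: eq)
  qed
  show "?P ?N" using fam_resc_in_BZ[OF F' I] top un st by simp
  fix N assume N: "?P N"
  show "N = ?N"
  proof (rule BZ_datum_unique[OF st p])
    show "BZ_datum {s..t} N" "BZ_datum {s..t} ?N"
      using N fam_resc_in_BZ[OF F' I] by (auto simp: BZ_def)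
    show "N {s..p} = ?N {s..p}" using N top st by simp
    show "N k = ?N k" if "k \<in> subsets_proper {s..t}" "\<not> (p \<in> k \<and> p + 1 \<notin> k)" for k
      using N un[OF that] that by simp
  qed
qed

end

lemma f_Z_eqI:
  assumes c: "c = - 1"
  shows "f_Z p (star_c F) = star_c F'"
proof
  fix k
  show "f_Z p (star_c F) k = star_c F' k"
  proof (cases "k \<in> mayac")
    case True
    let ?P = "\<lambda>I. I \<in> intervals \<and> k \<in> mayac_int I \<and>
      (\<forall>m\<in>{{..p}, {..p - 1} \<union> {p + 1}}. I \<in> Int_c (star_c F) (- m))"
    define I where "I = (SOME I. ?P I)"
    have "\<exists>I. ?P I"
    proof -
      obtain I where I: "I \<in> intervals" "- k \<in> maya_int I" "\<forall>m\<in>{{..p}, swapped p}. I \<in> Int_e F m"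
        using common_interval[OF F, of "{{..p}, swapped p}" "- k"] maya_basic True by (auto simp: mayac_iff)
      then have "k \<in> mayac_int I" by (auto simp: intervals_iff compl_mayac_int)
      then show ?thesis using I by (auto simp: Int_c_star_c swapped_def)
    qed
    then have I: "?P I" unfolding I_def by (rule someI_ex)
    then obtain s t where st: "s \<le> t" "I = {s..t}" by (auto simp: intervals_iff)
    have good: "{s..t} \<in> Int_e F {..p}" "{s..t} \<in> Int_e F (swapped p)"
      using I st by (auto simp: Int_c_star_c swapped_def)
    have "f_fin I p (fam_resc I (star_c F)) = fam_resc I (star_c F')"
      using operator_on_good_interval[OF st(1) good] c st by (simp add: f_fin_def)
    then have "f_Z p (star_c F) k = fam_resc I (star_c F') (res I k)"
      using True by (simp add: f_Z_def I_def Let_def)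
    also have "\<dots> = star_c F' k" using fam_resc_res I by blast
    finally show ?thesis .
  next
    case False
    then show ?thesis by (simp add: f_Z_def star_c_def)
  qed
qed

lemma e_Z_eqI:
  assumes c: "c = 1" and eps: "0 < eps_Z p (star_c F)"
  shows "e_Z p (star_c F) = Some (star_c F')"
proof -
  have "(\<lambda>k\<in>mayac. let I = (SOME I. I \<in> intervals \<and> k \<in> mayac_int I \<and>
      (\<forall>m\<in>{{..p}, {..p - 1} \<union> {p + 1}, {..p + 1}, {..p - 1}}. I \<in> Int_c (star_c F) (- m)))
    in the (e_fin I p (fam_resc I (star_c F))) (res I k)) = star_c F'" (is "?L = _")
  proof
    fix k
    show "?L k = star_c F' k"
    proof (cases "k \<in> mayac")
      case True
      let ?P = "\<lambda>I. I \<in> intervals \<and> k \<in> mayac_int I \<and>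
        (\<forall>m\<in>{{..p}, {..p - 1} \<union> {p + 1}, {..p + 1}, {..p - 1}}. I \<in> Int_c (star_c F) (- m))"
      define I where "I = (SOME I. ?P I)"
      have "\<exists>I. ?P I"
      proof -
        obtain I where I: "I \<in> intervals" "- k \<in> maya_int I"
            "\<forall>m\<in>{{..p}, swapped p, {..p + 1}, {..p - 1}}. I \<in> Int_e F m"
          using common_interval[OF F, of "{{..p}, swapped p, {..p + 1}, {..p - 1}}" "- k"] maya_basic True
          by (auto simp: mayac_iff)
        then have "k \<in> mayac_int I" by (auto simp: intervals_iff compl_mayac_int)
        then show ?thesis using I by (auto simp: Int_c_star_c swapped_def)
      qed
      then have I: "?P I" unfolding I_def by (rule someI_ex)
      then obtain s t where st: "s \<le> t" "I = {s..t}" by (auto simp: intervals_iff)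
      have good: "{s..t} \<in> Int_e F {..p}" "{s..t} \<in> Int_e F (swapped p)"
        "{s..t} \<in> Int_e F {..p + 1}" "{s..t} \<in> Int_e F {..p - 1}"
        using I st by (auto simp: Int_c_star_c swapped_def)
      note p = Int_e_basic[OF good(1) st(1)] Int_e_basic[OF good(3) st(1)] Int_e_basic[OF good(4) st(1)]
      \<comment> \<open>An interval good for all four sets computes \<open>eps_Z\<close>, so
        \<open>e_fin\<close> does not return \<open>None\<close>.\<close>
      have "eps_fin I p (fam_resc I (star_c F)) = eps_Z p (star_c F)"
      proof -
        have c0: "comp0 {s..t} (fam_resc {s..t} (star_c F)) ({s..<t + 2} - K) = F ({..<s} \<union> K)"
          if "K \<subseteq> {s..<t + 2}" for K
          by (rule comp0_fam_resc[OF st(1) _ that]) (rule maya_datumD(4)[OF F])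
        have sets: "{s..p} = {s..<t + 2} - {p + 1..<t + 2}" "{s..p - 1} \<union> {p + 1} = {s..<t + 2} - insert p {p + 2..<t + 2}"
          "{s..p - 1} = {s..<t + 2} - {p..<t + 2}" "{s..p + 1} = {s..<t + 2} - {p + 2..<t + 2}"
          using p by auto
        have th: "Theta (star_c F) {..p} = F ({..<s} \<union> {p + 1..<t + 2})"
          "Theta (star_c F) (swapped p) = F ({..<s} \<union> insert p {p + 2..<t + 2})"
          "Theta (star_c F) {..p + 1} = F ({..<s} \<union> {p + 2..<t + 2})"
          "Theta (star_c F) {..p - 1} = F ({..<s} \<union> {p..<t + 2})"
          using Theta_eq[OF _ good(1)] Theta_eq[OF _ good(2)] Theta_eq[OF _ good(3)] Theta_eq[OF _ good(4)]
            maya_basic Omega_basic[OF p(1,2)] by simp_all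
        have "eps_fin I p (fam_resc I (star_c F)) =
          - (F ({..<s} \<union> {p + 1..<t + 2}) + F ({..<s} \<union> insert p {p + 2..<t + 2})
             - F ({..<s} \<union> {p..<t + 2}) - F ({..<s} \<union> {p + 2..<t + 2}))"
        proof -
          have sub: "{p + 1..<t + 2} \<subseteq> {s..<t + 2}" "insert p {p + 2..<t + 2} \<subseteq> {s..<t + 2}"
            "{p..<t + 2} \<subseteq> {s..<t + 2}" "{p + 2..<t + 2} \<subseteq> {s..<t + 2}" using p by auto
          show ?thesis
            unfolding eps_fin_def st(2) interval_simps[OF st(1)]
            using c0[OF sub(1), folded sets(1)] c0[OF sub(2), folded sets(2)]
              c0[OF sub(3), folded sets(3)] c0[OF sub(4), folded sets(4)] by simp
        qed
        then show ?thesis unfolding eps_Z_def swapped_def[symmetric] th by simp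
      qed
      then have "e_fin I p (fam_resc I (star_c F)) = Some (fam_resc I (star_c F'))"
        using operator_on_good_interval[OF st(1) good(1,2)] good c eps st by (simp add: e_fin_def)
      then have "?L k = fam_resc I (star_c F') (res I k)"
        using True by (simp add: I_def Let_def)
      also have "\<dots> = star_c F' k" using fam_resc_res I by blast
      finally show ?thesis .
    next
      case False
      then show ?thesis by (simp add: star_c_def)
    qed
  qed
  then show ?thesis using eps by (simp add: e_Z_def)
qed

end

subsection \<open>The family of a Lusztig datum\<close>

lemma LusZ_iff: "a \<in> LusZ \<longleftrightarrow> a \<in> Delta \<rightarrow>\<^sub>E UNIV \<and> (\<exists>B. vanishes_from B a)"
  unfolding LusZ_def vanishes_from_def Delta_def by force

lemma vanishes_from_mono: "vanishes_from B a \<Longrightarrow> B \<le> B' \<Longrightarrow> vanishes_from B' a"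
  by (auto simp: vanishes_from_def)

lemma M_fin_eq_mm:
  assumes "s \<le> t" "K \<subseteq> {s..<t + 2}"
  shows "M_fin {s..t} (restrict a (Delta_int {s..t})) K = mm a s K"
proof -
  have "M_fin {s..t} b K = mm b s K" for b
  proof -
    have "{s..j - 1} = {s..<j}" for j by auto
    then show ?thesis
      using assms by (simp add: M_fin_def mm_def min_weight_def tableau_weight_def)
  qed
  moreover have "mm (restrict a (Delta_int {s..t})) s K = mm a s K"
    by (rule mm_cong[of _ _ "t + 2"])
      (use assms finite_subset in \<open>auto simp: Delta_int_def tilde_interval\<close>)
  ultimately show ?thesis by simp
qed

text \<open>Enlarging an interval to the right does not affect \<open>mm\<close>, and to the left
  \<open>mm_stable\<close> applies because the sea of \<open>k\<close> reaches \<open>B\<close>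
  beyond \<open>s\<close>. Any two stable values agree on a common larger interval, so the definite
  description is justified.\<close>

lemma M_Z_eq:
  assumes B: "vanishes_from B a" and k: "k \<in> maya" "{..<s + B} \<subseteq> k"
  shows "M_Z a k = mm a s (k \<inter> {s..})"
proof -
  have B0: "0 < B" using B by (simp add: vanishes_from_def)
  obtain n m where "{..<n} \<subseteq> k" "k \<subseteq> {..<m}" using k(1) by (auto simp: maya_iff)
  define t where "t = max s m"
  have t: "s \<le> t" "k \<subseteq> {..<t}" using \<open>k \<subseteq> {..<m}\<close> by (auto simp: t_def)
  have ks: "{..<s} \<subseteq> k" using k(2) B0 by auto
  have val: "k \<in> maya_int {r..u} \<and> M_fin {r..u} (restrict a (Delta_int {r..u})) (res {r..u} k) = mm a s (k \<inter> {s..})"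
    if ru: "r \<le> s" "t \<le> u" for r u
  proof
    have r: "r \<le> u" using ru t by simp
    have "r \<in> k" using k(2) B0 ru by auto
    then have "k \<noteq> {..<r}" by auto
    moreover have "u + 1 \<notin> k" using t ru by auto
    then have "k \<noteq> {..<u + 2}" by auto
    ultimately show "k \<in> maya_int {r..u}"
      using r ru ks t by (auto simp: maya_int_iff subset_iff)
    have "res {r..u} k = k \<inter> {r..<u + 2}" using r by (simp add: res_def tilde_interval)
    also have "\<dots> = {r..<s} \<union> (k \<inter> {s..})" using ru t ks by (auto simp: subset_iff)
    finally have R: "res {r..u} k = {r..<s} \<union> (k \<inter> {s..})" .
    have "M_fin {r..u} (restrict a (Delta_int {r..u})) (res {r..u} k) = mm a r (res {r..u} k)"
      by (rule M_fin_eq_mm[OF r]) (use r in \<open>auto simp: res_def tilde_interval\<close>)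
    also have "\<dots> = mm a r ({r..<s} \<union> (k \<inter> {s..}))" by (simp only: R)
    also have "\<dots> = mm a s (k \<inter> {s..})"
      by (rule mm_stable[OF B ru(1)]) (use maya_cut(1)[OF k(1) ks] k(2) in auto)
    finally show "M_fin {r..u} (restrict a (Delta_int {r..u})) (res {r..u} k) = mm a s (k \<inter> {s..})" .
  qed
  have I0: "{s..t} \<in> intervals" unfolding intervals_iff using t by blast
  have all: "\<forall>I\<in>intervals. {s..t} \<subseteq> I \<longrightarrow>
      k \<in> maya_int I \<and> M_fin I (restrict a (Delta_int I)) (res I k) = mm a s (k \<inter> {s..})"
  proof (intro ballI impI)
    fix I assume I: "I \<in> intervals" "{s..t} \<subseteq> I"
    then obtain r u where ru: "r \<le> u" "I = {r..u}" by (auto simp: intervals_iff)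
    then have "r \<le> s" "t \<le> u" using I t by auto
    then show "k \<in> maya_int I \<and> M_fin I (restrict a (Delta_int I)) (res I k) = mm a s (k \<inter> {s..})"
      using val ru by blast
  qed
  show ?thesis
    unfolding M_Z_def
  proof (rule the_equality)
    show "\<exists>I\<^sub>0\<in>intervals. \<forall>I\<in>intervals. I\<^sub>0 \<subseteq> I \<longrightarrow>
        k \<in> maya_int I \<and> M_fin I (restrict a (Delta_int I)) (res I k) = mm a s (k \<inter> {s..})"
      using I0 all by blast
  next
    fix v assume "\<exists>I\<^sub>0\<in>intervals. \<forall>I\<in>intervals. I\<^sub>0 \<subseteq> I \<longrightarrow>
        k \<in> maya_int I \<and> M_fin I (restrict a (Delta_int I)) (res I k) = v"
    then obtain I\<^sub>1 where I1: "I\<^sub>1 \<in> intervals" "\<forall>I\<in>intervals. I\<^sub>1 \<subseteq> I \<longrightarrow>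
        k \<in> maya_int I \<and> M_fin I (restrict a (Delta_int I)) (res I k) = v" by blast
    obtain J where J: "J \<in> intervals" "{s..t} \<subseteq> J" "I\<^sub>1 \<subseteq> J" using intervals_directed[OF I0 I1(1)] .
    have "M_fin J (restrict a (Delta_int J)) (res J k) = v" using I1(2) J by blast
    moreover have "M_fin J (restrict a (Delta_int J)) (res J k) = mm a s (k \<inter> {s..})" using all J by blast
    ultimately show "v = mm a s (k \<inter> {s..})" by simp
  qed
qed

lemma Phi_Z_eq:
  assumes "vanishes_from B a" "k \<in> maya" "{..<s + B} \<subseteq> k"
  shows "Phi_Z a k = mm a s (k \<inter> {s..})"
  using M_Z_eq[OF assms] assms(2) by (simp add: Phi_Z_def)

lemma Phi_Z_prefix:
  assumes B: "vanishes_from B a" and r: "r \<le> s - B" and Y: "finite Y" "Y \<subseteq> {s..}"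
  shows "Phi_Z a ({..<s} \<union> Y) = mm a r ({r..<s} \<union> Y)"
proof -
  have "0 < B" using B by (simp add: vanishes_from_def)
  then have "({..<s} \<union> Y) \<inter> {r..} = {r..<s} \<union> Y" using r Y by force
  then show ?thesis using Phi_Z_eq[OF B maya_prefix[OF Y(1)], of r s] r by fastforce
qed

lemma mm_low:
  assumes B: "vanishes_from B a" and r: "r \<le> r'" and Y: "Y \<subseteq> {r' + B..}"
  shows "mm a r Y = mm a r' Y"
proof -
  have "0 < B" "\<And>i j. B \<le> j - i \<Longrightarrow> a (i, j) = 0" using B by (auto simp: vanishes_from_def)
  then have "(\<Sum>i\<in>{r..<j}. int (a (i, j))) = (\<Sum>i\<in>{r'..<j}. int (a (i, j)))" if "j \<in> Y" for j
    using r Y that by (intro sum.mono_neutral_right) force+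
  then show ?thesis by (simp add: mm_def)
qed

text \<open>Once the sea is far enough away, \<open>mm_decouple\<close> removes it, and the
  component depends neither on \<open>s\<close> nor on the lower bound \<open>r\<close> of the
  subtracted sums.\<close>

lemma Phi_Z_far:
  assumes B: "vanishes_from B a" and zl: "zeros_left a"
  obtains s0 where "s0 \<le> y0"
    "\<And>s r Y. s \<le> s0 \<Longrightarrow> r \<le> y0 - B \<Longrightarrow> finite Y \<Longrightarrow> Y \<subseteq> {y0..} \<Longrightarrow> Phi_Z a ({..<s} \<union> Y) = mm a r Y"
proof -
  obtain s0 where s0: "s0 \<le> y0"
    "\<And>r s Y. r \<le> s \<Longrightarrow> s \<le> s0 \<Longrightarrow> finite Y \<Longrightarrow> Y \<subseteq> {y0..} \<Longrightarrow> mm a r ({r..<s} \<union> Y) = mm a r Y"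
    by (rule mm_decouple[OF B zl, of y0]) (erule that, blast)
  show thesis
  proof (rule that[OF s0(1)])
    fix s r Y assume s: "s \<le> s0" and r: "r \<le> y0 - B" and Y: "finite Y" "Y \<subseteq> {y0..}"
    have B0: "0 < B" using B by (simp add: vanishes_from_def)
    have Ys: "Y \<subseteq> {s..}" using Y s s0(1) by auto
    have "Phi_Z a ({..<s} \<union> Y) = mm a (min r (s - B)) ({min r (s - B)..<s} \<union> Y)"
      by (rule Phi_Z_prefix[OF B _ Y(1) Ys]) simp
    also have "\<dots> = mm a (min r (s - B)) Y" by (rule s0(2)) (use s Y B0 in auto)
    also have "\<dots> = mm a r Y" by (rule mm_low[OF B]) (use r Y in auto)
    finally show "Phi_Z a ({..<s} \<union> Y) = mm a r Y" .
  qed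
qed

lemma mm_tail_const:
  assumes B: "vanishes_from B a" and k: "k \<subseteq> {..<m}" and n: "r + B \<le> n" "n \<le> m" and v: "m + B \<le> v" "v \<le> v'"
  shows "mm a r ({n..<v'} - k) = mm a r ({n..<v} - k)"
  using v(2)
proof (induction v' rule: int_ge_induct)
  case (step w)
  have B0: "0 < B" using B by (simp add: vanishes_from_def)
  have "{n..<w + 1} - k = insert w ({n..<w} - k)"
    using step.hyps v n k B0 by fastforce
  moreover have "mm a r (insert w ({n..<w} - k)) = mm a r ({n..<w} - k)"
  proof (rule mm_extend_right[OF B])
    have "x \<notin> k" if "m \<le> x" for x using k that by auto
    then show "{w - B..<w} \<subseteq> {n..<w} - k" using step.hyps v n by auto
    show "r \<le> w - B" using step.hyps v n B0 by simp
  qed auto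
  ultimately show ?case using step.IH by simp
qed simp

text \<open>For a large interval, \<open>Omega\<close> consists of a distant sea, the gaps of
  \<open>k\<close> and a long tail. The sea decouples on the left, and on the right the tail may be
  cut at \<open>m + B\<close>.\<close>

lemma Int_e_Phi_Z:
  assumes B: "vanishes_from B a" and zl: "zeros_left a" and k: "k \<in> maya" "{..<n} \<subseteq> k" "k \<subseteq> {..<m}"
    and r: "r + B \<le> n" and v: "m + B \<le> v"
  obtains I where "I \<in> Int_e (Phi_Z a) k" "Phi_Z a (Omega I k) = mm a r ({n..<v} - k)"
proof -
  have B0: "0 < B" using B by (simp add: vanishes_from_def)
  have nm: "n \<le> m" using k(2,3) by (meson lessThan_subset_iff order_trans)
  obtain s0 where s0: "s0 \<le> n"
    "\<And>s r Y. s \<le> s0 \<Longrightarrow> r \<le> n - B \<Longrightarrow> finite Y \<Longrightarrow> Y \<subseteq> {n..} \<Longrightarrow> Phi_Z a ({..<s} \<union> Y) = mm a r Y"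
    by (rule Phi_Z_far[OF B zl, of n]) (erule that, blast)
  define s1 where "s1 = min (n - 1) s0"
  define t1 where "t1 = m + B"
  have st1: "s1 \<le> t1" using nm B0 by (auto simp: s1_def t1_def)
  have I1: "{s1..t1} \<in> intervals" unfolding intervals_iff using st1 by blast
  have val: "Phi_Z a (Omega {s..t} k) = mm a r ({n..<v} - k)" if st: "s \<le> s1" "t1 \<le> t" for s t
  proof -
    have le: "s \<le> t" using st st1 by simp
    have "n \<le> x" if "x \<notin> k" for x using k(2) that by (meson lessThan_iff not_le subsetD)
    then have "Omega {s..t} k = {..<s} \<union> ({n..<t + 2} - k)"
      using le st by (auto simp: Omega_def tilde_interval s1_def)
    moreover have "Phi_Z a ({..<s} \<union> ({n..<t + 2} - k)) = mm a r ({n..<t + 2} - k)"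
      by (rule s0(2)) (use st r in \<open>auto simp: s1_def\<close>)
    ultimately have "Phi_Z a (Omega {s..t} k) = mm a r ({n..<t + 2} - k)" by simp
    also have "\<dots> = mm a r ({n..<m + B} - k)"
      by (rule mm_tail_const[OF B k(3) r nm]) (use st B0 in \<open>auto simp: t1_def\<close>)
    also have "\<dots> = mm a r ({n..<v} - k)"
      by (rule mm_tail_const[OF B k(3) r nm, symmetric]) (use v in auto)
    finally show ?thesis .
  qed
  have "n - 1 \<in> k" using k(2) by auto
  then have "k \<noteq> {..<s1}" by (auto simp: s1_def)
  moreover have "m \<notin> k" using k(3) by auto
  then have "k \<noteq> {..<t1 + 2}" using B0 by (auto simp: t1_def)
  moreover have "{..<s1} \<subseteq> k" "k \<subseteq> {..<t1 + 2}" using k(2,3) B0 by (auto simp: s1_def t1_def subset_iff)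
  ultimately have "k \<in> maya_int {s1..t1}" using st1 by (simp add: maya_int_iff)
  moreover have "Phi_Z a (Omega J k) = mm a r ({n..<v} - k)" if J: "J \<in> intervals" "{s1..t1} \<subseteq> J" for J
  proof -
    obtain s t where st: "s \<le> t" "J = {s..t}" using J by (auto simp: intervals_iff)
    then have "s \<le> s1" "t1 \<le> t" using J st1 by auto
    then show ?thesis using val st by simp
  qed
  ultimately have "{s1..t1} \<in> Int_e (Phi_Z a) k" unfolding Int_e_def using I1 val[of s1 t1] by auto
  then show thesis using that val[of s1 t1] by simp
qed

lemma maya_datum_Phi_Z:
  assumes B: "vanishes_from B a" and zl: "zeros_left a"
  shows "maya_datum (Phi_Z a)"
  unfolding maya_datum_def
proof (intro conjI allI ballI)
  have B0: "0 < B" using B by (simp add: vanishes_from_def)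
  show "Phi_Z a \<in> maya \<rightarrow>\<^sub>E UNIV" by (simp add: Phi_Z_def)
  fix s
  let ?r = "s - B"
  have eq: "Phi_Z a ({..<s} \<union> Y) = mm a ?r ({?r..<s} \<union> Y)" if "finite Y" "Y \<subseteq> {s..}" for Y
    by (rule Phi_Z_prefix[OF B _ that]) simp
  show "supermodular {s..} (\<lambda>Y. Phi_Z a ({..<s} \<union> Y))"
    unfolding supermodular_def
  proof (intro allI impI, elim conjE)
    fix k i j assume k: "finite k" "k \<subseteq> {s..}" "i \<in> {s..}" "j \<in> {s..}" "i \<noteq> j" "i \<notin> k" "j \<notin> k"
    have "mm a ?r (insert i ({?r..<s} \<union> k)) + mm a ?r (insert j ({?r..<s} \<union> k)) \<le>
        mm a ?r (insert i (insert j ({?r..<s} \<union> k))) + mm a ?r ({?r..<s} \<union> k)"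
      by (rule mm_supermodular) (use k in auto)
    then show "Phi_Z a ({..<s} \<union> insert i k) + Phi_Z a ({..<s} \<union> insert j k) \<le>
        Phi_Z a ({..<s} \<union> insert i (insert j k)) + Phi_Z a ({..<s} \<union> k)"
      using k by (subst (1 2 3 4) eq) auto
  qed
  show "plucker {s..} (\<lambda>Y. Phi_Z a ({..<s} \<union> Y))"
    unfolding plucker_def
  proof (intro allI impI, elim conjE)
    fix k h i j assume k: "finite k" "k \<subseteq> {s..}" "h \<in> {s..}" "i \<in> {s..}" "j \<in> {s..}" "h < i" "i < j"
      "h \<notin> k" "i \<notin> k" "j \<notin> k"
    let ?k = "{?r..<s} \<union> k"
    have "mm a ?r (insert h (insert j ?k)) + mm a ?r (insert i ?k) =
        min (mm a ?r (insert h (insert i ?k)) + mm a ?r (insert j ?k))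
            (mm a ?r (insert i (insert j ?k)) + mm a ?r (insert h ?k))"
      by (rule mm_plucker) (use k in auto)
    then show "Phi_Z a ({..<s} \<union> insert h (insert j k)) + Phi_Z a ({..<s} \<union> insert i k) =
      min (Phi_Z a ({..<s} \<union> insert h (insert i k)) + Phi_Z a ({..<s} \<union> insert j k))
          (Phi_Z a ({..<s} \<union> insert i (insert j k)) + Phi_Z a ({..<s} \<union> insert h k))"
      using k by (subst (1 2 3 4 5 6) eq) auto
  qed
  show "Phi_Z a {..<n} = 0" for n
  proof -
    have "Phi_Z a ({..<n} \<union> {}) = mm a (n - B) ({n - B..<n} \<union> {})"
      by (rule Phi_Z_prefix[OF B]) auto
    then show ?thesis using mm_interval[of "n - B" "n - B" a n] by simp
  qed
next
  fix k assume k: "k \<in> maya"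
  then obtain n m where "{..<n} \<subseteq> k" "k \<subseteq> {..<m}" by (auto simp: maya_iff)
  then show "Int_e (Phi_Z a) k \<noteq> {}"
    using Int_e_Phi_Z[OF B zl k, of n m "n - B" "m + B"] by auto
qed

lemma Theta_Phi_Z:
  assumes B: "vanishes_from B a" and zl: "zeros_left a" and k: "k \<in> maya" "{..<n} \<subseteq> k" "k \<subseteq> {..<m}"
    and "r + B \<le> n" "m + B \<le> v"
  shows "Theta (star_c (Phi_Z a)) k = mm a r ({n..<v} - k)"
  using Int_e_Phi_Z[OF assms] Theta_eq[OF k(1)] by metis

lemma Theta_Phi_Z_basic:
  assumes B: "vanishes_from B a" and zl: "zeros_left a" and r: "r + B \<le> p" and v: "p + 2 + B \<le> v"
  shows "Theta (star_c (Phi_Z a)) {..p} = mm a r {p + 1..<v}"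
    "Theta (star_c (Phi_Z a)) (swapped p) = mm a r (insert p {p + 2..<v})"
    "Theta (star_c (Phi_Z a)) {..p + 1} = mm a r {p + 2..<v}"
    "Theta (star_c (Phi_Z a)) {..p - 1} = mm a r {p..<v}"
proof -
  have B0: "0 < B" using B by (simp add: vanishes_from_def)
  have "{p..<v} - swapped p = insert p {p + 2..<v}" using v B0 by (auto simp: swapped_def)
  moreover have "{..<p} \<subseteq> swapped p" "swapped p \<subseteq> {..<p + 2}" by (auto simp: swapped_def)
  ultimately show "Theta (star_c (Phi_Z a)) (swapped p) = mm a r (insert p {p + 2..<v})"
    using Theta_Phi_Z[OF B zl maya_basic(2), of p p "p + 2" r v] r v by simp
  have "Theta (star_c (Phi_Z a)) {..q} = mm a r {q + 1..<v}" if "p - 1 \<le> q" "q \<le> p + 1" for q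
  proof -
    have "{q + 1..<v} - {..q} = {q + 1..<v}" by auto
    moreover have "{..<q + 1} \<subseteq> {..q}" "{..q} \<subseteq> {..<q + 1}" by auto
    ultimately show ?thesis
      using Theta_Phi_Z[OF B zl maya_basic(1), of "q + 1" q "q + 1" r v] r v that by simp
  qed
  from this[of p] this[of "p + 1"] this[of "p - 1"]
  show "Theta (star_c (Phi_Z a)) {..p} = mm a r {p + 1..<v}"
    "Theta (star_c (Phi_Z a)) {..p + 1} = mm a r {p + 2..<v}"
    "Theta (star_c (Phi_Z a)) {..p - 1} = mm a r {p..<v}"
    by (simp_all add: add.assoc)
qed

lemma r_coef_eq:
  assumes B: "vanishes_from B a" and r: "r + B \<le> p" and v: "p + 1 + B \<le> v"
  shows "r_coef p a = (\<Sum>j\<in>{p + 1..<v}. \<Sum>i\<in>{r..<p + 1}. int (a (i, j)))"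
proof -
  have van: "\<And>i j. B \<le> j - i \<Longrightarrow> a (i, j) = 0" using B by (auto simp: vanishes_from_def)
  have sub: "{(s, t). s \<le> p \<and> t \<ge> p + 1 \<and> a (s, t) \<noteq> 0} \<subseteq> {r..<p + 1} \<times> {p + 1..<v}"
  proof clarify
    fix x y assume xy: "x \<le> p" "p + 1 \<le> y" "0 < a (x, y)"
    then have "\<not> B \<le> y - x" using van[where i = x and j = y] by auto
    then show "x \<in> {r..<p + 1} \<and> y \<in> {p + 1..<v}" using xy r v by auto
  qed
  have "r_coef p a = (\<Sum>(s, t)\<in>{r..<p + 1} \<times> {p + 1..<v}. int (a (s, t)))"
    unfolding r_coef_def by (rule sum.mono_neutral_left) (use sub in auto)
  also have "\<dots> = (\<Sum>i\<in>{r..<p + 1}. \<Sum>j\<in>{p + 1..<v}. int (a (i, j)))"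
    by (simp add: sum.cartesian_product)
  finally show ?thesis by (subst sum.swap) simp
qed

lemma Theta_Phi_Z_r_coef:
  assumes B: "vanishes_from B a" and zl: "zeros_left a"
  shows "Theta (star_c (Phi_Z a)) {..p} = - r_coef p a"
  using Theta_Phi_Z_basic(1)[OF B zl, of "p - B" p "p + 2 + B"] r_coef_eq[OF B, of "p - B" p "p + 2 + B"]
    mm_interval[of "p - B" "p + 1" a "p + 2 + B"] B
  by (simp add: vanishes_from_def)

text \<open>For large \<open>v\<close>, \<open>gap_slope\<close> and \<open>gap_value_large\<close>
  evaluate the four components of \<open>Theta\<close>; \<open>A_star\<close> vanishes there and
  \<open>gap_const\<close> cancels in the combination.\<close>

lemma eps_Z_Phi_Z:
  assumes B: "vanishes_from B a" and zl: "zeros_left a"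
  shows "eps_Z p (star_c (Phi_Z a)) = eps_star p a"
proof -
  have B0: "0 < B" using B by (simp add: vanishes_from_def)
  define r where "r = p - B"
  define v where "v = p + 2 + B"
  have rv: "r + B \<le> p" "p + 2 + B \<le> v" "p + 2 + B \<le> v + 1" "r \<le> p" using B0 by (auto simp: r_def v_def)
  note th = Theta_Phi_Z_basic[OF B zl rv(1,2)] and th' = Theta_Phi_Z_basic[OF B zl rv(1,3)]
  have "mm a r {p..<v} + mm a r {p + 2..<v + 1} - mm a r {p + 1..<v} - mm a r {p + 1..<v + 1} =
      gap_const a p r - A_star p a (v - 1)"
    by (rule gap_slope[OF B rv(4)]) (use B0 in \<open>simp add: v_def\<close>)
  moreover have "A_star p a (v - 1) = 0" by (rule A_star_zero[OF B]) (use B0 in \<open>auto simp: v_def\<close>)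
  moreover have "mm a r (insert p {p + 2..<v}) - mm a r {p + 1..<v} = gap_const a p r - eps_star p a"
    by (rule gap_value_large[OF B rv(4)]) (use kf_star_bound[OF B, of p] in \<open>simp add: v_def\<close>)
  ultimately show ?thesis
    unfolding eps_Z_def swapped_def[symmetric] using th th' by linarith
qed

subsection \<open>Mutual inverse property of the star operators\<close>

text \<open>\<open>e_star\<close> without the test for 0: a total function that can be iterated and
  applied to several rows at once.\<close>

definition lower_star :: "int \<Rightarrow> lusztig \<Rightarrow> lusztig" where
  "lower_star p a = (\<lambda>x\<in>Delta.
     if x = (p, ke_star p a + 1) then a x - 1
     else if x = (p + 1, ke_star p a + 1) then a x + 1
     else a x)"

lemma e_star_eq: "e_star p a = (if eps_star p a = 0 then None else Some (lower_star p a))"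
  by (simp add: e_star_def lower_star_def)

lemma lower_star_entry:
  assumes B: "vanishes_from B a" and "0 < eps_star p a" "i < j"
  shows "int (lower_star p a (i, j)) = int (a (i, j)) -
    (if i = p \<and> j = ke_star p a + 1 then 1 else 0) + (if i = p + 1 \<and> j = ke_star p a + 1 then 1 else 0)"
  using assms(3) ke_entry_pos[OF B assms(2)] unfolding lower_star_def Delta_def by (auto simp: of_nat_diff)

lemma vanishes_from_lower_star:
  assumes B: "vanishes_from B a" and e: "0 < eps_star p a"
  shows "vanishes_from (B + 2) (lower_star p a)"
  unfolding vanishes_from_def
proof (intro conjI allI impI)
  have B0: "0 < B" using B by (simp add: vanishes_from_def)
  then show "0 < B + 2" by simp
  fix i j :: int assume ij: "B + 2 \<le> j - i"
  have "\<not> (i = p \<and> j = ke_star p a + 1)" "\<not> (i = p + 1 \<and> j = ke_star p a + 1)"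
    using ij ke_star(4)[OF B e] by auto
  then show "lower_star p a (i, j) = 0"
    using lower_star_entry[OF B e, of i j] ij vanish[OF B, of j i] B0 by (simp split: if_splits)
qed

text \<open>\<open>A_star p a k\<close> sees column \<open>m + 1\<close> of row \<open>p\<close> for
  \<open>k \<le> m\<close>, and of row \<open>p + 1\<close>, with opposite sign, for
  \<open>k < m\<close>. Hence the change is \<open>2 * c\<close>, \<open>c\<close> or 0 to the left
  of, at, or to the right of \<open>m\<close>.\<close>

lemma A_star_change:
  assumes B: "vanishes_from B a" and B': "vanishes_from B' b" and k: "p \<le> k"
    and eq: "\<And>i j. i < j \<Longrightarrow> int (b (i, j)) = int (a (i, j)) +
      (if i = p \<and> j = m + 1 then c else 0) - (if i = p + 1 \<and> j = m + 1 then c else 0)"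
  shows "A_star p b k = A_star p a k + (if k \<le> m then c else 0) + (if k < m then c else 0)"
proof -
  define t where "t = max (k + 1) (max (p + B) (max (p + B') (m + 2)))"
  have t: "k < t" "p + B \<le> t" "p + B' \<le> t" "m + 1 < t" by (auto simp: t_def)
  have "A_star p b k = (\<Sum>j\<in>{k + 1..<t}. (int (a (p, j)) - int (a (p + 1, j + 1))) +
      ((if j = m + 1 then c else 0) + (if j = m then c else 0)))"
    unfolding A_star_eq[OF B' k t(1,3)] using k by (intro sum.cong refl) (auto simp: eq)
  also have "\<dots> = A_star p a k + ((\<Sum>j\<in>{k + 1..<t}. if j = m + 1 then c else 0) + (\<Sum>j\<in>{k + 1..<t}. if j = m then c else 0))"
    unfolding A_star_eq[OF B k t(1,2)] by (simp add: sum.distrib)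
  finally show ?thesis using t by (simp add: sum.delta)
qed

lemma Delta_ext_eqI:
  assumes "a \<in> Delta \<rightarrow>\<^sub>E UNIV" "b \<in> Delta \<rightarrow>\<^sub>E UNIV" "\<And>i j. i < j \<Longrightarrow> a (i, j) = b (i, j)"
  shows "a = b"
  by (rule PiE_ext[OF assms(1,2)]) (auto simp: Delta_def assms(3))

lemma f_star_PiE: "f_star p a \<in> Delta \<rightarrow>\<^sub>E UNIV"
  and lower_star_PiE: "lower_star p a \<in> Delta \<rightarrow>\<^sub>E UNIV"
  by (simp_all add: f_star_def lower_star_def)

text \<open>Left of \<open>kf_star\<close> the values stay below the maximum and rise by 2, at
  \<open>kf_star\<close> the value rises by 1, and to the right nothing changes. So the first
  maximiser becomes the last one.\<close>

lemma f_star_signature: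
  assumes B: "vanishes_from B a"
  shows "eps_star p (f_star p a) = eps_star p a + 1" "ke_star p (f_star p a) = kf_star p a"
proof -
  note B' = vanishes_from_f_star[OF B, of p]
  let ?k = "kf_star p a"
  have ch: "A_star p (f_star p a) k = A_star p a k + (if k \<le> ?k then 1 else 0) + (if k < ?k then 1 else 0)"
    if "p \<le> k" for k
    by (rule A_star_change[OF B B' that]) (rule f_star_entry[OF B])
  show e: "eps_star p (f_star p a) = eps_star p a + 1"
  proof (rule eps_star_eqI[OF B' kf_star(1)[OF B]])
    show "A_star p (f_star p a) ?k = eps_star p a + 1"
      using ch[OF kf_star(1)[OF B]] kf_star(2)[OF B] by simp
    fix k assume k: "p \<le> k"
    show "A_star p (f_star p a) k \<le> eps_star p a + 1"
      using ch[OF k] kf_star(3)[OF B k] A_star_le_eps[OF B k] by auto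
  qed
  show "ke_star p (f_star p a) = ?k"
  proof (rule ke_star_eqI[OF B' _ kf_star(1)[OF B]])
    show "0 < eps_star p (f_star p a)" using e eps_star_nonneg[OF B, of p] by simp
    show "A_star p (f_star p a) ?k = eps_star p (f_star p a)"
      using ch[OF kf_star(1)[OF B]] kf_star(2)[OF B] e by simp
    fix k assume k: "?k < k"
    then have "p \<le> k" using kf_star(1)[OF B, of p] by simp
    then show "A_star p (f_star p a) k < eps_star p (f_star p a)"
      using ch[of k] A_star_le_eps[OF B, of p k] e k by simp
  qed
qed

lemma lower_f_star:
  assumes B: "vanishes_from B a" and a: "a \<in> Delta \<rightarrow>\<^sub>E UNIV"
  shows "lower_star p (f_star p a) = a"
proof (rule Delta_ext_eqI[OF lower_star_PiE a])
  fix i j :: int assume ij: "i < j"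
  have e: "0 < eps_star p (f_star p a)"
    using f_star_signature(1)[OF B] eps_star_nonneg[OF B, of p] by simp
  have "int (lower_star p (f_star p a) (i, j)) = int (a (i, j))"
    using lower_star_entry[OF vanishes_from_f_star[OF B] e ij] f_star_entry[OF B ij, of p]
      f_star_signature(2)[OF B, of p] by simp
  then show "lower_star p (f_star p a) (i, j) = a (i, j)" by simp
qed

lemma lower_star_signature:
  assumes B: "vanishes_from B a" and e: "0 < eps_star p a"
  shows "eps_star p (lower_star p a) = eps_star p a - 1" "kf_star p (lower_star p a) = ke_star p a"
proof -
  note B' = vanishes_from_lower_star[OF B e]
  note ke = ke_star[OF B e]
  let ?k = "ke_star p a"
  have ch: "A_star p (lower_star p a) k = A_star p a k + (if k \<le> ?k then - 1 else 0) + (if k < ?k then - 1 else 0)"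
    if "p \<le> k" for k
    by (rule A_star_change[OF B B' that]) (use lower_star_entry[OF B e] in simp)
  show e': "eps_star p (lower_star p a) = eps_star p a - 1"
  proof (rule eps_star_eqI[OF B' ke(1)])
    show "A_star p (lower_star p a) ?k = eps_star p a - 1" using ch[OF ke(1)] ke(2) by simp
    fix k assume k: "p \<le> k"
    show "A_star p (lower_star p a) k \<le> eps_star p a - 1"
      using ch[OF k] ke(3)[of k] A_star_le_eps[OF B k] by auto
  qed
  show "kf_star p (lower_star p a) = ?k"
  proof (rule kf_star_eqI[OF B' ke(1)])
    show "A_star p (lower_star p a) ?k = eps_star p (lower_star p a)" using ch[OF ke(1)] ke(2) e' by simp
    fix k assume k: "p \<le> k" "k < ?k"
    then show "A_star p (lower_star p a) k < eps_star p (lower_star p a)"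
      using ch[of k] A_star_le_eps[OF B k(1)] e' by simp
  qed
qed

lemma f_lower_star:
  assumes B: "vanishes_from B a" and a: "a \<in> Delta \<rightarrow>\<^sub>E UNIV" and e: "0 < eps_star p a"
  shows "f_star p (lower_star p a) = a"
proof (rule Delta_ext_eqI[OF f_star_PiE a])
  fix i j :: int assume ij: "i < j"
  have "int (f_star p (lower_star p a) (i, j)) = int (a (i, j))"
    using f_star_entry[OF vanishes_from_lower_star[OF B e] ij, of p] lower_star_entry[OF B e ij]
      lower_star_signature(2)[OF B e] by simp
  then show "f_star p (lower_star p a) (i, j) = a (i, j)" by simp
qed

subsection \<open>Operators on the family of a Lusztig datum\<close>

lemma zeros_left_cong_rows:
  assumes "zeros_left a" "\<And>i j. i < j \<Longrightarrow> i < q \<Longrightarrow> b (i, j) = a (i, j)"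
  shows "zeros_left b"
  unfolding zeros_left_def
proof (intro allI impI)
  fix d :: nat and x :: int assume "0 < d"
  then obtain c where "c < min x q" "a (c, c + int d) = 0" using assms(1) unfolding zeros_left_def by blast
  then show "\<exists>c<x. b (c, c + int d) = 0" using assms(2)[of c "c + int d"] \<open>0 < d\<close> by auto
qed

lemma f_star_other_row: "i < j \<Longrightarrow> i \<noteq> p \<Longrightarrow> i \<noteq> p + 1 \<Longrightarrow> f_star p a (i, j) = a (i, j)"
  and lower_star_other_row: "i < j \<Longrightarrow> i \<noteq> p \<Longrightarrow> i \<noteq> p + 1 \<Longrightarrow> lower_star p a (i, j) = a (i, j)"
  by (auto simp: f_star_def lower_star_def Delta_def)

lemma zeros_left_f_star: "zeros_left a \<Longrightarrow> zeros_left (f_star p a)"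
  by (erule zeros_left_cong_rows[where q = p]) (auto simp: f_star_other_row)

lemma zeros_left_lower_star: "zeros_left a \<Longrightarrow> zeros_left (lower_star p a)"
  by (erule zeros_left_cong_rows[where q = p]) (auto simp: lower_star_other_row)

lemma Phi_Z_f_star_untouched:
  assumes B: "vanishes_from B a" and k: "k \<in> maya" "p \<in> k \<or> p + 1 \<notin> k"
  shows "Phi_Z (f_star p a) k = Phi_Z a k"
proof -
  obtain n where n: "{..<n} \<subseteq> k" using k by (auto simp: maya_iff)
  define s where "s = min p (n - B - 2)"
  have "0 < B" using B by (simp add: vanishes_from_def)
  then have s: "s \<le> p" "{..<s + (B + 2)} \<subseteq> k" "{..<s + B} \<subseteq> k" "{..<s} \<subseteq> k"
    using n by (auto simp: s_def subset_iff)
  have "Phi_Z (f_star p a) k = mm (f_star p a) s (k \<inter> {s..})"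
    by (rule Phi_Z_eq[OF vanishes_from_f_star[OF B] k(1) s(2)])
  also have "\<dots> = mm a s (k \<inter> {s..})"
    by (rule mm_f_star_untouched[OF B s(1)]) (use maya_cut(1)[OF k(1) s(4)] k(2) s(1) in auto)
  also have "\<dots> = Phi_Z a k" by (rule Phi_Z_eq[OF B k(1) s(3), symmetric])
  finally show ?thesis .
qed

lemma Theta_f_star:
  assumes B: "vanishes_from B a" and zl: "zeros_left a"
  shows "Theta (star_c (Phi_Z (f_star p a))) {..p} = Theta (star_c (Phi_Z a)) {..p} - 1"
proof -
  have B0: "0 < B" using B by (simp add: vanishes_from_def)
  define r where "r = p - B - 2"
  define v where "v = p + 4 + B"
  have "Theta (star_c (Phi_Z (f_star p a))) {..p} = mm (f_star p a) r {p + 1..<v}"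
    by (rule Theta_Phi_Z_basic(1)[OF vanishes_from_f_star[OF B] zeros_left_f_star[OF zl]]) (auto simp: r_def v_def)
  also have "\<dots> = mm a r {p + 1..<v} - 1"
    using mm_interval_f_star[OF B, of r p "p + 1" v] kf_star_bound[OF B, of p] B0 by (simp add: r_def v_def)
  also have "mm a r {p + 1..<v} = Theta (star_c (Phi_Z a)) {..p}"
    by (rule Theta_Phi_Z_basic(1)[OF B zl, symmetric]) (auto simp: r_def v_def)
  finally show ?thesis .
qed

lemma f_Z_Phi_Z:
  assumes B: "vanishes_from B a" and zl: "zeros_left a"
  shows "f_Z p (star_c (Phi_Z a)) = star_c (Phi_Z (f_star p a))"
  by (rule f_Z_eqI[where c = "- 1"])
    (use maya_datum_Phi_Z[OF B zl] maya_datum_Phi_Z[OF vanishes_from_f_star[OF B] zeros_left_f_star[OF zl]]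
      Phi_Z_f_star_untouched[OF B] Theta_f_star[OF B zl] in auto)

lemma Phi_Z_lower_star_untouched:
  assumes B: "vanishes_from B a" and a: "a \<in> Delta \<rightarrow>\<^sub>E UNIV" and e: "0 < eps_star p a"
    and k: "k \<in> maya" "p \<in> k \<or> p + 1 \<notin> k"
  shows "Phi_Z (lower_star p a) k = Phi_Z a k"
  using Phi_Z_f_star_untouched[OF vanishes_from_lower_star[OF B e] k] f_lower_star[OF B a e] by simp

lemma e_Z_Phi_Z:
  assumes B: "vanishes_from B a" and a: "a \<in> Delta \<rightarrow>\<^sub>E UNIV" and zl: "zeros_left a" and e: "0 < eps_star p a"
  shows "e_Z p (star_c (Phi_Z a)) = Some (star_c (Phi_Z (lower_star p a)))"
proof (rule e_Z_eqI[where c = 1])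
  note B' = vanishes_from_lower_star[OF B e] and zl' = zeros_left_lower_star[OF zl, of p]
  show "maya_datum (Phi_Z a)" "maya_datum (Phi_Z (lower_star p a))"
    using maya_datum_Phi_Z[OF B zl] maya_datum_Phi_Z[OF B' zl'] .
  show "Phi_Z (lower_star p a) k = Phi_Z a k" if "k \<in> maya" "p \<in> k \<or> p + 1 \<notin> k" for k
    by (rule Phi_Z_lower_star_untouched[OF B a e that])
  show "Theta (star_c (Phi_Z (lower_star p a))) {..p} = Theta (star_c (Phi_Z a)) {..p} + 1"
    using Theta_f_star[OF B' zl', of p] f_lower_star[OF B a e] by simp
  show "0 < eps_Z p (star_c (Phi_Z a))" using e eps_Z_Phi_Z[OF B zl] by simp
qed simp

subsection \<open>Simultaneous application to separated rows\<close>

text \<open>All factors read the original datum, which gives meaning to an infinite product. For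
  indices no two of which are adjacent this agrees with successive application, see
  \<open>rows_insert\<close>.\<close>

definition rows :: "int set \<Rightarrow> (int \<Rightarrow> lusztig \<Rightarrow> lusztig) \<Rightarrow> lusztig \<Rightarrow> lusztig" where
  "rows Q f a = (\<lambda>(i, j)\<in>Delta.
     if i \<in> Q then f i a (i, j) else if i - 1 \<in> Q then f (i - 1) a (i, j) else a (i, j))"

definition same_rows :: "int \<Rightarrow> lusztig \<Rightarrow> lusztig \<Rightarrow> bool" where
  "same_rows q a b \<longleftrightarrow> (\<forall>i j. i < j \<and> (i = q \<or> i = q + 1) \<longrightarrow> a (i, j) = b (i, j))"

definition row_operator :: "(int \<Rightarrow> lusztig \<Rightarrow> lusztig) \<Rightarrow> bool" where
  "row_operator f \<longleftrightarrow> (\<forall>q a. f q a \<in> Delta \<rightarrow>\<^sub>E UNIV) \<and>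
     (\<forall>q a i j. i < j \<and> i \<noteq> q \<and> i \<noteq> q + 1 \<longrightarrow> f q a (i, j) = a (i, j)) \<and>
     (\<forall>q a b. same_rows q a b \<longrightarrow> same_rows q (f q a) (f q b))"

lemma A_star_cong:
  assumes "same_rows q a b" "q \<le> k"
  shows "A_star q a k = A_star q b k"
proof -
  have "a (q, t) = b (q, t)" "a (q + 1, t + 1) = b (q + 1, t + 1)" if "k + 1 \<le> t" for t
    using assms that by (auto simp: same_rows_def)
  then show ?thesis unfolding A_star_def Let_def by (intro sum.cong) auto
qed

lemma eps_star_cong: "same_rows q a b \<Longrightarrow> eps_star q a = eps_star q b"
  unfolding eps_star_def using A_star_cong[of q a b] by (metis (no_types, opaque_lifting))

lemma kf_star_cong: "same_rows q a b \<Longrightarrow> kf_star q a = kf_star q b"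
  unfolding kf_star_def using A_star_cong[of q a b] eps_star_cong[of q a b] by metis

lemma ke_star_cong: "same_rows q a b \<Longrightarrow> ke_star q a = ke_star q b"
  unfolding ke_star_def using A_star_cong[of q a b] eps_star_cong[of q a b] by metis

lemma row_operator_f_star: "row_operator f_star"
  unfolding row_operator_def
proof (intro conjI allI impI)
  show "f_star q a \<in> Delta \<rightarrow>\<^sub>E UNIV" for q a by (rule f_star_PiE)
  show "f_star q a (i, j) = a (i, j)" if "i < j \<and> i \<noteq> q \<and> i \<noteq> q + 1" for q a i j
    using that by (intro f_star_other_row) auto
  show "same_rows q (f_star q a) (f_star q b)" if "same_rows q a b" for q a b
    using that kf_star_cong[OF that] by (auto simp: same_rows_def f_star_def Delta_def)
qed

lemma row_operator_lower_star: "row_operator lower_star"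
  unfolding row_operator_def
proof (intro conjI allI impI)
  show "lower_star q a \<in> Delta \<rightarrow>\<^sub>E UNIV" for q a by (rule lower_star_PiE)
  show "lower_star q a (i, j) = a (i, j)" if "i < j \<and> i \<noteq> q \<and> i \<noteq> q + 1" for q a i j
    using that by (intro lower_star_other_row) auto
  show "same_rows q (lower_star q a) (lower_star q b)" if "same_rows q a b" for q a b
    using that ke_star_cong[OF that] by (auto simp: same_rows_def lower_star_def Delta_def)
qed

lemma rows_apply: "i < j \<Longrightarrow> rows Q f a (i, j) =
    (if i \<in> Q then f i a (i, j) else if i - 1 \<in> Q then f (i - 1) a (i, j) else a (i, j))"
  by (simp add: rows_def Delta_def)

lemma rows_PiE: "rows Q f a \<in> Delta \<rightarrow>\<^sub>E UNIV"
  by (simp add: rows_def)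

lemma rows_empty: "a \<in> Delta \<rightarrow>\<^sub>E UNIV \<Longrightarrow> rows {} f a = a"
  by (rule Delta_ext_eqI[OF rows_PiE]) (auto simp: rows_apply)

definition separated :: "int set \<Rightarrow> bool" where
  "separated Q \<longleftrightarrow> (\<forall>q\<in>Q. q + 1 \<notin> Q)"

lemma separated_subset: "separated Q \<Longrightarrow> R \<subseteq> Q \<Longrightarrow> separated R"
  unfolding separated_def by blast

lemma same_rows_rows_outside:
  assumes "separated (insert q Q)" "q \<notin> Q"
  shows "same_rows q (rows Q f a) a"
proof -
  have "q - 1 \<notin> Q" "q + 1 \<notin> Q" using assms by (force simp: separated_def)+
  then show ?thesis using assms(2) by (auto simp: same_rows_def rows_apply)
qed

lemma same_rows_rows_inside:
  assumes "separated Q" "q \<in> Q"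
  shows "same_rows q (rows Q f a) (f q a)"
  using assms by (auto simp: same_rows_def rows_apply separated_def)

lemma rows_insert:
  assumes f: "row_operator f" and Q: "separated (insert q Q)" "q \<notin> Q"
  shows "rows (insert q Q) f a = f q (rows Q f a)"
proof (rule Delta_ext_eqI[OF rows_PiE])
  show "f q (rows Q f a) \<in> Delta \<rightarrow>\<^sub>E UNIV" using f by (auto simp: row_operator_def)
  fix i j :: int assume ij: "i < j"
  have nb: "q - 1 \<notin> Q" "q + 1 \<notin> Q" using Q by (force simp: separated_def)+
  have "same_rows q (f q (rows Q f a)) (f q a)"
    using f same_rows_rows_outside[OF Q] by (auto simp: row_operator_def)
  then have 1: "f q (rows Q f a) (i, j) = f q a (i, j)" if "i = q \<or> i = q + 1"
    using that ij by (auto simp: same_rows_def)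
  have 2: "f q (rows Q f a) (i, j) = rows Q f a (i, j)" if "\<not> (i = q \<or> i = q + 1)"
    using f that ij by (auto simp: row_operator_def)
  show "rows (insert q Q) f a (i, j) = f q (rows Q f a) (i, j)"
  proof (cases "i = q \<or> i = q + 1")
    case True
    then show ?thesis using 1 ij nb by (auto simp: rows_apply)
  next
    case False
    then have "i - 1 \<noteq> q" by auto
    then show ?thesis using 2 False ij by (simp add: rows_apply)
  qed
qed

lemma rows_rows_inverse:
  assumes f: "row_operator f" and g: "row_operator g" and Q: "separated Q" and a: "a \<in> Delta \<rightarrow>\<^sub>E UNIV"
    and inv: "\<And>q. q \<in> Q \<Longrightarrow> g q (f q a) = a"
  shows "rows Q g (rows Q f a) = a"
proof (rule Delta_ext_eqI[OF rows_PiE a])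
  fix i j :: int assume ij: "i < j"
  have *: "g q (rows Q f a) (i, j) = a (i, j)" if "q \<in> Q" "i = q \<or> i = q + 1" for q
  proof -
    have "same_rows q (g q (rows Q f a)) (g q (f q a))"
      using g same_rows_rows_inside[OF Q that(1)] by (auto simp: row_operator_def)
    then show ?thesis using inv[OF that(1)] that(2) ij by (auto simp: same_rows_def)
  qed
  show "rows Q g (rows Q f a) (i, j) = a (i, j)"
    using *[of i] *[of "i - 1"] ij by (auto simp: rows_apply)
qed

context
  fixes C :: "int set" and f :: "int \<Rightarrow> lusztig \<Rightarrow> lusztig" and a :: lusztig and B :: int
  assumes C: "separated C" and f: "row_operator f" and a: "a \<in> Delta \<rightarrow>\<^sub>E UNIV"
    and van: "\<And>Q. Q \<subseteq> C \<Longrightarrow> vanishes_from B (rows Q f a)"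
begin

lemma separated_insert: "q \<in> C \<Longrightarrow> Q \<subseteq> C \<Longrightarrow> separated (insert q Q)"
  by (rule separated_subset[OF C]) auto

lemma Phi_Z_rows_touched:
  assumes untouched: "\<And>Q q k. finite Q \<Longrightarrow> Q \<subseteq> C \<Longrightarrow> q \<in> C \<Longrightarrow> q \<notin> Q \<Longrightarrow> k \<in> maya \<Longrightarrow> q \<in> k \<or> q + 1 \<notin> k \<Longrightarrow>
      Phi_Z (f q (rows Q f a)) k = Phi_Z (rows Q f a) k"
    and k: "k \<in> maya" and L: "L = {q \<in> C. q \<notin> k \<and> q + 1 \<in> k}" "finite L"
  shows "Phi_Z (rows C f a) k = Phi_Z (rows L f a) k"
proof -
  obtain n m where nm: "{..<n} \<subseteq> k" "k \<subseteq> {..<m}" using k by (auto simp: maya_iff)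
  define s where "s = n - B"
  \<comment> \<open>The window starts at \<open>s - 1\<close> because row \<open>s\<close> may be
    changed by the factor with index \<open>s - 1\<close>.\<close>
  define W where "W = {s - 1..<m} \<union> L"
  have B0: "0 < B" using van[of "{}"] by (auto simp: vanishes_from_def)
  have s: "{..<s + B} \<subseteq> k" "{..<s} \<subseteq> k" using nm(1) B0 by (auto simp: s_def subset_iff)
  have "Phi_Z (rows C f a) k = mm (rows C f a) s (k \<inter> {s..})"
    by (rule Phi_Z_eq[OF van k s(1)]) simp
  also have "\<dots> = mm (rows (C \<inter> W) f a) s (k \<inter> {s..})"
    by (rule mm_cong[OF maya_cut(1)[OF k s(2)], of _ m]) (use nm(2) in \<open>auto simp: rows_apply W_def\<close>)
  also have "\<dots> = Phi_Z (rows (C \<inter> W) f a) k"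
    by (rule Phi_Z_eq[OF van k s(1), symmetric]) simp
  finally have win: "Phi_Z (rows C f a) k = Phi_Z (rows (C \<inter> W) f a) k" .
  have "Phi_Z (rows (L \<union> R) f a) k = Phi_Z (rows L f a) k" if "finite R" "R \<subseteq> C - L" for R
    using that
  proof (induction R rule: finite_induct)
    case (insert q R)
    have q: "q \<in> C" "q \<notin> L \<union> R" "L \<union> R \<subseteq> C" using insert L(1) by auto
    have "rows (L \<union> insert q R) f a = f q (rows (L \<union> R) f a)"
      using rows_insert[OF f separated_insert[OF q(1,3)] q(2)] by simp
    moreover have "q \<in> k \<or> q + 1 \<notin> k" using q L(1) by blast
    ultimately show ?case
      using untouched[OF _ q(3,1,2) k] insert L(2) by simp
  qed simp
  from this[of "C \<inter> W - L"] have "Phi_Z (rows (L \<union> (C \<inter> W - L)) f a) k = Phi_Z (rows L f a) k"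
    using L(2) by (auto simp: W_def)
  moreover have "L \<union> (C \<inter> W - L) = C \<inter> W" using L(1) by (auto simp: W_def)
  ultimately show ?thesis using win by simp
qed

end

subsection \<open>Periodic Lusztig data\<close>

definition residue_class :: "int \<Rightarrow> int \<Rightarrow> int set" where
  "residue_class l p = {q. [q = p] (mod l)}"

lemma vanishes_from_rows:
  assumes "\<And>q. q \<in> Q \<Longrightarrow> vanishes_from B' (f q a)" "vanishes_from B' a"
  shows "vanishes_from B' (rows Q f a)"
proof -
  have "0 < B'" using assms(2) by (simp add: vanishes_from_def)
  then have "rows Q f a (i, j) = 0" if "B' \<le> j - i" for i j
    using assms that by (auto simp: rows_apply vanishes_from_def)
  then show ?thesis using \<open>0 < B'\<close> by (simp add: vanishes_from_def)
qed

context
  fixes l :: int and a :: lusztig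
  assumes l: "2 \<le> l" and a_aff: "a \<in> LusAff l"
begin

lemma aff_PiE: "a \<in> Delta \<rightarrow>\<^sub>E UNIV"
  and aff_vanishes: "\<exists>B. vanishes_from B a"
  using a_aff by (auto simp: LusAff_def LusZ_iff)

lemma aff_shift: "i < j \<Longrightarrow> a (i + l, j + l) = a (i, j)"
proof -
  assume ij: "i < j"
  have "\<forall>(i, j)\<in>Delta. a (i, j) = a (i + l, j + l)" using a_aff unfolding LusAff_def by blast
  from bspec[OF this, of "(i, j)"] have "a (i, j) = a (i + l, j + l)"
    using ij by (simp only: Delta_def mem_Collect_eq prod.case)
  then show ?thesis by (rule sym)
qed

lemma A_star_shift:
  assumes "q \<le> k"
  shows "A_star (q + l) a (k + l) = A_star q a k"
proof -
  have up: "a (q + l, t + l) = a (q, t)" "a (q + l + 1, t + l + 1) = a (q + 1, t + 1)" if "k + 1 \<le> t" for t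
    using aff_shift[of q t] aff_shift[of "q + 1" "t + 1"] assms that by (auto simp: algebra_simps)
  have down: "a (q + l, t) = a (q, t - l)" "a (q + l + 1, t + 1) = a (q + 1, t - l + 1)" if "k + l + 1 \<le> t" for t
    using up[of "t - l"] that by simp_all
  show ?thesis
    unfolding A_star_def Let_def
    by (rule sum.reindex_bij_witness[of _ "\<lambda>t. t + l" "\<lambda>t. t - l"]) (auto simp: up down)
qed

lemma eps_star_shift: "eps_star (q + l) a = eps_star q a"
proof -
  have "{A_star (q + l) a k |k. k \<ge> q + l} = {A_star q a k |k. k \<ge> q}"
  proof (intro equalityI subsetI)
    fix y assume "y \<in> {A_star (q + l) a k |k. k \<ge> q + l}"
    then obtain k where "y = A_star (q + l) a k" "q \<le> k - l" by auto
    then have "y = A_star q a (k - l)" using A_star_shift[of q "k - l"] by simp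
    then show "y \<in> {A_star q a k |k. k \<ge> q}" using \<open>q \<le> k - l\<close> by blast
  next
    fix y assume "y \<in> {A_star q a k |k. k \<ge> q}"
    then obtain k where "y = A_star (q + l) a (k + l)" "q + l \<le> k + l" using A_star_shift by auto
    then show "y \<in> {A_star (q + l) a k |k. k \<ge> q + l}" by blast
  qed
  then show ?thesis by (simp add: eps_star_def)
qed

lemma eps_star_cong_mod:
  assumes "[p = q] (mod l)"
  shows "eps_star p a = eps_star q a"
proof -
  have nat_shift: "eps_star (q + int n * l) a = eps_star q a" for n q
  proof (induction n)
    case (Suc n)
    have "q + int (Suc n) * l = (q + int n * l) + l" by (simp add: algebra_simps)
    then show ?case by (simp only: Suc eps_star_shift)
  qed simp
  obtain m where m: "p = q + l * m" using assms by (metis cong_iff_lin cong_sym)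
  show ?thesis
  proof (cases "0 \<le> m")
    case True
    then show ?thesis using nat_shift[of q "nat m"] m by (simp add: mult.commute)
  next
    case False
    then have "q = p + int (nat (- m)) * l" using m by (simp add: algebra_simps)
    then show ?thesis using nat_shift[of p "nat (- m)"] by simp
  qed
qed

lemma kf_star_shift: "kf_star (q + l) a = kf_star q a + l"
proof -
  obtain B where B: "vanishes_from B a" using aff_vanishes by blast
  show ?thesis
  proof (rule kf_star_eqI[OF B])
    show "q + l \<le> kf_star q a + l" using kf_star(1)[OF B, of q] by simp
    show "A_star (q + l) a (kf_star q a + l) = eps_star (q + l) a"
      using kf_star(1,2)[OF B, of q] A_star_shift eps_star_shift by simp
    fix j assume "q + l \<le> j" "j < kf_star q a + l"
    then show "A_star (q + l) a j < eps_star (q + l) a"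
      using kf_star(3)[OF B, of q "j - l"] A_star_shift[of q "j - l"] eps_star_shift by simp
  qed
qed

lemma ke_star_shift:
  assumes e: "0 < eps_star q a"
  shows "ke_star (q + l) a = ke_star q a + l"
proof -
  obtain B where B: "vanishes_from B a" using aff_vanishes by blast
  note ke = ke_star[OF B e]
  show ?thesis
  proof (rule ke_star_eqI[OF B])
    show "0 < eps_star (q + l) a" using e eps_star_shift by simp
    show "q + l \<le> ke_star q a + l" using ke(1) by simp
    show "A_star (q + l) a (ke_star q a + l) = eps_star (q + l) a"
      using ke(1,2) A_star_shift eps_star_shift by simp
    fix j assume j: "ke_star q a + l < j"
    then show "A_star (q + l) a j < eps_star (q + l) a"
      using ke(1) ke(3)[of "j - l"] A_star_shift[of q "j - l"] eps_star_shift by simp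
  qed
qed

lemma f_star_shift: "i < j \<Longrightarrow> f_star (q + l) a (i + l, j + l) = f_star q a (i, j)"
  using aff_shift[of i j] kf_star_shift[of q] by (auto simp: f_star_def Delta_def)

lemma lower_star_shift:
  "0 < eps_star q a \<Longrightarrow> i < j \<Longrightarrow> lower_star (q + l) a (i + l, j + l) = lower_star q a (i, j)"
  using aff_shift[of i j] ke_star_shift[of q] by (auto simp: lower_star_def Delta_def)

lemma residue_class_shift: "q + l \<in> residue_class l p \<longleftrightarrow> q \<in> residue_class l p"
  by (simp add: residue_class_def cong_def)

lemma separated_residue_class: "separated (residue_class l p)"
proof -
  have False if "[q = p] (mod l)" "[q + 1 = p] (mod l)" for q
  proof -
    have "[q + 1 = q] (mod l)" using that cong_sym cong_trans by blast
    then have "l dvd 1" by (simp add: cong_iff_dvd_diff)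
    then show False using l by simp
  qed
  then show ?thesis by (auto simp: separated_def residue_class_def)
qed

lemma fhat_star_eq: "fhat_star l p a = rows (residue_class l p) f_star a"
  unfolding fhat_star_def rows_def residue_class_def mem_Collect_eq ..

lemma ehat_star_eq: "ehat_star l p a =
    (if eps_star p a = 0 then None else Some (rows (residue_class l p) lower_star a))"
proof (cases "eps_star p a = 0")
  case False
  then have "e_star q a = Some (lower_star q a)" if "[q = p] (mod l)" for q
    using eps_star_cong_mod[OF that] by (simp add: e_star_eq)
  then show ?thesis
    unfolding ehat_star_def rows_def residue_class_def mem_Collect_eq using False by (auto intro!: restrict_ext)
qed (simp add: ehat_star_def)

lemma rows_class_aff:
  assumes f: "\<And>q i j. q \<in> residue_class l p \<Longrightarrow> i < j \<Longrightarrow> f (q + l) a (i + l, j + l) = f q a (i, j)"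
    and van: "vanishes_from B' (rows (residue_class l p) f a)"
  shows "rows (residue_class l p) f a \<in> LusAff l"
proof -
  have "rows (residue_class l p) f a (i + l, j + l) = rows (residue_class l p) f a (i, j)" if ij: "i < j" for i j
  proof -
    have "i + l - 1 = (i - 1) + l" by simp
    then have m: "i + l - 1 \<in> residue_class l p \<longleftrightarrow> i - 1 \<in> residue_class l p"
      using residue_class_shift by metis
    have "i - 1 \<in> residue_class l p \<Longrightarrow> f (i + l - 1) a (i + l, j + l) = f (i - 1) a (i, j)"
      using f[of "i - 1" i j] ij by (simp add: algebra_simps)
    then show ?thesis using ij m residue_class_shift[of i p] f[of i i j] aff_shift[OF ij] by (simp add: rows_apply)
  qed
  then show ?thesis using van rows_PiE by (auto simp: LusAff_def LusZ_iff Delta_def)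
qed

lemma fhat_star_aff: "fhat_star l p a \<in> LusAff l"
proof -
  obtain B where B: "vanishes_from B a" using aff_vanishes by blast
  have "vanishes_from (B + 2) (rows (residue_class l p) f_star a)"
    by (rule vanishes_from_rows) (use vanishes_from_f_star[OF B] vanishes_from_mono[OF B] in auto)
  then show ?thesis unfolding fhat_star_eq using f_star_shift by (intro rows_class_aff) auto
qed

lemma ehat_star_aff:
  assumes "ehat_star l p a = Some b"
  shows "b \<in> LusAff l"
proof -
  obtain B where B: "vanishes_from B a" using aff_vanishes by blast
  have e: "0 < eps_star p a" and b: "b = rows (residue_class l p) lower_star a"
    using assms eps_star_nonneg[OF B, of p] by (auto simp: ehat_star_eq split: if_splits)
  have eq: "0 < eps_star q a" if "q \<in> residue_class l p" for q
    using eps_star_cong_mod[of q p] that e by (simp add: residue_class_def)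
  have "vanishes_from (B + 2) (rows (residue_class l p) lower_star a)"
    by (rule vanishes_from_rows) (use vanishes_from_lower_star[OF B eq] vanishes_from_mono[OF B] in auto)
  then show ?thesis unfolding b using lower_star_shift eq by (intro rows_class_aff) auto
qed

lemma eps_star_fhat: "eps_star p (fhat_star l p a) = eps_star p a + 1"
proof -
  obtain B where B: "vanishes_from B a" using aff_vanishes by blast
  have "same_rows p (rows (residue_class l p) f_star a) (f_star p a)"
    by (rule same_rows_rows_inside[OF separated_residue_class]) (simp add: residue_class_def)
  then show ?thesis unfolding fhat_star_eq using eps_star_cong f_star_signature(1)[OF B] by metis
qed

lemma eps_star_ehat:
  assumes "ehat_star l p a = Some b"
  shows "eps_star p b = eps_star p a - 1"
proof -
  obtain B where B: "vanishes_from B a" using aff_vanishes by blast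
  have e: "0 < eps_star p a" and b: "b = rows (residue_class l p) lower_star a"
    using assms eps_star_nonneg[OF B, of p] by (auto simp: ehat_star_eq split: if_splits)
  have "same_rows p (rows (residue_class l p) lower_star a) (lower_star p a)"
    by (rule same_rows_rows_inside[OF separated_residue_class]) (simp add: residue_class_def)
  then show ?thesis unfolding b using eps_star_cong lower_star_signature(1)[OF B e] by metis
qed

end

lemma ehat_fhat_star:
  assumes l: "2 \<le> l" and a: "a \<in> LusAff l"
  shows "ehat_star l p (fhat_star l p a) = Some a"
proof -
  obtain B where B: "vanishes_from B a" using aff_vanishes[OF l a] by blast
  have "eps_star p (fhat_star l p a) \<noteq> 0"
    using eps_star_fhat[OF l a, of p] eps_star_nonneg[OF B, of p] by simp
  moreover have "rows (residue_class l p) lower_star (rows (residue_class l p) f_star a) = a"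
    by (rule rows_rows_inverse[OF row_operator_f_star row_operator_lower_star separated_residue_class[OF l a] aff_PiE[OF l a]])
      (rule lower_f_star[OF B aff_PiE[OF l a]])
  ultimately show ?thesis
    using ehat_star_eq[OF l fhat_star_aff[OF l a]] fhat_star_eq[OF l a] by simp
qed

lemma fhat_ehat_star:
  assumes l: "2 \<le> l" and a: "a \<in> LusAff l" and b: "ehat_star l p a = Some b"
  shows "fhat_star l p b = a"
proof -
  obtain B where B: "vanishes_from B a" using aff_vanishes[OF l a] by blast
  have e: "0 < eps_star p a" and b': "b = rows (residue_class l p) lower_star a"
    using b eps_star_nonneg[OF B, of p] by (auto simp: ehat_star_eq[OF l a] split: if_splits)
  have eq: "0 < eps_star q a" if "q \<in> residue_class l p" for q
    using eps_star_cong_mod[OF l a, of q p] that e by (simp add: residue_class_def)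
  have "rows (residue_class l p) f_star (rows (residue_class l p) lower_star a) = a"
    by (rule rows_rows_inverse[OF row_operator_lower_star row_operator_f_star separated_residue_class[OF l a] aff_PiE[OF l a]])
      (rule f_lower_star[OF B aff_PiE[OF l a] eq])
  then show ?thesis using fhat_star_eq[OF l ehat_star_aff[OF l a b]] b' by simp
qed

subsection \<open>Aperiodic data\<close>

lemma LusAp_D: "a \<in> LusAp l \<Longrightarrow> a \<in> LusAff l"
  by (simp add: LusAp_def)

lemma LusAp_zeros_left:
  assumes "a \<in> LusAp l"
  shows "zeros_left a"
  unfolding zeros_left_def
proof (intro allI impI)
  fix d :: nat and x :: int assume d: "0 < d"
  have "\<forall>(i, j)\<in>Delta. \<exists>s\<in>{0..<l}. a (i + s, j + s) = 0" using assms unfolding LusAp_def by blast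
  from bspec[OF this, of "(x - l, x - l + int d)"]
  obtain s where "s \<in> {0..<l}" "a (x - l + s, x - l + int d + s) = 0"
    using d by (auto simp: Delta_def)
  moreover have "x - l + int d + s = (x - l + s) + int d" by simp
  ultimately show "\<exists>c<x. a (c, c + int d) = 0" by (intro exI[of _ "x - l + s"]) simp
qed

lemma aff_shift_mult:
  assumes l: "2 \<le> l" and a: "a \<in> LusAff l" and ij: "i < j"
  shows "a (i + l * m, j + l * m) = a (i, j)"
proof -
  have nat_shift: "a (i + int n * l, j + int n * l) = a (i, j)" if "i < j" for n i j
  proof (induction n)
    case (Suc n)
    have "i + int (Suc n) * l = (i + int n * l) + l" "j + int (Suc n) * l = (j + int n * l) + l"
      by (simp_all add: algebra_simps)
    then show ?case using Suc aff_shift[OF l a, of "i + int n * l" "j + int n * l"] that by (simp only:)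
  qed simp
  show ?thesis
  proof (cases "0 \<le> m")
    case True
    then show ?thesis using nat_shift[OF ij, of "nat m"] by (simp add: mult.commute)
  next
    case False
    then show ?thesis using nat_shift[of "i + l * m" "j + l * m" "nat (- m)"] ij by (simp add: algebra_simps)
  qed
qed

text \<open>By periodicity a zero anywhere on a diagonal has a translate within every
  period.\<close>

lemma LusAp_iff:
  assumes l: "2 \<le> l" and a: "a \<in> LusAff l"
  shows "a \<in> LusAp l \<longleftrightarrow> (\<forall>d>0. \<exists>i. a (i, i + int d) = 0)"
proof
  assume ap: "a \<in> LusAp l"
  show "\<forall>d>0. \<exists>i. a (i, i + int d) = 0"
    using LusAp_zeros_left[OF ap] unfolding zeros_left_def by blast
next
  assume z: "\<forall>d>0. \<exists>i. a (i, i + int d) = 0"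
  have "\<exists>s\<in>{0..<l}. a (i + s, j + s) = 0" if ij: "i < j" for i j
  proof -
    obtain i0 where i0: "a (i0, i0 + int (nat (j - i))) = 0" using z ij by (metis zero_less_nat_eq diff_gt_0_iff_gt)
    define s where "s = (i0 - i) mod l"
    define m where "m = (i0 - i) div l"
    have e: "i0 = i + s + l * m" unfolding s_def m_def by simp
    have "a (i + s + l * m, j + s + l * m) = a (i + s, j + s)"
      by (rule aff_shift_mult[OF l a]) (use ij in simp)
    moreover have "j + s + l * m = i0 + int (nat (j - i))" using e ij by simp
    then have "a (i + s + l * m, j + s + l * m) = 0" using i0 by (simp only: e[symmetric])
    ultimately have "a (i + s, j + s) = 0" by simp
    moreover have "s \<in> {0..<l}" using l by (simp add: s_def)
    ultimately show ?thesis by blast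
  qed
  then have "\<forall>(i, j)\<in>Delta. \<exists>s\<in>{0..<l}. a (i + s, j + s) = 0" by (auto simp: Delta_def)
  then show "a \<in> LusAp l" unfolding LusAp_def using a by blast
qed

text \<open>If the last zero on a diagonal is filled by an operator, then the extremality of \<open>kf_star\<close>
  (\<open>ke_star\<close>) provides another zero in the adjacent row.\<close>

lemma fhat_star_Ap:
  assumes l: "2 \<le> l" and ap: "a \<in> LusAp l"
  shows "fhat_star l p a \<in> LusAp l"
proof -
  note a = LusAp_D[OF ap]
  obtain B where B: "vanishes_from B a" using aff_vanishes[OF l a] by blast
  let ?C = "residue_class l p" and ?b = "fhat_star l p a"
  note sep = separated_residue_class[OF l a, of p]
  have b: "?b (i, j) = (if i \<in> ?C then f_star i a (i, j) else if i - 1 \<in> ?C then f_star (i - 1) a (i, j) else a (i, j))"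
    if "i < j" for i j unfolding fhat_star_eq[OF l a] by (rule rows_apply[OF that])
  have "\<exists>i. ?b (i, i + int d) = 0" if d: "0 < d" for d
  proof -
    obtain i where i: "a (i, i + int d) = 0" using ap d LusAp_iff[OF l a] by blast
    have lt: "i < i + int d" "i + 1 < i + 1 + int d" using d by auto
    have le: "int (f_star (i - 1) a (i, i + int d)) \<le> int (a (i, i + int d))"
      using f_star_entry[OF B lt(1), of "i - 1"] by simp
    show ?thesis
    proof (cases "i \<in> ?C \<and> i + int d = kf_star i a + 1")
      case False
      have "i \<in> ?C \<Longrightarrow> int (f_star i a (i, i + int d)) = 0"
        using f_star_entry[OF B lt(1), of i] i False by simp
      then have "?b (i, i + int d) = 0" using b[OF lt(1)] le i by auto
      then show ?thesis by blast
    next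
      case True
      have "a (i + 1, i + 1 + int d) = 0"
        using kf_entry_le[OF B, of i] True i by (simp add: algebra_simps)
      moreover have "int (f_star i a (i + 1, i + 1 + int d)) \<le> int (a (i + 1, i + 1 + int d))"
        using f_star_entry[OF B lt(2), of i] by simp
      moreover have "i + 1 \<notin> ?C" using sep True by (auto simp: separated_def)
      ultimately have "?b (i + 1, i + 1 + int d) = 0" using b[OF lt(2)] True by auto
      then show ?thesis by blast
    qed
  qed
  then show ?thesis using LusAp_iff[OF l fhat_star_aff[OF l a]] by blast
qed

lemma ehat_star_Ap:
  assumes l: "2 \<le> l" and ap: "a \<in> LusAp l" and eb: "ehat_star l p a = Some b"
  shows "b \<in> LusAp l"
proof -
  note a = LusAp_D[OF ap]
  obtain B where B: "vanishes_from B a" using aff_vanishes[OF l a] by blast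
  let ?C = "residue_class l p"
  note sep = separated_residue_class[OF l a, of p]
  have ep: "0 < eps_star p a" and b': "b = rows ?C lower_star a"
    using eb eps_star_nonneg[OF B, of p] by (auto simp: ehat_star_eq[OF l a] split: if_splits)
  have e: "0 < eps_star q a" if "q \<in> ?C" for q
    using eps_star_cong_mod[OF l a, of q p] that ep by (simp add: residue_class_def)
  have b: "b (i, j) = (if i \<in> ?C then lower_star i a (i, j) else if i - 1 \<in> ?C then lower_star (i - 1) a (i, j) else a (i, j))"
    if "i < j" for i j unfolding b' by (rule rows_apply[OF that])
  have "\<exists>i. b (i, i + int d) = 0" if d: "0 < d" for d
  proof -
    obtain i where i: "a (i, i + int d) = 0" using ap d LusAp_iff[OF l a] by blast
    have lt: "i < i + int d" "i - 1 < i - 1 + int d" using d by auto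
    have low: "int (lower_star q a (q, q + int d)) \<le> int (a (q, q + int d))" if "q \<in> ?C" for q
      using lower_star_entry[OF B e[OF that], of q "q + int d"] d by simp
    show ?thesis
    proof (cases "i - 1 \<in> ?C \<and> i + int d = ke_star (i - 1) a + 1")
      case False
      have "i - 1 \<in> ?C \<Longrightarrow> int (lower_star (i - 1) a (i, i + int d)) = 0"
        using lower_star_entry[OF B e lt(1), of "i - 1"] i False by simp
      then have "b (i, i + int d) = 0" using b[OF lt(1)] low[of i] i by auto
      then show ?thesis by blast
    next
      case True
      then have C: "i - 1 \<in> ?C" and k: "ke_star (i - 1) a = i - 1 + int d" by auto
      have "a (i - 1, i - 1 + int d) \<le> a (i, i + int d)"
        using ke_entry_le[OF B e[OF C]] k d by (simp add: algebra_simps)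
      then have "b (i - 1, i - 1 + int d) = 0"
        using b[OF lt(2)] low[OF C] C i by simp
      then show ?thesis by blast
    qed
  qed
  then show ?thesis using LusAp_iff[OF l ehat_star_aff[OF l a eb]] by blast
qed

subsection \<open>Weights\<close>

lemma r_coef_mm:
  assumes B: "vanishes_from B a" and r: "r + B \<le> p" and v: "p + 1 + B \<le> v"
  shows "r_coef p a = - mm a r {p + 1..<v}"
  using r_coef_eq[OF assms] mm_interval[of r "p + 1" a v] r B by (simp add: vanishes_from_def)

lemma r_coef_f_star:
  assumes B: "vanishes_from B a"
  shows "r_coef q (f_star p a) = r_coef q a + (if q = p then 1 else 0)"
proof -
  have B0: "0 < B" using B by (simp add: vanishes_from_def)
  define r where "r = min p (q - B - 2)"
  define v where "v = max (q + B + 3) (p + B + 3)"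
  have "r_coef q (f_star p a) = - mm (f_star p a) r {q + 1..<v}"
    by (rule r_coef_mm[OF vanishes_from_f_star[OF B]]) (auto simp: r_def v_def)
  also have "mm (f_star p a) r {q + 1..<v} = mm a r {q + 1..<v} - (if q = p then 1 else 0)"
    using mm_interval_f_star[OF B, of r p "q + 1" v] kf_star_bound[OF B, of p] B0 by (simp add: r_def v_def)
  also have "mm a r {q + 1..<v} = - r_coef q a"
    using r_coef_mm[OF B, of r q v] by (simp add: r_def v_def)
  finally show ?thesis by simp
qed

lemma r_coef_fhat_star:
  assumes l: "2 \<le> l" and a: "a \<in> LusAff l"
  shows "r_coef q (fhat_star l p a) = r_coef q a + (if [q = p] (mod l) then 1 else 0)"
proof -
  obtain B where B: "vanishes_from B a" using aff_vanishes[OF l a] by blast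
  \<comment> \<open>\<open>?W\<close> contains the indices of all factors that can change a row in
    \<open>{q - B - 2..<q + 1}\<close>, the rows that enter \<open>r_coef q\<close>.\<close>
  let ?C = "residue_class l p" and ?W = "{q - B - 3..q}"
  note sep = separated_residue_class[OF l a, of p]
  have van: "vanishes_from (B + 2) (rows Q f_star a)" for Q
    by (rule vanishes_from_rows) (use vanishes_from_f_star[OF B] vanishes_from_mono[OF B] in auto)
  have fin: "r_coef q (rows Q f_star a) = r_coef q a + (if q \<in> Q then 1 else 0)" if "finite Q" "Q \<subseteq> ?C" for Q
    using that
  proof (induction Q rule: finite_induct)
    case empty
    then show ?case by (simp add: rows_empty[OF aff_PiE[OF l a]])
  next
    case (insert x Q)
    have "separated (insert x Q)" using separated_subset[OF sep] insert.prems by blast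
    then have "rows (insert x Q) f_star a = f_star x (rows Q f_star a)"
      using rows_insert[OF row_operator_f_star] insert.hyps by blast
    then show ?case using insert r_coef_f_star[OF van, of q x Q] by auto
  qed
  have eq: "r_coef q (rows Q f_star a) =
      (\<Sum>j\<in>{q + 1..<q + B + 3}. \<Sum>i\<in>{q - B - 2..<q + 1}. int (rows Q f_star a (i, j)))" for Q
    by (rule r_coef_eq[OF van]) auto
  have "r_coef q (rows ?C f_star a) = r_coef q (rows (?C \<inter> ?W) f_star a)"
    unfolding eq by (intro sum.cong refl) (auto simp: rows_apply)
  also have "\<dots> = r_coef q a + (if q \<in> ?C \<inter> ?W then 1 else 0)" by (rule fin) auto
  finally show ?thesis
    using B unfolding fhat_star_eq[OF l a] by (simp add: residue_class_def vanishes_from_def)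
qed

lemma r_coef_nonneg: "0 \<le> r_coef p a"
  unfolding r_coef_def by (intro sum_nonneg) auto

lemma cong_Ihat: "p \<in> Ihat l \<Longrightarrow> q \<in> Ihat l \<Longrightarrow> [q = p] (mod l) \<longleftrightarrow> q = p"
  by (auto simp: Ihat_def cong_def)

lemma wt_lus_fhat_star:
  assumes l: "2 \<le> l" and a: "a \<in> LusAff l" and p: "p \<in> Ihat l"
  shows "wt_lus l (fhat_star l p a) = (\<lambda>x. wt_lus l a x - simple_root l p x)"
proof
  fix x
  have "wt_lus l (fhat_star l p a) x =
      (\<Sum>q\<in>Ihat l. - r_coef q a * simple_root l q x - (if q = p then simple_root l q x else 0))"
    unfolding wt_lus_def root_comb_def using r_coef_fhat_star[OF l a] cong_Ihat[OF p]
    by (intro sum.cong refl) (simp add: algebra_simps)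
  also have "\<dots> = wt_lus l a x - simple_root l p x"
    using p by (simp add: sum_subtractf wt_lus_def root_comb_def sum.delta Ihat_def)
  finally show "wt_lus l (fhat_star l p a) x = wt_lus l a x - simple_root l p x" .
qed

subsection \<open>Connectedness\<close>

text \<open>If all \<open>eps_star\<close> vanish, the tail sums \<open>S d p\<close> of the rows
  are nondecreasing in \<open>p\<close>, and periodicity makes them constant. Hence every diagonal
  of \<open>a\<close> is constant, and having a zero it vanishes.\<close>

lemma aperiodic_zero:
  assumes l: "2 \<le> l" and ap: "a \<in> LusAp l" and zero: "\<And>p. eps_star p a = 0"
  shows "a = (\<lambda>x\<in>Delta. 0)"
proof -
  note a = LusAp_D[OF ap]
  obtain B where B: "vanishes_from B a" using aff_vanishes[OF l a] by blast
  have B0: "0 < B" using B by (simp add: vanishes_from_def)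
  define S where "S d p = (\<Sum>j\<in>{p + d..<p + B}. int (a (p, j)))" for d p
  have le: "S d p \<le> S d (p + 1)" if d: "1 \<le> d" "d \<le> B" for d p
  proof -
    have "A_star p a (p + d - 1) = (\<Sum>j\<in>{p + d..<p + B}. int (a (p, j)) - int (a (p + 1, j + 1)))"
      using A_star_eq[OF B, of p "p + d - 1" "p + B"] d by simp
    also have "\<dots> = S d p - (\<Sum>j\<in>{p + d..<p + B}. int (a (p + 1, j + 1)))"
      by (simp add: sum_subtractf S_def)
    also have "(\<Sum>j\<in>{p + d..<p + B}. int (a (p + 1, j + 1))) = S d (p + 1)"
      unfolding S_def by (rule sum.reindex_bij_witness[of _ "\<lambda>j. j - 1" "\<lambda>j. j + 1"]) auto
    finally show ?thesis using A_star_le_eps[OF B, of p "p + d - 1"] zero[of p] d by simp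
  qed
  have per: "S d (p + l) = S d p" if "1 \<le> d" for d p
  proof -
    have "S d p = (\<Sum>j\<in>{p + d..<p + B}. int (a (p + l, j + l)))"
      unfolding S_def
    proof (rule sum.cong[OF HOL.refl])
      fix j assume "j \<in> {p + d..<p + B}"
      then have "p < j" using that by simp
      then show "int (a (p, j)) = int (a (p + l, j + l))" by (simp only: aff_shift[OF l a])
    qed
    also have "\<dots> = S d (p + l)"
      unfolding S_def by (rule sum.reindex_bij_witness[of _ "\<lambda>j. j - l" "\<lambda>j. j + l"]) auto
    finally show ?thesis by simp
  qed
  have const: "S d (p + 1) = S d p" if d: "1 \<le> d" "d \<le> B" for d p
  proof -
    have "S d (p + 1) \<le> S d (p + l)" by (rule int_step_mono) (use le[OF d] l in auto)
    then show ?thesis using per[OF d(1), of p] le[OF d, of p] by simp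
  qed
  have entry: "int (a (p, p + d)) = S d p - S (d + 1) p" if "d < B" for d p
  proof -
    have "{p + d..<p + B} = insert (p + d) {p + (d + 1)..<p + B}" using that by auto
    then show ?thesis by (simp add: S_def)
  qed
  have z: "a (p, p + int d) = 0" if d: "0 < d" for d p
  proof (cases "int d < B")
    case True
    have same: "a (q + 1, q + 1 + int d) = a (q, q + int d)" for q
      using entry[OF True, of q] entry[OF True, of "q + 1"] const[of "int d" q] const[of "int d + 1" q] True d by simp
    obtain i where i: "a (i, i + int d) = 0" using ap d LusAp_iff[OF l a] by blast
    have "a (i + int n, i + int n + int d) = 0" "a (i - int n, i - int n + int d) = 0" for n
    proof (induction n)
      case (Suc n)
      { case 1 show ?case using Suc(1) same[of "i + int n"] by (simp add: algebra_simps) }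
      { case 2 show ?case using Suc(2) same[of "i - int n - 1"] by (simp add: algebra_simps) }
    qed (use i in auto)
    from this[of "nat (p - i)"] this[of "nat (i - p)"] show ?thesis by (cases "i \<le> p") auto
  next
    case False
    then show ?thesis using B by (simp add: vanishes_from_def)
  qed
  show ?thesis
  proof (rule Delta_ext_eqI[OF aff_PiE[OF l a]])
    fix i j :: int assume "i < j"
    then show "a (i, j) = (\<lambda>x\<in>Delta. 0) (i, j)"
      using z[of "nat (j - i)" i] by (simp add: Delta_def)
  qed simp
qed

lemma aperiodic_raising:
  assumes l: "2 \<le> l" and ap: "a \<in> LusAp l" and ne: "a \<noteq> (\<lambda>x\<in>Delta. 0)"
  obtains p b where "p \<in> Ihat l" "ehat_star l p a = Some b"
proof -
  note a = LusAp_D[OF ap]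
  obtain q where q: "eps_star q a \<noteq> 0" using aperiodic_zero[OF l ap] ne by blast
  have "[q mod l = q] (mod l)" by (simp add: cong_def)
  then have "eps_star (q mod l) a \<noteq> 0" using eps_star_cong_mod[OF l a, of "q mod l" q] q by simp
  moreover have "q mod l \<in> Ihat l" using l by (simp add: Ihat_def)
  ultimately show ?thesis using that[of "q mod l"] ehat_star_eq[OF l a] by auto
qed

subsection \<open>Affine operators on the family of a Lusztig datum\<close>

lemma L_set_eq: "L_set l k p = {q \<in> residue_class l p. q \<notin> - k \<and> q + 1 \<in> - k}"
  by (auto simp: L_set_def residue_class_def)

lemma finite_L_set:
  assumes "k \<in> mayac"
  shows "finite (L_set l k p)"
proof -
  obtain n m where nm: "{..<n} \<subseteq> - k" "- k \<subseteq> {..<m}" using assms by (auto simp: mayac_iff maya_iff)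
  have "L_set l k p \<subseteq> {n..m}"
  proof
    fix q assume "q \<in> L_set l k p"
    then have "q \<in> k" "q + 1 \<notin> k" by (auto simp: L_set_def)
    then show "q \<in> {n..m}" using nm by force
  qed
  then show ?thesis by (rule finite_subset) simp
qed

context
  fixes l p :: int and a :: lusztig
  assumes l: "2 \<le> l" and ap: "a \<in> LusAp l"
begin

text \<open>The factors are applied one at a time. The intermediate data need not be periodic, so
  the induction carries \<open>zeros_left\<close> along to keep \<open>f_Z_Phi_Z\<close>
  applicable.\<close>

lemma fhat_Phi_Z: "fhat l p (star_c (Phi_Z a)) = star_c (Phi_Z (fhat_star l p a))"
proof -
  note a = LusAp_D[OF ap] and zl = LusAp_zeros_left[OF ap]
  obtain B where B: "vanishes_from B a" using aff_vanishes[OF l a] by blast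
  let ?C = "residue_class l p"
  note sep = separated_residue_class[OF l a, of p]
  have van: "vanishes_from (B + 2) (rows Q f_star a)" for Q
    by (rule vanishes_from_rows) (use vanishes_from_f_star[OF B] vanishes_from_mono[OF B] in auto)
  have fold: "fold f_Z qs (star_c (Phi_Z a)) = star_c (Phi_Z (rows (set qs) f_star a)) \<and>
      zeros_left (rows (set qs) f_star a)"
    if "distinct qs" "set qs \<subseteq> ?C" for qs
    using that
  proof (induction qs rule: rev_induct)
    case Nil
    then show ?case using zl by (simp add: rows_empty[OF aff_PiE[OF l a]])
  next
    case (snoc q qs)
    then have IH: "fold f_Z qs (star_c (Phi_Z a)) = star_c (Phi_Z (rows (set qs) f_star a))"
        "zeros_left (rows (set qs) f_star a)" and q: "q \<notin> set qs" "insert q (set qs) \<subseteq> ?C"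
      by auto
    have "rows (set (qs @ [q])) f_star a = f_star q (rows (set qs) f_star a)"
      using rows_insert[OF row_operator_f_star separated_subset[OF sep q(2)] q(1)] by simp
    then show ?case
      using IH f_Z_Phi_Z[OF van IH(2), of q] zeros_left_f_star[OF IH(2)] by simp
  qed
  show ?thesis
  proof
    fix k
    show "fhat l p (star_c (Phi_Z a)) k = star_c (Phi_Z (fhat_star l p a)) k"
    proof (cases "k \<in> mayac")
      case True
      let ?L = "L_set l k p"
      have fin: "finite ?L" by (rule finite_L_set[OF True])
      have LC: "?L \<subseteq> ?C" by (auto simp: L_set_eq)
      have mk: "- k \<in> maya" using True by (simp add: mayac_iff)
      have "fhat l p (star_c (Phi_Z a)) k = star_c (Phi_Z (rows ?L f_star a)) k"
        using True fold[of "sorted_list_of_set ?L"] fin LC by (simp add: fhat_def f_prod_def)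
      also have "\<dots> = Phi_Z (rows ?L f_star a) (- k)" using mk by (simp add: star_c_apply)
      also have "\<dots> = Phi_Z (rows ?C f_star a) (- k)"
        by (rule Phi_Z_rows_touched[OF sep row_operator_f_star aff_PiE[OF l a] van _ mk L_set_eq fin, symmetric])
          (rule Phi_Z_f_star_untouched[OF van])
      finally show ?thesis using mk fhat_star_eq[OF l a] by (simp add: star_c_apply)
    next
      case False
      then show ?thesis by (simp add: fhat_def star_c_def)
    qed
  qed
qed

lemma ehat_Phi_Z: "ehat l p (star_c (Phi_Z a)) = map_option (star_c \<circ> Phi_Z) (ehat_star l p a)"
proof -
  note a = LusAp_D[OF ap] and zl = LusAp_zeros_left[OF ap]
  obtain B where B: "vanishes_from B a" using aff_vanishes[OF l a] by blast
  let ?C = "residue_class l p"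
  note sep = separated_residue_class[OF l a, of p]
  have epsZ: "eps_Z p (star_c (Phi_Z a)) = eps_star p a" by (rule eps_Z_Phi_Z[OF B zl])
  show ?thesis
  proof (cases "eps_star p a = 0")
    case True
    then show ?thesis by (simp add: ehat_def epsZ ehat_star_eq[OF l a])
  next
    case False
    then have ep: "0 < eps_star p a" using eps_star_nonneg[OF B, of p] by simp
    have e: "0 < eps_star q a" if "q \<in> ?C" for q
      using eps_star_cong_mod[OF l a, of q p] that ep by (simp add: residue_class_def)
    have van: "vanishes_from (B + 2) (rows Q lower_star a)" if "Q \<subseteq> ?C" for Q
      by (rule vanishes_from_rows) (use that e vanishes_from_lower_star[OF B] vanishes_from_mono[OF B] in auto)
    have e': "0 < eps_star q (rows Q lower_star a)" if "insert q Q \<subseteq> ?C" "q \<notin> Q" for q Q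
      using eps_star_cong[OF same_rows_rows_outside[OF separated_subset[OF sep that(1)] that(2)]] e[of q] that by simp
    have fold: "fold (\<lambda>q N. Option.bind N (e_Z q)) qs (Some (star_c (Phi_Z a))) =
        Some (star_c (Phi_Z (rows (set qs) lower_star a))) \<and> zeros_left (rows (set qs) lower_star a)"
      if "distinct qs" "set qs \<subseteq> ?C" for qs
      using that
    proof (induction qs rule: rev_induct)
      case Nil
      then show ?case using zl by (simp add: rows_empty[OF aff_PiE[OF l a]])
    next
      case (snoc q qs)
      then have IH: "fold (\<lambda>q N. Option.bind N (e_Z q)) qs (Some (star_c (Phi_Z a))) =
          Some (star_c (Phi_Z (rows (set qs) lower_star a)))"
          "zeros_left (rows (set qs) lower_star a)" and q: "q \<notin> set qs" "insert q (set qs) \<subseteq> ?C"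
        by auto
      have S: "set qs \<subseteq> ?C" using q(2) by auto
      have "rows (set (qs @ [q])) lower_star a = lower_star q (rows (set qs) lower_star a)"
        using rows_insert[OF row_operator_lower_star separated_subset[OF sep q(2)] q(1)] by simp
      then show ?case
        using IH e_Z_Phi_Z[OF van[OF S] rows_PiE IH(2) e'[OF q(2,1)]] zeros_left_lower_star[OF IH(2)] by simp
    qed
    have "(\<lambda>k\<in>mayac. the (e_prod (L_set l k p) (star_c (Phi_Z a))) k) = star_c (Phi_Z (rows ?C lower_star a))"
    proof
      fix k
      show "(\<lambda>k\<in>mayac. the (e_prod (L_set l k p) (star_c (Phi_Z a))) k) k = star_c (Phi_Z (rows ?C lower_star a)) k"
      proof (cases "k \<in> mayac")
        case True
        let ?L = "L_set l k p"
        have fin: "finite ?L" by (rule finite_L_set[OF True])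
        have LC: "?L \<subseteq> ?C" by (auto simp: L_set_eq)
        have mk: "- k \<in> maya" using True by (simp add: mayac_iff)
        have "the (e_prod ?L (star_c (Phi_Z a))) k = star_c (Phi_Z (rows ?L lower_star a)) k"
          using fold[of "sorted_list_of_set ?L"] fin LC by (simp add: e_prod_def)
        also have "\<dots> = Phi_Z (rows ?L lower_star a) (- k)" using mk by (simp add: star_c_apply)
        also have "\<dots> = Phi_Z (rows ?C lower_star a) (- k)"
        proof (rule Phi_Z_rows_touched[OF sep row_operator_lower_star aff_PiE[OF l a] van _ mk L_set_eq fin, symmetric])
          fix Q q k assume *: "finite Q" "Q \<subseteq> ?C" "q \<in> ?C" "q \<notin> Q" "k \<in> maya" "q \<in> k \<or> q + 1 \<notin> k"
          then have "insert q Q \<subseteq> ?C" by auto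
          then show "Phi_Z (lower_star q (rows Q lower_star a)) k = Phi_Z (rows Q lower_star a) k"
            using Phi_Z_lower_star_untouched[OF van[OF *(2)] rows_PiE e'] * by blast
        qed
        finally show ?thesis using True mk by (simp add: star_c_apply)
      next
        case False
        then show ?thesis by (simp add: star_c_def)
      qed
    qed
    then show ?thesis using False by (simp add: ehat_def epsZ ehat_star_eq[OF l a])
  qed
qed

end

subsection \<open>Every affine datum comes from an aperiodic Lusztig datum\<close>

context
  fixes l :: int and F :: family
  assumes l: "2 \<le> l" and F: "maya_datum F"
    and periodic: "\<And>k. k \<in> maya \<Longrightarrow> F ((\<lambda>x. x - l) ` k) = F k"
begin

definition seg :: "int \<Rightarrow> int \<Rightarrow> int \<Rightarrow> int" where
  "seg s u v = F ({..<s} \<union> {u..<v})"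

lemma seg_empty: "seg s u u = 0"
  and seg_prefix: "s \<le> v \<Longrightarrow> seg s s v = 0"
proof -
  show "seg s u u = 0" using maya_datumD(4)[OF F] by (simp add: seg_def)
  assume "s \<le> v"
  then have "{..<s} \<union> {s..<v} = {..<v}" by auto
  then show "seg s s v = 0" using maya_datumD(4)[OF F] by (simp add: seg_def)
qed

lemma seg_supermodular:
  assumes "s \<le> i" "i < j"
  shows "seg s i j + seg s (i + 1) (j + 1) \<le> seg s i (j + 1) + seg s (i + 1) j"
proof -
  have "F ({..<s} \<union> insert i {i + 1..<j}) + F ({..<s} \<union> insert j {i + 1..<j}) \<le>
      F ({..<s} \<union> insert i (insert j {i + 1..<j})) + F ({..<s} \<union> {i + 1..<j})"
    by (rule supermodularD[OF maya_datumD(2)[OF F]]) (use assms in auto)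
  moreover have "insert j {i + 1..<j} = {i + 1..<j + 1}" "insert i {i + 1..<j} = {i..<j}"
    "insert i {i + 1..<j + 1} = {i..<j + 1}" using assms by auto
  ultimately show ?thesis by (simp only: seg_def)
qed

lemma seg_sea_supermodular:
  assumes "s < u" "u \<le> v"
  shows "seg (s + 1) u v + seg s u (v + 1) \<le> seg (s + 1) u (v + 1) + seg s u v"
proof -
  have "F ({..<s} \<union> insert s {u..<v}) + F ({..<s} \<union> insert v {u..<v}) \<le>
      F ({..<s} \<union> insert s (insert v {u..<v})) + F ({..<s} \<union> {u..<v})"
    by (rule supermodularD[OF maya_datumD(2)[OF F]]) (use assms in auto)
  moreover have "insert v {u..<v} = {u..<v + 1}" "{..<s} \<union> insert s Y = {..<s + 1} \<union> Y" for Y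
    using assms by auto
  ultimately show ?thesis by (simp only: seg_def)
qed

text \<open>Inverts \<open>mm_interval\<close>: an entry is the mixed second difference of interval
  components. Above the diagonal it is nonnegative by supermodularity, so \<open>nat\<close> loses
  nothing.\<close>

definition seg_datum :: "int \<Rightarrow> lusztig" where
  "seg_datum s = (\<lambda>(i, j). if s \<le> i then nat (seg s i (j + 1) + seg s (i + 1) j - seg s i j - seg s (i + 1) (j + 1)) else 0)"

lemma seg_datum_eq:
  "s \<le> i \<Longrightarrow> i < j \<Longrightarrow> int (seg_datum s (i, j)) = seg s i (j + 1) + seg s (i + 1) j - seg s i j - seg s (i + 1) (j + 1)"
  using seg_supermodular[of s i j] by (simp add: seg_datum_def)

lemma seg_datum_column:
  assumes "s \<le> u" "u \<le> j"
  shows "(\<Sum>i\<in>{s..<u}. int (seg_datum s (i, j))) = seg s u j - seg s u (j + 1)"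
  using assms
proof (induction u rule: int_ge_induct)
  case base
  then show ?case by (simp add: seg_prefix)
next
  case (step u)
  have "{s..<u + 1} = insert u {s..<u}" using step.hyps by auto
  then show ?case using step seg_datum_eq[of s u j] by simp
qed

lemma mm_seg_datum_interval:
  assumes "s \<le> u" "u \<le> v"
  shows "mm (seg_datum s) s {u..<v} = seg s u v"
  using assms(2)
proof (induction v rule: int_ge_induct)
  case base
  then show ?case by (simp add: seg_empty)
next
  case (step v)
  have "{u..<v + 1} = insert v {u..<v}" using step.hyps by auto
  then have "mm (seg_datum s) s {u..<v + 1} =
      mm (seg_datum s) s {u..<v} - (\<Sum>i\<in>{s..<u}. int (seg_datum s (i, v)))"
    unfolding mm_interval[OF assms(1)] by simp
  then show ?case using step seg_datum_column[OF assms(1), of v] by simp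
qed

lemma mm_seg_datum:
  assumes "finite K" "K \<subseteq> {s..}"
  shows "F ({..<s} \<union> K) = mm (seg_datum s) s K"
proof (rule plucker_agree_intervals[OF maya_datumD(3)[OF F] plucker_mm])
  fix u v assume uv: "{u..<v} \<subseteq> {s..}"
  show "F ({..<s} \<union> {u..<v}) = mm (seg_datum s) s {u..<v}"
  proof (cases "u < v")
    case True
    then have "u \<in> {u..<v}" by simp
    then have "s \<le> u" using uv by blast
    then show ?thesis using mm_seg_datum_interval[of s u v] True by (simp add: seg_def)
  next
    case False
    then show ?thesis using maya_datumD(4)[OF F] by simp
  qed
qed (use assms in auto)

lemma seg_shift: "seg (s + l) (u + l) (v + l) = seg s u v"
proof -
  have "(\<lambda>x. x - l) ` ({..<s + l} \<union> {u + l..<v + l}) = {..<s} \<union> {u..<v}"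
  proof (intro equalityI subsetI)
    fix x assume "x \<in> {..<s} \<union> {u..<v}"
    then have "x + l \<in> {..<s + l} \<union> {u + l..<v + l}" by auto
    then have "(x + l) - l \<in> (\<lambda>x. x - l) ` ({..<s + l} \<union> {u + l..<v + l})" by (rule imageI)
    then show "x \<in> (\<lambda>x. x - l) ` ({..<s + l} \<union> {u + l..<v + l})" by simp
  qed auto
  then show ?thesis
    using periodic[OF maya_prefix[of "{u + l..<v + l}" "s + l"]] by (simp add: seg_def)
qed

lemma seg_shift_mult: "seg (s + l * m) (u + l * m) (v + l * m) = seg s u v"
proof -
  have nat_shift: "seg (s + int n * l) (u + int n * l) (v + int n * l) = seg s u v" for n s u v
  proof (induction n)
    case (Suc n)
    have "w + int (Suc n) * l = (w + int n * l) + l" for w by (simp add: algebra_simps)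
    then show ?case by (simp only: Suc seg_shift)
  qed simp
  show ?thesis
  proof (cases "0 \<le> m")
    case True
    then show ?thesis using nat_shift[of s "nat m" u v] by (simp add: mult.commute)
  next
    case False
    then show ?thesis
      using nat_shift[of "s + l * m" "nat (- m)" "u + l * m" "v + l * m"] by (simp add: algebra_simps)
  qed
qed

text \<open>For a single \<open>u\<close> this is nonemptiness of \<open>Int_e\<close> at
  \<open>{..u - 1}\<close>, with a bound depending on \<open>u\<close>. By periodicity finitely many
  \<open>u\<close> represent all, and the maximum of their bounds works uniformly.\<close>

lemma seg_stable: "\<exists>L>0. \<forall>u. \<exists>c. \<forall>s\<le>u - L. \<forall>v\<ge>u + L. seg s u v = c"
proof -
  have ex: "\<exists>L>0. \<exists>c. \<forall>s\<le>u - L. \<forall>v\<ge>u + L. seg s u v = c" for u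
  proof -
    obtain I where I: "I \<in> Int_e F {..u - 1}" using maya_datumD(5)[OF F maya_basic(1)] by blast
    then obtain s t where st: "s \<le> t" "I = {s..t}" by (auto simp: Int_e_def intervals_iff)
    have b: "s \<le> u - 1" "u - 1 \<le> t" using Int_e_basic[of s t F "u - 1"] I st by auto
    define L where "L = max 1 (max (u - s) (t + 2 - u))"
    have "seg s' u v = Theta (star_c F) {..u - 1}" if "s' \<le> u - L" "u + L \<le> v" for s' v
    proof -
      have "s' \<le> s" "t \<le> v - 2" using that by (auto simp: L_def)
      then show ?thesis
        using Theta_eq_mono[OF maya_basic(1), of s t F "u - 1" s' "v - 2"]
          Omega_basic(1)[of s' "u - 1" "v - 2"] I st b by (simp add: seg_def)
    qed
    moreover have "0 < L" by (simp add: L_def)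
    ultimately show ?thesis by blast
  qed
  then obtain L where L: "\<And>u. 0 < L u" "\<And>u. \<exists>c. \<forall>s\<le>u - L u. \<forall>v\<ge>u + L u. seg s u v = c" by metis
  define L0 where "L0 = Max (L ` {0..<l})"
  have L0: "L u \<le> L0" if "u \<in> {0..<l}" for u unfolding L0_def using that by (intro Max_ge) auto
  have "0 < L0" using L0[of 0] L(1)[of 0] l by simp
  moreover have "\<exists>c. \<forall>s\<le>u - L0. \<forall>v\<ge>u + L0. seg s u v = c" for u
  proof -
    define w where "w = u mod l"
    define m where "m = u div l"
    have u: "u = w + l * m" by (simp add: w_def m_def)
    have w: "w \<in> {0..<l}" using l by (simp add: w_def)
    obtain c where c: "\<forall>s\<le>w - L w. \<forall>v\<ge>w + L w. seg s w v = c" using L(2) by blast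
    have "seg s u v = c" if "s \<le> u - L0" "u + L0 \<le> v" for s v
    proof -
      have "seg s u v = seg (s - l * m) w (v - l * m)"
        using seg_shift_mult[of "s - l * m" m w "v - l * m"] u by simp
      moreover have "s - l * m \<le> w - L w" "w + L w \<le> v - l * m" using that L0[OF w] u by auto
      ultimately show ?thesis using c by simp
    qed
    then show ?thesis by blast
  qed
  ultimately show ?thesis by blast
qed

section \<open>The limit of the data attached to receding seas\<close>

context
  fixes L :: int
  assumes L: "0 < L" and stable: "\<And>u. \<exists>c. \<forall>s\<le>u - L. \<forall>v\<ge>u + L. seg s u v = c"
begin

text \<open>The column sum over the rows before \<open>u\<close> is
  \<open>seg s u j - seg s u (j + 1)\<close>, which vanishes in the stable range; its terms are
  nonnegative, so each of them is 0.\<close>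

lemma seg_datum_zero:
  assumes "s \<le> i" "i < u" "s \<le> u - L" "u + L \<le> j"
  shows "seg_datum s (i, j) = 0"
proof -
  obtain c where c: "\<forall>s\<le>u - L. \<forall>v\<ge>u + L. seg s u v = c" using stable by blast
  have "seg s u j = c" "seg s u (j + 1) = c" using c assms by auto
  then have "(\<Sum>i\<in>{s..<u}. int (seg_datum s (i, j))) = 0"
    using seg_datum_column[of s u j] assms L by simp
  then have "\<forall>i\<in>{s..<u}. int (seg_datum s (i, j)) = 0" by (subst (asm) sum_nonneg_eq_0_iff) auto
  then show ?thesis using assms by simp
qed

lemma vanishes_from_seg_datum: "vanishes_from (2 * L + 1) (seg_datum s)"
  unfolding vanishes_from_def
proof (intro conjI allI impI)
  show "0 < 2 * L + 1" using L by simp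
  fix i j :: int assume ij: "2 * L + 1 \<le> j - i"
  show "seg_datum s (i, j) = 0"
  proof (cases "s \<le> i")
    case True
    \<comment> \<open>The auxiliary bound exceeds \<open>i\<close>, is at least \<open>s + L\<close>
      and leaves at least \<open>L\<close> before \<open>j\<close>; this is the origin of
      \<open>2 * L + 1\<close>.\<close>
    show ?thesis
      by (rule seg_datum_zero[OF True, of "max (i + 1) (s + L)"]) (use ij True L in auto)
  qed (simp add: seg_datum_def)
qed

text \<open>The effect \<open>?E v\<close> of moving the sea by one is nondecreasing in
  \<open>v\<close> by supermodularity, is 0 at the empty interval and again 0 in the stable range.
  So it vanishes throughout, and the position of the sea is irrelevant for every \<open>v\<close>,
  not only for distant ones.\<close>

lemma seg_sea_const:
  assumes u: "u \<le> v" and s: "s \<le> u - L"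
  shows "seg s u v = seg (u - L) u v"
  using s
proof (induction s rule: int_le_induct)
  case (step s)
  let ?E = "\<lambda>v. seg s u v - seg (s - 1) u v"
  obtain c where c: "\<forall>s\<le>u - L. \<forall>v\<ge>u + L. seg s u v = c" using stable by blast
  have mono: "?E w \<le> ?E (w + 1)" if "u \<le> w" for w
    using seg_sea_supermodular[of "s - 1" u w] step.hyps L that by simp
  have le: "?E w \<le> ?E w'" if "u \<le> w" "w \<le> w'" for w w'
    using that(2)
  proof (induction w' rule: int_ge_induct)
    case (step x)
    then show ?case using mono[of x] that(1) by simp
  qed simp
  have "?E u = 0" by (simp add: seg_empty)
  moreover have "?E (max v (u + L)) = 0" using c step.hyps by simp
  ultimately have "?E v = 0" using le[of u v] le[of v "max v (u + L)"] u by simp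
  then show ?case using step.IH by simp
qed simp

text \<open>In rows at distance at least \<open>L\<close> from the sea, \<open>seg_datum s\<close>
  no longer depends on \<open>s\<close>; row \<open>i\<close> is therefore read off with the sea at
  \<open>i - L\<close>.\<close>

definition limit_datum :: lusztig where
  "limit_datum = (\<lambda>(i, j)\<in>Delta. seg_datum (i - L) (i, j))"

lemma limit_datum_eq:
  assumes "i < j" "s \<le> i - L"
  shows "limit_datum (i, j) = seg_datum s (i, j)"
proof -
  have "seg s i v = seg (i - L) i v" if "i \<le> v" for v using seg_sea_const[of i v s] assms that by simp
  moreover have "seg s (i + 1) v = seg (i - L) (i + 1) v" if "i + 1 \<le> v" for v
    using seg_sea_const[of "i + 1" v s] seg_sea_const[of "i + 1" v "i - L"] assms that by simp
  ultimately show ?thesis using assms L by (simp add: limit_datum_def Delta_def seg_datum_def)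
qed

lemma vanishes_from_limit_datum: "vanishes_from (2 * L + 1) limit_datum"
  using vanishes_from_seg_datum limit_datum_eq[OF _ order_refl] L
  unfolding vanishes_from_def by force

lemma limit_datum_aff: "limit_datum \<in> LusAff l"
proof -
  have "limit_datum (i, j) = limit_datum (i + l, j + l)" if ij: "i < j" for i j
  proof -
    have "seg (i + l - L) (i + l) (j + l + 1) = seg (i - L) i (j + 1)"
      "seg (i + l - L) (i + l + 1) (j + l) = seg (i - L) (i + 1) j"
      "seg (i + l - L) (i + l) (j + l) = seg (i - L) i j"
      "seg (i + l - L) (i + l + 1) (j + l + 1) = seg (i - L) (i + 1) (j + 1)"
      using seg_shift[of "i - L" i "j + 1"] seg_shift[of "i - L" "i + 1" j]
        seg_shift[of "i - L" i j] seg_shift[of "i - L" "i + 1" "j + 1"]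
      by (simp_all add: algebra_simps)
    then show ?thesis using ij L by (simp add: limit_datum_def Delta_def seg_datum_def)
  qed
  moreover have "limit_datum \<in> Delta \<rightarrow>\<^sub>E UNIV" by (simp add: limit_datum_def)
  ultimately show ?thesis
    using vanishes_from_limit_datum unfolding LusAff_def LusZ_iff Delta_def by blast
qed

text \<open>\<open>F\<close> is given by \<open>seg_datum s\<close>, which may differ from the limit
  in the first \<open>L\<close> rows after \<open>s\<close>. Since the sea of \<open>k\<close>
  extends well beyond them, \<open>mm_stable\<close> strips these rows off before the two data are
  compared.\<close>

lemma F_eq_Phi_Z: "F = Phi_Z limit_datum"
proof (rule PiE_ext[OF maya_datumD(1)[OF F]])
  show "Phi_Z limit_datum \<in> maya \<rightarrow>\<^sub>E UNIV" by (simp add: Phi_Z_def)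
  fix k assume k: "k \<in> maya"
  then obtain n m where nm: "{..<n} \<subseteq> k" "k \<subseteq> {..<m}" by (auto simp: maya_iff)
  let ?B = "2 * L + 1"
  define s where "s = n - L - ?B"
  have sub: "{..<s} \<subseteq> k" "{..<s + L} \<subseteq> k" "{..<s + L + ?B} \<subseteq> k"
    using nm(1) L by (auto simp: s_def subset_iff)
  have "F k = F ({..<s} \<union> (k \<inter> {s..}))" using maya_cut(2)[OF k sub(1)] by simp
  also have "\<dots> = mm (seg_datum s) s (k \<inter> {s..})"
    by (rule mm_seg_datum[OF maya_cut(1)[OF k sub(1)]]) auto
  also have "k \<inter> {s..} = {s..<s + L} \<union> (k \<inter> {s + L..})" using sub(2) L by (auto simp: subset_iff)
  also have "mm (seg_datum s) s \<dots> = mm (seg_datum s) (s + L) (k \<inter> {s + L..})"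
    by (rule mm_stable[OF vanishes_from_seg_datum]) (use maya_cut(1)[OF k sub(2)] sub(3) L in auto)
  also have "\<dots> = mm limit_datum (s + L) (k \<inter> {s + L..})"
  proof (rule mm_cong[OF maya_cut(1)[OF k sub(2)], of _ m])
    show "k \<inter> {s + L..} \<subseteq> {s + L..<m}" using nm(2) by auto
    show "seg_datum s (i, j) = limit_datum (i, j)" if "s + L \<le> i" "i < j" for i j
      by (rule limit_datum_eq[symmetric]) (use that in auto)
  qed
  also have "\<dots> = Phi_Z limit_datum k"
    by (rule Phi_Z_eq[OF vanishes_from_limit_datum k sub(3), symmetric])
  finally show "F k = Phi_Z limit_datum k" .
qed

text \<open>If diagonal \<open>d\<close> had no zero, joining the block \<open>{r..<s}\<close> to
  \<open>{0..<L}\<close> would raise the component strictly, by \<open>mm_block_gt\<close>. But the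
  raised value is a component of \<open>F\<close>, and by \<open>seg_sea_const\<close> it does not
  change when the sea recedes from \<open>s\<close> to \<open>r\<close>, where it equals the value
  without the block.\<close>

lemma limit_datum_aperiodic: "limit_datum \<in> LusAp l"
proof (rule ccontr)
  assume "limit_datum \<notin> LusAp l"
  then have "\<not> (\<forall>d>0. \<exists>i. limit_datum (i, i + int d) = 0)"
    by (simp only: LusAp_iff[OF l limit_datum_aff] not_False_eq_True)
  then have "\<exists>d>0. \<forall>i. limit_datum (i, i + int d) \<noteq> 0"
    by (simp only: not_all not_imp not_ex)
  then obtain d :: nat where d: "0 < d" "\<forall>i. limit_datum (i, i + int d) \<noteq> 0"
    by (elim exE conjE)
  let ?B = "2 * L + 1"
  define s where "s = - L"
  define r where "r = s - ?B - L - int d"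
  have r: "r \<le> s - ?B" "int d \<le> s - r" "r \<le> s" "r \<le> 0 - L" using L by (auto simp: r_def s_def)
  have "mm limit_datum r {0..<L} < mm limit_datum r ({r..<s} \<union> {0..<L})"
  proof (rule mm_block_gt[OF r(3)])
    show "0 < limit_datum (c, c + int d)" for c using d(2) by simp
  qed (use d(1) r(2) L in \<open>auto simp: s_def\<close>)
  also have "\<dots> = Phi_Z limit_datum ({..<s} \<union> {0..<L})"
    by (rule Phi_Z_prefix[OF vanishes_from_limit_datum r(1), symmetric]) (use L in \<open>auto simp: s_def\<close>)
  also have "\<dots> = F ({..<s} \<union> {0..<L})"
    by (rule fun_cong[OF F_eq_Phi_Z, symmetric])
  also have "\<dots> = seg r 0 L"
    using seg_sea_const[of 0 L r] r(4) L by (simp add: seg_def s_def)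
  also have "\<dots> = mm (seg_datum r) r {0..<L}"
    using mm_seg_datum_interval[of r 0 L] r(4) L by simp
  also have "\<dots> = mm limit_datum r {0..<L}"
  proof -
    \<comment> \<open>Near \<open>r\<close> the two data may differ, but there the entries concerned
      are at distance at least \<open>?B\<close>, where both vanish.\<close>
    have "seg_datum r (i, j) = limit_datum (i, j)" if ij: "i < 0" "0 \<le> j" for i j
    proof (cases "r \<le> i - L")
      case True
      then show ?thesis using limit_datum_eq[of i j r] ij by simp
    next
      case False
      then have "?B \<le> j - i" using ij by (simp add: r_def s_def)
      then show ?thesis
        using vanishes_from_seg_datum[of r] vanishes_from_limit_datum by (simp add: vanishes_from_def)
    qed
    then show ?thesis
      using r(4) L by (simp add: mm_interval)
  qed
  finally show False by simp
qed

end

lemma affine_datum_from_aperiodic: "\<exists>a\<in>LusAp l. F = Phi_Z a"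
proof -
  obtain L where "0 < L" "\<And>u. \<exists>c. \<forall>s\<le>u - L. \<forall>v\<ge>u + L. seg s u v = c" using seg_stable by blast
  then show ?thesis using F_eq_Phi_Z limit_datum_aperiodic by blast
qed

end

subsection \<open>Transport of crystal structures\<close>

text \<open>The hypotheses on \<open>eop\<close> and \<open>fop\<close> include the value
  \<open>None\<close>, so \<open>f\<close> and its inverse both commute with the operators
  everywhere. This gives invertibility in the category and carries the crystal axioms over to
  \<open>C\<close>.\<close>

lemma crystal_iso_transport:
  assumes B: "crystal l B" and inj: "inj_on f (elems B)" and img: "elems C = f ` elems B"
    and wt: "\<And>b. b \<in> elems B \<Longrightarrow> wt C (f b) = wt B b"
    and eps: "\<And>p b. b \<in> elems B \<Longrightarrow> eps C p (f b) = eps B p b"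
    and phi: "\<And>p b. b \<in> elems B \<Longrightarrow> phi C p (f b) = phi B p b"
    and eop: "\<And>p b. b \<in> elems B \<Longrightarrow> eop C p (f b) = map_option f (eop B p b)"
    and fop: "\<And>p b. b \<in> elems B \<Longrightarrow> fop C p (f b) = map_option f (fop B p b)"
  shows "crystal_iso l B C f"
proof -
  define g where "g = inv_into (elems B) f"
  have gf: "g (f b) = b" if "b \<in> elems B" for b using inj that by (simp add: g_def)
  have fg: "f (g c) = c" "g c \<in> elems B" if "c \<in> elems C" for c
    using that img by (auto simp: g_def f_inv_into_f inv_into_into)
  have closed: "b' \<in> elems B" if "b \<in> elems B" "p \<in> Ihat l" "eop B p b = Some b' \<or> fop B p b = Some b'" for b b' p
    using B that unfolding crystal_def by blast
  have eq: "f b = f b' \<longleftrightarrow> b = b'" if "b \<in> elems B" "b' \<in> elems B" for b b'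
    using inj that by (auto dest: inj_onD)
  have "crystal l C"
    unfolding crystal_def img ball_simps
  proof (intro conjI ballI allI impI)
    fix b assume b: "b \<in> elems B"
    show "wt C (f b) \<in> weight_lattice l" using B b wt by (simp add: crystal_def)
    fix p assume p: "p \<in> Ihat l"
    have finite: "eps B p b \<noteq> \<infinity>" "phi B p b \<noteq> \<infinity>" "phi B p b = eps B p b + Fin (coroot p (wt B b))"
      and bot: "phi B p b = -\<infinity> \<longrightarrow> eop B p b = None \<and> fop B p b = None"
      and iff: "\<forall>b'\<in>elems B. fop B p b = Some b' \<longleftrightarrow> eop B p b' = Some b"
      using B p b unfolding crystal_def by blast+
    have raise: "wt B b' = (\<lambda>x. wt B b x + simple_root l p x)" "eps B p b' = eps B p b - 1"
      "phi B p b' = phi B p b + 1" if "eop B p b = Some b'" for b'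
      using B p b that unfolding crystal_def by blast+
    have lower: "wt B b' = (\<lambda>x. wt B b x - simple_root l p x)" "eps B p b' = eps B p b + 1"
      "phi B p b' = phi B p b - 1" if "fop B p b = Some b'" for b'
      using B p b that unfolding crystal_def by blast+
    show "eps C p (f b) \<noteq> \<infinity>" "phi C p (f b) \<noteq> \<infinity>" "phi C p (f b) = eps C p (f b) + Fin (coroot p (wt C (f b)))"
      using finite b by (simp_all add: eps phi wt)
    show "c \<in> f ` elems B" "wt C c = (\<lambda>x. wt C (f b) x + simple_root l p x)"
      "eps C p c = eps C p (f b) - 1" "phi C p c = phi C p (f b) + 1" if c: "eop C p (f b) = Some c" for c
    proof -
      obtain b' where b': "eop B p b = Some b'" "c = f b'" using c eop[OF b] by auto
      then have "b' \<in> elems B" using closed b p by blast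
      then show "c \<in> f ` elems B" "wt C c = (\<lambda>x. wt C (f b) x + simple_root l p x)"
        "eps C p c = eps C p (f b) - 1" "phi C p c = phi C p (f b) + 1"
        using raise[OF b'(1)] b b'(2) by (simp_all add: eps phi wt)
    qed
    show "c \<in> f ` elems B" "wt C c = (\<lambda>x. wt C (f b) x - simple_root l p x)"
      "eps C p c = eps C p (f b) + 1" "phi C p c = phi C p (f b) - 1" if c: "fop C p (f b) = Some c" for c
    proof -
      obtain b' where b': "fop B p b = Some b'" "c = f b'" using c fop[OF b] by auto
      then have "b' \<in> elems B" using closed b p by blast
      then show "c \<in> f ` elems B" "wt C c = (\<lambda>x. wt C (f b) x - simple_root l p x)"
        "eps C p c = eps C p (f b) + 1" "phi C p c = phi C p (f b) - 1"
        using lower[OF b'(1)] b b'(2) by (simp_all add: eps phi wt)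
    qed
    show "fop C p (f b) = Some (f b') \<longleftrightarrow> eop C p (f b') = Some (f b)" if b': "b' \<in> elems B" for b'
    proof -
      have "fop B p b = Some b' \<longleftrightarrow> eop B p b' = Some b" using iff b' by blast
      moreover have "fop C p (f b) = Some (f b') \<longleftrightarrow> fop B p b = Some b'"
        using fop[OF b] closed[OF b p] eq[OF _ b'] by (cases "fop B p b") auto
      moreover have "eop C p (f b') = Some (f b) \<longleftrightarrow> eop B p b' = Some b"
        using eop[OF b'] closed[OF b' p] eq[OF _ b] by (cases "eop B p b'") auto
      ultimately show ?thesis by simp
    qed
    show "eop C p (f b) = None" "fop C p (f b) = None" if "phi C p (f b) = -\<infinity>"
      using bot b that by (simp_all add: eop fop phi)
  qed
  moreover have "crystal_morphism l B C (map_option f)"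
    unfolding crystal_morphism_def using wt eps phi eop fop img by auto
  moreover have "crystal_morphism l C B (map_option g)"
    unfolding crystal_morphism_def
  proof (intro conjI ballI allI impI)
    fix c assume c: "c \<in> elems C"
    then obtain b where b: "b \<in> elems B" "c = f b" using img by blast
    show "map_option g (Some c) \<in> insert None (Some ` elems B)" using b gf by simp
    show "wt B d = wt C c" if "map_option g (Some c) = Some d" for d using that b gf wt by simp
    show "eps B p d = eps C p c" "phi B p d = phi C p c" if "map_option g (Some c) = Some d" for d p
      using that b gf eps phi by simp_all
  next
    fix p c c' d d' assume p: "p \<in> Ihat l" and c: "c \<in> elems C"
      and d: "map_option g (Some c) = Some d \<and> map_option g (Some c') = Some d'"
    obtain b where b: "b \<in> elems B" "c = f b" using c img by blast
    show "eop B p d = Some d'" if "eop C p c = Some c'"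
      using that d b gf eop[OF b(1)] closed[OF b(1) p] by auto
    show "fop B p d = Some d'" if "fop C p c = Some c'"
      using that d b gf fop[OF b(1)] closed[OF b(1) p] by auto
  qed simp
  ultimately show ?thesis unfolding crystal_iso_def using B gf fg by blast
qed

subsection \<open>The crystal of aperiodic Lusztig data\<close>

lemma coroot_simple_root: "p \<in> Ihat l \<Longrightarrow> coroot p (simple_root l p) = 2"
  by (simp add: coroot_def simple_root_def cartan_def)

lemma root_comb_in_lattice: "root_comb l c \<in> weight_lattice l"
  by (auto simp: weight_lattice_def root_comb_def simple_root_def)

lemma wt_lus_ehat_star:
  assumes l: "2 \<le> l" and a: "a \<in> LusAff l" and p: "p \<in> Ihat l" and b: "ehat_star l p a = Some b"
  shows "wt_lus l b = (\<lambda>x. wt_lus l a x + simple_root l p x)"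
  using wt_lus_fhat_star[OF l ehat_star_aff[OF l a b] p] fhat_ehat_star[OF l a b] by auto

lemma crystal_lus_ap:
  assumes l: "2 \<le> l"
  shows "crystal l (lus_ap_crystal l)"
proof -
  have one: "Fin (x::int) - 1 = Fin (x - 1)" "Fin x + 1 = Fin (x + 1)" for x
    by (simp_all add: one_extended_def)
  show ?thesis
    unfolding crystal_def lus_ap_crystal_def
  proof (simp, intro conjI ballI allI impI)
    fix a assume "a \<in> LusAp l"
    show "wt_lus l a \<in> weight_lattice l" unfolding wt_lus_def by (rule root_comb_in_lattice)
  next
    fix p a b assume p: "p \<in> Ihat l" and ap: "a \<in> LusAp l" and b: "ehat_star l p a = Some b"
    note a = LusAp_D[OF ap]
    show "b \<in> LusAp l" by (rule ehat_star_Ap[OF l ap b])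
    show w: "wt_lus l b = (\<lambda>x. wt_lus l a x + simple_root l p x)" by (rule wt_lus_ehat_star[OF l a p b])
    show "Fin (eps_star p b) = Fin (eps_star p a) - 1"
      using eps_star_ehat[OF l a b] one by simp
    show "Fin (eps_star p b + coroot p (wt_lus l b)) = Fin (eps_star p a + coroot p (wt_lus l a)) + 1"
      using eps_star_ehat[OF l a b] one coroot_simple_root[OF p] by (simp add: w coroot_def)
  next
    fix p a assume p: "p \<in> Ihat l" and ap: "a \<in> LusAp l"
    note a = LusAp_D[OF ap]
    show "fhat_star l p a \<in> LusAp l" by (rule fhat_star_Ap[OF l ap])
    show w: "wt_lus l (fhat_star l p a) = (\<lambda>x. wt_lus l a x - simple_root l p x)"
      by (rule wt_lus_fhat_star[OF l a p])
    show "Fin (eps_star p (fhat_star l p a)) = Fin (eps_star p a) + 1"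
      using eps_star_fhat[OF l a, of p] one by simp
    show "Fin (eps_star p (fhat_star l p a) + coroot p (wt_lus l (fhat_star l p a))) =
        Fin (eps_star p a + coroot p (wt_lus l a)) - 1"
      using eps_star_fhat[OF l a, of p] one coroot_simple_root[OF p] by (simp add: w coroot_def)
    show "(fhat_star l p a = b) = (ehat_star l p b = Some a)" if "b \<in> LusAp l" for b
      using ehat_fhat_star[OF l a, of p] fhat_ehat_star[OF l LusAp_D[OF that], of p a] by auto
  qed
qed

subsection \<open>The isomorphism\<close>

text \<open>With the sea far away, the components at intervals are rectangle sums of the datum up to
  sign, and their second differences recover every entry.\<close>

lemma Phi_Z_inj:
  assumes a: "a \<in> LusZ" "zeros_left a" and b: "b \<in> LusZ" "zeros_left b" and eq: "Phi_Z a = Phi_Z b"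
  shows "a = b"
proof -
  obtain A where A: "vanishes_from A a" using a by (auto simp: LusZ_iff)
  obtain B where B: "vanishes_from B b" using b by (auto simp: LusZ_iff)
  have mm: "mm a r {u..<v} = mm b r {u..<v}" if r: "r \<le> u - A" "r \<le> u - B" for r u v
  proof -
    obtain s0 where s0: "\<And>s r Y. s \<le> s0 \<Longrightarrow> r \<le> u - A \<Longrightarrow> finite Y \<Longrightarrow> Y \<subseteq> {u..} \<Longrightarrow> Phi_Z a ({..<s} \<union> Y) = mm a r Y"
      by (rule Phi_Z_far[OF A a(2), of u]) blast
    obtain s1 where s1: "\<And>s r Y. s \<le> s1 \<Longrightarrow> r \<le> u - B \<Longrightarrow> finite Y \<Longrightarrow> Y \<subseteq> {u..} \<Longrightarrow> Phi_Z b ({..<s} \<union> Y) = mm b r Y"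
      by (rule Phi_Z_far[OF B b(2), of u]) blast
    have "Phi_Z a ({..<min s0 s1} \<union> {u..<v}) = mm a r {u..<v}" by (rule s0) (use r in auto)
    moreover have "Phi_Z b ({..<min s0 s1} \<union> {u..<v}) = mm b r {u..<v}" by (rule s1) (use r in auto)
    ultimately show ?thesis using eq by simp
  qed
  show ?thesis
  proof (rule Delta_ext_eqI)
    show "a \<in> Delta \<rightarrow>\<^sub>E UNIV" "b \<in> Delta \<rightarrow>\<^sub>E UNIV" using a b by (auto simp: LusZ_iff)
    fix i j :: int assume ij: "i < j"
    define r where "r = min (i - A) (i - B)"
    have r: "r < i" using A B by (auto simp: r_def vanishes_from_def)
    have col: "(\<Sum>x\<in>{r..<u}. int (c (x, j))) = mm c r {u..<j} - mm c r {u..<j + 1}" if "r \<le> u" "u \<le> j" for c u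
    proof -
      have "{u..<j + 1} = insert j {u..<j}" using that by auto
      then show ?thesis unfolding mm_interval[OF that(1)] by simp
    qed
    have ent: "int (c (i, j)) = (\<Sum>x\<in>{r..<i + 1}. int (c (x, j))) - (\<Sum>x\<in>{r..<i}. int (c (x, j)))" for c :: lusztig
    proof -
      have "{r..<i + 1} = insert i {r..<i}" using r by auto
      then show ?thesis by simp
    qed
    have rA: "r \<le> i - A" "r \<le> i - B" "r \<le> i + 1 - A" "r \<le> i + 1 - B" by (auto simp: r_def)
    have "r \<le> i" "i \<le> j" "r \<le> i + 1" "i + 1 \<le> j" using r ij by auto
    note c = col[OF this(1,2)] col[OF this(3,4)]
    have "int (a (i, j)) = int (b (i, j))"
      unfolding ent c mm[OF rA(1,2)] mm[OF rA(3,4)] ..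
    then show "a (i, j) = b (i, j)" by simp
  qed
qed

lemma maya_translate: "k \<in> maya \<Longrightarrow> (\<lambda>x. x - l) ` k \<in> maya"
proof -
  assume "k \<in> maya"
  then obtain n m where nm: "{..<n} \<subseteq> k" "k \<subseteq> {..<m}" by (auto simp: maya_iff)
  have "x \<in> (\<lambda>x. x - l) ` k" if "x < n - l" for x
    by (rule image_eqI[of _ _ "x + l"]) (use that nm(1) in auto)
  then have "{..<n - l} \<subseteq> (\<lambda>x. x - l) ` k" by blast
  moreover have "(\<lambda>x. x - l) ` k \<subseteq> {..<m - l}" using nm(2) by auto
  ultimately show ?thesis unfolding maya_iff by blast
qed

lemma compl_translate: "- ((\<lambda>x::int. x - l) ` k) = (\<lambda>x. x - l) ` (- k)"
proof -
  have "bij (\<lambda>x::int. x - l)" by (rule bij_betw_byWitness[of _ "\<lambda>x. x + l"]) auto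
  then show ?thesis by (rule bij_image_Compl_eq[symmetric])
qed

lemma Phi_Z_periodic:
  assumes l: "2 \<le> l" and a: "a \<in> LusAff l" and k: "k \<in> maya"
  shows "Phi_Z a ((\<lambda>x. x - l) ` k) = Phi_Z a k"
proof -
  obtain B where B: "vanishes_from B a" using aff_vanishes[OF l a] by blast
  have B0: "0 < B" using B by (simp add: vanishes_from_def)
  let ?k = "(\<lambda>x. x - l) ` k"
  note mk = maya_translate[OF k, of l]
  obtain n m where nm: "{..<n} \<subseteq> k" "?k \<subseteq> {..<m}" using k mk by (meson maya_iff)
  define s where "s = n - B - l"
  have "x \<in> ?k" if "x < s + B" for x
    by (rule image_eqI[of _ _ "x + l"]) (use that nm(1) in \<open>auto simp: s_def\<close>)
  then have s: "{..<s + B} \<subseteq> ?k" "{..<s} \<subseteq> ?k" using B0 by auto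
  have s': "{..<s + l + B} \<subseteq> k" using nm(1) by (simp add: s_def)
  note fin = maya_cut(1)[OF mk s(2)]
  have "Phi_Z a k = mm a (s + l) (k \<inter> {s + l..})" by (rule Phi_Z_eq[OF B k s'])
  also have "k \<inter> {s + l..} = (\<lambda>x. x + l) ` (?k \<inter> {s..})"
  proof (intro equalityI subsetI)
    fix x assume "x \<in> k \<inter> {s + l..}"
    then have "x - l \<in> ?k \<inter> {s..}" by auto
    then have "(x - l) + l \<in> (\<lambda>x. x + l) ` (?k \<inter> {s..})" by (rule imageI)
    then show "x \<in> (\<lambda>x. x + l) ` (?k \<inter> {s..})" by simp
  qed auto
  also have "mm a (s + l) \<dots> = mm (\<lambda>(i, j). a (i + l, j + l)) s (?k \<inter> {s..})"
    by (rule mm_translate[OF fin])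
  also have "\<dots> = mm a s (?k \<inter> {s..})"
    by (rule mm_cong[OF fin, of _ m]) (use nm(2) aff_shift[OF l a] in auto)
  also have "\<dots> = Phi_Z a ?k" by (rule Phi_Z_eq[OF B mk s(1), symmetric])
  finally show ?thesis by simp
qed

lemma star_c_aff_iff:
  assumes "F \<in> maya \<rightarrow>\<^sub>E UNIV"
  shows "(\<forall>k\<in>mayac. star_c F ((\<lambda>x. x - l) ` k) = star_c F k) \<longleftrightarrow> (\<forall>k\<in>maya. F ((\<lambda>x. x - l) ` k) = F k)"
proof -
  have eq: "star_c F ((\<lambda>x. x - l) ` k) = F ((\<lambda>x. x - l) ` (- k))" "star_c F k = F (- k)" if "- k \<in> maya" for k
    using maya_translate[OF that, of l] that by (simp_all add: star_c_apply compl_translate)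
  show ?thesis
  proof
    assume *: "\<forall>k\<in>mayac. star_c F ((\<lambda>x. x - l) ` k) = star_c F k"
    show "\<forall>k\<in>maya. F ((\<lambda>x. x - l) ` k) = F k"
    proof
      fix k assume k: "k \<in> maya"
      then have "- k \<in> mayac" by (simp add: mayac_iff)
      then show "F ((\<lambda>x. x - l) ` k) = F k" using bspec[OF *, of "- k"] eq[of "- k"] k by simp
    qed
  next
    assume *: "\<forall>k\<in>maya. F ((\<lambda>x. x - l) ` k) = F k"
    show "\<forall>k\<in>mayac. star_c F ((\<lambda>x. x - l) ` k) = star_c F k"
    proof
      fix k assume "k \<in> mayac"
      then have k: "- k \<in> maya" by (simp add: mayac_iff)
      then show "star_c F ((\<lambda>x. x - l) ` k) = star_c F k" using bspec[OF *, OF k] eq[OF k] by simp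
    qed
  qed
qed

context
  fixes l :: int
  assumes l: "2 \<le> l"
begin

lemma aperiodic_bounds:
  assumes "a \<in> LusAp l"
  obtains B where "vanishes_from B a" "zeros_left a"
  using aff_vanishes[OF l LusAp_D[OF assms]] LusAp_zeros_left[OF assms] by blast

lemma maya_datum_aperiodic: "a \<in> LusAp l \<Longrightarrow> maya_datum (Phi_Z a)"
  by (erule aperiodic_bounds) (rule maya_datum_Phi_Z)

lemma Phi_Z_in_BZe_aff: "a \<in> LusAp l \<Longrightarrow> Phi_Z a \<in> BZe_aff l"
  unfolding BZe_aff_def
  using maya_datum_in_BZe_Z[OF maya_datum_aperiodic] Phi_Z_periodic[OF l LusAp_D] by blast

lemma BZe_aff_eq: "BZe_aff l = Phi_Z ` LusAp l"
proof (intro equalityI subsetI)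
  fix F assume "F \<in> BZe_aff l"
  then have "maya_datum F" "\<And>k. k \<in> maya \<Longrightarrow> F ((\<lambda>x. x - l) ` k) = F k"
    using BZe_Z_maya_datum by (auto simp: BZe_aff_def)
  then show "F \<in> Phi_Z ` LusAp l" using affine_datum_from_aperiodic[OF l] by blast
qed (use Phi_Z_in_BZe_aff in blast)

lemma BZ_aff_eq: "BZ_aff l = (star_c \<circ> Phi_Z) ` LusAp l"
proof (intro equalityI subsetI)
  fix M assume M: "M \<in> BZ_aff l"
  then have MZ: "M \<in> BZ_Z" and per: "\<forall>k\<in>mayac. M ((\<lambda>x. x - l) ` k) = M k" by (auto simp: BZ_aff_def)
  have se: "star_c (star_e M) = M" by (rule star_c_star_e) (use MZ in \<open>simp add: BZ_Z_def\<close>)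
  have d: "maya_datum (star_e M)" by (rule BZ_Z_maya_datum[OF MZ])
  have "\<forall>k\<in>maya. star_e M ((\<lambda>x. x - l) ` k) = star_e M k"
    using star_c_aff_iff[OF maya_datumD(1)[OF d], of l] per se by simp
  then obtain a where "a \<in> LusAp l" "star_e M = Phi_Z a"
    using affine_datum_from_aperiodic[OF l d] by blast
  then show "M \<in> (star_c \<circ> Phi_Z) ` LusAp l" using se by (metis comp_apply imageI)
next
  fix M assume "M \<in> (star_c \<circ> Phi_Z) ` LusAp l"
  then obtain a where a: "a \<in> LusAp l" "M = star_c (Phi_Z a)" by auto
  note d = maya_datum_aperiodic[OF a(1)]
  have "\<forall>k\<in>mayac. M ((\<lambda>x. x - l) ` k) = M k"
    unfolding a(2) star_c_aff_iff[OF maya_datumD(1)[OF d]] using Phi_Z_periodic[OF l LusAp_D[OF a(1)]] by blast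
  then show "M \<in> BZ_aff l" using maya_datum_star_c[OF d] a(2) by (simp add: BZ_aff_def)
qed

lemma zero_in_LusAp: "(\<lambda>x\<in>Delta. 0) \<in> LusAp l"
proof -
  have "vanishes_from 1 (\<lambda>x\<in>Delta. 0)" by (auto simp: vanishes_from_def Delta_def)
  then have "(\<lambda>x\<in>Delta. 0) \<in> LusZ" unfolding LusZ_iff by auto
  then have "(\<lambda>x\<in>Delta. 0) \<in> LusAff l" by (auto simp: LusAff_def Delta_def)
  then show ?thesis using LusAp_iff[OF l] by (simp add: Delta_def)
qed

lemma Phi_Z_zero: "Phi_Z (\<lambda>x\<in>Delta. 0) = Oe_fam"
proof
  fix k
  let ?z = "(\<lambda>x\<in>Delta. 0) :: lusztig"
  show "Phi_Z ?z k = Oe_fam k"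
  proof (cases "k \<in> maya")
    case True
    obtain B where B: "vanishes_from B ?z" "zeros_left ?z" by (rule aperiodic_bounds[OF zero_in_LusAp])
    have B0: "0 < B" using B by (simp add: vanishes_from_def)
    obtain n m where nm: "{..<n} \<subseteq> k" "k \<subseteq> {..<m}" using True by (auto simp: maya_iff)
    define s where "s = n - B"
    have s: "{..<s + B} \<subseteq> k" "{..<s} \<subseteq> k" using nm(1) B0 by (auto simp: s_def subset_iff)
    note fin = maya_cut(1)[OF True s(2)]
    have "Phi_Z ?z k = mm ?z s (k \<inter> {s..})" by (rule Phi_Z_eq[OF B(1) True s(1)])
    also have "\<dots> = mm (\<lambda>_. 0) s (k \<inter> {s..})"
      by (rule mm_cong[OF fin, of _ m]) (use nm(2) in \<open>auto simp: Delta_def\<close>)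
    also have "\<dots> = 0"
    proof -
      obtain C where "tableau (k \<inter> {s..}) C" using tableau_exists[OF fin] by blast
      then have "min_weight (\<lambda>_. 0) (k \<inter> {s..}) = 0"
        by (rule min_weight_eqI[OF fin]) (auto simp: tableau_weight_def)
      then show ?thesis by (simp add: mm_def)
    qed
    finally show ?thesis using True by (simp add: Oe_fam_def)
  next
    case False
    then show ?thesis by (simp add: Phi_Z_def Oe_fam_def)
  qed
qed

lemma star_c_Oe: "star_c Oe_fam = O_fam"
  by (rule ext) (simp add: star_c_def Oe_fam_def O_fam_def mayac_iff)

text \<open>Induction on the sum of the coefficients \<open>r_coef\<close>, the height of the
  weight: every nonzero aperiodic datum can be raised, and raising lowers the height by 1.\<close>

lemma aperiodic_connected:
  assumes zero: "P (\<lambda>x\<in>Delta. 0)"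
    and step: "\<And>p a. p \<in> Ihat l \<Longrightarrow> a \<in> LusAp l \<Longrightarrow> P a \<Longrightarrow> P (fhat_star l p a)"
    and a: "a \<in> LusAp l"
  shows "P a"
  using a
proof (induction "nat (\<Sum>q\<in>Ihat l. r_coef q a)" arbitrary: a rule: less_induct)
  case (less a)
  show ?case
  proof (cases "a = (\<lambda>x\<in>Delta. 0)")
    case True
    then show ?thesis using zero by simp
  next
    case False
    obtain p b where pb: "p \<in> Ihat l" "ehat_star l p a = Some b"
      by (rule aperiodic_raising[OF l less.prems False])
    note b = ehat_star_Ap[OF l less.prems pb(2)]
    have ab: "a = fhat_star l p b" using fhat_ehat_star[OF l LusAp_D[OF less.prems] pb(2)] by simp
    have "(\<Sum>q\<in>Ihat l. r_coef q a) = (\<Sum>q\<in>Ihat l. r_coef q b + (if q = p then 1 else 0))"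
      unfolding ab using r_coef_fhat_star[OF l LusAp_D[OF b]] cong_Ihat[OF pb(1)] by (intro sum.cong) auto
    also have "\<dots> = (\<Sum>q\<in>Ihat l. r_coef q b) + 1"
      using pb(1) by (simp add: sum.distrib sum.delta Ihat_def)
    finally have "nat (\<Sum>q\<in>Ihat l. r_coef q b) < nat (\<Sum>q\<in>Ihat l. r_coef q a)"
      using sum_nonneg[of "Ihat l" "\<lambda>q. r_coef q b"] r_coef_nonneg by simp
    then have "P b" using less.hyps b by blast
    then show ?thesis unfolding ab by (rule step[OF pb(1) b])
  qed
qed

lemma crystal_component_all:
  assumes zero: "f (\<lambda>x\<in>Delta. 0) = c0" and el: "elems C = f ` LusAp l"
    and fop: "\<And>p a. a \<in> LusAp l \<Longrightarrow> fop C p (f a) = Some (f (fhat_star l p a))"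
  shows "crystal_component l C c0 = C"
proof -
  let ?R = "(crystal_edges l C \<union> (crystal_edges l C)\<inverse>)\<^sup>*"
  have reach: "(c0, f a) \<in> ?R" if "a \<in> LusAp l" for a
    using that
  proof (rule aperiodic_connected[rotated 2])
    show "(c0, f (\<lambda>x\<in>Delta. 0)) \<in> ?R" using zero by simp
    fix p a assume p: "p \<in> Ihat l" and a: "a \<in> LusAp l" and IH: "(c0, f a) \<in> ?R"
    have "(f a, f (fhat_star l p a)) \<in> crystal_edges l C"
      unfolding crystal_edges_def using p a fhat_star_Ap[OF l a] fop[OF a] el by blast
    then show "(c0, f (fhat_star l p a)) \<in> ?R" using IH by (meson UnI1 rtrancl.rtrancl_into_rtrancl)
  qed
  have inside: "c \<in> elems C" if "(c0, c) \<in> ?R" for c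
    using that
  proof (induction rule: rtrancl_induct)
    case base
    then show ?case using zero el zero_in_LusAp by blast
  qed (auto simp: crystal_edges_def)
  have "{c. (c0, c) \<in> ?R} = elems C"
  proof (intro equalityI subsetI)
    fix c assume "c \<in> {c. (c0, c) \<in> ?R}"
    then show "c \<in> elems C" using inside by simp
  next
    fix c assume "c \<in> elems C"
    then obtain a where "a \<in> LusAp l" "c = f a" unfolding el by (elim imageE)
    then show "c \<in> {c. (c0, c) \<in> ?R}" using reach by simp
  qed
  then show ?thesis by (simp add: crystal_component_def)
qed

lemma BZ_O_eq: "BZ_O l = BZ_crystal l"
  unfolding BZ_O_def
  by (rule crystal_component_all[of "star_c \<circ> Phi_Z"])
    (simp_all add: Phi_Z_zero star_c_Oe BZ_crystal_def BZ_aff_eq fhat_Phi_Z[OF l])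

lemma BZe_O_eq: "BZe_O l = BZe_crystal l"
  unfolding BZe_O_def
proof (rule crystal_component_all[of Phi_Z])
  fix p a assume a: "a \<in> LusAp l"
  have "star_e (star_c (Phi_Z b)) = Phi_Z b" for b
    by (rule star_e_star_c) (simp add: Phi_Z_def)
  then show "fop (BZe_crystal l) p (Phi_Z a) = Some (Phi_Z (fhat_star l p a))"
    by (simp add: BZe_crystal_def fhat_Phi_Z[OF l a])
qed (simp_all add: Phi_Z_zero BZe_crystal_def BZe_aff_eq)

lemma aperiodic_crystal_iso: "crystal_iso l (lus_ap_crystal l) (BZ_O l) (star_c \<circ> Phi_Z)"
  unfolding BZ_O_eq
proof (rule crystal_iso_transport[OF crystal_lus_ap[OF l]])
  show "inj_on (star_c \<circ> Phi_Z) (elems (lus_ap_crystal l))"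
  proof (rule inj_onI)
    fix a b assume "a \<in> elems (lus_ap_crystal l)" "b \<in> elems (lus_ap_crystal l)"
      and eq: "(star_c \<circ> Phi_Z) a = (star_c \<circ> Phi_Z) b"
    then have ab: "a \<in> LusAp l" "b \<in> LusAp l" by (simp_all add: lus_ap_crystal_def)
    have "star_e (star_c (Phi_Z c)) = Phi_Z c" for c
      by (rule star_e_star_c) (simp add: Phi_Z_def)
    then have "Phi_Z a = Phi_Z b" using eq by (metis comp_apply)
    then show "a = b"
      using Phi_Z_inj ab LusAp_zeros_left[OF ab(1)] LusAp_zeros_left[OF ab(2)] LusAp_D[of a] LusAp_D[of b]
      by (auto simp: LusAff_def)
  qed
next
  fix p :: int and a assume "a \<in> elems (lus_ap_crystal l)"
  then have a: "a \<in> LusAp l" by (simp add: lus_ap_crystal_def)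
  obtain B where B: "vanishes_from B a" "zeros_left a" by (rule aperiodic_bounds[OF a])
  have w: "wt_BZ l (star_c (Phi_Z a)) = wt_lus l a"
    by (simp add: wt_BZ_def wt_lus_def Theta_Phi_Z_r_coef[OF B])
  show "wt (BZ_crystal l) ((star_c \<circ> Phi_Z) a) = wt (lus_ap_crystal l) a"
    by (simp add: BZ_crystal_def lus_ap_crystal_def w)
  show "eps (BZ_crystal l) p ((star_c \<circ> Phi_Z) a) = eps (lus_ap_crystal l) p a"
    by (simp add: BZ_crystal_def lus_ap_crystal_def eps_Z_Phi_Z[OF B])
  show "phi (BZ_crystal l) p ((star_c \<circ> Phi_Z) a) = phi (lus_ap_crystal l) p a"
    by (simp add: BZ_crystal_def lus_ap_crystal_def eps_Z_Phi_Z[OF B] w)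
  show "eop (BZ_crystal l) p ((star_c \<circ> Phi_Z) a) = map_option (star_c \<circ> Phi_Z) (eop (lus_ap_crystal l) p a)"
    by (simp add: BZ_crystal_def lus_ap_crystal_def ehat_Phi_Z[OF l a])
  show "fop (BZ_crystal l) p ((star_c \<circ> Phi_Z) a) = map_option (star_c \<circ> Phi_Z) (fop (lus_ap_crystal l) p a)"
    by (simp add: BZ_crystal_def lus_ap_crystal_def fhat_Phi_Z[OF l a])
qed (simp add: BZ_crystal_def lus_ap_crystal_def BZ_aff_eq)

end

theorem corollary6p4p4:
  fixes l :: int
  assumes "l \<ge> 3"
  shows "Phi_Z \<in> elems (lus_ap_crystal l) \<rightarrow> elems (BZe_O l)
    \<and> star_c \<in> elems (BZe_O l) \<rightarrow> elems (BZ_O l)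
    \<and> crystal_iso l (lus_ap_crystal l) (BZ_O l) (star_c \<circ> Phi_Z)"
proof (intro conjI)
  have l: "2 \<le> l" using assms by simp
  show "Phi_Z \<in> elems (lus_ap_crystal l) \<rightarrow> elems (BZe_O l)"
    using Phi_Z_in_BZe_aff[OF l] by (auto simp: BZe_O_eq[OF l] BZe_crystal_def lus_ap_crystal_def)
  show "star_c \<in> elems (BZe_O l) \<rightarrow> elems (BZ_O l)"
    by (auto simp: BZe_O_eq[OF l] BZ_O_eq[OF l] BZe_crystal_def BZ_crystal_def BZe_aff_eq[OF l] BZ_aff_eq[OF l])
  show "crystal_iso l (lus_ap_crystal l) (BZ_O l) (star_c \<circ> Phi_Z)"
    by (rule aperiodic_crystal_iso[OF l])
qed

end
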